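(* Let $G=(V,E)$ be a $3$-regular $3$-edge connected graph on $n$ vertices with non-negative edge costs $c\in\mathbb{R}_{\ge 0}^E$. Then in $O(n^3)$ time one can find a $2$-edge connected spanning multisubgraph $H$ of $G$ such that $c(H)\le \frac78\, c(G)$.
   Context: $c(G)=\sum_{e\in E}c_e$. A spanning multisubgraph of $G$ is a multigraph on vertex set $V$ each of whose edges is a copy of an edge of $G$ (edges of $G$ may be used more than once); its cost counts edges with multiplicity. It is $2$-edge connected if it is connected and remains connected after deleting any single edge. *)

theory Defs
  imports Complex_Main "HOL-Library.Multiset" "HOL-Library.Landau_Symbols"
begin

section \<open>Multigraphs\<close>

text \<open>
  A multigraph has a vertex set \<open>V\<close>, a set \<open>E\<close> of edge names, and a map \<open>ends\<close> sending an edge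
  name to its set of two endpoints, so parallel edges are allowed and simple graphs are the case
  where \<open>ends\<close> is injective on \<open>E\<close>. Loops are excluded; in a 3-regular 3-edge connected graph
  they cannot occur anyway, as the third edge at the vertex of a loop would be a bridge.
\<close>

definition multigraph :: "'v set \<Rightarrow> 'e set \<Rightarrow> ('e \<Rightarrow> 'v set) \<Rightarrow> bool" where
  "multigraph V E ends \<longleftrightarrow> finite V \<and> V \<noteq> {} \<and> finite E \<and>
     (\<forall>e\<in>E. \<exists>u\<in>V. \<exists>v\<in>V. u \<noteq> v \<and> ends e = {u, v})"

definition regular_graph :: "nat \<Rightarrow> 'v set \<Rightarrow> 'e set \<Rightarrow> ('e \<Rightarrow> 'v set) \<Rightarrow> bool" where
  "regular_graph d V E ends \<longleftrightarrow> (\<forall>v\<in>V. card {e \<in> E. v \<in> ends e} = d)"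

text \<open>
  Connectivity is defined for the multigraph on \<open>V\<close> whose edges are the elements of a multiset
  \<open>M\<close> of edge names; an edge name of multiplicity \<open>k\<close> stands for \<open>k\<close> parallel copies.
\<close>

definition connected_graph :: "'v set \<Rightarrow> ('e \<Rightarrow> 'v set) \<Rightarrow> 'e multiset \<Rightarrow> bool" where
  "connected_graph V ends M \<longleftrightarrow>
     (\<forall>u\<in>V. \<forall>v\<in>V. (\<lambda>x y. \<exists>e\<in>#M. ends e = {x, y})\<^sup>*\<^sup>* u v)"

definition edge_connected :: "nat \<Rightarrow> 'v set \<Rightarrow> ('e \<Rightarrow> 'v set) \<Rightarrow> 'e multiset \<Rightarrow> bool" where
  "edge_connected k V ends M \<longleftrightarrow>
     (\<forall>F. F \<subseteq># M \<and> size F < k \<longrightarrow> connected_graph V ends (M - F))"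

definition two_edge_connected :: "'v set \<Rightarrow> ('e \<Rightarrow> 'v set) \<Rightarrow> 'e multiset \<Rightarrow> bool" where
  "two_edge_connected V ends M \<longleftrightarrow>
     connected_graph V ends M \<and> (\<forall>e\<in>#M. connected_graph V ends (M - {#e#}))"

definition spanning_multisubgraph :: "'e set \<Rightarrow> 'e multiset \<Rightarrow> bool" where
  "spanning_multisubgraph E H \<longleftrightarrow> set_mset H \<subseteq> E"

definition cost :: "('e \<Rightarrow> real) \<Rightarrow> 'e multiset \<Rightarrow> real" where
  "cost c M = (\<Sum>e\<in>#M. c e)"


section \<open>A random access machine with real arithmetic\<close>

text \<open>
  Running time is measured on a random access machine with two memories: one holds natural
  numbers (used for indices, pointers and counters), the other real numbers (used for costs).
  Programs are finite pieces of syntax. There is no conversion from reals to naturals: reals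
  influence the control flow only through comparisons.
\<close>

type_synonym state = "(nat \<Rightarrow> nat) \<times> (nat \<Rightarrow> real)"

datatype nexp =
    NConst nat
  | NLoad nexp
  | NAdd nexp nexp
  | NSub nexp nexp
  | NMul nexp nexp
  | NDiv nexp nexp

datatype rexp =
    ROfNat nexp
  | RLoad nexp
  | RAdd rexp rexp
  | RSub rexp rexp
  | RMul rexp rexp
  | RDiv rexp rexp

datatype bexp =
    NLess nexp nexp
  | RLess rexp rexp
  | BNot bexp
  | BAnd bexp bexp

datatype com =
    Skip
  | NStore nexp nexp
  | RStore nexp rexp
  | Seq com com
  | Cond bexp com com
  | While bexp com

fun nval :: "nexp \<Rightarrow> state \<Rightarrow> nat" where
  "nval (NConst k) s = k"
| "nval (NLoad a) s = fst s (nval a s)"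
| "nval (NAdd a b) s = nval a s + nval b s"
| "nval (NSub a b) s = nval a s - nval b s"
| "nval (NMul a b) s = nval a s * nval b s"
| "nval (NDiv a b) s = nval a s div nval b s"

fun rval :: "rexp \<Rightarrow> state \<Rightarrow> real" where
  "rval (ROfNat a) s = real (nval a s)"
| "rval (RLoad a) s = snd s (nval a s)"
| "rval (RAdd a b) s = rval a s + rval b s"
| "rval (RSub a b) s = rval a s - rval b s"
| "rval (RMul a b) s = rval a s * rval b s"
| "rval (RDiv a b) s = rval a s / rval b s"

fun bval :: "bexp \<Rightarrow> state \<Rightarrow> bool" where
  "bval (NLess a b) s \<longleftrightarrow> nval a s < nval b s"
| "bval (RLess a b) s \<longleftrightarrow> rval a s < rval b s"
| "bval (BNot b) s \<longleftrightarrow> \<not> bval b s"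
| "bval (BAnd b b') s \<longleftrightarrow> bval b s \<and> bval b' s"

text \<open>
  \<open>exec w p s t s'\<close>: started in \<open>s\<close>, program \<open>p\<close> halts in \<open>s'\<close> after \<open>t\<close> steps. An atomic command
  or the evaluation of a guard is one step; as the expressions of a fixed program have bounded
  size, this agrees with counting individual operations up to a constant factor. The machine gets
  stuck when a stored natural number or the address of a store exceeds \<open>w\<close>. With \<open>w\<close> polynomial in
  the input size this is the usual restriction to words of logarithmic length, which rules out
  packing large amounts of data into a single natural number.
\<close>

inductive exec :: "nat \<Rightarrow> com \<Rightarrow> state \<Rightarrow> nat \<Rightarrow> state \<Rightarrow> bool" for w :: nat where
  Skip: "exec w Skip s 1 s"
| NStore: "nval a s \<le> w \<Longrightarrow> nval b s \<le> w \<Longrightarrow>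
    exec w (NStore a b) s 1 ((fst s)(nval a s := nval b s), snd s)"
| RStore: "nval a s \<le> w \<Longrightarrow>
    exec w (RStore a r) s 1 (fst s, (snd s)(nval a s := rval r s))"
| Seq: "exec w p s t s' \<Longrightarrow> exec w q s' t' s'' \<Longrightarrow> exec w (Seq p q) s (t + t') s''"
| CondTrue: "bval b s \<Longrightarrow> exec w p s t s' \<Longrightarrow> exec w (Cond b p q) s (1 + t) s'"
| CondFalse: "\<not> bval b s \<Longrightarrow> exec w q s t s' \<Longrightarrow> exec w (Cond b p q) s (1 + t) s'"
| WhileFalse: "\<not> bval b s \<Longrightarrow> exec w (While b p) s 1 s"
| WhileTrue: "bval b s \<Longrightarrow> exec w p s t s' \<Longrightarrow> exec w (While b p) s' t' s'' \<Longrightarrow>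
    exec w (While b p) s (1 + t + t') s''"

inductive_cases exec_SkipE: "exec w Skip s t s'"
inductive_cases exec_NStoreE: "exec w (NStore a b) s t s'"
inductive_cases exec_RStoreE: "exec w (RStore a r) s t s'"
inductive_cases exec_SeqE: "exec w (Seq p q) s t s'"
inductive_cases exec_CondE: "exec w (Cond b p q) s t s'"
inductive_cases exec_WhileE: "exec w (While b p) s t s'"

lemma exec_deterministic:
  "exec w p s t s' \<Longrightarrow> exec w p s u s'' \<Longrightarrow> t = u \<and> s' = s''"
proof (induction arbitrary: u s'' rule: exec.induct)
  case (Skip s)
  then show ?case by - (erule exec_SkipE; simp)
next
  case (NStore a s b)
  from NStore.prems show ?case by - (erule exec_NStoreE; simp)
next
  case (RStore a s r)
  from RStore.prems show ?case by - (erule exec_RStoreE; simp)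
next
  case (Seq p s t s' q t' s1)
  from Seq.prems obtain v v' r where "u = v + v'" "exec w p s v r" "exec w q r v' s''"
    by - (erule exec_SeqE)
  with Seq.IH(1)[of v r] Seq.IH(2)[of v' s''] show ?case by simp
next
  case (CondTrue b s p t s' q)
  from CondTrue.prems CondTrue.hyps obtain v where "u = 1 + v" "exec w p s v s''"
    by - (erule exec_CondE; simp)
  with CondTrue.IH[of v s''] show ?case by simp
next
  case (CondFalse b s q t s' p)
  from CondFalse.prems CondFalse.hyps obtain v where "u = 1 + v" "exec w q s v s''"
    by - (erule exec_CondE; simp)
  with CondFalse.IH[of v s''] show ?case by simp
next
  case (WhileFalse b s p)
  from WhileFalse.prems WhileFalse.hyps show ?case by - (erule exec_WhileE; simp)
next
  case (WhileTrue b s p t s' t' s1)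
  from WhileTrue.prems WhileTrue.hyps(1) obtain v v' r
    where "u = 1 + v + v'" "exec w p s v r" "exec w (While b p) r v' s''"
    by - (erule exec_WhileE; simp)
  with WhileTrue.IH(1)[of v r] WhileTrue.IH(2)[of v' s''] show ?case by simp
qed

text \<open>
  The input is the multigraph with vertices \<open>0, \<dots>, n - 1\<close> and edges \<open>0, \<dots>, m - 1\<close>, edge \<open>i\<close>
  having the endpoints \<open>a i\<close> and \<open>b i\<close> and the cost \<open>c i\<close>. All memory not used for the input is 0.
  The output is read off from the first \<open>m\<close> cells of the memory for natural numbers, which hold
  the multiplicities of the edges.
\<close>

definition input_state ::
    "nat \<Rightarrow> nat \<Rightarrow> (nat \<Rightarrow> nat) \<Rightarrow> (nat \<Rightarrow> nat) \<Rightarrow> (nat \<Rightarrow> real) \<Rightarrow> state" where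
  "input_state n m a b c =
     ((\<lambda>j. if j = 0 then n
           else if j = 1 then m
           else if j < 2 + 2 * m then (if even j then a ((j - 2) div 2) else b ((j - 2) div 2))
           else 0),
      (\<lambda>j. if j < m then c j else 0))"

definition output_multiset :: "nat \<Rightarrow> state \<Rightarrow> nat multiset" where
  "output_multiset m s = (\<Sum>i<m. replicate_mset (fst s i) i)"

end

theory Submission
  imports Defs
begin

text \<open>
  Partition the edges into four classes: deleting class 0 or class 1 leaves a 2-edge connected graph,
  deleting class 2 or class 3 leaves a connected one. Let \<open>L\<close> be the costlier of classes 2 and 3 and
  \<open>T\<close> a spanning tree avoiding \<open>L\<close>. The edges of \<open>L\<close> are coloured with three colours so that the
  at least two links covering a tree edge are never all of one colour; then deleting one colour class
  leaves a 2-edge connected graph. Among class 0, class 1 and the three colour classes, delete the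
  costliest one, of cost \<open>M\<close>: the total cost is at most
  \<open>M + M + 2 c(L) \<le> 2 M + 2 \<cdot> 3 M = 8 M\<close>, so at least an eighth of it is saved.

  The four classes are found by reducing a vertex set \<open>S\<close> with three boundary edges, one of which, \<open>x\<close>, has
  class 2 or 3. If \<open>a\<close> is the end of \<open>x\<close> in \<open>S\<close> and \<open>e = ay\<close> an edge inside \<open>S\<close>, either \<open>e\<close> can be deleted and
  its ends suppressed without creating a smaller cut, or some \<open>W \<subseteq> S - a\<close> containing \<open>y\<close> has exactly
  three boundary edges (found by a flow of value at most 4) and is contracted, to be reduced later.
  Undoing a deletion extends the classes by a local rule.

  Links are coloured in the order of increasing depth of the meet of their ends. When a link \<open>uv\<close> is coloured,
  all tree edges on its \<open>u\<close>-side that are so far covered by one colour only are covered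
  by the same link, and likewise on the \<open>v\<close>-side, so at most two colours have to be avoided.
\<close>

section \<open>A language of bounded loops\<close>

text \<open>Why the classes are of two kinds: undoing a deletion splits the protected edge
  \<open>x\<close> into \<open>x\<close> and \<open>f\<close>, which keep one common class. Deleting
  that class leaves the new vertex \<open>a\<close> attached by \<open>e\<close> alone, so it must
  be a class whose deletion need only leave a connected graph. The edge \<open>e\<close> itself goes
  to class 0 or 1; its loss is harmless, because \<open>a\<close> and \<open>y\<close> then merely
  subdivide edges that survive. A protected edge is always available, since the three boundary edges
  of a tight set cannot all have class 0 or 1. Cubic time: there are linearly many forward and
  backward steps, each with a constant number of quadratic searches. All programs are bounded loops,
  so the exponent is their nesting depth and no termination argument is mixed with the bound. The
  word size is controlled by the same restriction: an expression exceeds the memory that it reads by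
  a constant only, so contents grow linearly with time.\<close>

text \<open>
  Memory is a family of two-dimensional arrays: \<open>Arr j r c\<close> is entry \<open>(r, c)\<close> of array \<open>j\<close>. Loop bounds
  are \<open>k n\<close> (\<open>LN k\<close>) or \<open>m\<close> (\<open>LM\<close>). The real registers \<open>i\<close> of \<open>RZ\<close>, \<open>RA\<close>, \<open>RC\<close> and \<open>RLt\<close>
  live behind the costs, at address \<open>m + i\<close>; \<open>RA i e\<close> adds the cost of edge \<open>e\<close> to register \<open>i\<close>.
\<close>

datatype he = C nat | Arr nat he he | Inc he | Dec he | Nn
datatype hb = Lt he he | Eq he he | RLt nat nat | And hb hb | Neg hb
datatype lim = LN nat | LM
datatype hp = Set nat he he he | RZ nat | RA nat he | RC nat nat | Sq hp hp | If hb hp hp | For nat lim hp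

type_synonym mem = "nat \<Rightarrow> nat \<Rightarrow> nat \<Rightarrow> nat"
type_synonym store = "mem \<times> (nat \<Rightarrow> real)"

definition upd :: "nat \<Rightarrow> nat \<Rightarrow> nat \<Rightarrow> nat \<Rightarrow> mem \<Rightarrow> mem" where
  "upd j r c x \<sigma> = \<sigma>(j := (\<sigma> j)(r := (\<sigma> j r)(c := x)))"

lemma upd_apply: "upd j r c x \<sigma> j' r' c' = (if j' = j \<and> r' = r \<and> c' = c then x else \<sigma> j' r' c')"
  by (simp add: upd_def)

fun ev :: "nat \<Rightarrow> he \<Rightarrow> mem \<Rightarrow> nat" where
  "ev n (C k) \<sigma> = k"
| "ev n (Arr j r c) \<sigma> = \<sigma> j (ev n r \<sigma>) (ev n c \<sigma>)"
| "ev n (Inc e) \<sigma> = Suc (ev n e \<sigma>)"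
| "ev n (Dec e) \<sigma> = ev n e \<sigma> - 1"
| "ev n Nn \<sigma> = n"

fun bv :: "nat \<Rightarrow> nat \<Rightarrow> hb \<Rightarrow> store \<Rightarrow> bool" where
  "bv n m (Lt e f) s \<longleftrightarrow> ev n e (fst s) < ev n f (fst s)"
| "bv n m (Eq e f) s \<longleftrightarrow> ev n e (fst s) = ev n f (fst s)"
| "bv n m (RLt i j) s \<longleftrightarrow> snd s (m + i) < snd s (m + j)"
| "bv n m (And p q) s \<longleftrightarrow> bv n m p s \<and> bv n m q s"
| "bv n m (Neg p) s \<longleftrightarrow> \<not> bv n m p s"

fun lv :: "nat \<Rightarrow> nat \<Rightarrow> lim \<Rightarrow> nat" where
  "lv n m (LN k) = k * n"
| "lv n m LM = m"

definition setv :: "nat \<Rightarrow> nat \<Rightarrow> store \<Rightarrow> store" where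
  "setv v x s = (upd v 0 0 x (fst s), snd s)"

text \<open>The counter is a visible memory cell: it is 0 before the first pass and is overwritten
  after each pass, exactly as in the compiled while loop, so both agree cell by cell even after the
  loop has ended.\<close>

primrec loop :: "(store \<Rightarrow> store) \<Rightarrow> nat \<Rightarrow> nat \<Rightarrow>
    store \<Rightarrow> store" where
  "loop f v 0 s = setv v 0 s"
| "loop f v (Suc j) s = setv v (Suc j) (f (loop f v j s))"

primrec den :: "nat \<Rightarrow> nat \<Rightarrow> hp \<Rightarrow> store \<Rightarrow> store" where
  "den n m (Set j r c e) = (\<lambda>s. (upd j (ev n r (fst s)) (ev n c (fst s)) (ev n e (fst s)) (fst s), snd s))"
| "den n m (RZ i) = (\<lambda>s. (fst s, (snd s)(m + i := 0)))"
| "den n m (RA i e) = (\<lambda>s. (fst s, (snd s)(m + i := snd s (m + i) + snd s (ev n e (fst s)))))"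
| "den n m (RC i j) = (\<lambda>s. (fst s, (snd s)(m + i := snd s (m + j))))"
| "den n m (Sq p q) = (\<lambda>s. den n m q (den n m p s))"
| "den n m (If b p q) = (\<lambda>s. if bv n m b s then den n m p s else den n m q s)"
| "den n m (For v l p) = loop (den n m p) v (lv n m l)"

text \<open>Whole arrays are recorded instead of cells. This is precise enough for every frame
  argument, since each scalar variable is an array of its own.\<close>

primrec asg :: "hp \<Rightarrow> nat set" where
  "asg (Set j r c e) = {j}"
| "asg (RZ i) = {}"
| "asg (RA i e) = {}"
| "asg (RC i j) = {}"
| "asg (Sq p q) = asg p \<union> asg q"
| "asg (If b p q) = asg p \<union> asg q"
| "asg (For v l p) = insert v (asg p)"

lemma loop_frame:
  assumes "\<And>s. fst (f s) j = fst s j" "j \<noteq> v"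
  shows "fst (loop f v N s) j = fst s j"
  by (induction N) (use assms in \<open>auto simp: setv_def upd_def\<close>)

lemma den_frame: "j \<notin> asg p \<Longrightarrow> fst (den n m p s) j = fst s j"
proof (induction p arbitrary: s)
  case (For v l p)
  then show ?case by (auto intro!: loop_frame)
qed (auto simp: upd_def)

lemma loop_rule:
  assumes "I 0 (setv v 0 s)"
    and "\<And>j t. j < N \<Longrightarrow> I j t \<Longrightarrow> fst t v 0 0 = j \<Longrightarrow> I (Suc j) (setv v (Suc j) (f t))"
  shows "I N (loop f v N s)"
proof -
  have "k \<le> N \<Longrightarrow> I k (loop f v k s) \<and> fst (loop f v k s) v 0 0 = k" for k
    by (induction k) (use assms in \<open>auto simp: setv_def upd_def\<close>)
  then show ?thesis by blast
qed

section \<open>Compilation\<close>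

fun wfe :: "he \<Rightarrow> bool" where
  "wfe (C k) = True"
| "wfe (Arr j r c) = (j < 80 \<and> wfe r \<and> wfe c)"
| "wfe (Inc e) = wfe e"
| "wfe (Dec e) = wfe e"
| "wfe Nn = True"

fun wfb :: "hb \<Rightarrow> bool" where
  "wfb (Lt e f) = (wfe e \<and> wfe f)"
| "wfb (Eq e f) = (wfe e \<and> wfe f)"
| "wfb (RLt i j) = True"
| "wfb (And p q) = (wfb p \<and> wfb q)"
| "wfb (Neg p) = wfb p"

primrec wfp :: "hp \<Rightarrow> bool" where
  "wfp (Set j r c e) = (j < 80 \<and> wfe r \<and> wfe c \<and> wfe e)"
| "wfp (RZ i) = True"
| "wfp (RA i e) = wfe e"
| "wfp (RC i j) = True"
| "wfp (Sq p q) = (wfp p \<and> wfp q)"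
| "wfp (If b p q) = (wfb b \<and> wfp p \<and> wfp q)"
| "wfp (For v l p) = (v < 80 \<and> v \<notin> asg p \<and> wfp p)"

text \<open>The offset skips the input cells, the residue modulo 80 selects the array, and
  \<open>(r + c)^2 + r\<close> pairs row and column, lying between two consecutive squares. So
  arrays need no declared size, at the price of addresses quadratic in the indices.\<close>

definition addr :: "nat \<Rightarrow> nat \<Rightarrow> nat \<Rightarrow> nat \<Rightarrow> nat" where
  "addr m j r c = 2 + 2 * m + j + 80 * ((r + c) * (r + c) + r)"

definition cadr :: "nat \<Rightarrow> nexp \<Rightarrow> nexp \<Rightarrow> nexp" where
  "cadr j r c = NAdd (NAdd (NConst (2 + j)) (NMul (NConst 2) (NLoad (NConst 1))))
     (NMul (NConst 80) (NAdd (NMul (NAdd r c) (NAdd r c)) r))"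

fun ce :: "he \<Rightarrow> nexp" where
  "ce (C k) = NConst k"
| "ce (Arr j r c) = NLoad (cadr j (ce r) (ce c))"
| "ce (Inc e) = NAdd (ce e) (NConst 1)"
| "ce (Dec e) = NSub (ce e) (NConst 1)"
| "ce Nn = NLoad (NConst 0)"

definition rad :: "nat \<Rightarrow> nexp" where
  "rad i = NAdd (NLoad (NConst 1)) (NConst i)"

fun cb :: "hb \<Rightarrow> bexp" where
  "cb (Lt e f) = NLess (ce e) (ce f)"
| "cb (Eq e f) = BAnd (BNot (NLess (ce e) (ce f))) (BNot (NLess (ce f) (ce e)))"
| "cb (RLt i j) = RLess (RLoad (rad i)) (RLoad (rad j))"
| "cb (And p q) = BAnd (cb p) (cb q)"
| "cb (Neg p) = BNot (cb p)"

fun cl :: "lim \<Rightarrow> nexp" where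
  "cl (LN k) = NMul (NConst k) (NLoad (NConst 0))"
| "cl LM = NLoad (NConst 1)"

abbreviation va :: "nat \<Rightarrow> nexp" where "va v \<equiv> cadr v (NConst 0) (NConst 0)"

primrec cp :: "hp \<Rightarrow> com" where
  "cp (Set j r c e) = NStore (cadr j (ce r) (ce c)) (ce e)"
| "cp (RZ i) = RStore (rad i) (ROfNat (NConst 0))"
| "cp (RA i e) = RStore (rad i) (RAdd (RLoad (rad i)) (RLoad (ce e)))"
| "cp (RC i j) = RStore (rad i) (RLoad (rad j))"
| "cp (Sq p q) = Seq (cp p) (cp q)"
| "cp (If b p q) = Cond (cb b) (cp p) (cp q)"
| "cp (For v l p) = Seq (NStore (va v) (NConst 0))
     (While (NLess (NLoad (va v)) (cl l)) (Seq (cp p) (NStore (va v) (NAdd (NLoad (va v)) (NConst 1)))))"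

text \<open>Of the input cells only 0 and 1 are pinned. The others are left free, so that the output
  can be written over them while the arrays stay readable.\<close>

definition rep :: "nat \<Rightarrow> nat \<Rightarrow> state \<Rightarrow> store \<Rightarrow> bool" where
  "rep n m s st \<longleftrightarrow> fst s 0 = n \<and> fst s 1 = m \<and> snd s = snd st \<and>
     (\<forall>j<80. \<forall>r c. fst s (addr m j r c) = fst st j r c)"

text \<open>From \<open>r \<le> x\<close> follows \<open>x * x + r < (x + 1)^2\<close>, so the
  largest square below the sum determines \<open>x\<close>.\<close>

lemma square_pair_inj:
  fixes x y r r' :: nat
  assumes "x * x + r = y * y + r'" "r \<le> x" "r' \<le> y"
  shows "x = y \<and> r = r'"
proof -
  have "\<not> x < y" if "u * u + q = v * v + q'" "q \<le> u" "u < v" "x = u" "y = v" for u v q q' :: nat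
  proof -
    have "Suc u * Suc u \<le> v * v" using that(3) by (intro mult_le_mono) auto
    then show ?thesis using that by auto
  qed
  moreover have "\<not> y < x"
  proof
    assume "y < x"
    then have "Suc y * Suc y \<le> x * x" by (intro mult_le_mono) auto
    then show False using assms by auto
  qed
  ultimately have "x = y" using assms by (metis nat_neq_iff)
  then show ?thesis using assms by auto
qed

lemma addr_inj:
  assumes "addr m j r c = addr m j' r' c'" "j < 80" "j' < 80"
  shows "j = j' \<and> r = r' \<and> c = c'"
proof -
  let ?q = "(r + c) * (r + c) + r" and ?q' = "(r' + c') * (r' + c') + r'"
  have *: "j + 80 * ?q = j' + 80 * ?q'" using assms(1) by (simp add: addr_def)
  have "j = (j + 80 * ?q) mod 80" using assms(2) by (simp only: mod_mult_self2 mod_less)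
  also have "\<dots> = j'" unfolding * using assms(3) by (simp only: mod_mult_self2 mod_less)
  finally have "j = j'" .
  with * have "?q = ?q'" by simp
  from square_pair_inj[OF this] \<open>j = j'\<close> show ?thesis by auto
qed

lemma addr_eq_iff: "j < 80 \<Longrightarrow> j' < 80 \<Longrightarrow>
    addr m j r c = addr m j' r' c' \<longleftrightarrow> j = j' \<and> r = r' \<and> c = c'"
  using addr_inj by blast

lemma nval_cadr: "rep n m s st \<Longrightarrow> nval (cadr j r c) s = addr m j (nval r s) (nval c s)"
  by (simp add: cadr_def rep_def addr_def)

lemma nval_ce: "rep n m s st \<Longrightarrow> wfe e \<Longrightarrow> nval (ce e) s = ev n e (fst st)"
  by (induction e) (auto simp: nval_cadr, auto simp: rep_def)

lemma nval_rad: "rep n m s st \<Longrightarrow> nval (rad i) s = m + i"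
  by (simp add: rad_def rep_def)

lemma bval_cb: "rep n m s st \<Longrightarrow> wfb b \<Longrightarrow> bval (cb b) s = bv n m b st"
  by (induction b) (auto simp: nval_ce nval_rad, auto simp: rep_def)

lemma nval_cl: "rep n m s st \<Longrightarrow> nval (cl l) s = lv n m l"
  by (cases l) (auto simp: rep_def)

lemma rep_store:
  assumes "rep n m s st" "j < 80"
  shows "rep n m ((fst s)(addr m j r c := x), snd s) (upd j r c x (fst st), snd st)"
  using assms unfolding rep_def
  by (auto simp: addr_eq_iff upd_apply, auto simp: addr_def)

fun sz :: "he \<Rightarrow> nat" where
  "sz (C k) = k"
| "sz (Arr j r c) = sz r + sz c"
| "sz (Inc e) = Suc (sz e)"
| "sz (Dec e) = sz e"
| "sz Nn = 0"

primrec szp :: "hp \<Rightarrow> nat" where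
  "szp (Set j r c e) = Suc (sz r + sz c + sz e)"
| "szp (RZ i) = Suc i"
| "szp (RA i e) = Suc (i + sz e)"
| "szp (RC i j) = Suc (i + j)"
| "szp (Sq p q) = szp p + szp q"
| "szp (If b p q) = szp p + szp q"
| "szp (For v l p) = Suc (szp p)"

text \<open>Expressions contain no addition or multiplication of two memory contents, only
  constants, single reads, increments and truncated decrements. One evaluation therefore exceeds the
  largest cell by a fixed amount; this is what keeps all numbers polynomial.\<close>

lemma nval_ce_le: "\<forall>x. fst s x \<le> B \<Longrightarrow> nval (ce e) s \<le> B + sz e"
  by (induction e) (auto simp: le_diff_conv intro: trans_le_add1)

text \<open>A bound that depends on the syntax, \<open>n\<close> and \<open>m\<close> alone: both
  branches of a conditional are charged and a loop is charged its full limit. Each pass pays 2 more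
  for guard and increment, each loop 2 more for the initial store and the failing guard.\<close>

primrec time :: "nat \<Rightarrow> nat \<Rightarrow> hp \<Rightarrow> nat" where
  "time n m (Set j r c e) = 1"
| "time n m (RZ i) = 1"
| "time n m (RA i e) = 1"
| "time n m (RC i j) = 1"
| "time n m (Sq p q) = time n m p + time n m q"
| "time n m (If b p q) = Suc (time n m p + time n m q)"
| "time n m (For v l p) = 2 + lv n m l * (time n m p + 2)"

text \<open>Bounds the address of an entry whose row and column are at most \<open>B\<close>. The
  linear part has enough slack to dominate \<open>B\<close> itself too, so one hypothesis on
  \<open>w\<close> covers addresses, stored values and the real registers.\<close>

definition abound :: "nat \<Rightarrow> nat" where
  "abound B = 82 + 3 * B + 80 * ((2 * B) * (2 * B) + B)"

lemma abound_mono: "B \<le> B' \<Longrightarrow> abound B \<le> abound B'"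
  unfolding abound_def by (intro add_mono mult_le_mono) auto

lemma addr_le:
  assumes "j < 80" "r \<le> B" "c \<le> B" "m \<le> B"
  shows "addr m j r c \<le> abound B"
proof -
  have "(r + c) * (r + c) \<le> (2 * B) * (2 * B)" using assms by (intro mult_le_mono) auto
  then show ?thesis using assms by (simp add: addr_def abound_def)
qed

definition runs :: "nat \<Rightarrow> com \<Rightarrow> state \<Rightarrow> nat \<Rightarrow> state \<Rightarrow> nat \<Rightarrow> nat \<Rightarrow> nat \<Rightarrow> bool" where
  "runs w p s t s' B Q T \<longleftrightarrow> exec w p s t s' \<and> t \<le> T \<and> (\<forall>x. fst s' x \<le> B + Q * t)"

lemma exec_store_var:
  assumes rep: "rep n m s st" and bd: "\<forall>x. fst s x \<le> B" and "abound (B + Q) \<le> w" "1 \<le> Q" "v < 80"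
    and e: "nval e s = x" "x \<le> B + Q"
  shows "\<exists>s'. exec w (NStore (va v) e) s 1 s' \<and> (\<forall>x. fst s' x \<le> B + Q) \<and> rep n m s' (setv v x st)"
proof -
  have m: "m \<le> B" using rep bd by (auto simp: rep_def)
  have a: "nval (va v) s = addr m v 0 0" by (simp add: nval_cadr[OF rep])
  have "addr m v 0 0 \<le> abound (B + Q)" by (rule addr_le) (use assms m in auto)
  then have 1: "nval (va v) s \<le> w" using a assms by simp
  have "B + Q \<le> abound (B + Q)" by (simp add: abound_def)
  then have 2: "nval e s \<le> w" using assms by simp
  have "exec w (NStore (va v) e) s 1 ((fst s)(nval (va v) s := nval e s), snd s)"
    by (rule exec.NStore[OF 1 2])
  moreover have "rep n m ((fst s)(nval (va v) s := nval e s), snd s) (setv v x st)"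
    unfolding a e setv_def by (rule rep_store[OF rep \<open>v < 80\<close>])
  ultimately show ?thesis using bd e by (fastforce intro: trans_le_add1)
qed

text \<open>No cell grows by more than \<open>Q\<close> in one step, so contents stay below
  \<open>B + Q * time n m p\<close> and the machine never gets stuck. The bound \<open>B\<close> is
  generalized in the induction, because the second half of a sequence starts from the larger bound
  that the first half leaves behind.\<close>

lemma exec_cp:
  assumes "wfp p" "rep n m s st" "\<forall>x. fst s x \<le> B" "szp p \<le> Q" "abound (B + Q * time n m p) \<le> w"
  shows "\<exists>t s'. runs w (cp p) s t s' B Q (time n m p) \<and> rep n m s' (den n m p st)"
  using assms
proof (induction p arbitrary: s st B)
  case (Set j r c e)
  have m: "m \<le> B" using Set.prems(2,3) by (auto simp: rep_def)
  have r: "nval (ce r) s \<le> B + Q" "nval (ce c) s \<le> B + Q" "nval (ce e) s \<le> B + Q"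
    using nval_ce_le[OF Set.prems(3), of r] nval_ce_le[OF Set.prems(3), of c]
      nval_ce_le[OF Set.prems(3), of e] Set.prems(4) by auto
  have a: "nval (cadr j (ce r) (ce c)) s = addr m j (nval (ce r) s) (nval (ce c) s)"
    by (rule nval_cadr[OF Set.prems(2)])
  have "addr m j (nval (ce r) s) (nval (ce c) s) \<le> abound (B + Q)"
    by (rule addr_le) (use r m Set.prems(1) in auto)
  then have 1: "nval (cadr j (ce r) (ce c)) s \<le> w" using a Set.prems(5) by simp
  have "B + Q \<le> abound (B + Q)" by (simp add: abound_def)
  then have 2: "nval (ce e) s \<le> w" using r(3) Set.prems(5) by simp
  have ex: "exec w (cp (Set j r c e)) s 1
      ((fst s)(nval (cadr j (ce r) (ce c)) s := nval (ce e) s), snd s)"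
    using exec.NStore[OF 1 2] by simp
  have "rep n m ((fst s)(nval (cadr j (ce r) (ce c)) s := nval (ce e) s), snd s) (den n m (Set j r c e) st)"
    unfolding a using rep_store[OF Set.prems(2)] nval_ce[OF Set.prems(2)] Set.prems(1) by simp
  then show ?case using ex r(3) Set.prems(3) unfolding runs_def by (fastforce intro: trans_le_add1)
next
  case (RZ i)
  have m: "m \<le> B" using RZ.prems(2,3) by (auto simp: rep_def)
  have "B + Q \<le> abound (B + Q)" by (simp add: abound_def)
  then have 1: "nval (rad i) s \<le> w" using nval_rad[OF RZ.prems(2)] m RZ.prems by auto
  have "exec w (cp (RZ i)) s 1 (fst s, (snd s)(nval (rad i) s := rval (ROfNat (NConst 0)) s))"
    using exec.RStore[OF 1, of "ROfNat (NConst 0)"] by (simp del: rval.simps)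
  moreover have "rep n m (fst s, (snd s)(nval (rad i) s := rval (ROfNat (NConst 0)) s)) (den n m (RZ i) st)"
    using RZ.prems(2) nval_rad[OF RZ.prems(2)] by (auto simp: rep_def)
  ultimately show ?case using RZ.prems unfolding runs_def by (fastforce intro: trans_le_add1)
next
  case (RA i e)
  have m: "m \<le> B" using RA.prems(2,3) by (auto simp: rep_def)
  have "B + Q \<le> abound (B + Q)" by (simp add: abound_def)
  then have 1: "nval (rad i) s \<le> w" using nval_rad[OF RA.prems(2)] m RA.prems by auto
  have "exec w (cp (RA i e)) s 1 (fst s, (snd s)(nval (rad i) s := rval (RAdd (RLoad (rad i)) (RLoad (ce e))) s))"
    using exec.RStore[OF 1, of "RAdd (RLoad (rad i)) (RLoad (ce e))"] by (simp del: rval.simps)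
  moreover have "rep n m (fst s, (snd s)(nval (rad i) s := rval (RAdd (RLoad (rad i)) (RLoad (ce e))) s)) (den n m (RA i e) st)"
    using RA.prems(1,2) nval_rad[OF RA.prems(2)] nval_ce[OF RA.prems(2)] by (auto simp: rep_def)
  ultimately show ?case using RA.prems unfolding runs_def by (fastforce intro: trans_le_add1)
next
  case (RC i j)
  have m: "m \<le> B" using RC.prems(2,3) by (auto simp: rep_def)
  have "B + Q \<le> abound (B + Q)" by (simp add: abound_def)
  then have 1: "nval (rad i) s \<le> w" using nval_rad[OF RC.prems(2)] m RC.prems by auto
  have "exec w (cp (RC i j)) s 1 (fst s, (snd s)(nval (rad i) s := rval (RLoad (rad j)) s))"
    using exec.RStore[OF 1, of "RLoad (rad j)"] by (simp del: rval.simps)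
  moreover have "rep n m (fst s, (snd s)(nval (rad i) s := rval (RLoad (rad j)) s)) (den n m (RC i j) st)"
    using RC.prems(2) nval_rad[OF RC.prems(2)] by (auto simp: rep_def)
  ultimately show ?case using RC.prems unfolding runs_def by (fastforce intro: trans_le_add1)
next
  case (Sq p q)
  have "abound (B + Q * time n m p) \<le> w"
    by (rule order_trans[OF abound_mono Sq.prems(5)]) simp
  then obtain t s' where 1: "runs w (cp p) s t s' B Q (time n m p)" "rep n m s' (den n m p st)"
    using Sq.IH(1)[of s st B] Sq.prems by auto
  have le: "Q * t \<le> Q * time n m p" using 1(1) by (simp add: runs_def)
  have "abound (B + Q * t + Q * time n m q) \<le> w"
    by (rule order_trans[OF abound_mono Sq.prems(5)]) (use le in \<open>simp add: algebra_simps\<close>)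
  then obtain t' s'' where 2: "runs w (cp q) s' t' s'' (B + Q * t) Q (time n m q)"
      "rep n m s'' (den n m q (den n m p st))"
    using Sq.IH(2)[of s' "den n m p st" "B + Q * t"] Sq.prems 1 by (auto simp: runs_def)
  have "runs w (cp (Sq p q)) s (t + t') s'' B Q (time n m (Sq p q))"
    using 1(1) 2(1) exec.Seq[of w "cp p" s t s' "cp q" t' s'']
    by (auto simp: runs_def algebra_simps)
  then show ?case using 2(2) unfolding den.simps by blast
next
  case (If b p q)
  have ab: "abound (B + Q * time n m p) \<le> w" "abound (B + Q * time n m q) \<le> w"
    by (rule order_trans[OF abound_mono If.prems(5)], simp add: algebra_simps)+
  show ?case
  proof (cases "bv n m b st")
    case True
    then have g: "bval (cb b) s" using bval_cb[OF If.prems(2)] If.prems(1) by simp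
    obtain t s' where 1: "runs w (cp p) s t s' B Q (time n m p)" "rep n m s' (den n m p st)"
      using If.IH(1)[of s st B] If.prems ab by auto
    have "fst s' x \<le> B + Q * Suc t" for x
      using 1(1) by (auto simp: runs_def intro: order_trans)
    then have "runs w (cp (If b p q)) s (1 + t) s' B Q (time n m (If b p q))"
      using 1(1) exec.CondTrue[OF g, of w "cp p" t s' "cp q"] by (auto simp: runs_def)
    moreover have "den n m (If b p q) st = den n m p st" using True by simp
    ultimately show ?thesis using 1(2) by metis
  next
    case False
    then have g: "\<not> bval (cb b) s" using bval_cb[OF If.prems(2)] If.prems(1) by simp
    obtain t s' where 1: "runs w (cp q) s t s' B Q (time n m q)" "rep n m s' (den n m q st)"
      using If.IH(2)[of s st B] If.prems ab by auto
    have "fst s' x \<le> B + Q * Suc t" for x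
      using 1(1) by (auto simp: runs_def intro: order_trans)
    then have "runs w (cp (If b p q)) s (1 + t) s' B Q (time n m (If b p q))"
      using 1(1) exec.CondFalse[OF g, of w "cp q" t s' "cp p"] by (auto simp: runs_def)
    moreover have "den n m (If b p q) st = den n m q st" using False by simp
    ultimately show ?thesis using 1(2) by metis
  qed
next
  case (For v l p)
  define N where "N = lv n m l"
  let ?tp = "time n m p"
  let ?L = "\<lambda>k. loop (den n m p) v k st"
  let ?body = "Seq (cp p) (NStore (va v) (NAdd (NLoad (va v)) (NConst 1)))"
  let ?W = "While (NLess (NLoad (va v)) (cl l)) ?body"
  have Q: "1 \<le> Q" using For.prems(4) by simp
  have T: "time n m (For v l p) = 2 + N * (?tp + 2)" by (simp add: N_def)
  have v: "v < 80" using For.prems(1) by simp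
  have vL: "fst (?L k) v 0 0 = k" for k by (cases k) (auto simp: setv_def upd_def)
  have vp: "fst (den n m p (?L k)) v 0 0 = k" for k
    using vL[of k] den_frame[of v p n m "?L k"] For.prems(1) by simp
  \<comment> \<open>Induction over the number \<open>d\<close> of passes still to be made, starting
    in the state after \<open>N - d\<close> passes. The extra \<open>+ 1\<close> in the budget pays
    for the guard that finally fails.\<close>
  have W: "\<exists>t s''. runs w ?W s' t s'' B' Q (d * (?tp + 2) + 1) \<and> rep n m s'' (?L N)"
    if "d \<le> N" "rep n m s' (?L (N - d))" "\<forall>x. fst s' x \<le> B'" "abound (B' + Q * (d * (?tp + 2) + 1)) \<le> w"
    for d s' B'
    using that
  proof (induction d arbitrary: s' B')
    case 0
    have "nval (NLoad (va v)) s' = N"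
      using 0(2) nval_cadr[OF 0(2), of v "NConst 0" "NConst 0"] v vL[of N] by (simp add: rep_def)
    then have "\<not> bval (NLess (NLoad (va v)) (cl l)) s'" using nval_cl[OF 0(2), of l] by (simp add: N_def)
    then have "exec w ?W s' 1 s'" by (rule exec.WhileFalse)
    then show ?case using 0 unfolding runs_def by (fastforce intro: trans_le_add1)
  next
    case (Suc d)
    let ?k = "N - Suc d"
    have k: "Suc ?k = N - d" using Suc.prems(1) by simp
    have "nval (NLoad (va v)) s' = ?k"
      using Suc.prems(2) nval_cadr[OF Suc.prems(2), of v "NConst 0" "NConst 0"] v vL[of ?k] by (simp add: rep_def)
    then have g: "bval (NLess (NLoad (va v)) (cl l)) s'"
      using nval_cl[OF Suc.prems(2), of l] Suc.prems(1) by (simp add: N_def)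
    have "abound (B' + Q * ?tp) \<le> w"
      by (rule order_trans[OF abound_mono Suc.prems(4)]) (simp add: algebra_simps)
    then obtain t1 s1 where 1: "runs w (cp p) s' t1 s1 B' Q ?tp" "rep n m s1 (den n m p (?L ?k))"
      using For.IH[of s' "?L ?k" B'] For.prems(1,4) Suc.prems by auto
    have t1: "Q * t1 \<le> Q * ?tp" using 1(1) by (simp add: runs_def)
    have nv: "nval (NAdd (NLoad (va v)) (NConst 1)) s1 = Suc ?k"
      using 1(2) nval_cadr[OF 1(2), of v "NConst 0" "NConst 0"] v vp[of ?k] by (simp add: rep_def)
    have "nval (NLoad (va v)) s1 \<le> B' + Q * t1" using 1(1) by (simp add: runs_def)
    then have "Suc ?k \<le> B' + Q * t1 + Q" using nv Q by simp
    moreover have "abound (B' + Q * t1 + Q) \<le> w"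
      by (rule order_trans[OF abound_mono Suc.prems(4)]) (simp only: mult_Suc distrib_left distrib_right, use t1 in linarith)
    ultimately obtain s2 where 2: "exec w (NStore (va v) (NAdd (NLoad (va v)) (NConst 1))) s1 1 s2"
        "\<forall>x. fst s2 x \<le> B' + Q * t1 + Q" "rep n m s2 (setv v (Suc ?k) (den n m p (?L ?k)))"
      using exec_store_var[OF 1(2), of "B' + Q * t1" Q w v "NAdd (NLoad (va v)) (NConst 1)" "Suc ?k"]
        1(1) Q v nv by (auto simp: runs_def)
    have r2: "rep n m s2 (?L (N - d))" using 2(3) by (metis k loop.simps(2))
    have "abound (B' + Q * t1 + Q + Q * (d * (?tp + 2) + 1)) \<le> w"
      by (rule order_trans[OF abound_mono Suc.prems(4)]) (simp only: mult_Suc distrib_left distrib_right, use t1 in linarith)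
    then obtain t3 s3 where 3: "runs w ?W s2 t3 s3 (B' + Q * t1 + Q) Q (d * (?tp + 2) + 1)" "rep n m s3 (?L N)"
      using Suc.IH[of s2 "B' + Q * t1 + Q"] Suc.prems(1) r2 2(2) by auto
    have bd: "exec w ?body s' (t1 + 1) s2" 
      by (rule exec.Seq[OF _ 2(1)]) (use 1(1) in \<open>simp add: runs_def\<close>)
    have "exec w ?W s' (1 + (t1 + 1) + t3) s3"
      using exec.WhileTrue[OF g bd] 3(1) by (simp add: runs_def)
    moreover have "1 + (t1 + 1) + t3 \<le> Suc d * (?tp + 2) + 1" using 1(1) 3(1) by (simp add: runs_def)
    moreover have "fst s3 x \<le> B' + Q * (1 + (t1 + 1) + t3)" for x
    proof -
      have "fst s3 x \<le> B' + Q * t1 + Q + Q * t3" using 3(1) by (simp add: runs_def)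
      then show ?thesis by (simp add: algebra_simps)
    qed
    ultimately show ?case using 3(2) unfolding runs_def by blast
  qed
  have "abound (B + Q) \<le> w"
    by (rule order_trans[OF abound_mono For.prems(5)]) (simp add: N_def algebra_simps)
  then obtain s1 where 1: "exec w (NStore (va v) (NConst 0)) s 1 s1" "\<forall>x. fst s1 x \<le> B + Q" "rep n m s1 (setv v 0 st)"
    using exec_store_var[OF For.prems(2,3), of Q w v "NConst 0" 0] Q v by auto
  have "abound (B + Q + Q * (N * (?tp + 2) + 1)) \<le> w"
    by (rule order_trans[OF abound_mono For.prems(5)]) (simp add: N_def algebra_simps)
  then obtain t2 s2 where 2: "runs w ?W s1 t2 s2 (B + Q) Q (N * (?tp + 2) + 1)" "rep n m s2 (?L N)"
    using W[of N s1 "B + Q"] 1 by auto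
  have "runs w (cp (For v l p)) s (1 + t2) s2 B Q (time n m (For v l p))"
    using exec.Seq[OF 1(1)] 2(1) unfolding T runs_def by (auto simp: algebra_simps)
  moreover have "den n m (For v l p) st = ?L N" by (simp add: N_def)
  ultimately show ?case using 2(2) by metis
qed

section \<open>Polynomial time bounds\<close>

primrec dg :: "hp \<Rightarrow> nat" where
  "dg (Set j r c e) = 0"
| "dg (RZ i) = 0"
| "dg (RA i e) = 0"
| "dg (RC i j) = 0"
| "dg (Sq p q) = max (dg p) (dg q)"
| "dg (If b p q) = max (dg p) (dg q)"
| "dg (For v l p) = Suc (dg p)"

text \<open>Every loop limit is at most a constant times \<open>n\<close>, as
  \<open>m \<le> 3 * n\<close>; so each level of nesting contributes one factor \<open>n\<close>,
  and the exponent can be read off the syntax.\<close>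

lemma time_poly: "\<exists>K. \<forall>n m. 1 \<le> n \<longrightarrow> m \<le> 3 * n \<longrightarrow> time n m p \<le> K * n ^ dg p"
proof (induction p)
  case (Sq p q)
  then obtain K1 K2 where K: "\<forall>n m. 1 \<le> n \<longrightarrow> m \<le> 3 * n \<longrightarrow> time n m p \<le> K1 * n ^ dg p"
    "\<forall>n m. 1 \<le> n \<longrightarrow> m \<le> 3 * n \<longrightarrow> time n m q \<le> K2 * n ^ dg q" by blast
  have "time n m (Sq p q) \<le> (K1 + K2) * n ^ dg (Sq p q)" if "1 \<le> n" "m \<le> 3 * n" for n m
  proof -
    have "time n m (Sq p q) \<le> K1 * n ^ dg p + K2 * n ^ dg q" using K that by (simp add: add_mono)
    also have "\<dots> \<le> K1 * n ^ dg (Sq p q) + K2 * n ^ dg (Sq p q)"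
      using that by (intro add_mono mult_le_mono2 power_increasing) auto
    finally show ?thesis by (simp add: algebra_simps)
  qed
  then show ?case by blast
next
  case (If b p q)
  then obtain K1 K2 where K: "\<forall>n m. 1 \<le> n \<longrightarrow> m \<le> 3 * n \<longrightarrow> time n m p \<le> K1 * n ^ dg p"
    "\<forall>n m. 1 \<le> n \<longrightarrow> m \<le> 3 * n \<longrightarrow> time n m q \<le> K2 * n ^ dg q" by blast
  have "time n m (If b p q) \<le> (K1 + K2 + 1) * n ^ dg (If b p q)" if "1 \<le> n" "m \<le> 3 * n" for n m
  proof -
    have "time n m (If b p q) \<le> 1 + K1 * n ^ dg p + K2 * n ^ dg q" using K that by (simp add: add_mono)
    also have "\<dots> \<le> 1 * n ^ dg (If b p q) + K1 * n ^ dg (If b p q) + K2 * n ^ dg (If b p q)"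
      using that by (intro add_mono mult_le_mono2 power_increasing) auto
    finally show ?thesis by (simp add: algebra_simps)
  qed
  then show ?case by blast
next
  case (For v l p)
  then obtain K where K: "\<forall>n m. 1 \<le> n \<longrightarrow> m \<le> 3 * n \<longrightarrow> time n m p \<le> K * n ^ dg p" by blast
  define k where "k = (case l of LN k \<Rightarrow> k | LM \<Rightarrow> 3)"
  have "time n m (For v l p) \<le> (2 + k * (K + 2)) * n ^ dg (For v l p)" if "1 \<le> n" "m \<le> 3 * n" for n m
  proof -
    have l: "lv n m l \<le> k * n" using that by (auto simp: k_def split: lim.splits)
    have "1 \<le> n ^ dg p" using that by simp
    then have "time n m p + 2 \<le> (K + 2) * n ^ dg p"
      using K[rule_format, OF that] by (simp add: algebra_simps)
    then have "lv n m l * (time n m p + 2) \<le> (k * n) * ((K + 2) * n ^ dg p)" using l by (rule mult_le_mono[rotated])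
    moreover have "1 \<le> n ^ dg (For v l p)" using that by (intro one_le_power) auto
    ultimately have "time n m (For v l p) \<le> 2 * n ^ dg (For v l p) + (k * n) * ((K + 2) * n ^ dg p)"
      unfolding time.simps by linarith
    then show ?thesis by (simp add: algebra_simps)
  qed
  then show ?case by blast
qed (auto intro: exI[of _ 1])

section \<open>Cuts and regions\<close>

text \<open>
  A graph on a changing vertex set is given by the ends \<open>A i\<close>, \<open>B i\<close> of the edges \<open>i < m\<close>; deleted edges become loops,
  which no cut sees. In \<open>valid\<close>, \<open>q\<close> assigns the classes 0, 1, 2, 3 and the cuts inside \<open>S\<close> are exempt.
\<close>

definition cr :: "(nat \<Rightarrow> nat) \<Rightarrow> (nat \<Rightarrow> nat) \<Rightarrow> nat set \<Rightarrow> nat \<Rightarrow> bool" where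
  "cr A B U i \<longleftrightarrow> (A i \<in> U) \<noteq> (B i \<in> U)"

definition cut :: "nat \<Rightarrow> (nat \<Rightarrow> nat) \<Rightarrow> (nat \<Rightarrow> nat) \<Rightarrow> nat set \<Rightarrow> nat set" where
  "cut m A B U = {i. i < m \<and> cr A B U i}"

text \<open>Contracting everything outside \<open>S\<close> to one vertex would give a cubic 3-edge
  connected graph. Stated by cuts of subsets of \<open>S\<close>, the notion needs no such
  contraction and ignores changes elsewhere.\<close>

definition region :: "nat \<Rightarrow> (nat \<Rightarrow> nat) \<Rightarrow> (nat \<Rightarrow> nat) \<Rightarrow> nat set \<Rightarrow> bool" where
  "region m A B S \<longleftrightarrow> finite S \<and> S \<noteq> {} \<and> (\<forall>U. U \<subseteq> S \<longrightarrow> U \<noteq> {} \<longrightarrow> 3 \<le> card (cut m A B U)) \<and>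
     card (cut m A B S) = 3 \<and> (\<forall>v\<in>S. card (cut m A B {v}) = 3)"

definition valid :: "nat \<Rightarrow> (nat \<Rightarrow> nat) \<Rightarrow> (nat \<Rightarrow> nat) \<Rightarrow> (nat \<Rightarrow> nat) \<Rightarrow> nat set \<Rightarrow> nat set \<Rightarrow> bool" where
  "valid m A B q V S \<longleftrightarrow> (\<forall>U. U \<subseteq> V - S \<longrightarrow> U \<noteq> {} \<longrightarrow>
     (\<exists>i\<in>cut m A B U. q i \<noteq> 2) \<and> (\<exists>i\<in>cut m A B U. q i \<noteq> 3) \<and>
     2 \<le> card {i \<in> cut m A B U. q i \<noteq> 0} \<and> 2 \<le> card {i \<in> cut m A B U. q i \<noteq> 1})"

definition ends_in :: "nat \<Rightarrow> (nat \<Rightarrow> nat) \<Rightarrow> (nat \<Rightarrow> nat) \<Rightarrow> nat set \<Rightarrow> bool" where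
  "ends_in m A B V \<longleftrightarrow> (\<forall>i<m. A i \<noteq> B i \<longrightarrow> A i \<in> V \<and> B i \<in> V)"

definition joins :: "(nat \<Rightarrow> nat) \<Rightarrow> (nat \<Rightarrow> nat) \<Rightarrow> nat \<Rightarrow> nat \<Rightarrow> nat \<Rightarrow> bool" where
  "joins A B i u v \<longleftrightarrow> (A i = u \<and> B i = v) \<or> (A i = v \<and> B i = u)"

lemma cr_joins: "joins A B i u v \<Longrightarrow> cr A B U i \<longleftrightarrow> (u \<in> U) \<noteq> (v \<in> U)"
  by (auto simp: joins_def cr_def)

lemma finite_cut [simp]: "finite (cut m A B U)"
  by (simp add: cut_def)

lemma in_cut: "i \<in> cut m A B U \<longleftrightarrow> i < m \<and> cr A B U i"
  by (simp add: cut_def)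

lemma cr_remove: "v \<in> S \<Longrightarrow> cr A B (S - {v}) i \<longleftrightarrow> cr A B S i \<noteq> cr A B {v} i"
  by (auto simp: cr_def)

lemma cut_remove: "v \<in> S \<Longrightarrow>
    cut m A B (S - {v}) = (cut m A B S - cut m A B {v}) \<union> (cut m A B {v} - cut m A B S)"
  by (auto simp: cut_def cr_remove)

text \<open>The cut of \<open>S - {v}\<close> is the symmetric difference of the cuts of
  \<open>S\<close> and \<open>{v}\<close>. With degree 3 at \<open>v\<close>, lower bounds for
  \<open>S - {v}\<close> become upper bounds for the edges shared by the two cuts.\<close>

lemma card_cut_remove:
  assumes "v \<in> S"
  shows "card (cut m A B (S - {v})) + 2 * card (cut m A B S \<inter> cut m A B {v}) =
    card (cut m A B S) + card (cut m A B {v})"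
proof -
  let ?X = "cut m A B S" and ?Y = "cut m A B {v}"
  have "card (cut m A B (S - {v})) = card (?X - ?Y) + card (?Y - ?X)"
    unfolding cut_remove[OF assms] by (rule card_Un_disjoint) auto
  moreover have "card ?X = card (?X - ?Y) + card (?X \<inter> ?Y)"
    by (metis card_Diff_subset_Int card_mono finite_Int finite_cut inf_le1 le_add_diff_inverse2)
  moreover have "card ?Y = card (?Y - ?X) + card (?X \<inter> ?Y)"
    by (metis card_Diff_subset_Int card_mono finite_Int finite_cut inf_commute inf_le1 le_add_diff_inverse2)
  ultimately show ?thesis by simp
qed

lemma region_ge3: "region m A B S \<Longrightarrow> U \<subseteq> S \<Longrightarrow> U \<noteq> {} \<Longrightarrow> 3 \<le> card (cut m A B U)"
  by (simp add: region_def)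

text \<open>With two boundary edges at \<open>v\<close>, the nonempty set \<open>S - {v}\<close>
  would have a cut of at most 3 + 3 - 4 = 2 edges.\<close>

lemma region_one_boundary_edge:
  assumes R: "region m A B S" and "v \<in> S" "S \<noteq> {v}"
  shows "card (cut m A B S \<inter> cut m A B {v}) \<le> 1"
proof -
  have "S - {v} \<noteq> {}" using assms by auto
  then have "3 \<le> card (cut m A B (S - {v}))" using R unfolding region_def by auto
  then show ?thesis using card_cut_remove[OF assms(2), of m A B] R assms(2) unfolding region_def by auto
qed

lemma region_one_boundary_edgeD:
  assumes "region m A B S" "v \<in> S" "S \<noteq> {v}" "i \<in> cut m A B S" "j \<in> cut m A B S"
    "i \<in> cut m A B {v}" "j \<in> cut m A B {v}"
  shows "i = j"
proof (rule ccontr)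
  assume "i \<noteq> j"
  then have "card {i, j} = 2" by simp
  moreover have "card {i, j} \<le> card (cut m A B S \<inter> cut m A B {v})" using assms by (intro card_mono) auto
  ultimately show False using region_one_boundary_edge[OF assms(1-3)] by simp
qed

section \<open>Reducing a region\<close>

text \<open>The picture around the edge \<open>e\<close> to be deleted, with
  \<open>x = b0 a\<close>, \<open>e = a y\<close>, \<open>f = a p\<close>, \<open>g = r y\<close>
  and \<open>h = y s\<close>. One edge at \<open>y\<close> may leave \<open>S\<close>; the names are
  chosen so that this can only be \<open>g\<close>, hence nothing is said about where
  \<open>r\<close> lies.\<close>

locale deletable =
  fixes m :: nat and A B :: "nat \<Rightarrow> nat" and S :: "nat set" and x a b0 e y f p g r h s :: nat
  assumes R: "region m A B S"
    and x: "x < m" "joins A B x b0 a" and e: "e < m" "joins A B e a y" and f: "f < m" "joins A B f a p"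
    and g: "g < m" "joins A B g r y" and h: "h < m" "joins A B h y s"
    and a: "cut m A B {a} = {x, e, f}" and y: "cut m A B {y} = {e, g, h}"
    and inS: "a \<in> S" "y \<in> S" "p \<in> S" "s \<in> S" "b0 \<notin> S"
begin

lemma distinct_edges: "distinct [x, e, f, g, h]" "a \<noteq> y"
proof -
  have ca: "card (cut m A B {a}) = 3" and cy: "card (cut m A B {y}) = 3" using R inS by (auto simp: region_def)
  have "card {x, e, f} = 3" "card {e, g, h} = 3" using ca cy a y by auto
  then have 1: "x \<noteq> e" "x \<noteq> f" "e \<noteq> f" "e \<noteq> g" "e \<noteq> h" "g \<noteq> h"
    by (auto simp: card_insert_if split: if_splits)
  have "e \<in> cut m A B {a}" using a by simp
  then show "a \<noteq> y" using cr_joins[OF e(2), of "{a}"] by (auto simp: in_cut)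
  have "b0 \<noteq> y" using inS by auto
  have "x \<notin> cut m A B {y}" using cr_joins[OF x(2), of "{y}"] \<open>a \<noteq> y\<close> \<open>b0 \<noteq> y\<close> by (auto simp: in_cut)
  then have 2: "x \<noteq> g" "x \<noteq> h" using y by auto
  \<comment> \<open>An edge \<open>f\<close> parallel to \<open>e\<close> would leave the set
    \<open>{a, y}\<close> with at most two boundary edges.\<close>
  have "f \<notin> cut m A B {y}"
  proof
    assume fy: "f \<in> cut m A B {y}"
    then have py: "p = y" using cr_joins[OF f(2), of "{y}"] \<open>a \<noteq> y\<close> by (auto simp: in_cut)
    let ?U = "{a, y}"
    have U: "?U - {y} = {a}" using \<open>a \<noteq> y\<close> by auto
    have eU: "e \<notin> cut m A B ?U" "f \<notin> cut m A B ?U"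
      using cr_joins[OF e(2), of ?U] cr_joins[OF f(2), of ?U] py by (auto simp: in_cut)
    have "3 \<le> card (cut m A B ?U)" using R inS by (auto simp: region_def)
    moreover have "card (cut m A B {a}) + 2 * card (cut m A B ?U \<inter> cut m A B {y}) =
      card (cut m A B ?U) + card (cut m A B {y})" using card_cut_remove[of y ?U m A B] U by simp
    moreover have "cut m A B ?U \<inter> cut m A B {y} \<subseteq> {g, h} - {f}" using eU y by auto
    moreover have "f = g \<or> f = h" using fy y 1 by auto
    then have "card ({g, h} - {f}) \<le> 1" using 1 by auto
    ultimately show False using ca cy card_mono[of "{g, h} - {f}" "cut m A B ?U \<inter> cut m A B {y}"] by auto
  qed
  then have "f \<noteq> g" "f \<noteq> h" using y by auto
  then show "distinct [x, e, f, g, h]" using 1 2 by auto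
qed

lemma distinct_vertices: "p \<noteq> a" "p \<noteq> y" "s \<noteq> a" "s \<noteq> y" "r \<noteq> a" "r \<noteq> y" "b0 \<noteq> a" "b0 \<noteq> y"
proof -
  note d = distinct_edges
  show "b0 \<noteq> a" "b0 \<noteq> y" using inS by auto
  have "f \<in> cut m A B {a}" "f \<notin> cut m A B {y}" "g \<in> cut m A B {y}" "h \<in> cut m A B {y}"
    "g \<notin> cut m A B {a}" "h \<notin> cut m A B {a}" using a y d by auto
  then show "p \<noteq> a" "p \<noteq> y" "s \<noteq> a" "s \<noteq> y" "r \<noteq> a" "r \<noteq> y"
    using cr_joins[OF f(2), of "{a}"] cr_joins[OF f(2), of "{y}"] cr_joins[OF g(2), of "{a}"]
      cr_joins[OF g(2), of "{y}"] cr_joins[OF h(2), of "{a}"] cr_joins[OF h(2), of "{y}"] d(2) f(1) g(1) h(1)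
    by (auto simp: in_cut)
qed

lemma other_edges:
  assumes "i < m" "i \<notin> {x, e, f, g, h}" "A i \<noteq> B i"
  shows "A i \<noteq> a" "A i \<noteq> y" "B i \<noteq> a" "B i \<noteq> y"
proof -
  have "i \<notin> cut m A B {a}" "i \<notin> cut m A B {y}" using assms a y by auto
  then show "A i \<noteq> a" "A i \<noteq> y" "B i \<noteq> a" "B i \<noteq> y" using assms by (auto simp: in_cut cr_def)
qed

end

text \<open>Suppressing the ends of \<open>e\<close> merges \<open>f\<close> into \<open>x\<close>
  and \<open>h\<close> into \<open>g\<close>: the names \<open>x\<close> and \<open>g\<close>
  survive with new ends, while \<open>e\<close>, \<open>f\<close> and \<open>h\<close> become loops.
  Edge names are thus common to all levels and classes need no translation.\<close>

locale deletion = deletable m A B S x a b0 e y f p g r h s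
  for m :: nat and A B A' B' :: "nat \<Rightarrow> nat" and S :: "nat set" and x a b0 e y f p g r h s :: nat +
  assumes x': "joins A' B' x b0 p" and g': "joins A' B' g r s"
    and dead: "A' e = B' e" "A' f = B' f" "A' h = B' h"
    and same: "\<And>i. i < m \<Longrightarrow> i \<notin> {x, e, f, g, h} \<Longrightarrow> A' i = A i \<and> B' i = B i"
begin

lemma dead_cr: "\<not> cr A' B' U e" "\<not> cr A' B' U f" "\<not> cr A' B' U h"
  using dead by (auto simp: cr_def)

text \<open>With \<open>a\<close> on the side of \<open>p\<close> and \<open>y\<close> on the side
  of \<open>s\<close>, the edges \<open>f\<close> and \<open>h\<close> do not cross, and
  \<open>x\<close> and \<open>g\<close> cross before exactly if they cross after. Only
  \<open>e\<close> can make a difference.\<close>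

lemma cut_lift:
  assumes "a \<notin> U" "y \<notin> U"
  defines "U1 \<equiv> U \<union> (if p \<in> U then {a} else {}) \<union> (if s \<in> U then {y} else {})"
  shows "cut m A B U1 - {e} = cut m A' B' U"
proof -
  have mem: "a \<in> U1 \<longleftrightarrow> p \<in> U" "y \<in> U1 \<longleftrightarrow> s \<in> U" "\<And>v. v \<noteq> a \<Longrightarrow> v \<noteq> y \<Longrightarrow> v \<in> U1 \<longleftrightarrow> v \<in> U"
    using assms distinct_edges(2) by auto
  have "i \<in> cut m A B U1 - {e} \<longleftrightarrow> i \<in> cut m A' B' U" for i
  proof (cases "i < m \<and> i \<notin> {x, e, f, g, h}")
    case True
    then show ?thesis using same[of i] other_edges[of i] mem
      by (cases "A i = B i") (auto simp: in_cut cr_def)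
  next
    case False
    then consider "\<not> i < m" | "i = x" | "i = e" | "i = f" | "i = g" | "i = h" by auto
    then show ?thesis
    proof cases
      case 2
      then show ?thesis using x distinct_edges mem distinct_vertices
        by (auto simp: in_cut cr_joins[OF x(2)] cr_joins[OF x'])
    next
      case 3 then show ?thesis using dead_cr by (auto simp: in_cut)
    next
      case 4 then show ?thesis using dead_cr mem distinct_vertices by (auto simp: in_cut cr_joins[OF f(2)])
    next
      case 5 then show ?thesis using g distinct_edges mem distinct_vertices
        by (auto simp: in_cut cr_joins[OF g(2)] cr_joins[OF g'])
    next
      case 6 then show ?thesis using dead_cr mem distinct_vertices by (auto simp: in_cut cr_joins[OF h(2)])
    qed (auto simp: in_cut)
  qed
  then show ?thesis by blast
qed

text \<open>A lifted cut loses at most \<open>e\<close>, so it must have at least 4 edges whenever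
  \<open>e\<close> crosses. If the lifted set contains \<open>y\<close> but not \<open>a\<close>, it
  also contains \<open>s\<close>, and the hypothesis applies. If it contains \<open>a\<close> but
  not \<open>y\<close>, both \<open>x\<close> and \<open>e\<close> leave it at \<open>a\<close>, and
  removing \<open>a\<close> would turn a cut of 3 into one of at most 2; so such sets need not be
  searched for.\<close>

lemma region_after_deletion:
  assumes noW: "\<And>W. W \<subseteq> S - {a} \<Longrightarrow> y \<in> W \<Longrightarrow> 2 \<le> card W \<Longrightarrow> card (cut m A B W) \<noteq> 3"
  shows "region m A' B' (S - {a, y})"
proof -
  let ?S = "S - {a, y}"
  have fin: "finite S" using R by (simp add: region_def)
  have ge3: "3 \<le> card (cut m A' B' U)" if U: "U \<subseteq> ?S" "U \<noteq> {}" for U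
  proof -
    define U1 where "U1 = U \<union> (if p \<in> U then {a} else {}) \<union> (if s \<in> U then {y} else {})"
    have nU: "a \<notin> U" "y \<notin> U" using U by auto
    have lift: "cut m A B U1 - {e} = cut m A' B' U" unfolding U1_def by (rule cut_lift[OF nU])
    have U1: "U1 \<subseteq> S" "U1 \<noteq> {}" using U inS by (auto simp: U1_def)
    then have c3: "3 \<le> card (cut m A B U1)" using R by (auto simp: region_def)
    have mem: "a \<in> U1 \<longleftrightarrow> p \<in> U" "y \<in> U1 \<longleftrightarrow> s \<in> U" using nU distinct_edges(2) by (auto simp: U1_def)
    show ?thesis
    proof (cases "e \<in> cut m A B U1")
      case False
      then show ?thesis using lift c3 by simp
    next
      case True
      then have "(a \<in> U1) \<noteq> (y \<in> U1)" by (simp add: in_cut cr_joins[OF e(2)])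
      then have "card (cut m A B U1) \<noteq> 3"
      proof (cases "y \<in> U1")
        case True
        with \<open>(a \<in> U1) \<noteq> (y \<in> U1)\<close> have "a \<notin> U1" by simp
        have "s \<in> U1" "s \<noteq> y" using True mem distinct_vertices by (auto simp: U1_def)
        then have "card {s, y} \<le> card U1" using True U1 fin by (intro card_mono) (auto intro: finite_subset)
        then show ?thesis using noW[of U1] True U1 \<open>a \<notin> U1\<close> \<open>s \<noteq> y\<close> by auto
      next
        case False
        with \<open>(a \<in> U1) \<noteq> (y \<in> U1)\<close> have aU: "a \<in> U1" by simp
        have "U1 - {a} \<noteq> {}" using U nU by (auto simp: U1_def)
        then have "3 \<le> card (cut m A B (U1 - {a}))" using region_ge3[OF R, of "U1 - {a}"] U1 by auto
        moreover have "x \<in> cut m A B U1" using aU U1 inS x by (auto simp: in_cut cr_joins[OF x(2)])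
        then have "card {x, e} \<le> card (cut m A B U1 \<inter> cut m A B {a})" using True a by (intro card_mono) auto
        moreover have "card {x, e} = 2" using distinct_edges by simp
        moreover have "card (cut m A B {a}) = 3" using R inS by (auto simp: region_def)
        ultimately show ?thesis using card_cut_remove[OF aU, of m A B] by linarith
      qed
      then have "4 \<le> card (cut m A B U1)" using c3 by simp
      then show ?thesis using lift card_Diff_singleton[OF True] by simp
    qed
  qed
  have "card (cut m A' B' ?S) = 3"
  proof -
    have "cut m A B S - {e} = cut m A' B' ?S"
    proof -
      have "?S \<union> (if p \<in> ?S then {a} else {}) \<union> (if s \<in> ?S then {y} else {}) = S"
        using inS distinct_vertices by auto
      then show ?thesis using cut_lift[of ?S] by auto
    qed
    moreover have "e \<notin> cut m A B S" using inS by (simp add: in_cut cr_joins[OF e(2)])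
    ultimately show ?thesis using R by (simp add: region_def)
  qed
  moreover have "card (cut m A' B' {v}) = 3" if v: "v \<in> ?S" for v
  proof -
    have cv: "card (cut m A B {v}) = 3" using R v by (auto simp: region_def)
    \<comment> \<open>At \<open>p\<close> the edge \<open>f\<close> is replaced by \<open>x\<close>,
      at \<open>s\<close> the edge \<open>h\<close> by \<open>g\<close>. An upper bound of 3
      suffices, the lower one being known; thus the case \<open>p = s\<close> needs no separate
      count.\<close>
    have sub: "cut m A' B' {v} \<subseteq> (cut m A B {v} - (if p = v then {f} else {}) - (if s = v then {h} else {})) \<union>
        (if p = v then {x} else {}) \<union> (if s = v then {g} else {})" (is "_ \<subseteq> ?Z")
    proof
      fix i assume i: "i \<in> cut m A' B' {v}"
      have vv: "v \<noteq> a" "v \<noteq> y" "v \<noteq> b0" using v inS by auto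
      from i dead_cr have ne: "i \<noteq> e" "i \<noteq> f" "i \<noteq> h" by (auto simp: in_cut)
      show "i \<in> ?Z"
      proof (cases "i \<in> {x, g}")
        case False
        then show ?thesis using i ne same[of i] by (auto simp: in_cut cr_def)
      next
        case True
        then show ?thesis using i vv distinct_edges
          by (auto simp: in_cut cr_joins[OF x'] cr_joins[OF g'] cr_joins[OF g(2)])
      qed
    qed
    have pf: "f \<in> cut m A B {v}" if "p = v"
      using that f v by (auto simp: in_cut cr_joins[OF f(2)])
    have sh: "h \<in> cut m A B {v}" if "s = v"
      using that h v by (auto simp: in_cut cr_joins[OF h(2)])
    have "card ?Z \<le> 3"
    proof -
      have "card ?Z \<le> card (cut m A B {v} - (if p = v then {f} else {}) - (if s = v then {h} else {})) +
          card (if p = v then {x} else {}) + card (if s = v then {g} else {})"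
        by (intro order_trans[OF card_Un_le] add_mono card_Un_le order_refl)
      moreover have "h \<noteq> f" using distinct_edges by auto
      then have "card (cut m A B {v} - (if p = v then {f} else {}) - (if s = v then {h} else {})) =
          3 - (if p = v then 1 else 0) - (if s = v then 1 else 0)"
        using cv pf sh by (auto simp: card_Diff_singleton)
      ultimately show ?thesis by (auto split: if_splits)
    qed
    moreover have "finite ?Z" by simp
    ultimately have "card (cut m A' B' {v}) \<le> 3" using card_mono[OF \<open>finite ?Z\<close> sub] by linarith
    moreover have "3 \<le> card (cut m A' B' {v})" using ge3[of "{v}"] v by auto
    ultimately show ?thesis by simp
  qed
  ultimately show ?thesis using fin ge3 inS distinct_vertices unfolding region_def by blast
qed

lemma cut_outside:
  assumes "U \<inter> S = {}"
  shows "cut m A' B' U = cut m A B U"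
proof -
  have nU: "a \<notin> U" "y \<notin> U" "p \<notin> U" "s \<notin> U" using assms inS by auto
  then have "cut m A B U - {e} = cut m A' B' U" using cut_lift[of U] by simp
  moreover have "e \<notin> cut m A B U" using nU by (simp add: in_cut cr_joins[OF e(2)])
  ultimately show ?thesis by auto
qed

lemma valid_after_deletion:
  assumes "valid m A B q V S"
  shows "valid m A' B' q (V - {a, y}) (S - {a, y})"
proof -
  have "(V - {a, y}) - (S - {a, y}) = V - S" using inS by auto
  moreover have "cut m A' B' U = cut m A B U" if "U \<subseteq> V - S" for U
    by (rule cut_outside) (use that in auto)
  ultimately show ?thesis using assms unfolding valid_def by simp
qed

lemma ends_after_deletion:
  assumes "ends_in m A B V"
  shows "ends_in m A' B' (V - {a, y})" "b0 \<in> V" "p \<in> V" "r \<in> V" "s \<in> V"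
proof -
  have mem: "u \<in> V \<and> v \<in> V" if "i < m" "joins A B i u v" "u \<noteq> v" for i u v
    using assms that by (auto simp: ends_in_def joins_def)
  note d = distinct_vertices
  have "b0 \<in> V" using mem[OF x] d by blast
  moreover have "p \<in> V" using mem[OF f] d by blast
  moreover have "r \<in> V" using mem[OF g] d by blast
  moreover have "s \<in> V" using mem[OF h] d by blast
  ultimately show V: "b0 \<in> V" "p \<in> V" "r \<in> V" "s \<in> V" by auto
  show "ends_in m A' B' (V - {a, y})" unfolding ends_in_def
  proof (intro allI impI)
    fix i assume i: "i < m" "A' i \<noteq> B' i"
    show "A' i \<in> V - {a, y} \<and> B' i \<in> V - {a, y}"
    proof (cases "i \<in> {x, e, f, g, h}")
      case True
      then show ?thesis using i dead x' g' V d by (auto simp: joins_def)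
    next
      case False
      then show ?thesis using i same[of i] other_edges[of i] assms by (auto simp: ends_in_def)
    qed
  qed
qed

end

lemma region_local:
  assumes R: "region m A B S" and x: "x \<in> cut m A B S" "x \<in> cut m A B {a}" and a: "a \<in> S"
    and i: "i \<in> cut m A B {a}" "i \<noteq> x" and S: "S \<noteq> {a}"
  shows "i \<notin> cut m A B S"
  using region_one_boundary_edgeD[OF R a S x(1) _ x(2) i(1)] i(2) by auto

text \<open>Otherwise all three edges at \<open>y\<close> would leave \<open>W\<close>, and
  \<open>W - {y}\<close> would have an empty cut. Consequently two flow problems, one with sources
  \<open>y\<close> and \<open>r\<close>, one with sources \<open>y\<close> and \<open>s\<close>,
  detect every tight set.\<close>

lemma tight_set_neighbour:
  assumes R: "region m A B S" and y: "cut m A B {y} = {e, g, h}" and W: "W \<subseteq> S" "y \<in> W" "2 \<le> card W"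
    "card (cut m A B W) = 3" and e: "e \<in> cut m A B W" and g: "joins A B g r y" and h: "joins A B h y s"
  shows "r \<in> W \<or> s \<in> W"
proof (rule ccontr)
  assume n: "\<not> (r \<in> W \<or> s \<in> W)"
  have cy: "card (cut m A B {y}) = 3" using R W by (auto simp: region_def)
  have "g < m" "h < m" using y by (auto simp: set_eq_iff in_cut)
  then have sub: "cut m A B {y} \<subseteq> cut m A B W"
    using n y e W by (auto simp: in_cut cr_joins[OF g] cr_joins[OF h])
  then have "cut m A B W \<inter> cut m A B {y} = cut m A B {y}" by auto
  then have "card (cut m A B (W - {y})) = 0" using card_cut_remove[OF W(2), of m A B] W(4) cy by simp
  moreover have "W - {y} \<noteq> {}"
  proof
    assume "W - {y} = {}"
    then have "W = {y}" using W by auto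
    then show False using W by simp
  qed
  ultimately show False using region_ge3[OF R, of "W - {y}"] W by auto
qed

lemma region_subset:
  assumes "region m A B S" "W \<subseteq> S" "W \<noteq> {}" "card (cut m A B W) = 3"
  shows "region m A B W"
  using assms unfolding region_def by (auto intro: finite_subset)

section \<open>Contracting a tight set\<close>

lemma cut_contract:
  assumes w: "\<And>i. i < m \<Longrightarrow> A i \<noteq> w \<and> B i \<noteq> w" and "U \<inter> W = {}"
  shows "cut m (\<lambda>i. if A i \<in> W then w else A i) (\<lambda>i. if B i \<in> W then w else B i) U =
    cut m A B (if w \<in> U then (U - {w}) \<union> W else U)"
  using assms by (auto simp: cut_def cr_def)

lemma cut_congr: "(\<And>i. i < m \<Longrightarrow> A' i = A i \<and> B' i = B i) \<Longrightarrow> cut m A' B' U = cut m A B U"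
  by (auto simp: cut_def cr_def)

lemma region_after_contraction:
  assumes R: "region m A B S" and W: "W \<subseteq> S" "W \<noteq> {}" "card (cut m A B W) = 3"
    and w: "\<And>i. i < m \<Longrightarrow> A i \<noteq> w \<and> B i \<noteq> w" "w \<notin> S"
  shows "region m (\<lambda>i. if A i \<in> W then w else A i) (\<lambda>i. if B i \<in> W then w else B i) (insert w (S - W))"
proof -
  let ?A = "\<lambda>i. if A i \<in> W then w else A i" and ?B = "\<lambda>i. if B i \<in> W then w else B i"
  let ?S = "insert w (S - W)"
  have c: "cut m ?A ?B U = cut m A B (if w \<in> U then (U - {w}) \<union> W else U)" if "U \<subseteq> ?S" for U
    by (rule cut_contract) (use w W that in auto)
  have "3 \<le> card (cut m ?A ?B U)" if U: "U \<subseteq> ?S" "U \<noteq> {}" for U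
    unfolding c[OF U(1)] by (rule region_ge3[OF R]) (use U W w in auto)
  moreover have "card (cut m ?A ?B ?S) = 3"
  proof -
    have "(?S - {w}) \<union> W = S" using W w by auto
    then show ?thesis using c[of ?S] R by (simp add: region_def)
  qed
  moreover have "card (cut m ?A ?B {v}) = 3" if "v \<in> ?S" for v
    using c[of "{v}"] that W R by (auto simp: region_def)
  ultimately show ?thesis using R by (auto simp: region_def)
qed

lemma valid_after_contraction:
  assumes "valid m A B q V S" "W \<subseteq> S" "\<And>i. i < m \<Longrightarrow> A i \<noteq> w \<and> B i \<noteq> w" "w \<notin> V"
  shows "valid m (\<lambda>i. if A i \<in> W then w else A i) (\<lambda>i. if B i \<in> W then w else B i) q
    (insert w (V - W)) (insert w (S - W))"
proof -
  have "insert w (V - W) - insert w (S - W) = V - S" using assms(2,4) by auto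
  moreover have "cut m (\<lambda>i. if A i \<in> W then w else A i) (\<lambda>i. if B i \<in> W then w else B i) U = cut m A B U"
    if "U \<subseteq> V - S" for U
  proof -
    have "w \<notin> U" "U \<inter> W = {}" using that assms by auto
    then show ?thesis using cut_contract[of m A w B U W] assms(3) by simp
  qed
  ultimately show ?thesis using assms(1) unfolding valid_def by simp
qed

text \<open>Used for reopening \<open>W\<close>: a cut that avoids \<open>W\<close> also avoids the
  contracted vertex and has the same edges, so the exempt vertex turns into the exempt set.\<close>

lemma valid_before_contraction:
  assumes "valid m (\<lambda>i. if A i \<in> W then w else A i) (\<lambda>i. if B i \<in> W then w else B i) q (insert w (V - W)) {w}"
    "\<And>i. i < m \<Longrightarrow> A i \<noteq> w \<and> B i \<noteq> w" "w \<notin> V"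
  shows "valid m A B q V W"
proof -
  have "insert w (V - W) - {w} = V - W" using assms(3) by auto
  moreover have "cut m (\<lambda>i. if A i \<in> W then w else A i) (\<lambda>i. if B i \<in> W then w else B i) U = cut m A B U"
    if "U \<subseteq> V - W" for U
  proof -
    have "w \<notin> U" "U \<inter> W = {}" using that assms by auto
    then show ?thesis using cut_contract[of m A w B U W] assms(2) by simp
  qed
  ultimately show ?thesis using assms(1) unfolding valid_def by simp
qed

lemma cut_complement: "ends_in m A B V \<Longrightarrow> U \<subseteq> V \<Longrightarrow> cut m A B (V - U) = cut m A B U"
  by (auto simp: cut_def cr_def ends_in_def)

text \<open>Complementing a set does not change its cut. Hence with a single exempt vertex all
  proper cuts are controlled, and any vertex may take the exempt role.\<close>

lemma valid_singleton_change:
  assumes v: "valid m A B q V {u}" and e: "ends_in m A B V" and V: "u \<in> V" "v \<in> V"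
  shows "valid m A B q V {v}"
  unfolding valid_def
proof (intro allI impI)
  fix U assume U: "U \<subseteq> V - {v}" "U \<noteq> {}"
  define U' where "U' = (if u \<in> U then V - U else U)"
  have "U' \<subseteq> V - {u}" "U' \<noteq> {}" using U V by (auto simp: U'_def)
  moreover have "cut m A B U' = cut m A B U" using cut_complement[OF e, of U] U by (auto simp: U'_def)
  ultimately show "(\<exists>i\<in>cut m A B U. q i \<noteq> 2) \<and> (\<exists>i\<in>cut m A B U. q i \<noteq> 3) \<and>
     2 \<le> card {i \<in> cut m A B U. q i \<noteq> 0} \<and> 2 \<le> card {i \<in> cut m A B U. q i \<noteq> 1}"
    using v[unfolded valid_def, rule_format, of U'] by simp
qed

section \<open>Reinserting a deleted edge\<close>

lemma two_le_card:
  assumes "finite X" "i \<in> X" "j \<in> X" "i \<noteq> j"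
  shows "2 \<le> card X"
  using card_mono[of X "{i, j}"] assms by auto

lemma two_le_cardE:
  assumes "2 \<le> card X"
  obtains i j where "i \<in> X" "j \<in> X" "i \<noteq> j"
proof -
  have "finite X" using assms card.infinite by fastforce
  have "\<not> card X \<le> Suc 0" using assms by simp
  then show ?thesis using that card_le_Suc0_iff_eq[OF \<open>finite X\<close>] by blast
qed

context deletion
begin

lemma cr_image:
  assumes "i \<in> cut m A' B' (U - {a, y})" "i \<noteq> x" "i \<noteq> g"
  shows "i \<in> cut m A B U" "i \<notin> {x, e, f, g, h}"
proof -
  show n: "i \<notin> {x, e, f, g, h}" using assms dead_cr by (auto simp: in_cut)
  then show "i \<in> cut m A B U"
    using assms same[of i] other_edges[of i] by (cases "A i = B i") (auto simp: in_cut cr_def)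
qed

lemma cr_image_x: "x \<in> cut m A' B' (U - {a, y}) \<Longrightarrow> x \<in> cut m A B U \<or> f \<in> cut m A B U"
  using x(1) f(1) distinct_vertices by (auto simp: in_cut cr_joins[OF x'] cr_joins[OF x(2)] cr_joins[OF f(2)])

lemma cr_image_g: "g \<in> cut m A' B' (U - {a, y}) \<Longrightarrow> g \<in> cut m A B U \<or> h \<in> cut m A B U"
  using g(1) h(1) distinct_vertices by (auto simp: in_cut cr_joins[OF g'] cr_joins[OF g(2)] cr_joins[OF h(2)])

text \<open>An edge crossing in the reduced graph yields one crossing in the original graph:
  \<open>x\<close> yields \<open>x\<close> or \<open>f\<close>, \<open>g\<close> yields
  \<open>g\<close> or \<open>h\<close>, any other edge yields itself. Distinct edges have distinct
  images, so it is enough that both halves of a split edge stay outside class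
  \<open>k\<close>.\<close>

lemma two_crossing:
  assumes "2 \<le> card {i \<in> cut m A' B' (U - {a, y}). q i \<noteq> k}"
    and old: "\<And>i. i < m \<Longrightarrow> i \<notin> {x, e, f, g, h} \<Longrightarrow> q' i = q i"
    and x: "q x \<noteq> k \<Longrightarrow> q' x \<noteq> k \<and> q' f \<noteq> k" and g: "q g \<noteq> k \<Longrightarrow> q' g \<noteq> k \<and> q' h \<noteq> k"
  shows "2 \<le> card {i \<in> cut m A B U. q' i \<noteq> k}"
proof -
  obtain i j where ij: "i \<in> {i \<in> cut m A' B' (U - {a, y}). q i \<noteq> k}"
    "j \<in> {i \<in> cut m A' B' (U - {a, y}). q i \<noteq> k}" "i \<noteq> j" by (rule two_le_cardE[OF assms(1)])
  have im: "\<exists>i'\<in>{i \<in> cut m A B U. q' i \<noteq> k}. (if i = x then i' \<in> {x, f} else if i = g then i' \<in> {g, h} else i' = i \<and> i \<notin> {x, e, f, g, h})"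
    if i: "i \<in> {i \<in> cut m A' B' (U - {a, y}). q i \<noteq> k}" for i
  proof -
    consider "i = x" | "i = g" "i \<noteq> x" | "i \<noteq> x" "i \<noteq> g" by auto
    then show ?thesis
    proof cases
      case 1 then show ?thesis using i cr_image_x[of U] x by auto
    next
      case 2 then show ?thesis using i cr_image_g[of U] g distinct_edges by auto
    next
      case 3 then show ?thesis using i cr_image[of i U] old[of i] by (auto simp: in_cut)
    qed
  qed
  from im[OF ij(1)] im[OF ij(2)] obtain i' j' where "i' \<in> {i \<in> cut m A B U. q' i \<noteq> k}" "j' \<in> {i \<in> cut m A B U. q' i \<noteq> k}"
    "i' \<noteq> j'" using ij(3) distinct_edges by (auto split: if_splits)
  then show ?thesis by (intro two_le_card[of _ i' j']) auto
qed

text \<open>Four deletions are checked. Without class \<open>fc\<close>, the vertex \<open>a\<close>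
  hangs on \<open>e\<close>, and \<open>y\<close> on those of \<open>g\<close> and \<open>h\<close>
  that survive, which is enough for connectivity. Without class 0 or 1, the edges \<open>x\<close>
  and \<open>f\<close> survive; if the class of \<open>g\<close> is the deleted one, then
  \<open>e\<close> survives and, together with the half of \<open>g\<close> in class
  \<open>oc\<close>, gives \<open>y\<close> two edges; otherwise both halves survive. Without class
  \<open>oc\<close>, the edges \<open>x\<close>, \<open>e\<close>, \<open>f\<close> tie
  \<open>a\<close> and \<open>y\<close> to \<open>b0\<close> and \<open>p\<close>, but one half of
  \<open>g\<close> is missing. The set \<open>D\<close> is what remains connected to
  \<open>x\<close> without \<open>g\<close>; the half that inherits the old class must lead from
  \<open>y\<close> to an end of \<open>g\<close> that may lie outside \<open>D\<close>.\<close>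

lemma valid_insertion:
  assumes V: "valid m A' B' q V' {t}" "t \<in> V'" "b0 \<in> V'" "p \<in> V'" "r \<in> V'" "s \<in> V'" "a \<notin> V'" "y \<notin> V'"
    and fc: "q x = fc" "fc \<in> {2, 3}" and oc: "oc = 5 - fc"
    and new: "q' x = fc" "q' f = fc" "q' e = (if q g = 0 then 1 else 0)"
      "\<And>i. i < m \<Longrightarrow> i \<notin> {x, e, f, g, h} \<Longrightarrow> q' i = q i"
    and cls: "if r \<in> D then q' g = oc \<and> q' h = q g else q' g = q g \<and> q' h = oc"
    and D: "p0 \<in> D" "D \<subseteq> V'" "p0 \<in> {b0, p}"
      "\<And>v U. v \<in> D \<Longrightarrow> (p0 \<in> U) \<noteq> (v \<in> U) \<Longrightarrow> \<exists>i\<in>cut m A' B' U. q i \<noteq> oc \<and> i \<noteq> g"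
      "\<And>i. i \<in> cut m A' B' D \<Longrightarrow> q i \<noteq> oc \<Longrightarrow> i = g"
    and E: "ends_in m A' B' V'"
  shows "valid m A B q' (insert a (insert y V')) {t}"
  unfolding valid_def
proof (intro allI impI)
  fix U assume U: "U \<subseteq> insert a (insert y V') - {t}" "U \<noteq> {}"
  let ?U = "U - {a, y}"
  have ty: "t \<noteq> a" "t \<noteq> y" using V by auto
  have bnd: "b0 \<notin> {a, y}" "p \<notin> {a, y}" "r \<notin> {a, y}" "s \<notin> {a, y}" using distinct_vertices by auto
  note d = distinct_edges
  have oc': "oc \<in> {2, 3}" "oc \<noteq> fc" using fc oc by auto
  have e01: "q' e \<in> {0, 1}" using new by auto
  have gh: "{q' g, q' h} = {oc, q g}" using cls by (auto split: if_splits)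
  have gh': "q' g = oc \<or> q' g = q g" "q' h = oc \<or> q' h = q g" "q' g = oc \<or> q' h = oc"
    using cls by (auto split: if_splits)
  have cra: "cr A B U x = ((b0 \<in> ?U) \<noteq> (a \<in> U))" "cr A B U e = ((a \<in> U) \<noteq> (y \<in> U))"
    "cr A B U f = ((a \<in> U) \<noteq> (p \<in> ?U))" "cr A B U g = ((r \<in> ?U) \<noteq> (y \<in> U))" "cr A B U h = ((y \<in> U) \<noteq> (s \<in> ?U))"
    using cr_joins[OF x(2)] cr_joins[OF e(2)] cr_joins[OF f(2)] cr_joins[OF g(2)] cr_joins[OF h(2)] bnd by auto
  have mem: "i \<in> cut m A B U \<longleftrightarrow> cr A B U i" if "i \<in> {x, e, f, g, h}" for i
    using that x(1) e(1) f(1) g(1) h(1) by (auto simp: in_cut)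
  show "(\<exists>i\<in>cut m A B U. q' i \<noteq> 2) \<and> (\<exists>i\<in>cut m A B U. q' i \<noteq> 3) \<and>
     2 \<le> card {i \<in> cut m A B U. q' i \<noteq> 0} \<and> 2 \<le> card {i \<in> cut m A B U. q' i \<noteq> 1}"
  proof (cases "?U = {}")
    case True
    then have cr0: "cr A B U x = (a \<in> U)" "cr A B U e = ((a \<in> U) \<noteq> (y \<in> U))"
      "cr A B U f = (a \<in> U)" "cr A B U g = (y \<in> U)" "cr A B U h = (y \<in> U)"
      using cra unfolding True by simp_all
    have ay: "a \<in> U \<or> y \<in> U" using True U by auto
    have nfc: "\<exists>i\<in>cut m A B U. q' i \<noteq> fc"
    proof (cases "(a \<in> U) \<noteq> (y \<in> U)")
      case True
      then have "e \<in> cut m A B U" using cr0 mem[of e] by simp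
      moreover have "q' e \<noteq> fc" using e01 fc by auto
      ultimately show ?thesis by blast
    next
      case False
      then have "g \<in> cut m A B U" "h \<in> cut m A B U" using ay cr0 mem[of g] mem[of h] by auto
      then show ?thesis using gh' oc' by metis
    qed
    have noc: "\<exists>i\<in>cut m A B U. q' i \<noteq> oc"
    proof (cases "a \<in> U")
      case True
      then have "x \<in> cut m A B U" using cr0 mem[of x] by simp
      then show ?thesis using new(1) oc'(2) by (intro bexI[of _ x]) simp_all
    next
      case False
      then have "e \<in> cut m A B U" using ay cr0 mem[of e] by simp
      moreover have "q' e \<noteq> oc" using e01 oc' by auto
      ultimately show ?thesis by blast
    qed
    have two: "2 \<le> card {i \<in> cut m A B U. q' i \<noteq> k}" if "k \<in> {0, 1}" for k
    proof (cases "a \<in> U")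
      case True
      then have "x \<in> cut m A B U" "f \<in> cut m A B U" using cr0 mem[of x] mem[of f] by simp_all
      moreover have "q' x \<noteq> k" "q' f \<noteq> k" using new(1,2) fc(2) that by auto
      moreover have "x \<noteq> f" using d(1) by simp
      ultimately show ?thesis by (intro two_le_card[of _ x f]) simp_all
    next
      case False
      then have y: "y \<in> U" using ay by simp
      have in3: "e \<in> cut m A B U" "g \<in> cut m A B U" "h \<in> cut m A B U"
        using False y cr0 mem[of e] mem[of g] mem[of h] by simp_all
      have ne: "e \<noteq> g" "e \<noteq> h" "g \<noteq> h" using d by auto
      have ok: "oc \<noteq> k" using oc' that by auto
      show ?thesis
      proof (cases "q g = k")
        case True
        then have "q' e \<noteq> k" using new that by auto
        moreover have "q' g \<noteq> k \<or> q' h \<noteq> k" using gh'(3) ok by auto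
        ultimately show ?thesis using in3 ne
          by (elim disjE) (rule two_le_card[of _ e g] two_le_card[of _ e h]; simp)+
      next
        case False
        then have "q' g \<noteq> k" "q' h \<noteq> k" using gh'(1,2) ok by auto
        then show ?thesis using in3 ne by (intro two_le_card[of _ g h]) simp_all
      qed
    qed
    show ?thesis using nfc noc two[of 0] two[of 1] fc(2) oc' by auto
  next
    case False
    have sub: "?U \<subseteq> V' - {t}" using U by auto
    have v2: "\<exists>i\<in>cut m A' B' ?U. q i \<noteq> fc" "\<exists>i\<in>cut m A' B' ?U. q i \<noteq> oc"
      "\<And>k. k \<in> {0, 1} \<Longrightarrow> 2 \<le> card {i \<in> cut m A' B' ?U. q i \<noteq> k}"
    proof -
      from V(1) sub False have *: "(\<exists>i\<in>cut m A' B' ?U. q i \<noteq> 2) \<and> (\<exists>i\<in>cut m A' B' ?U. q i \<noteq> 3) \<and>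
         2 \<le> card {i \<in> cut m A' B' ?U. q i \<noteq> 0} \<and> 2 \<le> card {i \<in> cut m A' B' ?U. q i \<noteq> 1}"
        unfolding valid_def by blast
      have "fc = 2 \<or> fc = 3" "oc = 2 \<or> oc = 3" using fc(2) oc'(1) by auto
      then show "\<exists>i\<in>cut m A' B' ?U. q i \<noteq> fc" "\<exists>i\<in>cut m A' B' ?U. q i \<noteq> oc" using * by blast+
      show "2 \<le> card {i \<in> cut m A' B' ?U. q i \<noteq> k}" if "k \<in> {0, 1}" for k
        using that * by (elim insertE) simp_all
    qed
    have nfc: "\<exists>i\<in>cut m A B U. q' i \<noteq> fc"
    proof -
      obtain i where i: "i \<in> cut m A' B' ?U" "q i \<noteq> fc" using v2 by auto
      then have "i \<noteq> x" using fc by auto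
      show ?thesis
      proof (cases "i = g")
        case True
        then have "q' g \<noteq> fc" "q' h \<noteq> fc" using gh' oc' i by auto
        then show ?thesis using cr_image_g[of U] i True by auto
      next
        case False
        have "i < m" using i(1) by (simp add: in_cut)
        then have "q' i = q i" using cr_image[OF i(1) \<open>i \<noteq> x\<close> False] new(4)[of i] by simp
        then show ?thesis using cr_image(1)[OF i(1) \<open>i \<noteq> x\<close> False] i(2) by (intro bexI[of _ i]) simp_all
      qed
    qed
    have noc: "\<exists>i\<in>cut m A B U. q' i \<noteq> oc"
    proof (rule ccontr)
      assume no: "\<not> ?thesis"
      \<comment> \<open>The classes of \<open>x\<close>, \<open>e\<close> and \<open>f\<close>
        differ from \<open>oc\<close>, so none of these edges crosses and \<open>b0\<close>,
        \<open>a\<close>, \<open>y\<close>, \<open>p\<close> lie on one side.\<close>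
      then have x0: "x \<notin> cut m A B U" "f \<notin> cut m A B U" "e \<notin> cut m A B U" using new oc' e01 by auto
      have allg: "i = g" if "i \<in> cut m A' B' ?U" "q i \<noteq> oc" for i
      proof (rule ccontr)
        assume "i \<noteq> g"
        moreover have "i \<noteq> x" using that(1) cr_image_x[of U] x0 by auto
        ultimately show False using cr_image[OF that(1)] new(4)[of i] no that by (auto simp: in_cut)
      qed
      then have gU: "g \<in> cut m A' B' ?U" "q g \<noteq> oc" using v2 by auto
      then have rs: "(r \<in> ?U) \<noteq> (s \<in> ?U)" using bnd by (auto simp: in_cut cr_joins[OF g'])
      have sep: "(p0 \<in> ?U) = (v \<in> ?U)" if "v \<in> D" for v
        using D(4)[OF that, of ?U] allg by blast
      have xside: "(b0 \<in> ?U) = (a \<in> U)" "(a \<in> U) = (y \<in> U)" "(a \<in> U) = (p \<in> ?U)"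
        using x0 cra(1-3) mem[of x] mem[of e] mem[of f] by simp_all
      then have p0: "(p0 \<in> ?U) = (y \<in> U)" using D(3) by auto
      show False
      proof (cases "r \<in> D")
        case True
        then have "q' h \<noteq> oc" using cls gU by simp
        then have "h \<notin> cut m A B U" using no by blast
        then have "(y \<in> U) = (s \<in> ?U)" using cra(5) mem[of h] by simp
        then show False using sep[OF True] p0 rs by blast
      next
        case False
        then have "q' g \<noteq> oc" using cls gU by simp
        then have "g \<notin> cut m A B U" using no by blast
        then have yr: "(r \<in> ?U) = (y \<in> U)" using cra(4) mem[of g] by simp
        \<comment> \<open>Some edge of a class other than \<open>oc\<close> leaves \<open>D\<close>,
          and \<open>g\<close> is the only candidate. As \<open>r\<close> is outside
          \<open>D\<close>, the other end \<open>s\<close> must be inside.\<close>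
        have "g \<in> cut m A' B' D"
        proof -
          define D' where "D' = (if t \<in> D then V' - D else D)"
          have "D' \<subseteq> V' - {t}" "D' \<noteq> {}" using D V False by (auto simp: D'_def)
          then have *: "(\<exists>i\<in>cut m A' B' D'. q i \<noteq> 2) \<and> (\<exists>i\<in>cut m A' B' D'. q i \<noteq> 3)"
            using V(1) unfolding valid_def by blast
          have "oc = 2 \<or> oc = 3" using oc'(1) by auto
          then have "\<exists>i\<in>cut m A' B' D'. q i \<noteq> oc" using * by blast
          moreover have "cut m A' B' D' = cut m A' B' D" using cut_complement[OF E D(2)] by (simp add: D'_def)
          ultimately show ?thesis using D(5) by auto
        qed
        then have "s \<in> D" using False by (auto simp: in_cut cr_joins[OF g'])
        then show False using sep[of s] p0 rs yr by blast
      qed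
    qed
    have two: "2 \<le> card {i \<in> cut m A B U. q' i \<noteq> k}" if k: "k \<in> {0, 1}" for k
    proof (rule two_crossing[OF v2(3)[OF k]])
      show "q' i = q i" if "i < m" "i \<notin> {x, e, f, g, h}" for i using new(4) that by blast
      show "q' x \<noteq> k \<and> q' f \<noteq> k" using new fc k by auto
      show "q' g \<noteq> k \<and> q' h \<noteq> k" if "q g \<noteq> k" using gh' oc' k that by auto
    qed
    show ?thesis using nfc noc two[of 0] two[of 1] fc(2) oc' by auto
  qed
qed

end

section \<open>Flows\<close>

text \<open>Net flow out of \<open>v\<close>. Edges are undirected: a negative
  \<open>\<phi> i\<close> means flow from \<open>B i\<close> to \<open>A i\<close>. The loops left
  by deleted edges cancel.\<close>

definition excess :: "nat \<Rightarrow> (nat \<Rightarrow> nat) \<Rightarrow> (nat \<Rightarrow> nat) \<Rightarrow> (nat \<Rightarrow> int) \<Rightarrow> nat \<Rightarrow> int" where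
  "excess m A B \<phi> v = (\<Sum>i<m. \<phi> i * (of_bool (A i = v) - of_bool (B i = v)))"

lemma sum_excess:
  assumes "finite W"
  shows "(\<Sum>v\<in>W. excess m A B \<phi> v) = (\<Sum>i<m. \<phi> i * (of_bool (A i \<in> W) - of_bool (B i \<in> W)))"
proof -
  have 1: "(\<Sum>v\<in>W. of_bool (k = v) :: int) = of_bool (k \<in> W)" for k
    using assms by (simp add: of_bool_def)
  have "(\<Sum>v\<in>W. excess m A B \<phi> v) = (\<Sum>i<m. \<Sum>v\<in>W. \<phi> i * (of_bool (A i = v) - of_bool (B i = v)))"
    unfolding excess_def by (rule sum.swap)
  also have "\<dots> = (\<Sum>i<m. \<phi> i * (of_bool (A i \<in> W) - of_bool (B i \<in> W)))"
    by (simp add: sum_distrib_left[symmetric] sum_subtractf 1)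
  finally show ?thesis .
qed

lemma sum_excess_cut:
  assumes "finite W"
  shows "(\<Sum>v\<in>W. excess m A B \<phi> v) = (\<Sum>i\<in>cut m A B W. if A i \<in> W then \<phi> i else - \<phi> i)"
proof -
  have "(\<Sum>i<m. \<phi> i * (of_bool (A i \<in> W) - of_bool (B i \<in> W))) =
      (\<Sum>i\<in>cut m A B W. \<phi> i * (of_bool (A i \<in> W) - of_bool (B i \<in> W)))"
    by (rule sum.mono_neutral_right) (auto simp: cut_def cr_def)
  also have "\<dots> = (\<Sum>i\<in>cut m A B W. if A i \<in> W then \<phi> i else - \<phi> i)"
    by (rule sum.cong) (auto simp: cut_def cr_def)
  finally show ?thesis using sum_excess[OF assms] by metis
qed

lemma flow_le_cut:
  assumes "finite W" "\<And>i. i < m \<Longrightarrow> \<bar>\<phi> i\<bar> \<le> 1"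
  shows "(\<Sum>v\<in>W. excess m A B \<phi> v) \<le> int (card (cut m A B W))"
  unfolding sum_excess_cut[OF assms(1)]
proof -
  have "(\<Sum>i\<in>cut m A B W. if A i \<in> W then \<phi> i else - \<phi> i) \<le> (\<Sum>i\<in>cut m A B W. 1)"
    using assms(2) by (intro sum_mono) (fastforce simp: in_cut abs_le_iff)
  then show "(\<Sum>i\<in>cut m A B W. if A i \<in> W then \<phi> i else - \<phi> i) \<le> int (card (cut m A B W))" by simp
qed

lemma flow_eq_cut:
  assumes "finite W" "\<And>i. i < m \<Longrightarrow> A i \<in> W \<Longrightarrow> B i \<notin> W \<Longrightarrow> \<phi> i = 1"
    "\<And>i. i < m \<Longrightarrow> B i \<in> W \<Longrightarrow> A i \<notin> W \<Longrightarrow> \<phi> i = -1"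
  shows "(\<Sum>v\<in>W. excess m A B \<phi> v) = int (card (cut m A B W))"
  unfolding sum_excess_cut[OF assms(1)]
proof -
  have "(\<Sum>i\<in>cut m A B W. if A i \<in> W then \<phi> i else - \<phi> i) = (\<Sum>i\<in>cut m A B W. 1)"
    using assms(2,3) by (intro sum.cong) (auto simp: in_cut cr_def)
  then show "(\<Sum>i\<in>cut m A B W. if A i \<in> W then \<phi> i else - \<phi> i) = int (card (cut m A B W))" by simp
qed

section \<open>Reachability\<close>

text \<open>
  Array numbers: 0, 1 ends of the edges and 2 the set \<open>S\<close>, one row per level; 3 contracted set of a level; 4 to 10 kind and parameters of the
  operation that led from a level to the next; 11 current level; 12 next unused vertex name; 13 mode (0 reduce, 1 undo);
  14 finished; 15 to 30 variables of the current step; 31 classes; 32 distance from the sources plus one, 0 if unreached; 33 edge to the predecessor; 34, 35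
  whether an edge may be used forwards, backwards; 36 flow (1 forwards, 2 backwards); 40, 41, 42, 44 loop variables; 79 dummy.
\<close>

primrec real_free :: "hp \<Rightarrow> bool" where
  "real_free (Set j r c e) = True"
| "real_free (RZ i) = False"
| "real_free (RA i e) = False"
| "real_free (RC i j) = False"
| "real_free (Sq p q) = (real_free p \<and> real_free q)"
| "real_free (If b p q) = (real_free p \<and> real_free q)"
| "real_free (For v l p) = real_free p"

lemma loop_snd: "(\<And>s. snd (f s) = snd s) \<Longrightarrow> snd (loop f v N s) = snd s"
  by (induction N) (auto simp: setv_def)

lemma den_snd: "real_free p \<Longrightarrow> snd (den n m p s) = snd s"
proof (induction p arbitrary: s)
  case (For v l p)
  then show ?case by (auto intro!: loop_snd)
qed auto

lemma setv_other [simp]: "q \<noteq> v \<Longrightarrow> fst (setv v x s) q = fst s q"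
  by (simp add: setv_def upd_def)

lemma snd_setv [simp]: "snd (setv v x s) = snd s"
  by (simp add: setv_def)

lemma setv_same [simp]: "fst (setv v x s) v 0 0 = x"
  by (simp add: setv_def upd_def)

lemma for_rule:
  assumes "I 0 (setv v 0 s)"
    and "\<And>j t. j < lv n m l \<Longrightarrow> I j t \<Longrightarrow> fst t v 0 0 = j \<Longrightarrow> (\<And>q. q \<noteq> v \<Longrightarrow> q \<notin> asg p \<Longrightarrow> fst t q = fst s q) \<Longrightarrow>
      I (Suc j) (setv v (Suc j) (den n m p t))"
  shows "I (lv n m l) (den n m (For v l p) s)"
proof -
  define I' where "I' j t \<longleftrightarrow> I j t \<and> (\<forall>q. q \<noteq> v \<longrightarrow> q \<notin> asg p \<longrightarrow> fst t q = fst s q)" for j t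
  have "I' (lv n m l) (loop (den n m p) v (lv n m l) s)"
  proof (rule loop_rule)
    show "I' 0 (setv v 0 s)" using assms(1) by (simp add: I'_def)
    show "I' (Suc j) (setv v (Suc j) (den n m p t))" if "j < lv n m l" "I' j t" "fst t v 0 0 = j" for j t
      using that assms(2)[of j t] by (auto simp: I'_def den_frame)
  qed
  then show ?thesis by (simp add: I'_def)
qed

abbreviation V :: "nat \<Rightarrow> he" where "V j \<equiv> Arr j (C 0) (C 0)"
abbreviation A1 :: "nat \<Rightarrow> he \<Rightarrow> he" where "A1 j e \<equiv> Arr j (C 0) e"
abbreviation SetV :: "nat \<Rightarrow> he \<Rightarrow> hp" where "SetV j e \<equiv> Set j (C 0) (C 0) e"
abbreviation Set1 :: "nat \<Rightarrow> he \<Rightarrow> he \<Rightarrow> hp" where "Set1 j c e \<equiv> Set j (C 0) c e"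
abbreviation Sk :: hp where "Sk \<equiv> SetV 79 (C 0)"
abbreviation If1 :: "hb \<Rightarrow> hp \<Rightarrow> hp" where "If1 b p \<equiv> If b p Sk"

definition level_A :: "store \<Rightarrow> nat \<Rightarrow> nat" where "level_A s = fst s 0 (fst s 11 0 0)"
definition level_B :: "store \<Rightarrow> nat \<Rightarrow> nat" where "level_B s = fst s 1 (fst s 11 0 0)"

abbreviation ga :: "he \<Rightarrow> he" where "ga i \<equiv> Arr 0 (V 11) i"
abbreviation gb :: "he \<Rightarrow> he" where "gb i \<equiv> Arr 1 (V 11) i"
abbreviation rs :: "he \<Rightarrow> he" where "rs v \<equiv> Arr 2 (V 11) v"
abbreviation lab :: "he \<Rightarrow> he" where "lab v \<equiv> A1 32 v"
abbreviation iv :: he where "iv \<equiv> V 40"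
abbreviation vv :: he where "vv \<equiv> V 42"
abbreviation Ne :: "he \<Rightarrow> he \<Rightarrow> hb" where "Ne x y \<equiv> Neg (Eq x y)"

text \<open>Labels are set in place within a sweep and are never revised. They count the vertices on
  the path that was found, which need not be shortest; only their consistency along predecessor
  edges is used.\<close>

definition reach_body :: hp where
  "reach_body = Sq
    (If1 (And (Ne (lab (ga iv)) (C 0)) (And (Eq (lab (gb iv)) (C 0)) (Eq (A1 34 iv) (C 1))))
      (Sq (Set1 33 (gb iv) iv) (Set1 32 (gb iv) (Inc (lab (ga iv))))))
    (If1 (And (Ne (lab (gb iv)) (C 0)) (And (Eq (lab (ga iv)) (C 0)) (Eq (A1 35 iv) (C 1))))
      (Sq (Set1 33 (ga iv) iv) (Set1 32 (ga iv) (Inc (lab (gb iv))))))"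

definition REACH :: hp where
  "REACH = For 41 (LN 2) (For 40 LM reach_body)"

text \<open>A search forest: the sources are the vertices with nonzero \<open>L0\<close>, and every
  other labelled vertex is entered by a permitted edge from a vertex whose label is one smaller.
  Following \<open>P\<close> therefore ends at a source. The same certificate serves augmenting
  paths, the set \<open>D\<close> of the insertion rule and the spanning tree.\<close>

definition pred_ok :: "nat \<Rightarrow> (nat \<Rightarrow> nat) \<Rightarrow> (nat \<Rightarrow> nat) \<Rightarrow> (nat \<Rightarrow> nat) \<Rightarrow> (nat \<Rightarrow> nat) \<Rightarrow> (nat \<Rightarrow> nat) \<Rightarrow>
    (nat \<Rightarrow> nat) \<Rightarrow> (nat \<Rightarrow> nat) \<Rightarrow> bool" where
  "pred_ok m A B a1 a2 L0 L P \<longleftrightarrow> (\<forall>v. L0 v \<noteq> 0 \<longrightarrow> L v = L0 v) \<and>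
     (\<forall>v. L v \<noteq> 0 \<longrightarrow> L0 v = 0 \<longrightarrow> P v < m \<and>
       ((B (P v) = v \<and> a1 (P v) = 1 \<and> L (A (P v)) \<noteq> 0 \<and> L v = Suc (L (A (P v)))) \<or>
        (A (P v) = v \<and> a2 (P v) = 1 \<and> L (B (P v)) \<noteq> 0 \<and> L v = Suc (L (B (P v))))))"

definition closed_lab :: "nat \<Rightarrow> (nat \<Rightarrow> nat) \<Rightarrow> (nat \<Rightarrow> nat) \<Rightarrow> (nat \<Rightarrow> nat) \<Rightarrow> (nat \<Rightarrow> nat) \<Rightarrow> (nat \<Rightarrow> nat) \<Rightarrow> bool" where
  "closed_lab m A B a1 a2 L \<longleftrightarrow> (\<forall>i<m. (a1 i = 1 \<longrightarrow> L (A i) \<noteq> 0 \<longrightarrow> L (B i) \<noteq> 0) \<and>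
     (a2 i = 1 \<longrightarrow> L (B i) \<noteq> 0 \<longrightarrow> L (A i) \<noteq> 0))"

definition labcard :: "nat \<Rightarrow> (nat \<Rightarrow> nat) \<Rightarrow> nat" where
  "labcard n L = card {v. v < 2 * n \<and> L v \<noteq> 0}"

lemma labcard_new: "v < 2 * n \<Longrightarrow> L v = 0 \<Longrightarrow> labcard n (L(v := Suc x)) = Suc (labcard n L)"
proof -
  assume "v < 2 * n" "L v = 0"
  then have "{u. u < 2 * n \<and> (L(v := Suc x)) u \<noteq> 0} = insert v {u. u < 2 * n \<and> L u \<noteq> 0}" by auto
  then show ?thesis using \<open>L v = 0\<close> by (simp add: labcard_def)
qed

lemma pred_ok_step:
  assumes "pred_ok m A B a1 a2 L0 L P" "L v = 0" "i < m"
    "(B i = v \<and> a1 i = 1 \<and> x = A i) \<or> (A i = v \<and> a2 i = 1 \<and> x = B i)" "L x \<noteq> 0"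
  shows "pred_ok m A B a1 a2 L0 (L(v := Suc (L x))) (P(v := i))"
proof -
  have L0: "L0 v = 0" using assms by (auto simp: pred_ok_def)
  have xv: "x \<noteq> v" using assms by auto
  let ?L = "L(v := Suc (L x))" and ?P = "P(v := i)"
  show ?thesis unfolding pred_ok_def
  proof (rule conjI; intro allI impI)
    show "?L u = L0 u" if "L0 u \<noteq> 0" for u using that assms(1) L0 by (auto simp: pred_ok_def)
    fix u assume u: "?L u \<noteq> 0" "L0 u = 0"
    show "?P u < m \<and> ((B (?P u) = u \<and> a1 (?P u) = 1 \<and> ?L (A (?P u)) \<noteq> 0 \<and> ?L u = Suc (?L (A (?P u)))) \<or>
        (A (?P u) = u \<and> a2 (?P u) = 1 \<and> ?L (B (?P u)) \<noteq> 0 \<and> ?L u = Suc (?L (B (?P u)))))"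
    proof (cases "u = v")
      case True
      then show ?thesis using assms(3-5) xv by auto
    next
      case False
      then have "P u < m \<and> ((B (P u) = u \<and> a1 (P u) = 1 \<and> L (A (P u)) \<noteq> 0 \<and> L u = Suc (L (A (P u)))) \<or>
        (A (P u) = u \<and> a2 (P u) = 1 \<and> L (B (P u)) \<noteq> 0 \<and> L u = Suc (L (B (P u)))))"
        using assms(1) u unfolding pred_ok_def by auto
      moreover have "?P u = P u" using False by simp
      moreover have "?L w \<noteq> 0 \<and> ?L w = L w" if "L w \<noteq> 0" for w using that assms(2) by auto
      moreover have "?L u = L u" using False by simp
      ultimately show ?thesis by metis
    qed
  qed
qed

text \<open>A sweep over labels that are not yet closed labels a new vertex, so \<open>2 * n\<close>
  sweeps close them, all vertex names being below \<open>2 * n\<close>. No label exceeds the number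
  of labelled vertices; this bounds the length of predecessor paths.\<close>

lemma REACH_correct:
  assumes ids: "\<And>i. i < m \<Longrightarrow> level_A s i < 2 * n \<and> level_B s i < 2 * n"
    and L0: "\<And>v. v < 2 * n \<Longrightarrow> fst s 32 0 v \<le> labcard n (fst s 32 0)"
  defines "s' \<equiv> den n m REACH s"
  shows "pred_ok m (level_A s) (level_B s) (fst s 34 0) (fst s 35 0) (fst s 32 0) (fst s' 32 0) (fst s' 33 0)"
    and "closed_lab m (level_A s) (level_B s) (fst s 34 0) (fst s 35 0) (fst s' 32 0)"
    and "\<And>v. v < 2 * n \<Longrightarrow> fst s' 32 0 v \<le> 2 * n"
proof -
  let ?A = "level_A s" and ?B = "level_B s" and ?a1 = "fst s 34 0" and ?a2 = "fst s 35 0" and ?Lz = "fst s 32 0"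
  define ok where "ok t \<longleftrightarrow> pred_ok m ?A ?B ?a1 ?a2 ?Lz (fst t 32 0) (fst t 33 0) \<and>
    (\<forall>v<2 * n. fst t 32 0 v \<le> labcard n (fst t 32 0))" for t :: store
  define I where "I j t \<longleftrightarrow> ok t \<and> (closed_lab m ?A ?B ?a1 ?a2 (fst t 32 0) \<or> j \<le> labcard n (fst t 32 0))"
    for j and t :: store
  have "I (lv n m (LN 2)) (den n m (For 41 (LN 2) (For 40 LM reach_body)) s)"
  proof (rule for_rule)
    have "pred_ok m ?A ?B ?a1 ?a2 ?Lz ?Lz P" for P by (simp add: pred_ok_def)
    then show "I 0 (setv 41 0 s)" using L0 by (simp add: I_def ok_def)
  next
    fix j t assume It: "I j t"
      and fr: "\<And>q. q \<noteq> 41 \<Longrightarrow> q \<notin> asg (For 40 LM reach_body) \<Longrightarrow> fst t q = fst s q"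
    let ?Lr = "fst t 32 0"
    \<comment> \<open>The sweep is compared with the labels \<open>?Lr\<close> at its start: edges
      already visited have passed these labels on, and labels that were closed before the sweep do
      not change at all.\<close>
    define I2 where "I2 k u \<longleftrightarrow> ok u \<and> (\<forall>v. ?Lr v \<noteq> 0 \<longrightarrow> fst u 32 0 v \<noteq> 0) \<and>
       (closed_lab m ?A ?B ?a1 ?a2 ?Lr \<longrightarrow> fst u 32 0 = ?Lr) \<and>
       (\<forall>i<k. (?a1 i = 1 \<longrightarrow> ?Lr (?A i) \<noteq> 0 \<longrightarrow> fst u 32 0 (?B i) \<noteq> 0) \<and>
          (?a2 i = 1 \<longrightarrow> ?Lr (?B i) \<noteq> 0 \<longrightarrow> fst u 32 0 (?A i) \<noteq> 0))"
      for k and u :: store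
    have "I2 (lv n m LM) (den n m (For 40 LM reach_body) t)"
    proof (rule for_rule)
      show "I2 0 (setv 40 0 t)" using It by (simp add: I2_def I_def ok_def)
    next
      fix i u assume i: "i < lv n m LM" and Iu: "I2 i u" and iu: "fst u 40 0 0 = i"
        and fr2: "\<And>q. q \<noteq> 40 \<Longrightarrow> q \<notin> asg reach_body \<Longrightarrow> fst u q = fst t q"
      have im: "i < m" using i by simp
      have A: "fst u 0 (fst u 11 0 0) = ?A" "fst u 1 (fst u 11 0 0) = ?B" "fst u 34 0 = ?a1" "fst u 35 0 = ?a2"
        using fr2[of 0] fr[of 0] fr2[of 1] fr[of 1] fr2[of 11] fr[of 11] fr2[of 34] fr[of 34] fr2[of 35] fr[of 35]
        by (auto simp: reach_body_def level_A_def level_B_def)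
      define half where "half a x y = If1 (And (Ne (lab x) (C 0)) (And (Eq (lab y) (C 0)) (Eq (A1 a iv) (C 1))))
         (Sq (Set1 33 y iv) (Set1 32 y (Inc (lab x))))" for a x y
      have h: "I2 i t' \<Longrightarrow> fst t' 40 0 0 = i \<Longrightarrow> fst t' 11 0 0 = fst u 11 0 0 \<Longrightarrow> fst t' 0 = fst u 0 \<Longrightarrow> fst t' 1 = fst u 1 \<Longrightarrow>
          fst t' 34 = fst u 34 \<Longrightarrow> fst t' 35 = fst u 35 \<Longrightarrow>
          (a = 34 \<and> x = ga iv \<and> y = gb iv) \<or> (a = 35 \<and> x = gb iv \<and> y = ga iv) \<Longrightarrow>
          (let u' = den n m (half a x y) t' in I2 i u' \<and> fst u' 40 0 0 = i \<and> fst u' 11 0 0 = fst u 11 0 0 \<and>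
            fst u' 0 = fst u 0 \<and> fst u' 1 = fst u 1 \<and> fst u' 34 = fst u 34 \<and> fst u' 35 = fst u 35 \<and>
            (\<forall>v. fst t' 32 0 v \<noteq> 0 \<longrightarrow> fst u' 32 0 v \<noteq> 0) \<and>
            (a = 34 \<longrightarrow> ?a1 i = 1 \<longrightarrow> fst t' 32 0 (?A i) \<noteq> 0 \<longrightarrow> fst u' 32 0 (?B i) \<noteq> 0) \<and>
            (a = 35 \<longrightarrow> ?a2 i = 1 \<longrightarrow> fst t' 32 0 (?B i) \<noteq> 0 \<longrightarrow> fst u' 32 0 (?A i) \<noteq> 0))" for t' a x y
      proof -
        assume t': "I2 i t'" "fst t' 40 0 0 = i" "fst t' 11 0 0 = fst u 11 0 0" "fst t' 0 = fst u 0" "fst t' 1 = fst u 1"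
          "fst t' 34 = fst u 34" "fst t' 35 = fst u 35"
          and axy: "(a = 34 \<and> x = ga iv \<and> y = gb iv) \<or> (a = 35 \<and> x = gb iv \<and> y = ga iv)"
        define X where "X = (if a = 34 then ?A i else ?B i)"
        define Y where "Y = (if a = 34 then ?B i else ?A i)"
        define al where "al = (if a = 34 then ?a1 i else ?a2 i)"
        let ?Lt = "fst t' 32 0" and ?P = "fst t' 33 0"
        have e: "ev n x (fst t') = X" "ev n y (fst t') = Y" "ev n (A1 a iv) (fst t') = al" "ev n iv (fst t') = i"
          using axy t' A by (auto simp: X_def Y_def al_def)
        have exy: "ev n x (upd 33 0 Y i (fst t')) = X" "ev n y (upd 33 0 Y i (fst t')) = Y"
          using axy t' A by (auto simp: X_def Y_def upd_def)
        let ?c = "?Lt X \<noteq> 0 \<and> ?Lt Y = 0 \<and> al = 1"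
        define u' where "u' = den n m (half a x y) t'"
        have u': "fst u' = (if ?c then upd 32 0 Y (Suc (?Lt X)) (upd 33 0 Y i (fst t')) else upd 79 0 0 0 (fst t'))"
          unfolding u'_def half_def using e exy by (auto simp: upd_apply)
        have oth: "fst u' q = fst t' q" if "q \<noteq> 32" "q \<noteq> 33" "q \<noteq> 79" for q
          using that u' by (auto simp: upd_def)
        have L': "fst u' 32 0 = (if ?c then ?Lt(Y := Suc (?Lt X)) else ?Lt)" "fst u' 33 0 = (if ?c then ?P(Y := i) else ?P)"
          using u' by (auto simp: upd_def)
        have Y: "Y < 2 * n" using ids[OF im] by (auto simp: Y_def)
        have oku: "ok u'"
        proof (cases ?c)
          case True
          have okt: "pred_ok m ?A ?B ?a1 ?a2 ?Lz ?Lt ?P" "\<forall>v<2 * n. ?Lt v \<le> labcard n ?Lt"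
            using t'(1) by (auto simp: I2_def ok_def)
          have "pred_ok m ?A ?B ?a1 ?a2 ?Lz (?Lt(Y := Suc (?Lt X))) (?P(Y := i))"
            by (rule pred_ok_step[OF okt(1)]) (use True im axy in \<open>auto simp: X_def Y_def al_def\<close>)
          moreover have "X < 2 * n" using ids[OF im] by (auto simp: X_def)
          then have "(?Lt(Y := Suc (?Lt X))) v \<le> labcard n (?Lt(Y := Suc (?Lt X)))" if "v < 2 * n" for v
            using okt(2) labcard_new[OF Y, of ?Lt "?Lt X"] True that by (auto intro: le_SucI)
          ultimately show ?thesis using L' True by (auto simp: ok_def)
        next
          case False
          have "fst u' 32 0 = ?Lt" "fst u' 33 0 = ?P" using L' False by auto
          then show ?thesis using t'(1) by (simp add: I2_def ok_def)
        qed
        have mono: "\<forall>v. ?Lt v \<noteq> 0 \<longrightarrow> fst u' 32 0 v \<noteq> 0" using L' by auto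
        have cl: "fst u' 32 0 = ?Lr" if c: "closed_lab m ?A ?B ?a1 ?a2 ?Lr"
        proof -
          have LL: "?Lt = ?Lr" using t'(1) c by (auto simp: I2_def)
          then have "\<not> ?c" using c im axy by (auto simp: closed_lab_def X_def Y_def al_def)
          then have "fst u' 32 0 = ?Lt" using L' by auto
          then show ?thesis using LL by simp
        qed
        have "I2 i u'" using t'(1) oku mono cl by (auto simp: I2_def)
        moreover have "a = 34 \<longrightarrow> ?a1 i = 1 \<longrightarrow> ?Lt (?A i) \<noteq> 0 \<longrightarrow> fst u' 32 0 (?B i) \<noteq> 0"
          "a = 35 \<longrightarrow> ?a2 i = 1 \<longrightarrow> ?Lt (?B i) \<noteq> 0 \<longrightarrow> fst u' 32 0 (?A i) \<noteq> 0"
          using L' by (auto simp: X_def Y_def al_def)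
        ultimately show ?thesis using oth t' mono unfolding Let_def u'_def[symmetric] by auto
      qed
      define u1 where "u1 = den n m (half 34 (ga iv) (gb iv)) u"
      define u2 where "u2 = den n m (half 35 (gb iv) (ga iv)) u1"
      note 1 = h[of u 34 "ga iv" "gb iv", unfolded Let_def, folded u1_def]
      note 2 = h[of u1 35 "gb iv" "ga iv", unfolded Let_def, folded u2_def]
      have u2: "den n m reach_body u = u2" unfolding u2_def u1_def half_def reach_body_def by (simp only: den.simps(5))
      have "I2 (Suc i) u2"
      proof -
        have b: "I2 i u1" "I2 i u2" "\<forall>v. fst u 32 0 v \<noteq> 0 \<longrightarrow> fst u1 32 0 v \<noteq> 0" "\<forall>v. fst u1 32 0 v \<noteq> 0 \<longrightarrow> fst u2 32 0 v \<noteq> 0"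
          "?a1 i = 1 \<longrightarrow> fst u 32 0 (?A i) \<noteq> 0 \<longrightarrow> fst u1 32 0 (?B i) \<noteq> 0"
          "?a2 i = 1 \<longrightarrow> fst u1 32 0 (?B i) \<noteq> 0 \<longrightarrow> fst u2 32 0 (?A i) \<noteq> 0"
          using 1 2 Iu iu by auto
        have L1: "?Lr v \<noteq> 0 \<longrightarrow> fst u 32 0 v \<noteq> 0" for v using Iu by (auto simp: I2_def)
        show ?thesis unfolding I2_def
        proof (intro conjI allI impI)
          show "ok u2" "\<And>v. ?Lr v \<noteq> 0 \<Longrightarrow> fst u2 32 0 v \<noteq> 0"
            "closed_lab m ?A ?B ?a1 ?a2 ?Lr \<Longrightarrow> fst u2 32 0 = ?Lr" using b(2) by (auto simp: I2_def)
          show "fst u2 32 0 (?B i') \<noteq> 0" if "i' < Suc i" "?a1 i' = 1" "?Lr (?A i') \<noteq> 0" for i'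
            using b L1 that by (cases "i' = i") (auto simp: I2_def)
          show "fst u2 32 0 (?A i') \<noteq> 0" if "i' < Suc i" "?a2 i' = 1" "?Lr (?B i') \<noteq> 0" for i'
            using b L1 that by (cases "i' = i") (auto simp: I2_def)
        qed
      qed
      then show "I2 (Suc i) (setv 40 (Suc i) (den n m reach_body u))" unfolding u2 by (simp add: I2_def ok_def)
    qed
    then have I2: "I2 m (den n m (For 40 LM reach_body) t)" by simp
    let ?t' = "den n m (For 40 LM reach_body) t"
    have "closed_lab m ?A ?B ?a1 ?a2 (fst ?t' 32 0) \<or> Suc j \<le> labcard n (fst ?t' 32 0)"
    proof (cases "closed_lab m ?A ?B ?a1 ?a2 ?Lr")
      case True
      then show ?thesis using I2 unfolding I2_def by metis
    next
      case False
      then have "j \<le> labcard n ?Lr" using It by (auto simp: I_def)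
      obtain v where v: "v < 2 * n" "?Lr v = 0" "fst ?t' 32 0 v \<noteq> 0"
        using False I2 ids unfolding closed_lab_def I2_def by blast
      have "labcard n ?Lr < labcard n (fst ?t' 32 0)"
        unfolding labcard_def
      proof (rule psubset_card_mono)
        have "v \<in> {v. v < 2 * n \<and> fst ?t' 32 0 v \<noteq> 0}" "v \<notin> {v. v < 2 * n \<and> ?Lr v \<noteq> 0}" using v by blast+
        moreover have "{v. v < 2 * n \<and> ?Lr v \<noteq> 0} \<subseteq> {v. v < 2 * n \<and> fst ?t' 32 0 v \<noteq> 0}"
          using I2 unfolding I2_def by blast
        ultimately show "{v. v < 2 * n \<and> ?Lr v \<noteq> 0} \<subset> {v. v < 2 * n \<and> fst ?t' 32 0 v \<noteq> 0}" by blast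
      qed simp
      then show ?thesis using \<open>j \<le> labcard n ?Lr\<close> by simp
    qed
    then show "I (Suc j) (setv 41 (Suc j) ?t')" using I2 by (simp add: I_def I2_def ok_def)
  qed
  then have I: "I (2 * n) s'" unfolding s'_def REACH_def by simp
  have lc: "labcard n L \<le> 2 * n" for L
    using card_mono[of "{..<2 * n}" "{v. v < 2 * n \<and> L v \<noteq> 0}"] by (auto simp: labcard_def)
  show "pred_ok m ?A ?B ?a1 ?a2 ?Lz (fst s' 32 0) (fst s' 33 0)" using I by (simp add: I_def ok_def)
  show "fst s' 32 0 v \<le> 2 * n" if "v < 2 * n" for v using that I lc[of "fst s' 32 0"] by (auto simp: I_def ok_def intro: order_trans)
  show "closed_lab m ?A ?B ?a1 ?a2 (fst s' 32 0)"
  proof (cases "2 * n \<le> labcard n (fst s' 32 0)")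
    case True
    have "{v. v < 2 * n \<and> fst s' 32 0 v \<noteq> 0} = {..<2 * n}"
      by (rule card_subset_eq) (use True lc[of "fst s' 32 0"] in \<open>auto simp: labcard_def\<close>)
    then show ?thesis using ids unfolding closed_lab_def by blast
  next
    case False
    then show ?thesis using I by (auto simp: I_def)
  qed
qed

section \<open>Searching a tight set\<close>

text \<open>For the many loops that tabulate a function \<open>F\<close> in one row: when pass
  \<open>i\<close> starts, the columns before \<open>i\<close> are done and all other entries of the
  array are still the old ones.\<close>

lemma fill:
  assumes v: "j \<noteq> v" and N: "N = lv n m l"
    and step: "\<And>t i. i < N \<Longrightarrow> fst t v 0 0 = i \<Longrightarrow> (\<And>q. q \<noteq> v \<Longrightarrow> q \<notin> asg p \<Longrightarrow> fst t q = fst s q) \<Longrightarrow>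
      (\<And>r c. fst t j r c = (if r = R \<and> c < i then F c else fst s j r c)) \<Longrightarrow>
      fst (den n m p t) j = (fst t j)(R := (fst t j R)(i := F i))"
  shows "fst (den n m (For v l p) s) j r c = (if r = R \<and> c < N then F c else fst s j r c)"
proof -
  define I where "I i t \<longleftrightarrow> (\<forall>r c. fst t j r c = (if r = R \<and> c < i then F c else fst s j r c))"
    for i and t :: store
  have "I (lv n m l) (den n m (For v l p) s)"
  proof (rule for_rule)
    show "I 0 (setv v 0 s)" using v by (simp add: I_def)
    show "I (Suc i) (setv v (Suc i) (den n m p t))"
      if "i < lv n m l" "I i t" "fst t v 0 0 = i" "\<And>q. q \<noteq> v \<Longrightarrow> q \<notin> asg p \<Longrightarrow> fst t q = fst s q" for i t
    proof -
      have "fst (den n m p t) j = (fst t j)(R := (fst t j R)(i := F i))"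
        by (rule step) (use that N in \<open>auto simp: I_def\<close>)
      then show ?thesis using that(2) v by (auto simp: I_def less_Suc_eq)
    qed
  qed
  then show ?thesis using N by (simp add: I_def)
qed

section \<open>Unit flows by augmenting paths\<close>

definition ALF1 :: hp where
  "ALF1 = For 40 LM (If (Eq (A1 36 iv) (C 1)) (Set1 34 iv (C 0)) (Set1 34 iv (C 1)))"
definition ALF2 :: hp where
  "ALF2 = For 40 LM (If (Eq (A1 36 iv) (C 2)) (Set1 35 iv (C 0)) (Set1 35 iv (C 1)))"
definition LABI :: hp where
  "LABI = For 42 (LN 2) (Set1 32 vv (C 0))"
text \<open>The sinks are \<open>a\<close> and everything outside \<open>S\<close>. A set of
  labelled vertices without a sink is thus automatically a subset of \<open>S\<close> that avoids
  \<open>a\<close>.\<close>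

definition FINDT :: hp where
  "FINDT = Sq (SetV 47 (C 0)) (For 42 (LN 2) (If1 (And (Ne (lab vv) (C 0))
     (Neg (And (Eq (rs vv) (C 1)) (Ne vv (V 16))))) (Sq (SetV 29 vv) (SetV 47 (C 1)))))"
definition aug_body :: hp where
  "aug_body = If1 (Lt (C 1) (lab (V 30))) (Sq (SetV 46 (A1 33 (V 30)))
     (If (Eq (gb (V 46)) (V 30))
       (Sq (If (Eq (A1 36 (V 46)) (C 2)) (Set1 36 (V 46) (C 0)) (Set1 36 (V 46) (C 1))) (SetV 30 (ga (V 46))))
       (Sq (If (Eq (A1 36 (V 46)) (C 1)) (Set1 36 (V 46) (C 0)) (Set1 36 (V 46) (C 2))) (SetV 30 (gb (V 46))))))"
definition AUG :: hp where
  "AUG = Sq (SetV 30 (V 29)) (For 41 (LN 2) aug_body)"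
definition FITER :: hp where
  "FITER = If1 (Eq (V 28) (C 1)) (Sq ALF1 (Sq ALF2 (Sq LABI (Sq (Set1 32 (V 20) (C 1)) (Sq (Set1 32 (V 26) (C 1))
     (Sq REACH (Sq FINDT (If (Eq (V 47) (C 0)) (Sq (SetV 27 (C 1)) (SetV 28 (C 0))) AUG))))))))"
definition FLOWZ :: hp where
  "FLOWZ = Sq (SetV 27 (C 0)) (Sq (SetV 28 (C 1)) (Sq (For 40 LM (Set1 36 iv (C 0)))
     (Sq FITER (Sq FITER (Sq FITER FITER)))))"

definition phi :: "(nat \<Rightarrow> nat) \<Rightarrow> nat \<Rightarrow> int" where
  "phi F i = (if F i = 1 then 1 else if F i = 2 then -1 else 0)"

lemma ALF1_correct: "fst (den n m ALF1 s) 34 r c = (if r = 0 \<and> c < m then (if fst s 36 0 c = 1 then 0 else 1) else fst s 34 r c)"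
  unfolding ALF1_def by (rule fill[where F = "\<lambda>c. if fst s 36 0 c = 1 then 0 else 1"]) (auto simp: upd_def)

lemma ALF2_correct: "fst (den n m ALF2 s) 35 r c = (if r = 0 \<and> c < m then (if fst s 36 0 c = 2 then 0 else 1) else fst s 35 r c)"
  unfolding ALF2_def by (rule fill[where F = "\<lambda>c. if fst s 36 0 c = 2 then 0 else 1"]) (auto simp: upd_def)

lemma LABI_correct: "fst (den n m LABI s) 32 r c = (if r = 0 \<and> c < 2 * n then 0 else fst s 32 r c)"
  unfolding LABI_def by (rule fill[where F = "\<lambda>c. 0"]) (auto simp: upd_def)

lemma FINDT_correct:
  fixes s and n m :: nat defines "s' \<equiv> den n m FINDT s" and "snk \<equiv> \<lambda>v. fst s 32 0 v \<noteq> 0 \<and> \<not> (fst s 2 (fst s 11 0 0) v = 1 \<and> v \<noteq> fst s 16 0 0)"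
  shows "if fst s' 47 0 0 = 0 then \<forall>v<2 * n. \<not> snk v else fst s' 29 0 0 < 2 * n \<and> snk (fst s' 29 0 0)"
proof -
  define I where "I j t \<longleftrightarrow> (if fst t 47 0 0 = 0 then \<forall>v<j. \<not> snk v else fst t 29 0 0 < 2 * n \<and> snk (fst t 29 0 0))"
    for j and t :: store
  have "I (lv n m (LN 2)) (den n m (For 42 (LN 2) (If1 (And (Ne (lab vv) (C 0))
     (Neg (And (Eq (rs vv) (C 1)) (Ne vv (V 16))))) (Sq (SetV 29 vv) (SetV 47 (C 1))))) (den n m (SetV 47 (C 0)) s))"
    (is "I _ (den n m (For 42 (LN 2) ?p) ?s)")
  proof (rule for_rule)
    show "I 0 (setv 42 0 ?s)" by (simp add: I_def upd_def)
    show "I (Suc j) (setv 42 (Suc j) (den n m ?p t))" if j: "j < lv n m (LN 2)" and It: "I j t" and v: "fst t 42 0 0 = j"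
        and fr: "\<And>q. q \<noteq> 42 \<Longrightarrow> q \<notin> asg ?p \<Longrightarrow> fst t q = fst ?s q" for j t
    proof -
      have e: "fst t 32 = fst s 32" "fst t 2 = fst s 2" "fst t 11 = fst s 11" "fst t 16 = fst s 16"
        using fr[of 32] fr[of 2] fr[of 11] fr[of 16] by (auto simp: upd_def)
      have b: "bv n m (And (Ne (lab vv) (C 0)) (Neg (And (Eq (rs vv) (C 1)) (Ne vv (V 16))))) t = snk j"
        using e v by (simp add: snk_def)
      show ?thesis
      proof (cases "snk j")
        case True
        then have "den n m ?p t = den n m (Sq (SetV 29 vv) (SetV 47 (C 1))) t" using b by (simp only: den.simps if_True)
        then show ?thesis using j v True by (simp add: I_def upd_def)
      next
        case False
        then have "den n m ?p t = den n m Sk t" using b by (simp only: den.simps if_False)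
        then show ?thesis using It False by (auto simp: I_def upd_def less_Suc_eq)
      qed
    qed
  qed
  then show ?thesis by (simp add: I_def s'_def FINDT_def)
qed

lemma excess_upd:
  assumes "i < m"
  shows "excess m A B (\<phi>(i := x)) v = excess m A B \<phi> v + (x - \<phi> i) * (of_bool (A i = v) - of_bool (B i = v))"
proof -
  let ?d = "\<lambda>i. of_bool (A i = v) - of_bool (B i = v) :: int"
  have "(\<Sum>j<m. (\<phi>(i := x)) j * ?d j) = (\<Sum>j\<in>{..<m} - {i}. \<phi> j * ?d j) + x * ?d i"
    using assms by (subst sum.remove[of _ i]) auto
  moreover have "(\<Sum>j<m. \<phi> j * ?d j) = (\<Sum>j\<in>{..<m} - {i}. \<phi> j * ?d j) + \<phi> i * ?d i"
    using assms by (subst sum.remove[of _ i]) auto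
  ultimately show ?thesis unfolding excess_def by (simp add: algebra_simps)
qed

lemma phi_upd: "phi (F(i := k)) = (phi F)(i := (if k = 1 then 1 else if k = 2 then -1 else 0))"
  by (auto simp: phi_def)

text \<open>Walking back from the sink \<open>T\<close>, one more unit is sent along each
  predecessor edge, so that a unit of excess moves from \<open>T\<close> to the current vertex.
  Predecessor edges still ahead carry their original flow, since an edge just changed joins the two
  current labels and cannot enter a vertex of smaller or equal label.\<close>

lemma AUG_correct:
  fixes s and n m :: nat
  defines "A \<equiv> level_A s" and "B \<equiv> level_B s" and "L \<equiv> fst s 32 0" and "P \<equiv> fst s 33 0" and "FL \<equiv> fst s 36 0"
    and "T \<equiv> fst s 29 0 0" and "FL' \<equiv> fst (den n m AUG s) 36 0"
  assumes pk: "pred_ok m A B a1 a2 Lz L P" and a1: "\<And>i. i < m \<Longrightarrow> a1 i = 1 \<Longrightarrow> FL i \<noteq> 1"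
    and a2: "\<And>i. i < m \<Longrightarrow> a2 i = 1 \<Longrightarrow> FL i \<noteq> 2" and Lz: "\<And>v. Lz v \<noteq> 0 \<Longrightarrow> Lz v = 1"
    and T: "L T \<noteq> 0" "L T \<le> 2 * n" and FL: "\<And>i. i < m \<Longrightarrow> FL i \<le> 2"
  shows "(\<forall>i<m. FL' i \<le> 2) \<and> (\<exists>c. Lz c \<noteq> 0 \<and>
    (\<forall>v. excess m A B (phi FL') v = excess m A B (phi FL) v + of_bool (v = c) - of_bool (v = T)))"
proof -
  have Lz0: "Lz v = 0" if "1 < L v" for v
    using that pk Lz[of v] unfolding pred_ok_def by (metis nat_neq_iff)
  \<comment> \<open>The alternative \<open>L c = 1\<close> covers the idle rounds at a source. As
    \<open>L T \<le> 2 * n\<close>, the other alternative is impossible after \<open>2 * n\<close>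
    rounds.\<close>
  define J where "J j t \<longleftrightarrow> (let c = fst t 30 0 0; F = fst t 36 0 in L c \<noteq> 0 \<and> (L c = 1 \<or> L c + j \<le> L T) \<and>
      (\<forall>i<m. F i \<le> 2) \<and> (\<forall>v. excess m A B (phi F) v = excess m A B (phi FL) v + of_bool (v = c) - of_bool (v = T)) \<and>
      (\<forall>v. 1 < L v \<longrightarrow> L v \<le> L c \<longrightarrow> F (P v) = FL (P v)))" for j and t :: store
  let ?s = "den n m (SetV 30 (V 29)) s"
  have "J (lv n m (LN 2)) (den n m (For 41 (LN 2) aug_body) ?s)"
  proof (rule for_rule)
    have "fst ?s 36 0 = FL" "fst ?s 30 0 0 = T" by (auto simp: upd_def T_def FL_def)
    then show "J 0 (setv 41 0 ?s)" using T FL by (simp add: J_def)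
  next
    fix j t assume j: "j < lv n m (LN 2)" and Jt: "J j t"
      and fr: "\<And>q. q \<noteq> 41 \<Longrightarrow> q \<notin> asg aug_body \<Longrightarrow> fst t q = fst ?s q"
    have e: "fst t 0 (fst t 11 0 0) = A" "fst t 1 (fst t 11 0 0) = B" "fst t 32 0 = L" "fst t 33 0 = P"
      using fr[of 0] fr[of 1] fr[of 11] fr[of 32] fr[of 33]
      by (auto simp: aug_body_def upd_def A_def B_def level_A_def level_B_def L_def P_def)
    define c where "c = fst t 30 0 0"
    define F where "F = fst t 36 0"
    have Jc: "L c \<noteq> 0" "L c = 1 \<or> L c + j \<le> L T" "\<forall>i<m. F i \<le> 2"
       "\<And>v. excess m A B (phi F) v = excess m A B (phi FL) v + of_bool (v = c) - of_bool (v = T)"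
       "\<And>v. 1 < L v \<Longrightarrow> L v \<le> L c \<Longrightarrow> F (P v) = FL (P v)"
      using Jt by (auto simp: J_def Let_def c_def F_def)
    let ?t' = "den n m aug_body t"
    show "J (Suc j) (setv 41 (Suc j) ?t')"
    proof (cases "1 < L c")
      case False
      then have "?t' = den n m Sk t" using e c_def unfolding aug_body_def by simp
      then have "fst ?t' 30 0 0 = c" "fst ?t' 36 0 = F" by (auto simp: upd_def c_def F_def)
      then show ?thesis using Jc False by (auto simp: J_def)
    next
      case True
      define i where "i = P c"
      have pc: "i < m \<and> ((B i = c \<and> a1 i = 1 \<and> L (A i) \<noteq> 0 \<and> L c = Suc (L (A i))) \<or>
          (A i = c \<and> a2 i = 1 \<and> L (B i) \<noteq> 0 \<and> L c = Suc (L (B i))))"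
        using pk Lz0[OF True] Jc(1) unfolding pred_ok_def i_def by blast
      then have im: "i < m" by simp
      have Fi: "F i = FL i" using Jc(5)[of c] True by (simp add: i_def)
      define F' where "F' = F(i := (if B i = c then (if F i = 2 then 0 else 1) else (if F i = 1 then 0 else 2)))"
      define c' where "c' = (if B i = c then A i else B i)"
      have t': "fst ?t' 30 0 0 = c'" "fst ?t' 36 0 = F'"
        using True e unfolding aug_body_def c'_def F'_def
        by (auto simp: upd_def c_def[symmetric] F_def[symmetric] i_def[symmetric])
      have pT: "a1 i = 1 \<and> L (A i) \<noteq> 0 \<and> L c = Suc (L (A i))" if "B i = c"
        using pc that by (metis n_not_Suc_n)
      have pF: "A i = c \<and> a2 i = 1 \<and> L (B i) \<noteq> 0 \<and> L c = Suc (L (B i))" if "B i \<noteq> c"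
        using pc that by blast
      have "L c' \<noteq> 0 \<and> L c = Suc (L c')"
      proof (cases "B i = c")
        case True
        then have c': "c' = A i" by (simp add: c'_def)
        show ?thesis unfolding c' using pT[OF True] by blast
      next
        case False
        then have c': "c' = B i" by (simp add: c'_def)
        show ?thesis unfolding c' using pF[OF False] by blast
      qed
      then have lc: "L c' \<noteq> 0" "L c = Suc (L c')" by blast+
      have ex: "excess m A B (phi F') v = excess m A B (phi F) v + of_bool (v = c') - of_bool (v = c)" for v
      proof (cases "B i = c")
        case True
        then have "a1 i = 1" using pT by blast
        then have "F i \<noteq> 1" using a1[OF im] Fi by simp
        moreover have "F i \<le> 2" using Jc(3) im by simp
        ultimately have "phi F' = (phi F)(i := phi F i + 1)"
          unfolding F'_def phi_upd using True by (auto simp: phi_def)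
        then show ?thesis using excess_upd[OF im, of A B "phi F" "phi F i + 1" v] True by (simp add: c'_def eq_commute)
      next
        case False
        then have "a2 i = 1" "A i = c" using pF by blast+
        then have "F i \<noteq> 2" using a2[OF im] Fi by simp
        moreover have "F i \<le> 2" using Jc(3) im by simp
        ultimately have "phi F' = (phi F)(i := phi F i - 1)"
          unfolding F'_def phi_upd using False by (auto simp: phi_def)
        then show ?thesis using excess_upd[OF im, of A B "phi F" "phi F i - 1" v] False \<open>A i = c\<close>
          by (simp add: c'_def eq_commute)
      qed
      have "F' (P v) = FL (P v)" if v: "1 < L v" "L v \<le> L c'" for v
      proof -
        have "P v \<noteq> i"
        proof
          assume "P v = i"
          moreover have "L v \<noteq> 0" using v by simp
          ultimately have "(B i = v \<and> L v = Suc (L (A i))) \<or> (A i = v \<and> L v = Suc (L (B i)))"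
            using pk Lz0[OF v(1)] unfolding pred_ok_def by blast
          then have "L v = Suc (L (A i)) \<or> L v = Suc (L (B i))" "v = A i \<or> v = B i" by blast+
          moreover have "{A i, B i} = {c, c'}" using pF by (auto simp: c'_def)
          ultimately show False using lc v by (auto simp: doubleton_eq_iff)
        qed
        then show ?thesis using Jc(5)[of v] v lc by (simp add: F'_def)
      qed
      moreover have "\<forall>i<m. F' i \<le> 2" using Jc(3) by (auto simp: F'_def)
      moreover have "L c' = 1 \<or> L c' + Suc j \<le> L T" using Jc(2) lc by auto
      ultimately show ?thesis using lc Jc(4) ex t' by (simp add: J_def)
    qed
  qed
  then have J: "J (2 * n) (den n m AUG s)" by (simp add: AUG_def)
  define c where "c = fst (den n m AUG s) 30 0 0"
  have c: "L c \<noteq> 0" "L c = 1 \<or> L c + 2 * n \<le> L T" "\<forall>i<m. FL' i \<le> 2"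
    "\<forall>v. excess m A B (phi FL') v = excess m A B (phi FL) v + of_bool (v = c) - of_bool (v = T)"
    using J by (auto simp: J_def Let_def c_def FL'_def)
  have "L c = 1" using c T by auto
  have "Lz c \<noteq> 0"
  proof
    assume "Lz c = 0"
    then have "L c = Suc (L (A (P c))) \<and> L (A (P c)) \<noteq> 0 \<or> L c = Suc (L (B (P c))) \<and> L (B (P c)) \<noteq> 0"
      using pk c(1) unfolding pred_ok_def by blast
    then show False using \<open>L c = 1\<close> by auto
  qed
  then show ?thesis using c by blast
qed

definition reg :: "nat \<Rightarrow> store \<Rightarrow> nat set" where
  "reg n s = {v. v < 2 * n \<and> fst s 2 (fst s 11 0 0) v = 1}"

text \<open>The two sources are not merged into one vertex; instead the flow value is the sum of
  their excesses, and how it is divided between them is left open.\<close>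

definition flow_inv :: "nat \<Rightarrow> nat \<Rightarrow> nat \<Rightarrow> store \<Rightarrow> bool" where
  "flow_inv n m c s \<longleftrightarrow> (\<forall>i<m. fst s 36 0 i \<le> 2) \<and>
    (\<forall>v\<in>reg n s - {fst s 16 0 0, fst s 20 0 0, fst s 26 0 0}. excess m (level_A s) (level_B s) (phi (fst s 36 0)) v = 0) \<and>
    excess m (level_A s) (level_B s) (phi (fst s 36 0)) (fst s 20 0 0) +
    excess m (level_A s) (level_B s) (phi (fst s 36 0)) (fst s 26 0 0) = int c"

definition labset :: "nat \<Rightarrow> store \<Rightarrow> nat set" where
  "labset n s = {v. v < 2 * n \<and> fst s 32 0 v \<noteq> 0}"

definition flow_done :: "nat \<Rightarrow> nat \<Rightarrow> store \<Rightarrow> nat \<Rightarrow> bool" where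
  "flow_done n m s c \<longleftrightarrow> labset n s \<subseteq> reg n s - {fst s 16 0 0} \<and> fst s 20 0 0 \<in> labset n s \<and> fst s 26 0 0 \<in> labset n s \<and>
     card (cut m (level_A s) (level_B s) (labset n s)) = c"

text \<open>\<open>LABI\<close> clears only the first \<open>2 * n\<close> cells. The rest must be
  known to be zero before the labels can be described as one function on all naturals.\<close>

definition lab_zero :: "nat \<Rightarrow> store \<Rightarrow> bool" where
  "lab_zero n s \<longleftrightarrow> (\<forall>v\<ge>2 * n. fst s 32 0 v = 0)"

lemma pred_ok_zero:
  assumes "pred_ok m A B a1 a2 Lz L P" "\<And>i. i < m \<Longrightarrow> A i < k \<and> B i < k" "\<And>v. k \<le> v \<Longrightarrow> Lz v = 0" "k \<le> v"
  shows "L v = 0"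
proof (rule ccontr)
  assume "L v \<noteq> 0"
  then have "P v < m \<and> (B (P v) = v \<or> A (P v) = v)" using assms(1,3,4) unfolding pred_ok_def by blast
  then show False using assms(2)[of "P v"] assms(4) by auto
qed

lemma asg_progs: "asg ALF1 = {40, 34}" "asg ALF2 = {40, 35}" "asg LABI = {42, 32}" "asg REACH = {41, 40, 33, 32, 79}"
    "asg FINDT = {47, 42, 29, 79}" "asg AUG = {30, 41, 46, 36, 79}"
  by (auto simp: ALF1_def ALF2_def LABI_def REACH_def reach_body_def FINDT_def AUG_def aug_body_def)

lemma asg_FITER: "asg FITER = {40, 34, 35, 42, 32, 41, 33, 79, 47, 29, 27, 28, 30, 46, 36}"
  by (auto simp: FITER_def asg_progs)

text \<open>If no sink is reached, the labelled set is closed under residual edges, so every edge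
  leaving it is saturated outwards and its cut equals the excess inside, which is \<open>c\<close>.
  Otherwise the unit sent to the sink raises the value by one.\<close>

lemma FITER_correct:
  fixes s and n m c :: nat defines "s' \<equiv> den n m FITER s"
  assumes ids: "\<And>i. i < m \<Longrightarrow> level_A s i < 2 * n \<and> level_B s i < 2 * n" and lz: "lab_zero n s"
    and ok: "fst s 28 0 0 = 1" "fst s 27 0 0 = 0" and inv: "flow_inv n m c s"
    and yz: "fst s 20 0 0 \<in> reg n s - {fst s 16 0 0}" "fst s 26 0 0 \<in> reg n s - {fst s 16 0 0}" "fst s 20 0 0 \<noteq> fst s 26 0 0"
  shows "lab_zero n s' \<and> ((fst s' 28 0 0 = 1 \<and> fst s' 27 0 0 = 0 \<and> flow_inv n m (Suc c) s') \<or>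
    (fst s' 28 0 0 = 0 \<and> fst s' 27 0 0 = 1 \<and> flow_done n m s' c))"
proof -
  let ?A = "level_A s" and ?B = "level_B s" and ?y = "fst s 20 0 0" and ?z = "fst s 26 0 0" and ?a = "fst s 16 0 0"
  let ?FL = "fst s 36 0"
  define sa where "sa = den n m ALF1 s"
  define sb where "sb = den n m ALF2 sa"
  define sc where "sc = den n m LABI sb"
  define s1 where "s1 = den n m (Sq (Set1 32 (V 20) (C 1)) (Set1 32 (V 26) (C 1))) sc"
  define s2 where "s2 = den n m REACH s1"
  define s3 where "s3 = den n m FINDT s2"
  have s': "s' = den n m (If (Eq (V 47) (C 0)) (Sq (SetV 27 (C 1)) (SetV 28 (C 0))) AUG) s3"
    unfolding s'_def FITER_def s3_def s2_def s1_def sc_def sb_def sa_def using ok by simp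
  have fa: "fst sa q = fst s q" if "q \<notin> {40, 34}" for q
    unfolding sa_def by (rule den_frame) (use that asg_progs in auto)
  have fb: "fst sb q = fst sa q" if "q \<notin> {40, 35}" for q
    unfolding sb_def by (rule den_frame) (use that asg_progs in auto)
  have fc: "fst sc q = fst sb q" if "q \<notin> {42, 32}" for q
    unfolding sc_def by (rule den_frame) (use that asg_progs in auto)
  have fd: "fst s1 q = fst sc q" if "q \<noteq> 32" for q using that by (simp add: s1_def upd_def)
  have f1: "fst s1 q = fst s q" if "q \<notin> {40, 34, 35, 42, 32}" for q
    using that fa fb fc fd by auto
  have f2: "fst s2 q = fst s1 q" if "q \<notin> {41, 40, 33, 32, 79}" for q
    unfolding s2_def by (rule den_frame) (use that asg_progs in auto)
  have f3: "fst s3 q = fst s2 q" if "q \<notin> {47, 42, 29, 79}" for q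
    unfolding s3_def by (rule den_frame) (use that asg_progs in auto)
  have lA: "level_A s1 = ?A" "level_B s1 = ?B" "level_A s2 = ?A" "level_B s2 = ?B" "level_A s3 = ?A" "level_B s3 = ?B"
    by (auto simp: level_A_def level_B_def f1 f2 f3)
  have al: "fst s1 34 0 i = 1 \<longleftrightarrow> ?FL i \<noteq> 1" "fst s1 35 0 i = 1 \<longleftrightarrow> ?FL i \<noteq> 2" if "i < m" for i
    using that fd[of 34] fc[of 34] fb[of 34] fd[of 35] fc[of 35] ALF1_correct[of n m s 0 i] ALF2_correct[of n m sa 0 i] fa[of 36]
    by (auto simp: sa_def[symmetric] sb_def[symmetric])
  have y2: "?y < 2 * n" "?z < 2 * n" using yz by (auto simp: reg_def)
  have "fst sc 32 0 v = 0" for v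
    using LABI_correct[of n m sb 0 v] fb[of 32] fa[of 32] lz unfolding sc_def lab_zero_def by auto
  moreover have "fst sc 20 = fst s 20" "fst sc 26 = fst s 26"
    using fa[of 20] fb[of 20] fc[of 20] fa[of 26] fb[of 26] fc[of 26] by auto
  ultimately have L1: "fst s1 32 0 v = (if v = ?y \<or> v = ?z then 1 else 0)" for v
    by (auto simp: s1_def upd_def)
  have "{?y} \<subseteq> {v. v < 2 * n \<and> fst s1 32 0 v \<noteq> 0}" using y2 L1 by auto
  then have "card {?y} \<le> labcard n (fst s1 32 0)" unfolding labcard_def by (intro card_mono) auto
  then have "fst s1 32 0 v \<le> labcard n (fst s1 32 0)" for v using L1[of v] by auto
  then have R: "pred_ok m ?A ?B (fst s1 34 0) (fst s1 35 0) (fst s1 32 0) (fst s2 32 0) (fst s2 33 0)"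
    "closed_lab m ?A ?B (fst s1 34 0) (fst s1 35 0) (fst s2 32 0)"
    "\<And>v. v < 2 * n \<Longrightarrow> fst s2 32 0 v \<le> 2 * n"
    using REACH_correct[of m s1 n] ids lA unfolding s2_def by auto
  have lz2: "fst s2 32 0 v = 0" if "2 * n \<le> v" for v
    by (rule pred_ok_zero[OF R(1), of "2 * n"]) (use ids L1 y2 that in auto)
  define snk where "snk v \<longleftrightarrow> fst s2 32 0 v \<noteq> 0 \<and> v \<notin> reg n s - {?a}" for v
  have T: "if fst s3 47 0 0 = 0 then \<forall>v<2 * n. \<not> snk v else fst s3 29 0 0 < 2 * n \<and> snk (fst s3 29 0 0)"
    using FINDT_correct[of n m s2] f1[of 2] f2[of 2] f1[of 11] f2[of 11] f1[of 16] f2[of 16]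
    unfolding s3_def[symmetric] snk_def reg_def by (auto split: if_splits)
  have ylab: "fst s2 32 0 ?y \<noteq> 0" "fst s2 32 0 ?z \<noteq> 0"
    using R(1) L1 unfolding pred_ok_def by (metis One_nat_def Suc_neq_Zero)+
  have l3: "fst s3 32 = fst s2 32" using f3 by simp
  show ?thesis
  proof (cases "fst s3 47 0 0 = 0")
    case True
    then have e: "s' = den n m (Sq (SetV 27 (C 1)) (SetV 28 (C 0))) s3" using s' by simp
    have fr: "fst s' q = fst s3 q" if "q \<notin> {27, 28}" for q using that e by (auto simp: upd_def)
    have lev: "level_A s' = ?A" "level_B s' = ?B" "reg n s' = reg n s" "fst s' 16 = fst s 16" "fst s' 20 = fst s 20" "fst s' 26 = fst s 26"
      by (auto simp: level_A_def level_B_def reg_def fr f1 f2 f3)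
    have W: "labset n s' = {v. v < 2 * n \<and> fst s2 32 0 v \<noteq> 0}" using fr[of 32] l3 by (auto simp: labset_def)
    have "\<forall>v<2 * n. \<not> snk v" using T True by simp
    then have sub: "labset n s' \<subseteq> reg n s - {?a}" unfolding W snk_def by blast
    have yW: "?y \<in> labset n s'" "?z \<in> labset n s'" using W ylab y2 by auto
    have fin: "finite (labset n s')" by (simp add: labset_def)
    have "(\<Sum>v\<in>labset n s'. excess m ?A ?B (phi ?FL) v) = int (card (cut m ?A ?B (labset n s')))"
    proof (rule flow_eq_cut[OF fin])
      fix i assume i: "i < m"
      have in_W: "?A i \<in> labset n s' \<longleftrightarrow> fst s2 32 0 (?A i) \<noteq> 0" "?B i \<in> labset n s' \<longleftrightarrow> fst s2 32 0 (?B i) \<noteq> 0"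
        using ids[OF i] W by auto
      have cl: "(fst s1 34 0 i = 1 \<longrightarrow> fst s2 32 0 (?A i) \<noteq> 0 \<longrightarrow> fst s2 32 0 (?B i) \<noteq> 0) \<and>
          (fst s1 35 0 i = 1 \<longrightarrow> fst s2 32 0 (?B i) \<noteq> 0 \<longrightarrow> fst s2 32 0 (?A i) \<noteq> 0)"
        using R(2) i unfolding closed_lab_def by blast
      show "phi ?FL i = 1" if "?A i \<in> labset n s'" "?B i \<notin> labset n s'"
        using cl al[OF i] that in_W by (auto simp: phi_def)
      show "phi ?FL i = -1" if "?B i \<in> labset n s'" "?A i \<notin> labset n s'"
        using cl al[OF i] that in_W by (auto simp: phi_def)
    qed
    moreover have "(\<Sum>v\<in>labset n s'. excess m ?A ?B (phi ?FL) v) = (\<Sum>v\<in>{?y, ?z}. excess m ?A ?B (phi ?FL) v)"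
      by (rule sum.mono_neutral_right[OF fin]) (use yW sub inv in \<open>auto simp: flow_inv_def\<close>)
    moreover have "(\<Sum>v\<in>{?y, ?z}. excess m ?A ?B (phi ?FL) v) = int c" using inv yz(3) by (simp add: flow_inv_def)
    ultimately have "card (cut m ?A ?B (labset n s')) = c" by simp
    moreover have "lab_zero n s'" using fr[of 32] l3 lz2 by (auto simp: lab_zero_def)
    moreover have "fst s' 28 0 0 = 0" "fst s' 27 0 0 = 1" using e by (auto simp: upd_def)
    ultimately show ?thesis using sub yW lev by (simp add: flow_done_def)
  next
    case False
    then have e: "s' = den n m AUG s3" using s' by simp
    have fr: "fst s' q = fst s3 q" if "q \<notin> {30, 41, 46, 36, 79}" for q
      unfolding e by (rule den_frame) (use that asg_progs in auto)
    have lev: "level_A s' = ?A" "level_B s' = ?B" "reg n s' = reg n s" "fst s' 16 = fst s 16" "fst s' 20 = fst s 20" "fst s' 26 = fst s 26"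
      by (auto simp: level_A_def level_B_def reg_def fr f1 f2 f3)
    let ?T = "fst s3 29 0 0"
    have T': "?T < 2 * n" "fst s2 32 0 ?T \<noteq> 0" "?T \<notin> reg n s - {?a}" using T False by (auto simp: snk_def)
    have FL3: "fst s3 36 = fst s 36" "fst s3 33 = fst s2 33" using f1 f2 f3 by auto
    have "(\<forall>i<m. fst s' 36 0 i \<le> 2) \<and> (\<exists>c'. fst s1 32 0 c' \<noteq> 0 \<and>
      (\<forall>v. excess m ?A ?B (phi (fst s' 36 0)) v = excess m ?A ?B (phi ?FL) v + of_bool (v = c') - of_bool (v = ?T)))"
      unfolding e FL3(1)[symmetric] lA(5,6)[symmetric]
    proof (rule AUG_correct)
      show "pred_ok m (level_A s3) (level_B s3) (fst s1 34 0) (fst s1 35 0) (fst s1 32 0) (fst s3 32 0) (fst s3 33 0)"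
        using R(1) lA l3 FL3 by simp
      show "fst s3 36 0 i \<noteq> 1" if "i < m" "fst s1 34 0 i = 1" for i using al(1)[OF that(1)] that FL3 by simp
      show "fst s3 36 0 i \<noteq> 2" if "i < m" "fst s1 35 0 i = 1" for i using al(2)[OF that(1)] that FL3 by simp
      show "fst s1 32 0 v = 1" if "fst s1 32 0 v \<noteq> 0" for v using L1[of v] that by (simp split: if_splits)
      show "fst s3 32 0 ?T \<noteq> 0" "fst s3 32 0 ?T \<le> 2 * n" using T' l3 R(3)[of ?T] by auto
      show "fst s3 36 0 i \<le> 2" if "i < m" for i using inv that FL3 by (simp add: flow_inv_def)
    qed
    then obtain c' where c': "\<forall>i<m. fst s' 36 0 i \<le> 2" "fst s1 32 0 c' \<noteq> 0"
      "\<And>v. excess m ?A ?B (phi (fst s' 36 0)) v = excess m ?A ?B (phi ?FL) v + of_bool (v = c') - of_bool (v = ?T)"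
      by blast
    have cyz: "c' = ?y \<or> c' = ?z" using c'(2) L1[of c'] by (auto split: if_splits)
    have "?y \<noteq> ?T" "?z \<noteq> ?T" using yz T'(3) by auto
    then have "excess m ?A ?B (phi (fst s' 36 0)) ?y + excess m ?A ?B (phi (fst s' 36 0)) ?z = int (Suc c)"
      using c'(3)[of ?y] c'(3)[of ?z] cyz yz(3) inv by (auto simp: flow_inv_def)
    moreover have "excess m ?A ?B (phi (fst s' 36 0)) v = 0" if "v \<in> reg n s - {?a, ?y, ?z}" for v
    proof -
      have "v \<noteq> c'" "v \<noteq> ?T" using that cyz T'(3) by auto
      then show ?thesis using c'(3)[of v] that inv by (auto simp: flow_inv_def)
    qed
    ultimately have "flow_inv n m (Suc c) s'" using c'(1) lev by (simp add: flow_inv_def)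
    moreover have "lab_zero n s'" using fr[of 32] l3 lz2 by (auto simp: lab_zero_def)
    moreover have "fst s' 28 0 0 = 1" "fst s' 27 0 0 = 0" using fr f3 f2 f1 ok by auto
    ultimately show ?thesis by blast
  qed
qed

lemma asg_FLOWZ: "asg FLOWZ = {40, 34, 35, 42, 32, 41, 33, 79, 47, 29, 27, 28, 30, 46, 36}"
  by (auto simp: FLOWZ_def asg_FITER)

text \<open>Four units leaving a set refute a cut of size 3. If the flow stops at some
  \<open>k < 4\<close>, the labelled set is a nonempty part of the region with a cut of
  \<open>k\<close> edges, which forces \<open>k = 3\<close>.\<close>

lemma FLOWZ_correct:
  fixes s and n m :: nat defines "s' \<equiv> den n m FLOWZ s"
  assumes ids: "\<And>i. i < m \<Longrightarrow> level_A s i < 2 * n \<and> level_B s i < 2 * n" and lz: "lab_zero n s"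
    and yz: "fst s 20 0 0 \<in> reg n s - {fst s 16 0 0}" "fst s 26 0 0 \<in> reg n s - {fst s 16 0 0}" "fst s 20 0 0 \<noteq> fst s 26 0 0"
    and R: "region m (level_A s) (level_B s) (reg n s)"
  shows "lab_zero n s'"
    and "(fst s' 27 0 0 = 1 \<and> flow_done n m s' 3) \<or>
      (fst s' 27 0 0 = 0 \<and> (\<forall>W\<subseteq>reg n s - {fst s 16 0 0}. fst s 20 0 0 \<in> W \<longrightarrow> fst s 26 0 0 \<in> W \<longrightarrow>
         card (cut m (level_A s) (level_B s) W) \<noteq> 3))"
proof -
  let ?A = "level_A s" and ?B = "level_B s" and ?y = "fst s 20 0 0" and ?z = "fst s 26 0 0" and ?a = "fst s 16 0 0"
  define same where "same t \<longleftrightarrow> level_A t = ?A \<and> level_B t = ?B \<and> reg n t = reg n s \<and> fst t 16 = fst s 16 \<and>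
     fst t 20 = fst s 20 \<and> fst t 26 = fst s 26" for t
  \<comment> \<open>Once a cut has been found the remaining iterations are idle; hence only
    \<open>k < c\<close> is recorded for its size.\<close>
  define st where "st c t \<longleftrightarrow> same t \<and> lab_zero n t \<and> ((fst t 28 0 0 = 1 \<and> fst t 27 0 0 = 0 \<and> flow_inv n m c t) \<or>
     (fst t 28 0 0 = 0 \<and> fst t 27 0 0 = 1 \<and> (\<exists>k<c. flow_done n m t k)))" for c t
  have step: "st (Suc c) (den n m FITER t)" if "st c t" for c t
  proof -
    have fr: "fst (den n m FITER t) q = fst t q" if "q \<notin> asg FITER" for q by (rule den_frame[OF that])
    have sm: "same (den n m FITER t)" using that fr unfolding same_def st_def level_A_def level_B_def reg_def asg_FITER by auto
    show ?thesis
    proof (cases "fst t 28 0 0 = 1")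
      case True
      have "lab_zero n (den n m FITER t) \<and> ((fst (den n m FITER t) 28 0 0 = 1 \<and> fst (den n m FITER t) 27 0 0 = 0 \<and> flow_inv n m (Suc c) (den n m FITER t)) \<or>
         (fst (den n m FITER t) 28 0 0 = 0 \<and> fst (den n m FITER t) 27 0 0 = 1 \<and> flow_done n m (den n m FITER t) c))"
        by (rule FITER_correct) (use that True ids yz in \<open>auto simp: st_def same_def\<close>)
      then show ?thesis using sm unfolding st_def by blast
    next
      case False
      then have "den n m FITER t = den n m Sk t" by (simp add: FITER_def)
      then have d: "fst (den n m FITER t) q = fst t q" if "q \<noteq> 79" for q using that by (simp add: upd_def)
      have t: "lab_zero n t" "fst t 28 0 0 = 0" "fst t 27 0 0 = 1" "\<exists>k<c. flow_done n m t k" using that False by (auto simp: st_def)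
      have "lab_zero n (den n m FITER t)" using t d by (simp add: lab_zero_def)
      moreover have "flow_done n m (den n m FITER t) k = flow_done n m t k" for k
        using d by (simp add: flow_done_def labset_def reg_def level_A_def level_B_def)
      ultimately show ?thesis using sm t d unfolding st_def by (auto intro: less_SucI)
    qed
  qed
  define s0 where "s0 = den n m (Sq (SetV 27 (C 0)) (Sq (SetV 28 (C 1)) (For 40 LM (Set1 36 iv (C 0))))) s"
  have fr0: "fst s0 q = fst s q" if "q \<notin> {27, 28, 40, 36}" for q
    unfolding s0_def by (rule den_frame) (use that in auto)
  let ?t = "den n m (SetV 28 (C 1)) (den n m (SetV 27 (C 0)) s)"
  have "fst (den n m (For 40 LM (Set1 36 iv (C 0))) ?t) 36 r c = (if r = 0 \<and> c < m then 0 else fst ?t 36 r c)" for r c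
    by (rule fill[where F = "\<lambda>c. 0"]) (auto simp: upd_def)
  then have FL0: "fst s0 36 0 i = 0" if "i < m" for i using that by (simp add: s0_def)
  have "fst s0 28 = fst ?t 28" "fst s0 27 = fst ?t 27"
    using den_frame[of 28 "For 40 LM (Set1 36 iv (C 0))" n m ?t] den_frame[of 27 "For 40 LM (Set1 36 iv (C 0))" n m ?t]
    by (auto simp: s0_def)
  then have 27: "fst s0 28 0 0 = 1" "fst s0 27 0 0 = 0" by (auto simp: upd_def)
  have sm0: "same s0" unfolding same_def level_A_def level_B_def reg_def using fr0 by auto
  have ex0: "excess m ?A ?B (phi (fst s0 36 0)) v = 0" for v
    unfolding excess_def using FL0 by (intro sum.neutral) (auto simp: phi_def)
  have "st 0 s0" using sm0 27 lz fr0[of 32] FL0 ex0 unfolding st_def flow_inv_def lab_zero_def same_def by auto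
  then have "st 4 (den n m FITER (den n m FITER (den n m FITER (den n m FITER s0))))"
    using step by (metis One_nat_def Suc_1 eval_nat_numeral(2,3) numeral_3_eq_3 numeral_One semiring_norm(26,27))
  moreover have "s' = den n m FITER (den n m FITER (den n m FITER (den n m FITER s0)))"
    unfolding s'_def FLOWZ_def s0_def by simp
  ultimately have st: "st 4 s'" by simp
  then show "lab_zero n s'" by (simp add: st_def)
  show "(fst s' 27 0 0 = 1 \<and> flow_done n m s' 3) \<or>
      (fst s' 27 0 0 = 0 \<and> (\<forall>W\<subseteq>reg n s - {?a}. ?y \<in> W \<longrightarrow> ?z \<in> W \<longrightarrow> card (cut m ?A ?B W) \<noteq> 3))"
  proof (cases "fst s' 28 0 0 = 1")
    case True
    then have inv: "fst s' 27 0 0 = 0" "flow_inv n m 4 s'" "same s'" using st by (auto simp: st_def)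
    have "card (cut m ?A ?B W) \<noteq> 3" if W: "W \<subseteq> reg n s - {?a}" "?y \<in> W" "?z \<in> W" for W
    proof -
      let ?f = "excess m ?A ?B (phi (fst s' 36 0))"
      have fin: "finite W" using W finite_subset[of W "{..<2 * n}"] by (auto simp: reg_def)
      have "(\<Sum>v\<in>W. ?f v) = (\<Sum>v\<in>{?y, ?z}. ?f v)"
        by (rule sum.mono_neutral_right[OF fin]) (use W inv in \<open>auto simp: flow_inv_def same_def\<close>)
      also have "\<dots> = 4" using inv yz(3) by (simp add: flow_inv_def same_def)
      finally have "(\<Sum>v\<in>W. ?f v) = 4" .
      moreover have "(\<Sum>v\<in>W. ?f v) \<le> int (card (cut m ?A ?B W))"
        by (rule flow_le_cut[OF fin]) (simp add: phi_def)
      ultimately show ?thesis by simp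
    qed
    then show ?thesis using inv by blast
  next
    case False
    then obtain k where k: "k < 4" "fst s' 27 0 0 = 1" "flow_done n m s' k" "same s'" using st by (auto simp: st_def)
    have "labset n s' \<subseteq> reg n s" "labset n s' \<noteq> {}" using k by (auto simp: flow_done_def same_def)
    then have "3 \<le> k" using region_ge3[OF R, of "labset n s'"] k(3,4) by (simp add: flow_done_def same_def)
    then have "k = 3" using k(1) by simp
    then show ?thesis using k by blast
  qed
qed

section \<open>Naming the edges and vertices around the protected edge\<close>

lemma den_If_True: "bv n m b s \<Longrightarrow> den n m (If b p q) s = den n m p s"
  by simp

lemma den_If_False: "\<not> bv n m b s \<Longrightarrow> den n m (If b p q) s = den n m q s"
  by simp

text \<open>The loop cannot be left early, so the last match wins. The flag \<open>fl\<close> tells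
  a match from a stale content of \<open>q\<close>.\<close>

definition SCAN :: "hb \<Rightarrow> nat \<Rightarrow> nat \<Rightarrow> hp" where
  "SCAN b q fl = Sq (SetV fl (C 0)) (For 40 LM (If1 b (Sq (SetV q iv) (SetV fl (C 1)))))"

lemma asg_SCAN: "asg (SCAN b q fl) = {fl, 40, q, 79}"
  by (auto simp: SCAN_def)

lemma SCAN_correct:
  fixes s and n m q fl :: nat and b defines "s' \<equiv> den n m (SCAN b q fl) s"
  assumes b: "\<And>t. (\<And>j. j \<notin> {fl, 40, q, 79} \<Longrightarrow> fst t j = fst s j) \<Longrightarrow> bv n m b t = Pr (fst t 40 0 0)"
    and ne: "q \<noteq> 40" "fl \<noteq> 40" "q \<noteq> fl" "q \<noteq> 79" "fl \<noteq> 79"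
  shows "(fst s' fl 0 0 = 0 \<and> (\<forall>i<m. \<not> Pr i)) \<or> (fst s' fl 0 0 = 1 \<and> fst s' q 0 0 < m \<and> Pr (fst s' q 0 0))"
proof -
  let ?p = "If1 b (Sq (SetV q iv) (SetV fl (C 1)))"
  let ?s = "den n m (SetV fl (C 0)) s"
  define I where "I j t \<longleftrightarrow> (fst t fl 0 0 = 0 \<and> (\<forall>i<j. \<not> Pr i)) \<or> (fst t fl 0 0 = 1 \<and> fst t q 0 0 < m \<and> Pr (fst t q 0 0))"
    for j and t :: store
  have "I (lv n m LM) (den n m (For 40 LM ?p) ?s)"
  proof (rule for_rule)
    show "I 0 (setv 40 0 ?s)" using ne by (simp add: I_def upd_def)
    show "I (Suc j) (setv 40 (Suc j) (den n m ?p t))" if j: "j < lv n m LM" and It: "I j t" and v: "fst t 40 0 0 = j"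
        and fr: "\<And>q. q \<noteq> 40 \<Longrightarrow> q \<notin> asg ?p \<Longrightarrow> fst t q = fst ?s q" for j t
    proof -
      have "fst t i = fst s i" if "i \<notin> {fl, 40, q, 79}" for i
        using fr[of i] that by (auto simp: upd_def)
      then have b: "bv n m b t = Pr j" using b v by auto
      show ?thesis
      proof (cases "Pr j")
        case True
        then show ?thesis using b j v ne by (simp add: I_def upd_def)
      next
        case False
        then show ?thesis using b It ne by (auto simp: I_def upd_def less_Suc_eq)
      qed
    qed
  qed
  then show ?thesis by (simp add: I_def s'_def SCAN_def)
qed

definition Xor :: "hb \<Rightarrow> hb \<Rightarrow> hb" where
  "Xor p q = Neg (And (Neg (And p (Neg q))) (Neg (And (Neg p) q)))"

lemma bv_Xor [simp]: "bv n m (Xor p q) s \<longleftrightarrow> bv n m p s \<noteq> bv n m q s"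
  by (auto simp: Xor_def)

definition At :: "he \<Rightarrow> he \<Rightarrow> hb" where
  "At v i = Xor (Eq (ga i) v) (Eq (gb i) v)"

definition OTH :: "nat \<Rightarrow> he \<Rightarrow> he \<Rightarrow> hp" where
  "OTH q v i = If (Eq (ga i) v) (SetV q (gb i)) (SetV q (ga i))"

definition oth :: "(nat \<Rightarrow> nat) \<Rightarrow> (nat \<Rightarrow> nat) \<Rightarrow> nat \<Rightarrow> nat \<Rightarrow> nat" where
  "oth A B v i = (if A i = v then B i else A i)"

lemma joins_oth: "cr A B {v} i \<Longrightarrow> joins A B i v (oth A B v i)"
  by (auto simp: cr_def joins_def oth_def)

lemma joins_sym: "joins A B i u v \<longleftrightarrow> joins A B i v u"
  by (auto simp: joins_def)

lemma asg_OTH: "asg (OTH q v i) = {q}"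
  by (simp add: OTH_def)

lemma OTH_correct: "fst (den n m (OTH q v i) s) q 0 0 = oth (level_A s) (level_B s) (ev n v (fst s)) (ev n i (fst s))"
  by (simp add: OTH_def oth_def level_A_def level_B_def upd_def)

definition inner :: hb where
  "inner = And (Eq (rs (ga iv)) (C 1)) (Eq (rs (gb iv)) (C 1))"

definition PREP1 :: hp where
  "PREP1 = Sq (If (Eq (rs (ga (V 15))) (C 1)) (SetV 16 (ga (V 15))) (SetV 16 (gb (V 15))))
     (SCAN (And (Ne iv (V 15)) (And (At (V 16) iv) inner)) 17 18)"

text \<open>The two edges at \<open>y\<close> other than \<open>e\<close> are found in no particular
  order. The final exchange makes \<open>h\<close> the one whose other end lies in
  \<open>S\<close>.\<close>

definition PREP2 :: hp where
  "PREP2 = Sq (SCAN (And (At (V 16) iv) (And (Ne iv (V 15)) (Ne iv (V 17)))) 19 45)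
    (Sq (OTH 25 (V 16) (V 19)) (Sq (OTH 20 (V 16) (V 17))
    (Sq (SCAN (And (At (V 20) iv) (Ne iv (V 17))) 21 45)
    (Sq (SCAN (And (At (V 20) iv) (And (Ne iv (V 17)) (Ne iv (V 21)))) 22 45)
    (Sq (OTH 23 (V 20) (V 21)) (Sq (OTH 24 (V 20) (V 22))
    (If1 (Ne (rs (V 24)) (C 1)) (Sq (SetV 46 (V 21)) (Sq (SetV 21 (V 22)) (Sq (SetV 22 (V 46))
      (Sq (SetV 46 (V 23)) (Sq (SetV 23 (V 24)) (SetV 24 (V 46))))))))))))))"

lemma asg_PREP1: "asg PREP1 = {16, 18, 40, 17, 79}"
  by (auto simp: PREP1_def asg_SCAN)

lemma asg_PREP2: "asg PREP2 = {45, 40, 19, 79, 25, 20, 21, 22, 23, 24, 46}"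
  by (auto simp: PREP2_def asg_SCAN asg_OTH)

text \<open>In the negative outcome all edges at \<open>a\<close> are boundary edges of
  \<open>S\<close>. A region allows this only if it is the single vertex \<open>a\<close>, so this
  outcome ends the reduction of \<open>S\<close>.\<close>

lemma PREP1_correct:
  fixes s and n m :: nat defines "s' \<equiv> den n m PREP1 s"
  assumes ids: "\<And>i. i < m \<Longrightarrow> level_A s i < 2 * n \<and> level_B s i < 2 * n"
    and x: "fst s 15 0 0 \<in> cut m (level_A s) (level_B s) (reg n s)"
  defines "a \<equiv> fst s' 16 0 0" and "e \<equiv> fst s' 17 0 0" and "x \<equiv> fst s 15 0 0"
  shows "a \<in> reg n s" "oth (level_A s) (level_B s) a x \<notin> reg n s" "joins (level_A s) (level_B s) x (oth (level_A s) (level_B s) a x) a"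
    and "(fst s' 18 0 0 = 0 \<and> (\<forall>i<m. i \<noteq> x \<longrightarrow> cr (level_A s) (level_B s) {a} i \<longrightarrow> cr (level_A s) (level_B s) (reg n s) i)) \<or>
      (fst s' 18 0 0 = 1 \<and> e < m \<and> e \<noteq> x \<and> cr (level_A s) (level_B s) {a} e \<and> oth (level_A s) (level_B s) a e \<in> reg n s)"
proof -
  let ?A = "level_A s" and ?B = "level_B s"
  define s1 where "s1 = den n m (If (Eq (rs (ga (V 15))) (C 1)) (SetV 16 (ga (V 15))) (SetV 16 (gb (V 15)))) s"
  have f1: "fst s1 q = fst s q" if "q \<noteq> 16" for q unfolding s1_def by (rule den_frame) (use that in auto)
  have s': "s' = den n m (SCAN (And (Ne iv (V 15)) (And (At (V 16) iv) inner)) 17 18) s1"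
    by (simp add: s'_def PREP1_def s1_def)
  have x': "x < m" "cr ?A ?B (reg n s) x" using x by (auto simp: in_cut x_def)
  have idx: "?A x < 2 * n" "?B x < 2 * n" using ids[OF x'(1)] by auto
  have a1: "fst s1 16 0 0 = (if ?A x \<in> reg n s then ?A x else ?B x)"
    using idx by (simp add: s1_def upd_def reg_def level_A_def level_B_def x_def)
  have a: "a = fst s1 16 0 0" unfolding a_def s'
    using den_frame[of 16 "SCAN (And (Ne iv (V 15)) (And (At (V 16) iv) inner)) 17 18" n m s1] by (simp add: asg_SCAN)
  show aS: "a \<in> reg n s" "oth ?A ?B a x \<notin> reg n s"
    using x' a a1 by (auto simp: cr_def oth_def)
  show "joins ?A ?B x (oth ?A ?B a x) a" using x' a a1 by (auto simp: joins_def oth_def cr_def split: if_splits)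
  define Pr where "Pr i \<longleftrightarrow> i \<noteq> x \<and> cr ?A ?B {a} i \<and>
     fst s 2 (fst s 11 0 0) (?A i) = 1 \<and> fst s 2 (fst s 11 0 0) (?B i) = 1" for i
  have "(fst s' 18 0 0 = 0 \<and> (\<forall>i<m. \<not> Pr i)) \<or> (fst s' 18 0 0 = 1 \<and> fst s' 17 0 0 < m \<and> Pr (fst s' 17 0 0))"
    unfolding s'
  proof (rule SCAN_correct)
    fix t :: store assume fr: "\<And>j. j \<notin> {18, 40, 17, 79} \<Longrightarrow> fst t j = fst s1 j"
    have "fst t 0 = fst s 0" "fst t 1 = fst s 1" "fst t 2 = fst s 2" "fst t 11 = fst s 11" "fst t 15 = fst s 15" "fst t 16 = fst s1 16"
      using fr f1 by auto
    then show "bv n m (And (Ne iv (V 15)) (And (At (V 16) iv) inner)) t = Pr (fst t 40 0 0)"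
      by (simp add: Pr_def At_def inner_def cr_def level_A_def level_B_def x_def a)
  qed auto
  moreover have "Pr i \<longleftrightarrow> i \<noteq> x \<and> cr ?A ?B {a} i \<and> oth ?A ?B a i \<in> reg n s" if "i < m" for i
    using ids[OF that] aS by (auto simp: Pr_def cr_def oth_def reg_def)
  moreover have "cr ?A ?B (reg n s) i \<longleftrightarrow> oth ?A ?B a i \<notin> reg n s" if "cr ?A ?B {a} i" for i
    using that aS by (auto simp: cr_def oth_def)
  ultimately show "(fst s' 18 0 0 = 0 \<and> (\<forall>i<m. i \<noteq> x \<longrightarrow> cr ?A ?B {a} i \<longrightarrow> cr ?A ?B (reg n s) i)) \<or>
      (fst s' 18 0 0 = 1 \<and> e < m \<and> e \<noteq> x \<and> cr ?A ?B {a} e \<and> oth ?A ?B a e \<in> reg n s)"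
    unfolding e_def by blast
qed

lemma card3_two_known:
  assumes "card X = 3" "u \<in> X" "v \<in> X" "u \<noteq> v"
  obtains w where "X = {u, v, w}" "w \<noteq> u" "w \<noteq> v"
proof -
  have "finite X" using assms(1) card.infinite by fastforce
  then have "card (X - {u, v}) = 1" using assms by (simp add: card_Diff_subset)
  then obtain w where w: "X - {u, v} = {w}" by (rule card_1_singletonE)
  then have "X = {u, v, w}" "w \<noteq> u" "w \<noteq> v" using assms by auto
  then show ?thesis by (rule that)
qed

definition prep_ok :: "nat \<Rightarrow> (nat \<Rightarrow> nat) \<Rightarrow> (nat \<Rightarrow> nat) \<Rightarrow> nat set \<Rightarrow> nat \<Rightarrow> nat \<Rightarrow> nat \<Rightarrow> nat \<Rightarrow> nat \<Rightarrow> nat \<Rightarrow> nat \<Rightarrow> nat \<Rightarrow> nat \<Rightarrow> nat \<Rightarrow> bool" where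
  "prep_ok m A B S x a e y f p g r h s \<longleftrightarrow> e < m \<and> joins A B e a y \<and> f < m \<and> joins A B f a p \<and>
     g < m \<and> joins A B g r y \<and> h < m \<and> joins A B h y s \<and> cut m A B {a} = {x, e, f} \<and> cut m A B {y} = {e, g, h} \<and>
     y \<in> S \<and> p \<in> S \<and> s \<in> S"

lemma PREP2_correct:
  fixes s and n m :: nat defines "s' \<equiv> den n m PREP2 s"
  assumes ids: "\<And>i. i < m \<Longrightarrow> level_A s i < 2 * n \<and> level_B s i < 2 * n"
    and R: "region m (level_A s) (level_B s) (reg n s)"
    and x: "fst s 15 0 0 \<in> cut m (level_A s) (level_B s) (reg n s)" "fst s 15 0 0 \<in> cut m (level_A s) (level_B s) {fst s 16 0 0}"
    and a: "fst s 16 0 0 \<in> reg n s"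
    and e: "fst s 17 0 0 < m" "fst s 17 0 0 \<noteq> fst s 15 0 0" "cr (level_A s) (level_B s) {fst s 16 0 0} (fst s 17 0 0)"
      "oth (level_A s) (level_B s) (fst s 16 0 0) (fst s 17 0 0) \<in> reg n s"
  shows "prep_ok m (level_A s) (level_B s) (reg n s) (fst s 15 0 0) (fst s 16 0 0) (fst s 17 0 0) (fst s' 20 0 0)
     (fst s' 19 0 0) (fst s' 25 0 0) (fst s' 21 0 0) (fst s' 23 0 0) (fst s' 22 0 0) (fst s' 24 0 0)"
proof -
  let ?A = "level_A s" and ?B = "level_B s" and ?S = "reg n s"
  let ?x = "fst s 15 0 0" and ?a = "fst s 16 0 0" and ?e = "fst s 17 0 0"
  define y where "y = oth ?A ?B ?a ?e"
  have je: "joins ?A ?B ?e ?a y" using joins_oth[OF e(3)] by (simp add: y_def)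
  have ya: "y \<noteq> ?a" using e(3) cr_joins[OF je, of "{?a}"] by auto
  have Sa: "?S \<noteq> {?a}" using e(4) ya by (auto simp: y_def)
  have Sy: "?S \<noteq> {y}" using a ya by auto
  obtain f where f: "cut m ?A ?B {?a} = {?x, ?e, f}" "f \<noteq> ?x" "f \<noteq> ?e"
    by (rule card3_two_known[of "cut m ?A ?B {?a}" ?x ?e]) (use R a x e in \<open>auto simp: region_def in_cut\<close>)
  have uf: "i = f" if "i < m" "cr ?A ?B {?a} i" "i \<noteq> ?x" "i \<noteq> ?e" for i using f that by (auto simp: cut_def)
  have fm: "f < m" "cr ?A ?B {?a} f" using f(1) by (auto simp: cut_def set_eq_iff)
  have fin: "oth ?A ?B ?a f \<in> ?S"
  proof -
    have "f \<notin> cut m ?A ?B ?S" by (rule region_local[OF R x a _ f(2) Sa]) (use fm in \<open>simp add: in_cut\<close>)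
    then show ?thesis using fm a by (auto simp: in_cut cr_def oth_def)
  qed
  have yS: "y \<in> ?S" using e(4) by (simp add: y_def)
  have "?e \<in> cut m ?A ?B {y}" using e(1) cr_joins[OF je, of "{y}"] ya by (auto simp: in_cut)
  then have ce: "card (cut m ?A ?B {y} - {?e}) = 2" using R yS by (simp add: region_def)
  then obtain g0 h0 where gh0: "cut m ?A ?B {y} - {?e} = {g0, h0}" "g0 \<noteq> h0" by (auto simp: card_2_iff)
  have ugh: "i \<in> {g0, h0} \<longleftrightarrow> i < m \<and> cr ?A ?B {y} i \<and> i \<noteq> ?e" for i using gh0(1) by (auto simp: cut_def set_eq_iff)
  define s1 where "s1 = den n m (SCAN (And (At (V 16) iv) (And (Ne iv (V 15)) (Ne iv (V 17)))) 19 45) s"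
  define s2 where "s2 = den n m (OTH 20 (V 16) (V 17)) (den n m (OTH 25 (V 16) (V 19)) s1)"
  define s3 where "s3 = den n m (SCAN (And (At (V 20) iv) (Ne iv (V 17))) 21 45) s2"
  define s4 where "s4 = den n m (SCAN (And (At (V 20) iv) (And (Ne iv (V 17)) (Ne iv (V 21)))) 22 45) s3"
  define s5 where "s5 = den n m (OTH 24 (V 20) (V 22)) (den n m (OTH 23 (V 20) (V 21)) s4)"
  have s': "s' = den n m (If1 (Ne (rs (V 24)) (C 1)) (Sq (SetV 46 (V 21)) (Sq (SetV 21 (V 22)) (Sq (SetV 22 (V 46))
      (Sq (SetV 46 (V 23)) (Sq (SetV 23 (V 24)) (SetV 24 (V 46)))))))) s5"
    by (simp add: s'_def PREP2_def s5_def s4_def s3_def s2_def s1_def)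
  have f1: "fst s1 q = fst s q" if "q \<notin> {45, 40, 19, 79}" for q
    unfolding s1_def by (rule den_frame) (use that in \<open>auto simp: asg_SCAN\<close>)
  have f2: "fst s2 q = fst s1 q" if "q \<notin> {20, 25}" for q
    unfolding s2_def using that by (simp add: den_frame asg_OTH)
  have f3: "fst s3 q = fst s2 q" if "q \<notin> {45, 40, 21, 79}" for q
    unfolding s3_def by (rule den_frame) (use that in \<open>auto simp: asg_SCAN\<close>)
  have f4: "fst s4 q = fst s3 q" if "q \<notin> {45, 40, 22, 79}" for q
    unfolding s4_def by (rule den_frame) (use that in \<open>auto simp: asg_SCAN\<close>)
  have f5: "fst s5 q = fst s4 q" if "q \<notin> {23, 24}" for q
    unfolding s5_def using that by (simp add: den_frame asg_OTH)
  have "(fst s1 45 0 0 = 0 \<and> (\<forall>i<m. \<not> (cr ?A ?B {?a} i \<and> i \<noteq> ?x \<and> i \<noteq> ?e))) \<or>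
      (fst s1 45 0 0 = 1 \<and> fst s1 19 0 0 < m \<and> cr ?A ?B {?a} (fst s1 19 0 0) \<and> fst s1 19 0 0 \<noteq> ?x \<and> fst s1 19 0 0 \<noteq> ?e)"
    unfolding s1_def
  proof (rule SCAN_correct[where Pr = "\<lambda>i. cr ?A ?B {?a} i \<and> i \<noteq> ?x \<and> i \<noteq> ?e"])
    fix t :: store assume fr: "\<And>j. j \<notin> {45, 40, 19, 79} \<Longrightarrow> fst t j = fst s j"
    show "bv n m (And (At (V 16) iv) (And (Ne iv (V 15)) (Ne iv (V 17)))) t =
      (cr ?A ?B {?a} (fst t 40 0 0) \<and> fst t 40 0 0 \<noteq> ?x \<and> fst t 40 0 0 \<noteq> ?e)"
      by (simp add: At_def cr_def level_A_def level_B_def fr)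
  qed auto
  then have s1f: "fst s1 19 0 0 = f" using fm f uf by blast
  have lA1: "level_A s1 = ?A" "level_B s1 = ?B" by (auto simp: level_A_def level_B_def f1)
  have "fst s2 25 = fst (den n m (OTH 25 (V 16) (V 19)) s1) 25" unfolding s2_def by (rule den_frame) (simp add: asg_OTH)
  then have s2p: "fst s2 25 0 0 = oth ?A ?B ?a f" using OTH_correct[of n m 25 "V 16" "V 19" s1] lA1 s1f f1 by simp
  have fx: "fst (den n m (OTH 25 (V 16) (V 19)) s1) q = fst s1 q" if "q \<noteq> 25" for q
    by (rule den_frame) (use that in \<open>simp add: asg_OTH\<close>)
  then have "level_A (den n m (OTH 25 (V 16) (V 19)) s1) = ?A" "level_B (den n m (OTH 25 (V 16) (V 19)) s1) = ?B"
    using lA1 by (auto simp: level_A_def level_B_def)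
  then have s2y: "fst s2 20 0 0 = y"
    using OTH_correct[of n m 20 "V 16" "V 17" "den n m (OTH 25 (V 16) (V 19)) s1"] fx f1 by (simp add: s2_def y_def)
  have "(fst s3 45 0 0 = 0 \<and> (\<forall>i<m. \<not> (cr ?A ?B {y} i \<and> i \<noteq> ?e))) \<or>
      (fst s3 45 0 0 = 1 \<and> fst s3 21 0 0 < m \<and> cr ?A ?B {y} (fst s3 21 0 0) \<and> fst s3 21 0 0 \<noteq> ?e)"
    unfolding s3_def
  proof (rule SCAN_correct[where Pr = "\<lambda>i. cr ?A ?B {y} i \<and> i \<noteq> ?e"])
    fix t :: store assume fr: "\<And>j. j \<notin> {45, 40, 21, 79} \<Longrightarrow> fst t j = fst s2 j"
    show "bv n m (And (At (V 20) iv) (Ne iv (V 17))) t = (cr ?A ?B {y} (fst t 40 0 0) \<and> fst t 40 0 0 \<noteq> ?e)"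
      by (simp add: At_def cr_def level_A_def level_B_def fr f2 f1 s2y)
  qed auto
  then have s3g: "fst s3 21 0 0 \<in> {g0, h0}" using ugh by blast
  define g where "g = fst s3 21 0 0"
  obtain h where h: "{g0, h0} = {g, h}" "g \<noteq> h" using s3g gh0(2) by (auto simp: g_def)
  have "(fst s4 45 0 0 = 0 \<and> (\<forall>i<m. \<not> (cr ?A ?B {y} i \<and> i \<noteq> ?e \<and> i \<noteq> g))) \<or>
      (fst s4 45 0 0 = 1 \<and> fst s4 22 0 0 < m \<and> cr ?A ?B {y} (fst s4 22 0 0) \<and> fst s4 22 0 0 \<noteq> ?e \<and> fst s4 22 0 0 \<noteq> g)"
    unfolding s4_def
  proof (rule SCAN_correct[where Pr = "\<lambda>i. cr ?A ?B {y} i \<and> i \<noteq> ?e \<and> i \<noteq> g"])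
    fix t :: store assume fr: "\<And>j. j \<notin> {45, 40, 22, 79} \<Longrightarrow> fst t j = fst s3 j"
    show "bv n m (And (At (V 20) iv) (And (Ne iv (V 17)) (Ne iv (V 21)))) t =
       (cr ?A ?B {y} (fst t 40 0 0) \<and> fst t 40 0 0 \<noteq> ?e \<and> fst t 40 0 0 \<noteq> g)"
      by (simp add: At_def cr_def level_A_def level_B_def fr f3 f2 f1 s2y g_def)
  qed auto
  moreover have "h < m \<and> cr ?A ?B {y} h \<and> h \<noteq> ?e \<and> h \<noteq> g" using ugh[of h] h by auto
  ultimately have *: "fst s4 22 0 0 < m \<and> cr ?A ?B {y} (fst s4 22 0 0) \<and> fst s4 22 0 0 \<noteq> ?e \<and> fst s4 22 0 0 \<noteq> g"
    by blast
  then have "fst s4 22 0 0 \<in> {g0, h0}" using ugh by blast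
  then have s4h: "fst s4 22 0 0 = h" using h(1) * by blast
  have g': "g < m" "cr ?A ?B {y} g" "h < m" "cr ?A ?B {y} h" using ugh[of g] ugh[of h] h(1) by auto
  have cy: "cut m ?A ?B {y} = {?e, g, h}" using gh0(1) h(1) \<open>?e \<in> cut m ?A ?B {y}\<close> by auto
  have s4y: "fst s4 20 0 0 = y" "fst s4 21 0 0 = g" using f4 f3 s2y by (auto simp: g_def)
  have lA4: "level_A s4 = ?A" "level_B s4 = ?B" by (auto simp: level_A_def level_B_def f1 f2 f3 f4)
  have fy: "fst (den n m (OTH 23 (V 20) (V 21)) s4) q = fst s4 q" if "q \<noteq> 23" for q
    by (rule den_frame) (use that in \<open>simp add: asg_OTH\<close>)
  then have l4: "level_A (den n m (OTH 23 (V 20) (V 21)) s4) = ?A" "level_B (den n m (OTH 23 (V 20) (V 21)) s4) = ?B"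
    using lA4 by (auto simp: level_A_def level_B_def)
  have "fst s5 23 = fst (den n m (OTH 23 (V 20) (V 21)) s4) 23" unfolding s5_def by (rule den_frame) (simp add: asg_OTH)
  then have s5r: "fst s5 23 0 0 = oth ?A ?B y g" using OTH_correct[of n m 23 "V 20" "V 21" s4] lA4 s4y by simp
  have s5s: "fst s5 24 0 0 = oth ?A ?B y h"
    using OTH_correct[of n m 24 "V 20" "V 22" "den n m (OTH 23 (V 20) (V 21)) s4"] l4 fy s4y s4h by (simp add: s5_def)
  let ?sw = "\<not> oth ?A ?B y h \<in> ?S"
  have ohn: "oth ?A ?B y h < 2 * n" using ids[OF g'(3)] by (auto simp: oth_def)
  have "bv n m (Ne (rs (V 24)) (C 1)) s5 = ?sw"
    using ohn s5s by (simp add: reg_def f5 f4 f3 f2 f1)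
  then have fin': "fst s' 21 0 0 = (if ?sw then h else g)" "fst s' 22 0 0 = (if ?sw then g else h)"
    "fst s' 23 0 0 = (if ?sw then oth ?A ?B y h else oth ?A ?B y g)"
    "fst s' 24 0 0 = (if ?sw then oth ?A ?B y g else oth ?A ?B y h)"
    "fst s' 20 0 0 = y" "fst s' 25 0 0 = oth ?A ?B ?a f" "fst s' 19 0 0 = f"
    using s4y s4h s5r s5s s2p s1f unfolding s' by (auto simp: upd_def f5 f4 f3 f2)
  have jg: "joins ?A ?B g (oth ?A ?B y g) y" "joins ?A ?B g y (oth ?A ?B y g)"
     "joins ?A ?B h (oth ?A ?B y h) y" "joins ?A ?B h y (oth ?A ?B y h)"
    using joins_oth[OF g'(2)] joins_oth[OF g'(4)] joins_sym by blast+
  \<comment> \<open>If both \<open>g\<close> and \<open>h\<close> left \<open>S\<close>, there would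
    be two boundary edges at \<open>y\<close>.\<close>
  have gin: "oth ?A ?B y g \<in> ?S" if sw: ?sw
  proof (rule ccontr)
    assume "oth ?A ?B y g \<notin> ?S"
    then have "g \<in> cut m ?A ?B ?S" "h \<in> cut m ?A ?B ?S"
      using sw g' yS cr_joins[OF jg(1), of ?S] cr_joins[OF jg(3), of ?S] by (auto simp: in_cut)
    then show False using region_one_boundary_edgeD[OF R yS Sy, of g h] cy h(2) by auto
  qed
  show ?thesis unfolding prep_ok_def fin'
    using e(1) je fm(1) joins_oth[OF fm(2)] g' jg f(1) cy yS fin gin by auto
qed

section \<open>Deciding whether a tight set obstructs the deletion\<close>

definition SEARCH :: hp where
  "SEARCH = Sq (SetV 27 (C 0)) (Sq
     (If1 (And (Eq (rs (V 23)) (C 1)) (Ne (V 23) (V 16))) (Sq (SetV 26 (V 23)) FLOWZ))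
     (If1 (And (Eq (V 27) (C 0)) (And (Eq (rs (V 24)) (C 1)) (Ne (V 24) (V 16)))) (Sq (SetV 26 (V 24)) FLOWZ)))"

lemma asg_SEARCH: "asg SEARCH = {26, 40, 34, 35, 42, 32, 41, 33, 79, 47, 29, 27, 28, 30, 46, 36}"
  by (auto simp: SEARCH_def asg_FLOWZ)

text \<open>By \<open>tight_set_neighbour\<close> the two flow runs are exhaustive. A neighbour of
  \<open>y\<close> that is outside \<open>S\<close> or equal to \<open>a\<close> belongs to no
  admissible set, so its run is skipped; the second run is skipped as well once the first one has
  found a set.\<close>

lemma SEARCH_correct:
  fixes s and n m :: nat defines "s' \<equiv> den n m SEARCH s"
  assumes ids: "\<And>i. i < m \<Longrightarrow> level_A s i < 2 * n \<and> level_B s i < 2 * n" and lz: "lab_zero n s"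
    and R: "region m (level_A s) (level_B s) (reg n s)"
    and p: "prep_ok m (level_A s) (level_B s) (reg n s) x (fst s 16 0 0) e (fst s 20 0 0)
     f p' g (fst s 23 0 0) h (fst s 24 0 0)" and a: "fst s 16 0 0 \<in> reg n s"
  shows "lab_zero n s'"
    and "(fst s' 27 0 0 = 1 \<and> labset n s' \<subseteq> reg n s - {fst s 16 0 0} \<and> 2 \<le> card (labset n s') \<and>
        card (cut m (level_A s) (level_B s) (labset n s')) = 3) \<or>
      (fst s' 27 0 0 = 0 \<and> (\<forall>W\<subseteq>reg n s - {fst s 16 0 0}. fst s 20 0 0 \<in> W \<longrightarrow> 2 \<le> card W \<longrightarrow>
         card (cut m (level_A s) (level_B s) W) \<noteq> 3))"
proof -
  let ?A = "level_A s" and ?B = "level_B s" and ?S = "reg n s"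
  let ?a = "fst s 16 0 0" and ?y = "fst s 20 0 0" and ?r = "fst s 23 0 0" and ?q = "fst s 24 0 0"
  have cy: "cut m ?A ?B {?y} = {e, g, h}" and jg: "joins ?A ?B g ?r ?y" and jh: "joins ?A ?B h ?y ?q" and je: "joins ?A ?B e ?a ?y"
    and yS: "?y \<in> ?S" and qS: "?q \<in> ?S" and em: "e < m" and gm: "g < m" and hm: "h < m" using p by (auto simp: prep_ok_def)
  have e3: "e \<in> cut m ?A ?B {?y}" "g \<in> cut m ?A ?B {?y}" "h \<in> cut m ?A ?B {?y}" using cy by auto
  have ry: "?r \<noteq> ?y" "?q \<noteq> ?y" "?y \<noteq> ?a"
    using e3 cr_joins[OF jg, of "{?y}"] cr_joins[OF jh, of "{?y}"] cr_joins[OF je, of "{?y}"] by (auto simp: in_cut)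
  define good where "good z t \<longleftrightarrow> fst t 27 0 0 = 1 \<and> labset n t \<subseteq> ?S - {?a} \<and> 2 \<le> card (labset n t) \<and>
        card (cut m ?A ?B (labset n t)) = 3" for z :: nat and t
  define bad where "bad z \<longleftrightarrow> (\<forall>W\<subseteq>?S - {?a}. ?y \<in> W \<longrightarrow> z \<in> W \<longrightarrow> card (cut m ?A ?B W) \<noteq> 3)" for z
  have F: "lab_zero n t' \<and> (good z t' \<or> fst t' 27 0 0 = 0 \<and> bad z) \<and> (\<forall>q. q \<notin> asg SEARCH \<longrightarrow> fst t' q = fst s q)"
    if t: "\<forall>q. q \<notin> asg SEARCH \<longrightarrow> fst t q = fst s q" "lab_zero n t" and z: "ev n ze (fst t) = z" "z \<in> ?S - {?a}" "z \<noteq> ?y"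
      and t': "t' = den n m (Sq (SetV 26 ze) FLOWZ) t" for t t' z ze
  proof -
    define u where "u = den n m (SetV 26 ze) t"
    have fu: "fst u q = fst s q" if "q \<notin> asg SEARCH" for q
      using that t(1) by (auto simp: u_def upd_def asg_SEARCH)
    have u26: "fst u 26 0 0 = z" using z by (simp add: u_def upd_def)
    have lu: "level_A u = ?A" "level_B u = ?B" "reg n u = ?S" "fst u 16 = fst s 16" "fst u 20 = fst s 20"
      by (auto simp: level_A_def level_B_def reg_def fu asg_SEARCH)
    have "lab_zero n u" using t(2) by (simp add: lab_zero_def u_def upd_def)
    have t'': "t' = den n m FLOWZ u" by (simp add: t' u_def)
    have fr: "fst t' q = fst s q" if "q \<notin> asg SEARCH" for q
      unfolding t'' using den_frame[of q FLOWZ n m u] fu[OF that] that by (simp add: asg_FLOWZ asg_SEARCH)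
    have lt': "level_A t' = ?A" "level_B t' = ?B" "reg n t' = ?S" "fst t' 16 = fst s 16" "fst t' 20 = fst s 20"
      by (auto simp: level_A_def level_B_def reg_def fr asg_SEARCH)
    have t26: "fst t' 26 = fst u 26" unfolding t'' by (rule den_frame) (simp add: asg_FLOWZ)
    have C: "lab_zero n t'" "(fst t' 27 0 0 = 1 \<and> flow_done n m t' 3) \<or> (fst t' 27 0 0 = 0 \<and> bad z)"
      using FLOWZ_correct[of m u n] ids \<open>lab_zero n u\<close> z yS ry R lu u26 unfolding t''[symmetric] bad_def by auto
    have "good z t'" if "fst t' 27 0 0 = 1" "flow_done n m t' 3"
    proof -
      have "{?y, z} \<subseteq> labset n t'" using that lt' t26 u26 by (auto simp: flow_done_def)
      then have "card {?y, z} \<le> card (labset n t')" by (intro card_mono) (auto simp: labset_def)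
      then show ?thesis using that lt' z by (simp add: good_def flow_done_def)
    qed
    then show ?thesis using C fr by blast
  qed
  define s0 where "s0 = den n m (SetV 27 (C 0)) s"
  define s1 where "s1 = den n m (If1 (And (Eq (rs (V 23)) (C 1)) (Ne (V 23) (V 16))) (Sq (SetV 26 (V 23)) FLOWZ)) s0"
  have s': "s' = den n m (If1 (And (Eq (V 27) (C 0)) (And (Eq (rs (V 24)) (C 1)) (Ne (V 24) (V 16)))) (Sq (SetV 26 (V 24)) FLOWZ)) s1"
    by (simp add: s'_def SEARCH_def s1_def s0_def)
  have fr0: "\<forall>q. q \<notin> asg SEARCH \<longrightarrow> fst s0 q = fst s q" by (auto simp: s0_def upd_def asg_SEARCH)
  have lz0: "lab_zero n s0" using lz by (simp add: s0_def lab_zero_def upd_def)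
  have rn: "?r < 2 * n" "?q < 2 * n" using ids[OF gm] ids[OF hm] jg jh by (auto simp: joins_def)
  have b1: "bv n m (And (Eq (rs (V 23)) (C 1)) (Ne (V 23) (V 16))) s0 = (?r \<in> ?S - {?a})"
    using rn fr0 by (auto simp: reg_def asg_SEARCH)
  have 1: "lab_zero n s1 \<and> (good ?r s1 \<or> fst s1 27 0 0 = 0 \<and> bad ?r) \<and> (\<forall>q. q \<notin> asg SEARCH \<longrightarrow> fst s1 q = fst s q)"
  proof (cases "?r \<in> ?S - {?a}")
    case True
    then have "s1 = den n m (Sq (SetV 26 (V 23)) FLOWZ) s0" unfolding s1_def by (intro den_If_True) (simp only: b1)
    then show ?thesis using F[OF fr0 lz0, of "V 23" ?r s1] True ry fr0 by (auto simp: asg_SEARCH)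
  next
    case False
    then have "s1 = den n m Sk s0" unfolding s1_def by (intro den_If_False) (simp only: b1 not_False_eq_True)
    moreover have "bad ?r" using False by (auto simp: bad_def)
    ultimately show ?thesis using fr0 lz0 by (auto simp: upd_def asg_SEARCH s0_def lab_zero_def)
  qed
  have b2: "bv n m (And (Eq (V 27) (C 0)) (And (Eq (rs (V 24)) (C 1)) (Ne (V 24) (V 16)))) s1 =
      (fst s1 27 0 0 = 0 \<and> ?q \<in> ?S - {?a})"
    using rn 1 by (auto simp: reg_def asg_SEARCH)
  have badall: "\<forall>W\<subseteq>?S - {?a}. ?y \<in> W \<longrightarrow> 2 \<le> card W \<longrightarrow> card (cut m ?A ?B W) \<noteq> 3" if "bad ?r" "bad ?q"
  proof (intro allI impI)
    fix W assume W: "W \<subseteq> ?S - {?a}" "?y \<in> W" "2 \<le> card W"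
    show "card (cut m ?A ?B W) \<noteq> 3"
    proof
      assume c: "card (cut m ?A ?B W) = 3"
      have "e \<in> cut m ?A ?B W" using em W by (auto simp: in_cut cr_joins[OF je])
      then have "?r \<in> W \<or> ?q \<in> W"
        by (intro tight_set_neighbour[OF R cy _ W(2,3) c _ jg jh]) (use W in auto)
      then show False using that W c by (auto simp: bad_def)
    qed
  qed
  have "lab_zero n s' \<and> (good 0 s' \<or> fst s' 27 0 0 = 0 \<and> bad ?r \<and> bad ?q)"
  proof (cases "fst s1 27 0 0 = 0 \<and> ?q \<in> ?S - {?a}")
    case True
    then have "s' = den n m (Sq (SetV 26 (V 24)) FLOWZ) s1" unfolding s' by (intro den_If_True) (simp only: b2)
    then show ?thesis using F[of s1 "V 24" ?q s'] 1 True ry by (auto simp: asg_SEARCH good_def)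
  next
    case False
    then have e': "s' = den n m Sk s1" unfolding s' by (intro den_If_False) (simp only: b2 not_False_eq_True)
    have "labset n s' = labset n s1" "fst s' 27 = fst s1 27" "fst s' 32 = fst s1 32" using e' by (auto simp: labset_def upd_def)
    moreover have "bad ?q" if "?q \<notin> ?S - {?a}" using that by (auto simp: bad_def)
    ultimately show ?thesis using 1 False by (auto simp: good_def lab_zero_def)
  qed
  then show "lab_zero n s'" "(fst s' 27 0 0 = 1 \<and> labset n s' \<subseteq> ?S - {?a} \<and> 2 \<le> card (labset n s') \<and>
        card (cut m ?A ?B (labset n s')) = 3) \<or>
      (fst s' 27 0 0 = 0 \<and> (\<forall>W\<subseteq>?S - {?a}. ?y \<in> W \<longrightarrow> 2 \<le> card W \<longrightarrow> card (cut m ?A ?B W) \<noteq> 3))"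
    using badall by (auto simp: good_def)
qed

section \<open>The stack of reductions\<close>

text \<open>In \<open>inv\<close>, \<open>Vs j\<close> is the vertex set at level \<open>j\<close>; the contraction at level \<open>j\<close> creates vertex \<open>n + j\<close>.\<close>

definition wset :: "nat \<Rightarrow> store \<Rightarrow> nat \<Rightarrow> nat set" where
  "wset n s j = {v. v < 2 * n \<and> fst s 3 j v = 1}"

text \<open>Undoing a deletion reads only the edge names and \<open>r\<close>, so only these are
  stored; the other vertices of the configuration are recovered by the existential.\<close>

definition del_op :: "nat \<Rightarrow> store \<Rightarrow> (nat \<Rightarrow> nat set) \<Rightarrow> nat \<Rightarrow> bool" where
  "del_op m s Vs j \<longleftrightarrow> (\<exists>S a b0 y p q. deletion m (fst s 0 j) (fst s 1 j) (fst s 0 (Suc j)) (fst s 1 (Suc j)) S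
     (fst s 5 0 j) a b0 (fst s 6 0 j) y (fst s 7 0 j) p (fst s 8 0 j) (fst s 10 0 j) (fst s 9 0 j) q \<and>
     a \<in> Vs j \<and> y \<in> Vs j \<and> Vs (Suc j) = Vs j - {a, y} \<and> fst s 31 0 (fst s 5 0 j) \<in> {2, 3})"

definition con_op :: "nat \<Rightarrow> nat \<Rightarrow> store \<Rightarrow> (nat \<Rightarrow> nat set) \<Rightarrow> nat \<Rightarrow> bool" where
  "con_op n m s Vs j \<longleftrightarrow> region m (fst s 0 j) (fst s 1 j) (wset n s j) \<and> wset n s j \<subset> Vs j \<and> 2 \<le> card (wset n s j) \<and>
     (\<forall>i<m. fst s 0 (Suc j) i = (if fst s 0 j i \<in> wset n s j then n + j else fst s 0 j i) \<and>
        fst s 1 (Suc j) i = (if fst s 1 j i \<in> wset n s j then n + j else fst s 1 j i)) \<and>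
     Vs (Suc j) = insert (n + j) (Vs j - wset n s j)"

text \<open>A deletion removes two vertices and a contraction replaces at least two by one, which
  gives \<open>card (Vs j) + j \<le> n\<close>. So there are fewer than \<open>n\<close> levels
  above the first, and the new names \<open>n + j\<close> stay below \<open>2 * n\<close>.\<close>

definition lev_ok :: "nat \<Rightarrow> nat \<Rightarrow> store \<Rightarrow> (nat \<Rightarrow> nat set) \<Rightarrow> nat \<Rightarrow> bool" where
  "lev_ok n m s Vs j \<longleftrightarrow> ends_in m (fst s 0 j) (fst s 1 j) (Vs j) \<and> Vs j \<subseteq> {..<n + j} \<and> card (Vs j) + j \<le> n \<and>
     (\<forall>i<m. fst s 0 j i < n + j \<and> fst s 1 j i < n + j)"

definition cur_ok :: "nat \<Rightarrow> nat \<Rightarrow> store \<Rightarrow> (nat \<Rightarrow> nat set) \<Rightarrow> bool" where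
  "cur_ok n m s Vs \<longleftrightarrow> (let V = Vs (fst s 11 0 0) in if fst s 13 0 0 = 0
     then region m (level_A s) (level_B s) (reg n s) \<and> reg n s \<subseteq> V \<and>
       fst s 15 0 0 \<in> cut m (level_A s) (level_B s) (reg n s) \<and> fst s 31 0 (fst s 15 0 0) \<in> {2, 3} \<and>
       valid m (level_A s) (level_B s) (fst s 31 0) V (reg n s)
     else \<exists>t\<in>V. valid m (level_A s) (level_B s) (fst s 31 0) V {t})"

text \<open>The protected edge of a pending deletion must keep class 2 or 3; it does because it never lies inside a set that is reduced later.\<close>

definition prot :: "nat \<Rightarrow> store \<Rightarrow> bool" where
  "prot n s \<longleftrightarrow> (\<forall>i<fst s 11 0 0. fst s 4 0 i = 1 \<longrightarrow>
     (fst s 13 0 0 = 0 \<longrightarrow> \<not> (level_A s (fst s 5 0 i) \<in> reg n s \<and> level_B s (fst s 5 0 i) \<in> reg n s)) \<and>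
     (\<forall>j<fst s 11 0 0. i < j \<longrightarrow> (fst s 4 0 j = 1 \<longrightarrow> fst s 5 0 i \<notin> {fst s 6 0 j, fst s 7 0 j, fst s 9 0 j}) \<and>
       (fst s 4 0 j = 2 \<longrightarrow> \<not> (fst s 0 j (fst s 5 0 i) \<in> wset n s j \<and> fst s 1 j (fst s 5 0 i) \<in> wset n s j))))"

definition inv :: "nat \<Rightarrow> nat \<Rightarrow> (nat \<Rightarrow> nat) \<Rightarrow> (nat \<Rightarrow> nat) \<Rightarrow> store \<Rightarrow> (nat \<Rightarrow> nat set) \<Rightarrow> bool" where
  "inv n m A0 B0 s Vs \<longleftrightarrow> (\<forall>i<m. fst s 0 0 i = A0 i \<and> fst s 1 0 i = B0 i) \<and> fst s 12 0 0 = n + fst s 11 0 0 \<and>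
     lab_zero n s \<and> (\<forall>i<m. fst s 31 0 i \<le> 3) \<and> Vs 0 = {..<n} \<and> 1 \<le> n \<and>
     (\<forall>j\<le>fst s 11 0 0. lev_ok n m s Vs j) \<and>
     (\<forall>j<fst s 11 0 0. fst s 4 0 j = 1 \<and> del_op m s Vs j \<or> fst s 4 0 j = 2 \<and> con_op n m s Vs j) \<and>
     cur_ok n m s Vs \<and> prot n s \<and> (fst s 14 0 0 = 0 \<or> fst s 14 0 0 = 1 \<and> fst s 11 0 0 = 0 \<and> fst s 13 0 0 = 1)"

text \<open>Reducing a set of \<open>k\<close> vertices takes at most \<open>2 k - 4\<close> steps.\<close>

definition mu :: "nat \<Rightarrow> store \<Rightarrow> nat" where
  "mu n s = (if fst s 13 0 0 = 0 then 2 * card (reg n s) - 4 else 0) +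
     (\<Sum>j<fst s 11 0 0. if fst s 4 0 j = 1 then 1 else 2 * card (wset n s j) - 4 + 1)"

text \<open>The arrays listed here are all that the invariant reads apart from the labels; hence
  preparation and search, which work on other arrays, preserve it.\<close>

lemma inv_cong:
  assumes "inv n m A0 B0 s Vs" "\<And>q. q \<in> {0..15} \<union> {31} \<Longrightarrow> fst t q = fst s q" "lab_zero n t"
  shows "inv n m A0 B0 t Vs" "mu n t = mu n s"
proof -
  have e: "fst t 0 = fst s 0" "fst t 1 = fst s 1" "fst t 2 = fst s 2" "fst t 3 = fst s 3" "fst t 4 = fst s 4" "fst t 5 = fst s 5"
    "fst t 6 = fst s 6" "fst t 7 = fst s 7" "fst t 8 = fst s 8" "fst t 9 = fst s 9" "fst t 10 = fst s 10" "fst t 11 = fst s 11"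
    "fst t 12 = fst s 12" "fst t 13 = fst s 13" "fst t 14 = fst s 14" "fst t 15 = fst s 15" "fst t 31 = fst s 31"
    by (auto intro!: assms(2))
  show "inv n m A0 B0 t Vs" using assms(1,3)
    unfolding inv_def lev_ok_def del_op_def con_op_def cur_ok_def prot_def wset_def level_A_def level_B_def reg_def e by simp
  show "mu n t = mu n s" unfolding mu_def reg_def wset_def e by simp
qed

lemma inv_bound:
  assumes "inv n m A0 B0 s Vs"
  shows "fst s 11 0 0 < n" "\<And>i. i < m \<Longrightarrow> level_A s i < 2 * n \<and> level_B s i < 2 * n" "finite (Vs (fst s 11 0 0))"
    "\<And>i. i < m \<Longrightarrow> level_A s i < n + fst s 11 0 0 \<and> level_B s i < n + fst s 11 0 0" "Vs (fst s 11 0 0) \<subseteq> {..<n + fst s 11 0 0}"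
proof -
  let ?k = "fst s 11 0 0"
  have l: "lev_ok n m s Vs ?k" using assms by (auto simp: inv_def)
  show fin: "finite (Vs ?k)" using l finite_subset[of "Vs ?k" "{..<n + ?k}"] by (auto simp: lev_ok_def)
  have "Vs ?k \<noteq> {}" using assms unfolding inv_def cur_ok_def region_def by (auto simp: Let_def split: if_splits)
  then have "0 < card (Vs ?k)" using fin by (simp add: card_gt_0_iff)
  then show k: "?k < n" using l by (auto simp: lev_ok_def)
  show "level_A s i < n + ?k \<and> level_B s i < n + ?k" if "i < m" for i
    using l that by (auto simp: lev_ok_def level_A_def level_B_def)
  then show "level_A s i < 2 * n \<and> level_B s i < 2 * n" if "i < m" for i
    using that k by (metis add_strict_left_mono less_trans mult_2)
  show "Vs ?k \<subseteq> {..<n + ?k}" using l by (simp add: lev_ok_def)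
qed

section \<open>Pushing a deletion\<close>

definition COPY :: hp where
  "COPY = Sq (For 40 LM (Set 0 (Inc (V 11)) iv (ga iv))) (Sq (For 40 LM (Set 1 (Inc (V 11)) iv (gb iv)))
     (For 42 (LN 2) (Set 2 (Inc (V 11)) vv (rs vv))))"

text \<open>The common end 0 is arbitrary: neither cuts nor \<open>ends_in\<close> look at loops, so
  it does not matter whether 0 is still a vertex.\<close>

definition KILL :: "he \<Rightarrow> hp" where
  "KILL i = Sq (Set 0 (Inc (V 11)) i (C 0)) (Set 1 (Inc (V 11)) i (C 0))"

definition MOVE :: "he \<Rightarrow> he \<Rightarrow> he \<Rightarrow> hp" where
  "MOVE i u v = If (Eq (ga i) u) (Set 0 (Inc (V 11)) i v) (Set 1 (Inc (V 11)) i v)"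

definition DEL :: hp where
  "DEL = Sq COPY (Sq (KILL (V 17)) (Sq (KILL (V 19)) (Sq (KILL (V 22)) (Sq (MOVE (V 15) (V 16) (V 25))
     (Sq (MOVE (V 21) (V 20) (V 24)) (Sq (Set 2 (Inc (V 11)) (V 16) (C 0)) (Sq (Set 2 (Inc (V 11)) (V 20) (C 0))
     (Sq (Set1 4 (V 11) (C 1)) (Sq (Set1 5 (V 11) (V 15)) (Sq (Set1 6 (V 11) (V 17)) (Sq (Set1 7 (V 11) (V 19))
     (Sq (Set1 8 (V 11) (V 21)) (Sq (Set1 9 (V 11) (V 22)) (Sq (Set1 10 (V 11) (V 23))
     (Sq (SetV 12 (Inc (V 12))) (SetV 11 (Inc (V 11))))))))))))))))))"

lemma asg_DEL: "asg DEL = {40, 42, 0, 1, 2, 4, 5, 6, 7, 8, 9, 10, 11, 12}"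
  by (auto simp: DEL_def COPY_def KILL_def MOVE_def)

lemma COPY_correct:
  fixes s and n m :: nat defines "s' \<equiv> den n m COPY s" and "k \<equiv> fst s 11 0 0"
  shows "fst s' 0 r c = (if r = Suc k \<and> c < m then fst s 0 k c else fst s 0 r c)"
    "fst s' 1 r c = (if r = Suc k \<and> c < m then fst s 1 k c else fst s 1 r c)"
    "fst s' 2 r c = (if r = Suc k \<and> c < 2 * n then fst s 2 k c else fst s 2 r c)"
    "q \<notin> {0, 1, 2, 40, 42} \<Longrightarrow> fst s' q = fst s q"
proof -
  let ?p0 = "For 40 LM (Set 0 (Inc (V 11)) iv (ga iv))" and ?p1 = "For 40 LM (Set 1 (Inc (V 11)) iv (gb iv))"
    and ?p2 = "For 42 (LN 2) (Set 2 (Inc (V 11)) vv (rs vv))"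
  define s1 where "s1 = den n m ?p0 s"
  define s2 where "s2 = den n m ?p1 s1"
  have s': "s' = den n m ?p2 s2" by (simp add: s'_def COPY_def s1_def s2_def)
  have f1: "fst s1 q = fst s q" if "q \<notin> {0, 40}" for q unfolding s1_def by (rule den_frame) (use that in auto)
  have f2: "fst s2 q = fst s1 q" if "q \<notin> {1, 40}" for q unfolding s2_def by (rule den_frame) (use that in auto)
  have f3: "fst s' q = fst s2 q" if "q \<notin> {2, 42}" for q unfolding s' by (rule den_frame) (use that in auto)
  have "fst s1 0 r c = (if r = Suc k \<and> c < m then fst s 0 k c else fst s 0 r c)"
    unfolding s1_def by (rule fill[where F = "fst s 0 k" and R = "Suc k"]) (auto simp: upd_def k_def)
  then show "fst s' 0 r c = (if r = Suc k \<and> c < m then fst s 0 k c else fst s 0 r c)" using f2 f3 by auto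
  have "fst s2 1 r c = (if r = Suc k \<and> c < m then fst s1 1 k c else fst s1 1 r c)"
    unfolding s2_def by (rule fill[where F = "fst s1 1 k" and R = "Suc k"]) (auto simp: upd_def k_def f1)
  then show "fst s' 1 r c = (if r = Suc k \<and> c < m then fst s 1 k c else fst s 1 r c)" using f1 f3 by auto
  have "fst s' 2 r c = (if r = Suc k \<and> c < 2 * n then fst s2 2 k c else fst s2 2 r c)"
    unfolding s' by (rule fill[where F = "fst s2 2 k" and R = "Suc k"]) (auto simp: upd_def k_def f1 f2)
  then show "fst s' 2 r c = (if r = Suc k \<and> c < 2 * n then fst s 2 k c else fst s 2 r c)" using f1 f2 by auto
  show "fst s' q = fst s q" if "q \<notin> {0, 1, 2, 40, 42}" using that f1 f2 f3 by auto
qed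

lemma DEL_effect:
  fixes s and n m :: nat defines "s' \<equiv> den n m DEL s" and "k \<equiv> fst s 11 0 0"
  defines "x \<equiv> fst s 15 0 0" and "a \<equiv> fst s 16 0 0" and "e \<equiv> fst s 17 0 0" and "f \<equiv> fst s 19 0 0" and "y \<equiv> fst s 20 0 0"
    and "g \<equiv> fst s 21 0 0" and "h \<equiv> fst s 22 0 0" and "r \<equiv> fst s 23 0 0" and "q \<equiv> fst s 24 0 0" and "p \<equiv> fst s 25 0 0"
  assumes d: "distinct [x, e, f, g, h]"
  shows "\<And>j. j \<noteq> Suc k \<Longrightarrow> fst s' 0 j = fst s 0 j \<and> fst s' 1 j = fst s 1 j"
    and "\<And>i. i < m \<Longrightarrow> fst s' 0 (Suc k) i = (if i \<in> {e, f, h} then 0 else if i = x \<and> fst s 0 k x = a then p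
      else if i = g \<and> fst s 0 k g = y then q else fst s 0 k i)"
    and "\<And>i. i < m \<Longrightarrow> fst s' 1 (Suc k) i = (if i \<in> {e, f, h} then 0 else if i = x \<and> fst s 0 k x \<noteq> a then p
      else if i = g \<and> fst s 0 k g \<noteq> y then q else fst s 1 k i)"
    and "\<And>v. v < 2 * n \<Longrightarrow> fst s' 2 (Suc k) v = (if v = a \<or> v = y then 0 else fst s 2 k v)"
    and "fst s' 4 0 = (fst s 4 0)(k := 1)" "fst s' 5 0 = (fst s 5 0)(k := x)" "fst s' 6 0 = (fst s 6 0)(k := e)"
      "fst s' 7 0 = (fst s 7 0)(k := f)" "fst s' 8 0 = (fst s 8 0)(k := g)" "fst s' 9 0 = (fst s 9 0)(k := h)"
      "fst s' 10 0 = (fst s 10 0)(k := r)" "fst s' 11 0 0 = Suc k" "fst s' 12 0 0 = Suc (fst s 12 0 0)"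
    and "\<And>j. j \<notin> {40, 42, 0, 1, 2, 4, 5, 6, 7, 8, 9, 10, 11, 12} \<Longrightarrow> fst s' j = fst s j"
proof -
  define s1 where "s1 = den n m COPY s"
  note c = COPY_correct[where s = s and n = n and m = m, folded s1_def k_def]
  have nm: "fst s1 11 = fst s 11" "fst s1 15 = fst s 15" "fst s1 16 = fst s 16" "fst s1 17 = fst s 17" "fst s1 19 = fst s 19"
    "fst s1 20 = fst s 20" "fst s1 21 = fst s 21" "fst s1 22 = fst s 22" "fst s1 23 = fst s 23" "fst s1 24 = fst s 24"
    "fst s1 25 = fst s 25" "fst s1 12 = fst s 12" "fst s1 4 = fst s 4" "fst s1 5 = fst s 5" "fst s1 6 = fst s 6" "fst s1 7 = fst s 7"
    "fst s1 8 = fst s 8" "fst s1 9 = fst s 9" "fst s1 10 = fst s 10" using c(4) by auto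
  have k: "fst s 11 0 0 = k" "fst s 15 0 0 = x" "fst s 16 0 0 = a" "fst s 17 0 0 = e" "fst s 19 0 0 = f" "fst s 20 0 0 = y"
    "fst s 21 0 0 = g" "fst s 22 0 0 = h" "fst s 23 0 0 = r" "fst s 24 0 0 = q" "fst s 25 0 0 = p"
    by (simp_all add: k_def x_def a_def e_def f_def y_def g_def h_def r_def q_def p_def)
  let ?p = "Sq (KILL (V 17)) (Sq (KILL (V 19)) (Sq (KILL (V 22)) (Sq (MOVE (V 15) (V 16) (V 25))
     (Sq (MOVE (V 21) (V 20) (V 24)) (Sq (Set 2 (Inc (V 11)) (V 16) (C 0)) (Set 2 (Inc (V 11)) (V 20) (C 0)))))))"
  define s2 where "s2 = den n m ?p s1"
  have k0: "fst s1 0 k = fst s 0 k" using c(1)[of k] by auto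
  have s2: "fst s2 = upd 2 (Suc k) y 0 (upd 2 (Suc k) a 0 (
      (if fst s 0 k g = y then upd 0 (Suc k) g q else upd 1 (Suc k) g q) (
      (if fst s 0 k x = a then upd 0 (Suc k) x p else upd 1 (Suc k) x p) (
      upd 1 (Suc k) h 0 (upd 0 (Suc k) h 0 (upd 1 (Suc k) f 0 (upd 0 (Suc k) f 0 (
      upd 1 (Suc k) e 0 (upd 0 (Suc k) e 0 (fst s1))))))))))"
  proof -
    define t1 where "t1 = den n m (Sq (KILL (V 17)) (Sq (KILL (V 19)) (KILL (V 22)))) s1"
    have t1: "fst t1 = upd 1 (Suc k) h 0 (upd 0 (Suc k) h 0 (upd 1 (Suc k) f 0 (upd 0 (Suc k) f 0 (
        upd 1 (Suc k) e 0 (upd 0 (Suc k) e 0 (fst s1))))))"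
      unfolding t1_def KILL_def by (simp add: upd_apply nm k)
    have o: "fst t1 j = fst s1 j" if "j > 2" for j using that unfolding t1 by (auto simp: upd_def)
    have k1: "fst t1 11 0 0 = k" "fst t1 15 0 0 = x" "fst t1 16 0 0 = a" "fst t1 20 0 0 = y" "fst t1 21 0 0 = g" "fst t1 24 0 0 = q"
      "fst t1 25 0 0 = p" using o nm k by simp_all
    have k2: "fst t1 0 k = fst s 0 k" using k0 unfolding t1 by (simp add: upd_def)
    define t2 where "t2 = den n m (MOVE (V 15) (V 16) (V 25)) t1"
    have t2: "fst t2 = (if fst s 0 k x = a then upd 0 (Suc k) x p else upd 1 (Suc k) x p) (fst t1)"
      unfolding t2_def MOVE_def by (simp add: k1 k2)
    have o2: "fst t2 j = fst t1 j" if "j > 2" for j using that unfolding t2 by (auto simp: upd_def)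
    have k3: "fst t2 11 0 0 = k" "fst t2 16 0 0 = a" "fst t2 20 0 0 = y" "fst t2 21 0 0 = g" "fst t2 24 0 0 = q"
      using o2 k1 by simp_all
    have k4: "fst t2 0 k = fst s 0 k" using k2 unfolding t2 by (auto simp: upd_def)
    define t3 where "t3 = den n m (MOVE (V 21) (V 20) (V 24)) t2"
    have t3: "fst t3 = (if fst s 0 k g = y then upd 0 (Suc k) g q else upd 1 (Suc k) g q) (fst t2)"
      unfolding t3_def MOVE_def by (simp add: k3 k4)
    have o3: "fst t3 j = fst t2 j" if "j > 2" for j using that unfolding t3 by (auto simp: upd_def)
    have k5: "fst t3 11 0 0 = k" "fst t3 16 0 0 = a" "fst t3 20 0 0 = y" using o3 k3 by simp_all
    have "s2 = den n m (Sq (Set 2 (Inc (V 11)) (V 16) (C 0)) (Set 2 (Inc (V 11)) (V 20) (C 0))) t3"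
      unfolding s2_def t3_def t2_def t1_def by (simp only: den.simps(5))
    then have "fst s2 = upd 2 (Suc k) y 0 (upd 2 (Suc k) a 0 (fst t3))" by (simp add: k5 upd_apply)
    then show ?thesis unfolding t3 t2 t1 .
  qed
  have s': "s' = den n m (Sq (Set1 4 (V 11) (C 1)) (Sq (Set1 5 (V 11) (V 15)) (Sq (Set1 6 (V 11) (V 17)) (Sq (Set1 7 (V 11) (V 19))
     (Sq (Set1 8 (V 11) (V 21)) (Sq (Set1 9 (V 11) (V 22)) (Sq (Set1 10 (V 11) (V 23))
     (Sq (SetV 12 (Inc (V 12))) (SetV 11 (Inc (V 11))))))))))) s2"
    unfolding s'_def DEL_def s2_def s1_def by (simp only: den.simps(5))
  have o: "fst s2 j = fst s1 j" if "j > 2" for j using that unfolding s2 by (auto simp: upd_def)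
  have nm2: "fst s2 11 0 0 = k" "fst s2 15 0 0 = x" "fst s2 17 0 0 = e" "fst s2 19 0 0 = f"
    "fst s2 21 0 0 = g" "fst s2 22 0 0 = h" "fst s2 23 0 0 = r" using o nm k by simp_all
  define u0 where "u0 = den n m (Set1 4 (V 11) (C 1)) s2"
  have u0: "fst u0 = upd 4 0 k 1 (fst s2)" unfolding u0_def by (simp add: upd_apply nm2)
  define u1 where "u1 = den n m (Set1 5 (V 11) (V 15)) u0"
  have u1: "fst u1 = upd 5 0 k x (upd 4 0 k 1 (fst s2))" unfolding u1_def by (simp add: upd_apply nm2 u0)
  define u2 where "u2 = den n m (Set1 6 (V 11) (V 17)) u1"
  have u2: "fst u2 = upd 6 0 k e (upd 5 0 k x (upd 4 0 k 1 (fst s2)))" unfolding u2_def by (simp add: upd_apply nm2 u1)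
  define u3 where "u3 = den n m (Set1 7 (V 11) (V 19)) u2"
  have u3: "fst u3 = upd 7 0 k f (upd 6 0 k e (upd 5 0 k x (upd 4 0 k 1 (fst s2))))" unfolding u3_def by (simp add: upd_apply nm2 u2)
  define u4 where "u4 = den n m (Set1 8 (V 11) (V 21)) u3"
  have u4: "fst u4 = upd 8 0 k g (upd 7 0 k f (upd 6 0 k e (upd 5 0 k x (upd 4 0 k 1 (fst s2)))))" unfolding u4_def by (simp add: upd_apply nm2 u3)
  define u5 where "u5 = den n m (Set1 9 (V 11) (V 22)) u4"
  have u5: "fst u5 = upd 9 0 k h (upd 8 0 k g (upd 7 0 k f (upd 6 0 k e (upd 5 0 k x (upd 4 0 k 1 (fst s2))))))" unfolding u5_def by (simp add: upd_apply nm2 u4)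
  define u6 where "u6 = den n m (Set1 10 (V 11) (V 23)) u5"
  have u6: "fst u6 = upd 10 0 k r (upd 9 0 k h (upd 8 0 k g (upd 7 0 k f (upd 6 0 k e (upd 5 0 k x (upd 4 0 k 1 (fst s2)))))))" unfolding u6_def by (simp add: upd_apply nm2 u5)
  have s'u: "s' = den n m (Sq (SetV 12 (Inc (V 12))) (SetV 11 (Inc (V 11)))) u6"
    unfolding s' u6_def u5_def u4_def u3_def u2_def u1_def u0_def by (simp only: den.simps(5))
  have fs': "fst s' = upd 11 0 0 (Suc k) (upd 12 0 0 (Suc (fst s 12 0 0)) (fst u6))"
    unfolding s'u using nm2 o nm by (simp add: u6 upd_apply)
  have s'012: "fst s' 0 = fst s2 0" "fst s' 1 = fst s2 1" "fst s' 2 = fst s2 2" unfolding fs' u6 by (simp_all add: upd_def)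
  show "\<And>j. j \<noteq> Suc k \<Longrightarrow> fst s' 0 j = fst s 0 j \<and> fst s' 1 j = fst s 1 j"
    unfolding s'012 s2 using c(1,2) by (auto simp: upd_def fun_eq_iff)
  show "fst s' 0 (Suc k) i = (if i \<in> {e, f, h} then 0 else if i = x \<and> fst s 0 k x = a then p
      else if i = g \<and> fst s 0 k g = y then q else fst s 0 k i)" if "i < m" for i
    unfolding s'012 s2 using d that c(1)[of "Suc k" i] by (auto simp: upd_apply)
  show "fst s' 1 (Suc k) i = (if i \<in> {e, f, h} then 0 else if i = x \<and> fst s 0 k x \<noteq> a then p
      else if i = g \<and> fst s 0 k g \<noteq> y then q else fst s 1 k i)" if "i < m" for i
    unfolding s'012 s2 using d that c(2)[of "Suc k" i] by (auto simp: upd_apply)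
  show "fst s' 2 (Suc k) v = (if v = a \<or> v = y then 0 else fst s 2 k v)" if "v < 2 * n" for v
    unfolding s'012 s2 using that c(3)[of "Suc k" v] by (auto simp: upd_apply)
  show "fst s' 4 0 = (fst s 4 0)(k := 1)" "fst s' 5 0 = (fst s 5 0)(k := x)" "fst s' 6 0 = (fst s 6 0)(k := e)"
      "fst s' 7 0 = (fst s 7 0)(k := f)" "fst s' 8 0 = (fst s 8 0)(k := g)" "fst s' 9 0 = (fst s 9 0)(k := h)"
      "fst s' 10 0 = (fst s 10 0)(k := r)" "fst s' 11 0 0 = Suc k" "fst s' 12 0 0 = Suc (fst s 12 0 0)"
    unfolding fs' u6 using nm2 o nm by (simp_all add: upd_def)
  show "\<And>j. j \<notin> {40, 42, 0, 1, 2, 4, 5, 6, 7, 8, 9, 10, 11, 12} \<Longrightarrow> fst s' j = fst s j"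
    unfolding s'_def by (rule den_frame) (simp add: asg_DEL)
qed

lemma del_op_cong:
  assumes "fst t 0 j = fst s 0 j" "fst t 1 j = fst s 1 j" "fst t 0 (Suc j) = fst s 0 (Suc j)" "fst t 1 (Suc j) = fst s 1 (Suc j)"
    "fst t 5 0 j = fst s 5 0 j" "fst t 6 0 j = fst s 6 0 j" "fst t 7 0 j = fst s 7 0 j" "fst t 8 0 j = fst s 8 0 j"
    "fst t 9 0 j = fst s 9 0 j" "fst t 10 0 j = fst s 10 0 j" "fst s 31 0 (fst s 5 0 j) \<in> {2, 3} \<Longrightarrow> fst t 31 0 (fst s 5 0 j) \<in> {2, 3}"
    "Vs' j = Vs j" "Vs' (Suc j) = Vs (Suc j)" "del_op m s Vs j"
  shows "del_op m t Vs' j"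
proof -
  from assms(14)[unfolded del_op_def] obtain S a b0 y p q where
    d: "deletion m (fst s 0 j) (fst s 1 j) (fst s 0 (Suc j)) (fst s 1 (Suc j)) S
     (fst s 5 0 j) a b0 (fst s 6 0 j) y (fst s 7 0 j) p (fst s 8 0 j) (fst s 10 0 j) (fst s 9 0 j) q"
    and V: "a \<in> Vs j" "y \<in> Vs j" "Vs (Suc j) = Vs j - {a, y}" and c: "fst s 31 0 (fst s 5 0 j) \<in> {2, 3}"
    by (elim exE conjE) (rule that)
  show ?thesis unfolding del_op_def assms(1-10,12,13) by (intro exI conjI) (rule d V assms(11)[OF c])+
qed

lemma con_op_cong:
  assumes "fst t 0 j = fst s 0 j" "fst t 1 j = fst s 1 j" "fst t 0 (Suc j) = fst s 0 (Suc j)" "fst t 1 (Suc j) = fst s 1 (Suc j)"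
    "fst t 3 j = fst s 3 j" "Vs' j = Vs j" "Vs' (Suc j) = Vs (Suc j)" "con_op n m s Vs j"
  shows "con_op n m t Vs' j"
  using assms(8) unfolding con_op_def wset_def assms(1-7) .

lemma lev_ok_cong:
  assumes "fst t 0 j = fst s 0 j" "fst t 1 j = fst s 1 j" "Vs' j = Vs j" "lev_ok n m s Vs j"
  shows "lev_ok n m t Vs' j"
  using assms(4) unfolding lev_ok_def assms(1-3) .

lemma DEL_correct:
  fixes s and n m :: nat defines "s' \<equiv> den n m DEL s"
  assumes I: "inv n m A0 B0 s Vs" and mo: "fst s 13 0 0 = 0" and dn: "fst s 14 0 0 = 0"
    and a: "fst s 16 0 0 \<in> reg n s" "joins (level_A s) (level_B s) (fst s 15 0 0) b0 (fst s 16 0 0)" "b0 \<notin> reg n s"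
    and p: "prep_ok m (level_A s) (level_B s) (reg n s) (fst s 15 0 0) (fst s 16 0 0) (fst s 17 0 0) (fst s 20 0 0)
     (fst s 19 0 0) (fst s 25 0 0) (fst s 21 0 0) (fst s 23 0 0) (fst s 22 0 0) (fst s 24 0 0)"
    and noW: "\<forall>W\<subseteq>reg n s - {fst s 16 0 0}. fst s 20 0 0 \<in> W \<longrightarrow> 2 \<le> card W \<longrightarrow> card (cut m (level_A s) (level_B s) W) \<noteq> 3"
  shows "\<exists>Vs'. inv n m A0 B0 s' Vs'" "mu n s' < mu n s"
proof -
  define k where "k = fst s 11 0 0"
  define x where "x = fst s 15 0 0"
  define a' where "a' = fst s 16 0 0"
  define e where "e = fst s 17 0 0"
  define f where "f = fst s 19 0 0"
  define y where "y = fst s 20 0 0"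
  define g where "g = fst s 21 0 0"
  define h where "h = fst s 22 0 0"
  define r where "r = fst s 23 0 0"
  define q where "q = fst s 24 0 0"
  define p' where "p' = fst s 25 0 0"
  define S where "S = reg n s"
  define A where "A = level_A s"
  define B where "B = level_B s"
  have lv: "A = fst s 0 k" "B = fst s 1 k" by (auto simp: A_def B_def level_A_def level_B_def k_def)
  note nms = k_def[symmetric] x_def[symmetric] a'_def[symmetric] e_def[symmetric] f_def[symmetric] y_def[symmetric] g_def[symmetric]
    h_def[symmetric] r_def[symmetric] q_def[symmetric] p'_def[symmetric] S_def[symmetric] A_def[symmetric] B_def[symmetric]
  have R: "region m A B S" and SV: "S \<subseteq> Vs k" and xc: "x \<in> cut m A B S" and cx: "fst s 31 0 x \<in> {2, 3}"
    and val: "valid m A B (fst s 31 0) (Vs k) S"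
    using I mo unfolding inv_def cur_ok_def Let_def nms by auto
  note b = inv_bound[OF I, unfolded nms]
  have xm: "x < m" using xc by (simp add: in_cut)
  have D0: "deletable m A B S x a' b0 e y f p' g r h q"
    using p a R xm unfolding prep_ok_def deletable_def nms by blast
  then interpret D0: deletable m A B S x a' b0 e y f p' g r h q .
  note ef = DEL_effect[where s = s and n = n and m = m, unfolded nms, folded s'_def, OF D0.distinct_edges(1)]
  let ?A = "fst s' 0 (Suc k)" and ?B = "fst s' 1 (Suc k)"
  have jx: "A x = a' \<and> B x = b0 \<or> A x = b0 \<and> B x = a'" "A g = y \<and> B g = r \<or> A g = r \<and> B g = y"
    using D0.x(2) D0.g(2) unfolding joins_def by auto
  have D: "deletion m A B ?A ?B S x a' b0 e y f p' g r h q"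
  proof (intro deletion.intro deletion_axioms.intro D0)
    note dd = D0.distinct_edges(1) D0.distinct_vertices
    show "joins ?A ?B x b0 p'" using ef(2)[OF xm] ef(3)[OF xm] jx dd unfolding joins_def lv by auto
    show "joins ?A ?B g r q" using ef(2)[OF D0.g(1)] ef(3)[OF D0.g(1)] jx dd unfolding joins_def lv by auto
    show "?A e = ?B e" "?A f = ?B f" "?A h = ?B h"
      using ef(2,3)[OF D0.e(1)] ef(2,3)[OF D0.f(1)] ef(2,3)[OF D0.h(1)] by simp_all
    show "?A i = A i \<and> ?B i = B i" if "i < m" "i \<notin> {x, e, f, g, h}" for i
      using ef(2)[OF that(1)] ef(3)[OF that(1)] that(2) unfolding lv by auto
  qed
  then interpret D: deletion m A B ?A ?B S x a' b0 e y f p' g r h q .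
  have fr: "fst s' j = fst s j" if "j \<in> {3, 13, 14, 15, 31, 32}" for j using ef(14) that by auto
  have k': "fst s' 11 0 0 = Suc k" by (rule ef(12))
  have reg': "reg n s' = S - {a', y}" unfolding reg_def k' S_def k_def[symmetric] using ef(4) by (auto split: if_splits)
  have lv': "level_A s' = ?A" "level_B s' = ?B" by (simp_all add: level_A_def level_B_def k')
  define Vs' where "Vs' = Vs(Suc k := Vs k - {a', y})"
  have V': "Vs' j = Vs j" if "j \<le> k" for j using that by (auto simp: Vs'_def)
  have lk: "lev_ok n m s Vs k" using I by (simp add: inv_def k_def)
  have aV: "a' \<in> Vs k" "y \<in> Vs k" using SV D0.inS by auto
  have R': "region m ?A ?B (S - {a', y})"
    by (rule D.region_after_deletion) (use noW in \<open>unfold nms, blast\<close>)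
  have lev: "lev_ok n m s' Vs' j" if "j \<le> Suc k" for j
  proof (cases "j = Suc k")
    case False
    then have jk: "j \<le> k" using that by simp
    moreover have "lev_ok n m s Vs j" using I jk by (simp add: inv_def k_def)
    ultimately show ?thesis using ef(1)[of j] V' by (intro lev_ok_cong[of s' j s Vs' Vs]) auto
  next
    case True
    have E: "ends_in m A B (Vs k)" using lk by (simp add: lev_ok_def lv)
    note ea = D.ends_after_deletion[OF E]
    have c2: "card (Vs k - {a', y}) + 2 = card (Vs k)"
    proof -
      have "card {a', y} = 2" using D0.distinct_edges(2) by simp
      moreover have "card {a', y} \<le> card (Vs k)" using b(3) aV by (intro card_mono) auto
      ultimately show ?thesis using aV by (simp add: card_Diff_subset)
    qed
    have lt: "?A i < n + Suc k \<and> ?B i < n + Suc k" if "i < m" for i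
    proof -
      have "p' < n + k" "q < n + k" using ea b(5) by auto
      moreover have "fst s 0 k i < n + k" "fst s 1 k i < n + k" using lk that by (auto simp: lev_ok_def)
      ultimately show ?thesis using ef(2)[OF that] ef(3)[OF that] by (auto split: if_splits)
    qed
    have Vk: "Vs' (Suc k) = Vs k - {a', y}" by (simp add: Vs'_def)
    show ?thesis unfolding True lev_ok_def Vk using ea(1) b(5) c2 lk lt by (auto simp: lev_ok_def)
  qed
  have ops: "fst s' 4 0 j = 1 \<and> del_op m s' Vs' j \<or> fst s' 4 0 j = 2 \<and> con_op n m s' Vs' j" if "j < Suc k" for j
  proof (cases "j = k")
    case True
    have "del_op m s' Vs' k" unfolding del_op_def
    proof (intro exI conjI)
      show "deletion m (fst s' 0 k) (fst s' 1 k) ?A ?B S (fst s' 5 0 k) a' b0 (fst s' 6 0 k) y (fst s' 7 0 k) p' (fst s' 8 0 k)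
        (fst s' 10 0 k) (fst s' 9 0 k) q" using D ef(1)[of k] ef(6-11) by (simp add: lv)
      show "a' \<in> Vs' k" "y \<in> Vs' k" using aV V' by auto
      show "Vs' (Suc k) = Vs' k - {a', y}" by (simp add: Vs'_def)
      show "fst s' 31 0 (fst s' 5 0 k) \<in> {2, 3}" using cx fr[of 31] ef(6) by simp
    qed
    then show ?thesis using ef(5) True by simp
  next
    case False
    then have j: "j < k" using that by simp
    have e: "fst s' 4 0 j = fst s 4 0 j" "fst s' 0 j = fst s 0 j" "fst s' 1 j = fst s 1 j" "fst s' 0 (Suc j) = fst s 0 (Suc j)"
      "fst s' 1 (Suc j) = fst s 1 (Suc j)" "fst s' 5 0 j = fst s 5 0 j" "fst s' 6 0 j = fst s 6 0 j" "fst s' 7 0 j = fst s 7 0 j"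
      "fst s' 8 0 j = fst s 8 0 j" "fst s' 9 0 j = fst s 9 0 j" "fst s' 10 0 j = fst s 10 0 j" "fst s' 3 j = fst s 3 j"
      "fst s' 31 = fst s 31" "Vs' j = Vs j" "Vs' (Suc j) = Vs (Suc j)"
      using j ef(1)[of j] ef(1)[of "Suc j"] ef(5-11) fr V' by auto
    have "fst s 4 0 j = 1 \<and> del_op m s Vs j \<or> fst s 4 0 j = 2 \<and> con_op n m s Vs j" using I j by (simp add: inv_def k_def)
    then show ?thesis
      using del_op_cong[OF e(2-11) _ e(14,15), of m] con_op_cong[OF e(2-5,12,14,15), of n m] unfolding e(1,13) by blast
  qed
  have xc': "x \<in> cut m ?A ?B (S - {a', y})"
    using xm D0.inS D0.distinct_vertices unfolding in_cut cr_joins[OF D.x'] by auto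
  have cur: "cur_ok n m s' Vs'"
    unfolding cur_ok_def Let_def k' reg' lv' using fr mo R' SV xc' cx D.valid_after_deletion[OF val]
    by (auto simp: Vs'_def x_def)
  \<comment> \<open>An earlier protected edge never has both ends in \<open>S\<close>, whereas
    \<open>e\<close>, \<open>f\<close> and \<open>h\<close> do. So it can only be \<open>x\<close>,
    \<open>g\<close> or an edge not involved; \<open>x\<close> keeps its end \<open>b0\<close>
    outside, and a protected \<open>g\<close> keeps \<open>r\<close> outside.\<close>
  have in_S: "A j \<in> S \<and> B j \<in> S" if "j \<in> {e, f, h}" for j
    using that D0.inS D0.e(2) D0.f(2) D0.h(2) unfolding joins_def by auto
  have "prot n s'" unfolding prot_def k' reg' lv'
  proof (intro allI impI)
    fix i assume i: "i < Suc k" "fst s' 4 0 i = 1"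
    let ?x = "fst s' 5 0 i"
    have old: "\<not> (A ?x \<in> S \<and> B ?x \<in> S)" if "i < k"
      using I that i(2) ef(5,6) mo unfolding inv_def prot_def nms by (auto split: if_splits)
    have xi: "?x < m"
    proof (cases "i = k")
      case True
      then show ?thesis using ef(6) xm by simp
    next
      case False
      then have ik: "i < k" "fst s 4 0 i = 1" using i ef(5) by auto
      have "fst s 4 0 i = 1 \<and> del_op m s Vs i \<or> fst s 4 0 i = 2 \<and> con_op n m s Vs i"
        using I ik(1) unfolding inv_def nms by blast
      then have "del_op m s Vs i" using ik(2) by simp
      then have "fst s 5 0 i < m" unfolding del_op_def deletion_def deletable_def by (elim exE conjE)
      then show ?thesis using ef(6) False by simp
    qed
    have "\<not> (?A ?x \<in> S - {a', y} \<and> ?B ?x \<in> S - {a', y})"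
    proof (cases "?x = x \<or> i = k")
      case True
      then have "?x = x" using ef(6) by auto
      then show ?thesis using D.x' D0.inS(5) unfolding joins_def by auto
    next
      case False
      then have "i < k" using i by simp
      note old = old[OF this]
      show ?thesis
      proof (cases "?x = g")
        case True
        have "r \<notin> S" using old D0.g(2) D0.inS(2) unfolding True joins_def by auto
        then show ?thesis using D.g' unfolding True joins_def by auto
      next
        case False
        moreover have "?x \<notin> {e, f, h}" using old in_S by blast
        ultimately show ?thesis using D.same[OF xi] old \<open>\<not> (?x = x \<or> i = k)\<close> by auto
      qed
    qed
    moreover have "(fst s' 4 0 j = 1 \<longrightarrow> ?x \<notin> {fst s' 6 0 j, fst s' 7 0 j, fst s' 9 0 j}) \<and>
       (fst s' 4 0 j = 2 \<longrightarrow> \<not> (fst s' 0 j ?x \<in> wset n s' j \<and> fst s' 1 j ?x \<in> wset n s' j))" if j: "j < Suc k" "i < j" for j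
    proof (cases "j = k")
      case True
      then show ?thesis using old in_S j ef(5,7,8,10) by auto
    next
      case False
      moreover have "fst s' 0 j = fst s 0 j" "fst s' 1 j = fst s 1 j" "wset n s' j = wset n s j" "i < k" "i \<noteq> k" "j < k"
        using ef(1)[of j] fr[of 3] j False by (auto simp: wset_def)
      moreover have "fst s 4 0 i = 1" using i(2) ef(5) \<open>i \<noteq> k\<close> by simp
      ultimately show ?thesis using I j ef(5-10) unfolding inv_def prot_def nms by simp
    qed
    ultimately show "(fst s' 13 0 0 = 0 \<longrightarrow> \<not> (?A ?x \<in> S - {a', y} \<and> ?B ?x \<in> S - {a', y})) \<and> (\<forall>j<Suc k. i < j \<longrightarrow>
      (fst s' 4 0 j = 1 \<longrightarrow> ?x \<notin> {fst s' 6 0 j, fst s' 7 0 j, fst s' 9 0 j}) \<and>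
       (fst s' 4 0 j = 2 \<longrightarrow> \<not> (fst s' 0 j ?x \<in> wset n s' j \<and> fst s' 1 j ?x \<in> wset n s' j)))" by blast
  qed
  note pr = this
  have "inv n m A0 B0 s' Vs'" unfolding inv_def k'
  proof (intro conjI)
    show "\<forall>i<m. fst s' 0 0 i = A0 i \<and> fst s' 1 0 i = B0 i" using I ef(1)[of 0] by (simp add: inv_def)
    show "fst s' 12 0 0 = n + Suc k" using I ef(13) by (simp add: inv_def k_def)
    show "lab_zero n s'" using I fr[of 32] by (simp add: inv_def lab_zero_def)
    show "\<forall>i<m. fst s' 31 0 i \<le> 3" using I fr[of 31] by (simp add: inv_def)
    show "Vs' 0 = {..<n}" "1 \<le> n" using I V' by (auto simp: inv_def)
  qed (use lev ops cur pr fr dn in auto)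
  then show "\<exists>Vs'. inv n m A0 B0 s' Vs'" by blast
  have finS: "finite S" using R by (simp add: region_def)
  \<comment> \<open>With at least three vertices the truncated \<open>2 * card S - 4\<close> really
    falls, by at least 2, against the single step that is added for undoing the deletion.\<close>
  have c3: "3 \<le> card S"
  proof -
    have "card {a', y, p'} = 3" using D0.distinct_edges(2) D0.distinct_vertices by auto
    then show ?thesis using card_mono[OF finS, of "{a', y, p'}"] D0.inS by auto
  qed
  have cS: "card (S - {a', y}) + 2 = card S"
  proof -
    have "card {a', y} = 2" using D0.distinct_edges(2) by simp
    then show ?thesis using c3 D0.inS by (simp add: card_Diff_subset)
  qed
  have "(\<Sum>j<k. if fst s' 4 0 j = 1 then 1 else 2 * card (wset n s' j) - 4 + 1) =
    (\<Sum>j<k. if fst s 4 0 j = 1 then 1 else 2 * card (wset n s j) - 4 + 1)"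
    by (rule sum.cong) (use ef(5) fr[of 3] in \<open>auto simp: wset_def\<close>)
  moreover have "fst s' 4 0 k = 1" using ef(5) by simp
  ultimately show "mu n s' < mu n s" using fr[of 13] mo c3 cS unfolding mu_def reg' k' k_def[symmetric] S_def[symmetric] by simp
qed

section \<open>Pushing a contraction\<close>

text \<open>The set to be contracted is taken directly from the labels of the search that found it;
  array 3 keeps a copy, since later searches overwrite the labels.\<close>

definition CONT :: hp where
  "CONT = Sq (For 42 (LN 2) (If (Ne (lab vv) (C 0)) (Set 3 (V 11) vv (C 1)) (Set 3 (V 11) vv (C 0))))
    (Sq (For 40 LM (If (Ne (lab (ga iv)) (C 0)) (Set 0 (Inc (V 11)) iv (V 12)) (Set 0 (Inc (V 11)) iv (ga iv))))
    (Sq (For 40 LM (If (Ne (lab (gb iv)) (C 0)) (Set 1 (Inc (V 11)) iv (V 12)) (Set 1 (Inc (V 11)) iv (gb iv))))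
    (Sq (For 42 (LN 2) (If (Ne (lab vv) (C 0)) (Set 2 (Inc (V 11)) vv (C 0)) (Set 2 (Inc (V 11)) vv (rs vv))))
    (Sq (Set 2 (Inc (V 11)) (V 12) (C 1)) (Sq (Set1 4 (V 11) (C 2)) (Sq (SetV 12 (Inc (V 12))) (SetV 11 (Inc (V 11)))))))))"

lemma asg_CONT: "asg CONT = {40, 42, 0, 1, 2, 3, 4, 11, 12}"
  by (auto simp: CONT_def)

lemma CONT_effect:
  fixes s and n m :: nat defines "s' \<equiv> den n m CONT s" and "k \<equiv> fst s 11 0 0" and "w \<equiv> fst s 12 0 0" and "L \<equiv> fst s 32 0"
  shows "\<And>j. j \<noteq> Suc k \<Longrightarrow> fst s' 0 j = fst s 0 j \<and> fst s' 1 j = fst s 1 j"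
    and "\<And>i. i < m \<Longrightarrow> fst s' 0 (Suc k) i = (if L (fst s 0 k i) \<noteq> 0 then w else fst s 0 k i)"
    and "\<And>i. i < m \<Longrightarrow> fst s' 1 (Suc k) i = (if L (fst s 1 k i) \<noteq> 0 then w else fst s 1 k i)"
    and "\<And>v. v < 2 * n \<Longrightarrow> fst s' 2 (Suc k) v = (if v = w then 1 else if L v \<noteq> 0 then 0 else fst s 2 k v)"
    and "\<And>j. j \<noteq> k \<Longrightarrow> fst s' 3 j = fst s 3 j"
    and "\<And>v. v < 2 * n \<Longrightarrow> fst s' 3 k v = of_bool (L v \<noteq> 0)"
    and "fst s' 4 0 = (fst s 4 0)(k := 2)" "fst s' 11 0 0 = Suc k" "fst s' 12 0 0 = Suc w"
    and "\<And>j. j \<notin> {40, 42, 0, 1, 2, 3, 4, 11, 12} \<Longrightarrow> fst s' j = fst s j"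
proof -
  let ?p0 = "For 42 (LN 2) (If (Ne (lab vv) (C 0)) (Set 3 (V 11) vv (C 1)) (Set 3 (V 11) vv (C 0)))"
    and ?pa = "For 40 LM (If (Ne (lab (ga iv)) (C 0)) (Set 0 (Inc (V 11)) iv (V 12)) (Set 0 (Inc (V 11)) iv (ga iv)))"
    and ?pb = "For 40 LM (If (Ne (lab (gb iv)) (C 0)) (Set 1 (Inc (V 11)) iv (V 12)) (Set 1 (Inc (V 11)) iv (gb iv)))"
    and ?pr = "For 42 (LN 2) (If (Ne (lab vv) (C 0)) (Set 2 (Inc (V 11)) vv (C 0)) (Set 2 (Inc (V 11)) vv (rs vv)))"
  define s1 where "s1 = den n m ?p0 s"
  define s2 where "s2 = den n m ?pa s1"
  define s3 where "s3 = den n m ?pb s2"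
  define s4 where "s4 = den n m ?pr s3"
  have f1: "fst s1 q = fst s q" if "q \<notin> {3, 42}" for q unfolding s1_def by (rule den_frame) (use that in auto)
  have f2: "fst s2 q = fst s1 q" if "q \<notin> {0, 40}" for q unfolding s2_def by (rule den_frame) (use that in auto)
  have f3: "fst s3 q = fst s2 q" if "q \<notin> {1, 40}" for q unfolding s3_def by (rule den_frame) (use that in auto)
  have f4: "fst s4 q = fst s3 q" if "q \<notin> {2, 42}" for q unfolding s4_def by (rule den_frame) (use that in auto)
  have 3: "fst s1 3 r c = (if r = k \<and> c < 2 * n then of_bool (L c \<noteq> 0) else fst s 3 r c)" for r c
    unfolding s1_def by (rule fill[where F = "\<lambda>c. of_bool (L c \<noteq> 0)" and R = k]) (auto simp: upd_def k_def L_def)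
  have 0: "fst s2 0 r c = (if r = Suc k \<and> c < m then (if L (fst s 0 k c) \<noteq> 0 then w else fst s 0 k c) else fst s 0 r c)" for r c
    unfolding s2_def f1[of 0, simplified, symmetric]
    by (rule fill[where F = "\<lambda>c. if L (fst s1 0 k c) \<noteq> 0 then w else fst s1 0 k c" and R = "Suc k"])
      (auto simp: upd_def k_def L_def w_def f1)
  have 1: "fst s3 1 r c = (if r = Suc k \<and> c < m then (if L (fst s2 1 k c) \<noteq> 0 then w else fst s2 1 k c) else fst s2 1 r c)" for r c
    unfolding s3_def
    by (rule fill[where F = "\<lambda>c. if L (fst s2 1 k c) \<noteq> 0 then w else fst s2 1 k c" and R = "Suc k"])
      (auto simp: upd_def k_def L_def w_def f1 f2)
  have 2: "fst s4 2 r c = (if r = Suc k \<and> c < 2 * n then (if L c \<noteq> 0 then 0 else fst s3 2 k c) else fst s3 2 r c)" for r c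
    unfolding s4_def
    by (rule fill[where F = "\<lambda>c. if L c \<noteq> 0 then 0 else fst s3 2 k c" and R = "Suc k"])
      (auto simp: upd_def k_def L_def w_def f1 f2 f3)
  have f: "fst s4 11 0 0 = k" "fst s4 12 0 0 = w" "fst s4 4 = fst s 4" using f1 f2 f3 f4 by (simp_all add: k_def w_def)
  have s': "s' = den n m (Sq (Set 2 (Inc (V 11)) (V 12) (C 1)) (Sq (Set1 4 (V 11) (C 2)) (Sq (SetV 12 (Inc (V 12))) (SetV 11 (Inc (V 11)))))) s4"
    unfolding s'_def CONT_def s4_def s3_def s2_def s1_def by (simp only: den.simps(5))
  have fs: "fst s' = upd 11 0 0 (Suc k) (upd 12 0 0 (Suc w) (upd 4 0 k 2 (upd 2 (Suc k) w 1 (fst s4))))"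
    unfolding s' by (simp add: upd_apply f)
  have n: "fst s' 0 = fst s2 0" "fst s' 1 = fst s3 1" "fst s' 3 = fst s1 3" unfolding fs using f2 f3 f4 by (simp_all add: upd_def)
  show "fst s' 0 j = fst s 0 j \<and> fst s' 1 j = fst s 1 j" if "j \<noteq> Suc k" for j
    unfolding n using 0 1 that f1 f2 by (auto simp: fun_eq_iff)
  show "fst s' 0 (Suc k) i = (if L (fst s 0 k i) \<noteq> 0 then w else fst s 0 k i)" if "i < m" for i
    unfolding n using 0 that by simp
  show "fst s' 1 (Suc k) i = (if L (fst s 1 k i) \<noteq> 0 then w else fst s 1 k i)" if "i < m" for i
    unfolding n using 1 that f1 f2 by simp
  show "fst s' 2 (Suc k) v = (if v = w then 1 else if L v \<noteq> 0 then 0 else fst s 2 k v)" if "v < 2 * n" for v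
    unfolding fs using 2 that f1 f2 f3 by (auto simp: upd_def)
  show "fst s' 3 j = fst s 3 j" if "j \<noteq> k" for j unfolding n using 3 that by (auto simp: fun_eq_iff)
  show "fst s' 3 k v = of_bool (L v \<noteq> 0)" if "v < 2 * n" for v unfolding n using 3 that by simp
  show "fst s' 4 0 = (fst s 4 0)(k := 2)" "fst s' 11 0 0 = Suc k" "fst s' 12 0 0 = Suc w"
    unfolding fs using f by (simp_all add: upd_def)
  show "fst s' j = fst s j" if "j \<notin> {40, 42, 0, 1, 2, 3, 4, 11, 12}" for j
    unfolding s'_def by (rule den_frame) (use that in \<open>simp add: asg_CONT\<close>)
qed

lemma region_congr: "(\<And>i. i < m \<Longrightarrow> A' i = A i \<and> B' i = B i) \<Longrightarrow> region m A' B' S = region m A B S"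
  using cut_congr[of m A' A B' B] by (simp add: region_def)

lemma valid_congr: "(\<And>i. i < m \<Longrightarrow> A' i = A i \<and> B' i = B i) \<Longrightarrow> valid m A' B' q U S = valid m A B q U S"
  using cut_congr[of m A' A B' B] by (simp add: valid_def)

lemma CONT_correct:
  fixes s and n m :: nat defines "s' \<equiv> den n m CONT s"
  assumes I: "inv n m A0 B0 s Vs" and mo: "fst s 13 0 0 = 0" and dn: "fst s 14 0 0 = 0"
    and W: "labset n s \<subset> reg n s" "2 \<le> card (labset n s)" "card (cut m (level_A s) (level_B s) (labset n s)) = 3"
  shows "\<exists>Vs'. inv n m A0 B0 s' Vs'" "mu n s' < mu n s"
proof -
  define k where "k = fst s 11 0 0"
  define x where "x = fst s 15 0 0"
  define S where "S = reg n s"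
  define A where "A = level_A s"
  define B where "B = level_B s"
  define W where "W = labset n s"
  have lv: "A = fst s 0 k" "B = fst s 1 k" by (auto simp: A_def B_def level_A_def level_B_def k_def)
  note nms = k_def[symmetric] x_def[symmetric] S_def[symmetric] A_def[symmetric] B_def[symmetric] W_def[symmetric]
  have R: "region m A B S" and SV: "S \<subseteq> Vs k" and xc: "x \<in> cut m A B S" and cx: "fst s 31 0 x \<in> {2, 3}"
    and val: "valid m A B (fst s 31 0) (Vs k) S" and nk: "fst s 12 0 0 = n + k" and lz: "lab_zero n s"
    using I mo unfolding inv_def cur_ok_def Let_def nms by auto
  note b = inv_bound[OF I, unfolded nms]
  note W = W[unfolded nms]
  have L: "fst s 32 0 v \<noteq> 0 \<longleftrightarrow> v \<in> W" for v
    using lz by (cases "v < 2 * n") (auto simp: W_def labset_def lab_zero_def)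
  note ef = CONT_effect[where s = s and n = n and m = m, unfolded nms nk L, folded s'_def]
  let ?A = "fst s' 0 (Suc k)" and ?B = "fst s' 1 (Suc k)" and ?w = "n + k"
  have AB: "?A i = (if A i \<in> W then ?w else A i) \<and> ?B i = (if B i \<in> W then ?w else B i)" if "i < m" for i
    using ef(2,3)[OF that] lv by simp
  let ?AW = "\<lambda>i. if A i \<in> W then ?w else A i" and ?BW = "\<lambda>i. if B i \<in> W then ?w else B i"
  have cg: "region m ?A ?B X = region m ?AW ?BW X" "valid m ?A ?B q X Y = valid m ?AW ?BW q X Y"
    "cut m ?A ?B X = cut m ?AW ?BW X" for q X Y
    by (rule region_congr valid_congr cut_congr; rule AB; assumption)+
  have wf: "A i \<noteq> ?w \<and> B i \<noteq> ?w" if "i < m" for i using b(4)[OF that] lv by auto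
  have wV: "?w \<notin> Vs k" using b(5) by auto
  have w2: "?w < 2 * n" using b(1) by simp
  have WS: "W \<subseteq> S" "W \<noteq> {}" using W by auto
  have finS: "finite S" using R by (simp add: region_def)
  then have finW: "finite W" using WS finite_subset by blast
  have fr: "fst s' j = fst s j" if "j \<notin> {40, 42, 0, 1, 2, 3, 4, 11, 12}" for j using ef(10) that by auto
  have k': "fst s' 11 0 0 = Suc k" by (rule ef(8))
  have reg': "reg n s' = insert ?w (S - W)"
    unfolding reg_def k' S_def k_def[symmetric] using ef(4) w2 by (auto split: if_splits)
  have lv': "level_A s' = ?A" "level_B s' = ?B" by (simp_all add: level_A_def level_B_def k')
  have "W \<subseteq> {..<2 * n}" by (auto simp: W_def labset_def)
  then have wk: "wset n s' k = W" unfolding wset_def using ef(6) by (auto simp: of_bool_def split: if_splits)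
  define Vs' where "Vs' = Vs(Suc k := insert ?w (Vs k - W))"
  have V': "Vs' j = Vs j" if "j \<le> k" for j using that by (auto simp: Vs'_def)
  have Vk: "Vs' (Suc k) = insert ?w (Vs k - W)" by (simp add: Vs'_def)
  have lk: "lev_ok n m s Vs k" using I by (simp add: inv_def k_def)
  have E: "ends_in m A B (Vs k)" using lk by (simp add: lev_ok_def lv)
  have R': "region m ?A ?B (insert ?w (S - W))"
    unfolding cg by (rule region_after_contraction[OF R WS W(3)]) (use wf wV SV in auto)
  have lev: "lev_ok n m s' Vs' j" if "j \<le> Suc k" for j
  proof (cases "j = Suc k")
    case False
    then have jk: "j \<le> k" using that by simp
    moreover have "lev_ok n m s Vs j" using I jk by (simp add: inv_def k_def)
    ultimately show ?thesis using ef(1)[of j] V' by (intro lev_ok_cong[of s' j s Vs' Vs]) auto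
  next
    case True
    have "ends_in m ?A ?B (insert ?w (Vs k - W))" using AB E by (auto simp: ends_in_def)
    moreover have "insert ?w (Vs k - W) \<subseteq> {..<n + Suc k}" using b(5) by auto
    moreover have "card (insert ?w (Vs k - W)) + Suc k \<le> n"
    proof -
      have WV: "W \<subseteq> Vs k" using WS SV by auto
      have "card W \<le> card (Vs k)" by (rule card_mono[OF b(3) WV])
      moreover have "card (insert ?w (Vs k - W)) = Suc (card (Vs k) - card W)"
        using wV b(3) finW WV by (simp add: card_Diff_subset)
      ultimately show ?thesis using W(2) lk by (auto simp: lev_ok_def)
    qed
    moreover have "?A i < n + Suc k \<and> ?B i < n + Suc k" if "i < m" for i
      using AB[OF that] b(4)[OF that] by auto
    ultimately show ?thesis unfolding True lev_ok_def Vk by blast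
  qed
  have ops: "fst s' 4 0 j = 1 \<and> del_op m s' Vs' j \<or> fst s' 4 0 j = 2 \<and> con_op n m s' Vs' j" if "j < Suc k" for j
  proof (cases "j = k")
    case True
    have "con_op n m s' Vs' k" unfolding con_op_def wk
    proof (intro conjI)
      show "region m (fst s' 0 k) (fst s' 1 k) W" using region_subset[OF R WS W(3)] ef(1)[of k] by (simp add: lv)
      show "W \<subset> Vs' k" using W(1) SV V' by auto
      show "\<forall>i<m. ?A i = (if fst s' 0 k i \<in> W then n + k else fst s' 0 k i) \<and> ?B i = (if fst s' 1 k i \<in> W then n + k else fst s' 1 k i)"
        using AB ef(1)[of k] by (simp add: lv)
      show "Vs' (Suc k) = insert (n + k) (Vs' k - W)" by (simp add: Vs'_def)
    qed (rule W)
    then show ?thesis using ef(7) True by simp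
  next
    case False
    then have j: "j < k" using that by simp
    have e: "fst s' 4 0 j = fst s 4 0 j" "fst s' 0 j = fst s 0 j" "fst s' 1 j = fst s 1 j" "fst s' 0 (Suc j) = fst s 0 (Suc j)"
      "fst s' 1 (Suc j) = fst s 1 (Suc j)" "fst s' 5 0 j = fst s 5 0 j" "fst s' 6 0 j = fst s 6 0 j" "fst s' 7 0 j = fst s 7 0 j"
      "fst s' 8 0 j = fst s 8 0 j" "fst s' 9 0 j = fst s 9 0 j" "fst s' 10 0 j = fst s 10 0 j" "fst s' 3 j = fst s 3 j"
      "fst s' 31 = fst s 31" "Vs' j = Vs j" "Vs' (Suc j) = Vs (Suc j)"
      using j ef(1)[of j] ef(1)[of "Suc j"] ef(7) ef(5)[of j] fr V' by auto
    have "fst s 4 0 j = 1 \<and> del_op m s Vs j \<or> fst s 4 0 j = 2 \<and> con_op n m s Vs j" using I j by (simp add: inv_def k_def)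
    then show ?thesis
      using del_op_cong[OF e(2-11) _ e(14,15), of m] con_op_cong[OF e(2-5,12,14,15), of n m] unfolding e(1,13) by blast
  qed
  have cutS: "cut m ?A ?B (insert ?w (S - W)) = cut m A B S"
  proof -
    have "(insert ?w (S - W) - {?w}) \<union> W = S" using WS wV SV by auto
    moreover have "insert ?w (S - W) \<inter> W = {}" using wV WS SV by auto
    ultimately show ?thesis using cut_contract[of m A ?w B "insert ?w (S - W)" W] wf unfolding cg by auto
  qed
  have "valid m ?A ?B (fst s 31 0) (insert ?w (Vs k - W)) (insert ?w (S - W))"
    unfolding cg by (rule valid_after_contraction[OF val WS(1) _ wV]) (rule wf)
  then have cur: "cur_ok n m s' Vs'"
    unfolding cur_ok_def Let_def k' reg' lv' Vk using fr mo R' SV xc cx cutS by (auto simp: x_def)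
  have pr: "prot n s'" unfolding prot_def k' reg' lv'
  proof (intro allI impI)
    fix i assume i: "i < Suc k" "fst s' 4 0 i = 1"
    let ?x = "fst s' 5 0 i"
    have ik: "i < k" "fst s 4 0 i = 1" using i ef(7) by (auto split: if_splits)
    have x5: "?x = fst s 5 0 i" using fr[of 5] by simp
    have old: "\<not> (A ?x \<in> S \<and> B ?x \<in> S)"
      using I ik mo fr[of 5] unfolding inv_def prot_def nms by auto
    have "fst s 4 0 i = 1 \<and> del_op m s Vs i \<or> fst s 4 0 i = 2 \<and> con_op n m s Vs i"
      using I ik(1) unfolding inv_def nms by blast
    then have "del_op m s Vs i" using ik(2) by simp
    then have xi: "?x < m" unfolding del_op_def deletion_def deletable_def x5 by (elim exE conjE)
    have "\<not> (?A ?x \<in> insert ?w (S - W) \<and> ?B ?x \<in> insert ?w (S - W))"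
      using old AB[OF xi] wf[OF xi] WS by (auto split: if_splits)
    moreover have "(fst s' 4 0 j = 1 \<longrightarrow> ?x \<notin> {fst s' 6 0 j, fst s' 7 0 j, fst s' 9 0 j}) \<and>
       (fst s' 4 0 j = 2 \<longrightarrow> \<not> (fst s' 0 j ?x \<in> wset n s' j \<and> fst s' 1 j ?x \<in> wset n s' j))" if j: "j < Suc k" "i < j" for j
    proof (cases "j = k")
      case True
      have "fst s' 0 k = A" "fst s' 1 k = B" using ef(1)[of k] lv by auto
      then show ?thesis using old WS wk ef(7) True by auto
    next
      case False
      moreover have "fst s' 0 j = fst s 0 j" "fst s' 1 j = fst s 1 j" "wset n s' j = wset n s j" "j < k"
        using ef(1)[of j] ef(5)[of j] j False by (auto simp: wset_def)
      ultimately show ?thesis using I j ik ef(7) fr unfolding inv_def prot_def nms by simp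
    qed
    ultimately show "(fst s' 13 0 0 = 0 \<longrightarrow> \<not> (?A ?x \<in> insert ?w (S - W) \<and> ?B ?x \<in> insert ?w (S - W))) \<and> (\<forall>j<Suc k. i < j \<longrightarrow>
      (fst s' 4 0 j = 1 \<longrightarrow> ?x \<notin> {fst s' 6 0 j, fst s' 7 0 j, fst s' 9 0 j}) \<and>
       (fst s' 4 0 j = 2 \<longrightarrow> \<not> (fst s' 0 j ?x \<in> wset n s' j \<and> fst s' 1 j ?x \<in> wset n s' j)))" by blast
  qed
  have "inv n m A0 B0 s' Vs'" unfolding inv_def k'
  proof (intro conjI)
    show "\<forall>i<m. fst s' 0 0 i = A0 i \<and> fst s' 1 0 i = B0 i" using I ef(1)[of 0] by (simp add: inv_def)
    show "fst s' 12 0 0 = n + Suc k" using ef(9) by simp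
    show "lab_zero n s'" using I fr[of 32] by (simp add: inv_def lab_zero_def)
    show "\<forall>i<m. fst s' 31 0 i \<le> 3" using I fr[of 31] by (simp add: inv_def)
    show "Vs' 0 = {..<n}" "1 \<le> n" using I V' by (auto simp: inv_def)
  qed (use lev ops cur pr fr dn in auto)
  then show "\<exists>Vs'. inv n m A0 B0 s' Vs'" by blast
  have cS: "card W < card S" using W(1) finS psubset_card_mono by blast
  have c1: "card (insert ?w (S - W)) = Suc (card S - card W)"
  proof -
    have "?w \<notin> S" using wV SV by auto
    then show ?thesis using finS finW WS by (simp add: card_Diff_subset)
  qed
  \<comment> \<open>With \<open>s\<close> vertices in the region and \<open>w\<close> in the
    contracted set: \<open>2 * (s - w + 1) - 4\<close> for the smaller region,
    \<open>2 * w - 4\<close> for the later reduction of the set and 1 for reopening it add up to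
    \<open>2 * s - 5\<close>, one less than before.\<close>
  have "(\<Sum>j<k. if fst s' 4 0 j = 1 then 1 else 2 * card (wset n s' j) - 4 + 1) =
    (\<Sum>j<k. if fst s 4 0 j = 1 then 1 else 2 * card (wset n s j) - 4 + 1)"
    by (rule sum.cong) (use ef(5,7) in \<open>auto simp: wset_def\<close>)
  moreover have "fst s' 4 0 k = 2" using ef(7) by simp
  ultimately show "mu n s' < mu n s" using fr[of 13] mo cS c1 W(2)
    unfolding mu_def reg' k' k_def[symmetric] S_def[symmetric] by (simp add: wk)
qed

section \<open>Popping\<close>

text \<open>Going back from \<open>v\<close> along predecessors the labels fall strictly until
  \<open>p0\<close> is reached, so at some point a usable edge changes from one side of
  \<open>U\<close> to the other.\<close>

lemma reach_separation:
  assumes pk: "pred_ok m A B a1 a2 L0 L P" and L0: "\<And>v. L0 v \<noteq> 0 \<Longrightarrow> v = p0"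
    and v: "L v \<noteq> 0" "(p0 \<in> U) \<noteq> (v \<in> U)"
  shows "\<exists>i\<in>cut m A B U. a1 i = 1 \<or> a2 i = 1"
  using v
proof (induction "L v" arbitrary: v rule: less_induct)
  case less
  have "L0 v = 0" using L0[of v] less.prems by auto
  then have P: "P v < m" "(B (P v) = v \<and> a1 (P v) = 1 \<and> L (A (P v)) \<noteq> 0 \<and> L v = Suc (L (A (P v)))) \<or>
        (A (P v) = v \<and> a2 (P v) = 1 \<and> L (B (P v)) \<noteq> 0 \<and> L v = Suc (L (B (P v))))"
    using pk less.prems(1) unfolding pred_ok_def by auto
  define u where "u = (if B (P v) = v \<and> a1 (P v) = 1 \<and> L (A (P v)) \<noteq> 0 \<and> L v = Suc (L (A (P v))) then A (P v) else B (P v))"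
  have u: "L u \<noteq> 0" "L u < L v" "joins A B (P v) u v" "a1 (P v) = 1 \<or> a2 (P v) = 1"
    using P(2) unfolding u_def joins_def by auto
  show ?case
  proof (cases "(u \<in> U) = (v \<in> U)")
    case True
    then show ?thesis using less.hyps[OF u(2,1)] less.prems(2) by auto
  next
    case False
    then have "P v \<in> cut m A B U" using P(1) cr_joins[OF u(3)] by (simp add: in_cut)
    then show ?thesis using u(4) by blast
  qed
qed

lemma protD:
  assumes "prot n s" "i < j" "j < fst s 11 0 0" "fst s 4 0 i = 1"
  shows "fst s 4 0 j = 1 \<Longrightarrow> fst s 5 0 i \<notin> {fst s 6 0 j, fst s 7 0 j, fst s 9 0 j}"
    "fst s 4 0 j = 2 \<Longrightarrow> \<not> (fst s 0 j (fst s 5 0 i) \<in> wset n s j \<and> fst s 1 j (fst s 5 0 i) \<in> wset n s j)"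
proof -
  have "i < fst s 11 0 0" using assms by simp
  note p = assms(1)[unfolded prot_def, rule_format, OF this assms(4), THEN conjunct2, rule_format, OF assms(3,2)]
  show "fst s 4 0 j = 1 \<Longrightarrow> fst s 5 0 i \<notin> {fst s 6 0 j, fst s 7 0 j, fst s 9 0 j}" using p by blast
  show "fst s 4 0 j = 2 \<Longrightarrow> \<not> (fst s 0 j (fst s 5 0 i) \<in> wset n s j \<and> fst s 1 j (fst s 5 0 i) \<in> wset n s j)" using p by blast
qed

section \<open>Undoing a deletion\<close>

definition LOAD :: hp where
  "LOAD = Sq (SetV 15 (A1 5 (Dec (V 11)))) (Sq (SetV 17 (A1 6 (Dec (V 11)))) (Sq (SetV 19 (A1 7 (Dec (V 11)))) (Sq (SetV 21 (A1 8 (Dec (V 11)))) (Sq (SetV 22 (A1 9 (Dec (V 11)))) (Sq (SetV 23 (A1 10 (Dec (V 11)))) (Sq (SetV 37 (A1 31 (V 15))) (If (Eq (V 37) (C 2)) (SetV 38 (C 3)) (SetV 38 (C 2)))))))))"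

lemma asg_LOAD: "asg LOAD = {15, 17, 19, 21, 22, 23, 37, 38}"
  by (auto simp: LOAD_def)

text \<open>The operation between two levels is stored under the lower one, so the current level is
  decremented for every access. Cell 37 receives the class of \<open>x\<close>, cell 38 the other
  one of 2 and 3.\<close>

lemma LOAD_effect:
  fixes s and n m :: nat
  assumes "fst s 11 0 0 = Suc j"
  shows "fst (den n m LOAD s) = upd 38 0 0 (if fst s 31 0 (fst s 5 0 j) = 2 then 3 else 2) (upd 37 0 0 (fst s 31 0 (fst s 5 0 j)) (upd 23 0 0 (fst s 10 0 j) (upd 22 0 0 (fst s 9 0 j) (upd 21 0 0 (fst s 8 0 j) (upd 19 0 0 (fst s 7 0 j) (upd 17 0 0 (fst s 6 0 j) (upd 15 0 0 (fst s 5 0 j) (fst s))))))))"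
proof -
  define u0 where "u0 = den n m (SetV 15 (A1 5 (Dec (V 11)))) s"
  have u0: "fst u0 = upd 15 0 0 (fst s 5 0 j) (fst s)" unfolding u0_def by (simp add: upd_apply assms)
  define u1 where "u1 = den n m (SetV 17 (A1 6 (Dec (V 11)))) u0"
  have u1: "fst u1 = upd 17 0 0 (fst s 6 0 j) (upd 15 0 0 (fst s 5 0 j) (fst s))" unfolding u1_def by (simp add: upd_apply assms u0)
  define u2 where "u2 = den n m (SetV 19 (A1 7 (Dec (V 11)))) u1"
  have u2: "fst u2 = upd 19 0 0 (fst s 7 0 j) (upd 17 0 0 (fst s 6 0 j) (upd 15 0 0 (fst s 5 0 j) (fst s)))" unfolding u2_def by (simp add: upd_apply assms u1)
  define u3 where "u3 = den n m (SetV 21 (A1 8 (Dec (V 11)))) u2"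
  have u3: "fst u3 = upd 21 0 0 (fst s 8 0 j) (upd 19 0 0 (fst s 7 0 j) (upd 17 0 0 (fst s 6 0 j) (upd 15 0 0 (fst s 5 0 j) (fst s))))" unfolding u3_def by (simp add: upd_apply assms u2)
  define u4 where "u4 = den n m (SetV 22 (A1 9 (Dec (V 11)))) u3"
  have u4: "fst u4 = upd 22 0 0 (fst s 9 0 j) (upd 21 0 0 (fst s 8 0 j) (upd 19 0 0 (fst s 7 0 j) (upd 17 0 0 (fst s 6 0 j) (upd 15 0 0 (fst s 5 0 j) (fst s)))))" unfolding u4_def by (simp add: upd_apply assms u3)
  define u5 where "u5 = den n m (SetV 23 (A1 10 (Dec (V 11)))) u4"
  have u5: "fst u5 = upd 23 0 0 (fst s 10 0 j) (upd 22 0 0 (fst s 9 0 j) (upd 21 0 0 (fst s 8 0 j) (upd 19 0 0 (fst s 7 0 j) (upd 17 0 0 (fst s 6 0 j) (upd 15 0 0 (fst s 5 0 j) (fst s))))))" unfolding u5_def by (simp add: upd_apply assms u4)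
  define u6 where "u6 = den n m (SetV 37 (A1 31 (V 15))) u5"
  have u6: "fst u6 = upd 37 0 0 (fst s 31 0 (fst s 5 0 j)) (upd 23 0 0 (fst s 10 0 j) (upd 22 0 0 (fst s 9 0 j) (upd 21 0 0 (fst s 8 0 j) (upd 19 0 0 (fst s 7 0 j) (upd 17 0 0 (fst s 6 0 j) (upd 15 0 0 (fst s 5 0 j) (fst s)))))))" unfolding u6_def by (simp add: upd_apply assms u5)
  define u7 where "u7 = den n m (If (Eq (V 37) (C 2)) (SetV 38 (C 3)) (SetV 38 (C 2))) u6"
  have u7: "fst u7 = upd 38 0 0 (if fst s 31 0 (fst s 5 0 j) = 2 then 3 else 2) (upd 37 0 0 (fst s 31 0 (fst s 5 0 j)) (upd 23 0 0 (fst s 10 0 j) (upd 22 0 0 (fst s 9 0 j) (upd 21 0 0 (fst s 8 0 j) (upd 19 0 0 (fst s 7 0 j) (upd 17 0 0 (fst s 6 0 j) (upd 15 0 0 (fst s 5 0 j) (fst s))))))))" unfolding u7_def by (simp add: upd_apply assms u6)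
  have "den n m LOAD s = u7" unfolding LOAD_def u7_def u6_def u5_def u4_def u3_def u2_def u1_def u0_def by (simp only: den.simps(5))
  then show ?thesis by (simp only: u7)
qed

text \<open>Usable, in both directions, are the edges that survive the removal of class
  \<open>oc\<close> and of \<open>g\<close>. What can be reached from an end of \<open>x\<close> is
  then the set \<open>D\<close> of the insertion rule.\<close>

definition ALI :: hp where
  "ALI = For 40 LM (If (And (Ne (A1 31 iv) (V 38)) (Ne iv (V 21))) (Sq (Set1 34 iv (C 1)) (Set1 35 iv (C 1)))
     (Sq (Set1 34 iv (C 0)) (Set1 35 iv (C 0))))"

text \<open>The order of the assignments matters: the old class of \<open>g\<close> decides the
  class of \<open>e\<close> and is copied to \<open>h\<close> before \<open>g\<close> is
  overwritten.\<close>

definition FIN :: hp where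
  "FIN = Sq (If (Eq (A1 31 (V 21)) (C 0)) (Set1 31 (V 17) (C 1)) (Set1 31 (V 17) (C 0)))
     (Sq (Set1 31 (V 19) (V 37))
     (Sq (If (Ne (lab (V 23)) (C 0)) (Sq (Set1 31 (V 22) (A1 31 (V 21))) (Set1 31 (V 21) (V 38))) (Set1 31 (V 22) (V 38)))
     (Sq (SetV 12 (Dec (V 12))) (SetV 11 (Dec (V 11))))))"

definition INS :: hp where
  "INS = Sq LOAD (Sq ALI (Sq LABI (Sq (Set1 32 (ga (V 15)) (C 1)) (Sq REACH FIN))))"

lemma asg_INS: "asg INS = {15, 17, 19, 21, 22, 23, 37, 38, 34, 35, 40, 42, 32, 41, 33, 79, 31, 12, 11}"
  by (auto simp: INS_def asg_LOAD asg_progs ALI_def FIN_def)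

lemma FIN_effect:
  fixes s and n m :: nat defines "s' \<equiv> den n m FIN s" and "q \<equiv> fst s 31 0"
    and "e \<equiv> fst s 17 0 0" and "f \<equiv> fst s 19 0 0" and "g \<equiv> fst s 21 0 0" and "h \<equiv> fst s 22 0 0"
  assumes d: "distinct [e, f, g, h]"
  shows "fst s' 31 0 = (if fst s 32 0 (fst s 23 0 0) \<noteq> 0
      then q(e := if q g = 0 then 1 else 0, f := fst s 37 0 0, h := q g, g := fst s 38 0 0)
      else q(e := if q g = 0 then 1 else 0, f := fst s 37 0 0, h := fst s 38 0 0))"
    "fst s' 11 0 0 = fst s 11 0 0 - 1" "fst s' 12 0 0 = fst s 12 0 0 - 1"
proof -
  have k: "fst s 17 0 0 = e" "fst s 19 0 0 = f" "fst s 21 0 0 = g" "fst s 22 0 0 = h" "fst s 31 0 = q"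
    by (simp_all add: e_def f_def g_def h_def q_def)
  define u0 where "u0 = den n m (If (Eq (A1 31 (V 21)) (C 0)) (Set1 31 (V 17) (C 1)) (Set1 31 (V 17) (C 0))) s"
  have u0: "fst u0 = upd 31 0 e (if q g = 0 then 1 else 0) (fst s)" unfolding u0_def by (simp add: k)
  define u1 where "u1 = den n m (Set1 31 (V 19) (V 37)) u0"
  have u1: "fst u1 = upd 31 0 f (fst s 37 0 0) (fst u0)" unfolding u1_def by (simp add: u0 upd_apply k)
  define u2 where "u2 = den n m (If (Ne (lab (V 23)) (C 0)) (Sq (Set1 31 (V 22) (A1 31 (V 21))) (Set1 31 (V 21) (V 38))) (Set1 31 (V 22) (V 38))) u1"
  have u2: "fst u2 = (if fst s 32 0 (fst s 23 0 0) \<noteq> 0 then upd 31 0 g (fst s 38 0 0) (upd 31 0 h (q g) (fst u1))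
      else upd 31 0 h (fst s 38 0 0) (fst u1))"
    unfolding u2_def using d by (simp add: u1 u0 upd_apply k)
  have s': "s' = den n m (Sq (SetV 12 (Dec (V 12))) (SetV 11 (Dec (V 11)))) u2"
    unfolding s'_def FIN_def u2_def u1_def u0_def by (simp only: den.simps(5))
  have o: "fst u2 i = fst s i" if "i \<noteq> 31" for i using that unfolding u2 u1 u0 by (simp add: upd_def)
  have fs: "fst s' = upd 11 0 0 (fst s 11 0 0 - 1) (upd 12 0 0 (fst s 12 0 0 - 1) (fst u2))"
    unfolding s' by (simp add: upd_apply o)
  show "fst s' 11 0 0 = fst s 11 0 0 - 1" "fst s' 12 0 0 = fst s 12 0 0 - 1" unfolding fs by (simp_all add: upd_apply)
  have "fst s' 31 0 = fst u2 31 0" unfolding fs by (simp add: upd_def)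
  then show "fst s' 31 0 = (if fst s 32 0 (fst s 23 0 0) \<noteq> 0
      then q(e := if q g = 0 then 1 else 0, f := fst s 37 0 0, h := q g, g := fst s 38 0 0)
      else q(e := if q g = 0 then 1 else 0, f := fst s 37 0 0, h := fst s 38 0 0))"
    unfolding u2 u1 u0 by (simp add: upd_def q_def)
qed

lemma INS_effect:
  fixes s and n m j :: nat
  defines "s' \<equiv> den n m INS s" and "x \<equiv> fst s 5 0 j" and "e \<equiv> fst s 6 0 j" and "f \<equiv> fst s 7 0 j" and "g \<equiv> fst s 8 0 j"
    and "h \<equiv> fst s 9 0 j" and "r \<equiv> fst s 10 0 j" and "q \<equiv> fst s 31 0"
  defines "fc \<equiv> q x" and "p0 \<equiv> fst s 0 (Suc j) x"
  defines "oc \<equiv> if fc = 2 then 3 else 2"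
  assumes k: "fst s 11 0 0 = Suc j" and d: "distinct [e, f, g, h]" and lz: "lab_zero n s"
    and ids': "\<forall>i<m. level_A s i < 2 * n \<and> level_B s i < 2 * n" and x: "x < m"
  shows "\<exists>L P. pred_ok m (level_A s) (level_B s) (\<lambda>i. of_bool (i < m \<and> q i \<noteq> oc \<and> i \<noteq> g)) (\<lambda>i. of_bool (i < m \<and> q i \<noteq> oc \<and> i \<noteq> g))
       (\<lambda>v. of_bool (v = p0)) L P \<and>
     closed_lab m (level_A s) (level_B s) (\<lambda>i. of_bool (i < m \<and> q i \<noteq> oc \<and> i \<noteq> g)) (\<lambda>i. of_bool (i < m \<and> q i \<noteq> oc \<and> i \<noteq> g)) L \<and>
     lab_zero n s' \<and>
     fst s' 31 0 = (if L r \<noteq> 0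
      then q(e := if q g = 0 then 1 else 0, f := fc, h := q g, g := oc)
      else q(e := if q g = 0 then 1 else 0, f := fc, h := oc))"
    "fst s' 11 0 0 = j" "fst s' 12 0 0 = fst s 12 0 0 - 1"
proof -
  have ids: "level_A s i < 2 * n \<and> level_B s i < 2 * n" if "i < m" for i using ids' that by blast
  define s1 where "s1 = den n m LOAD s"
  note s1 = LOAD_effect[OF k, of n m, folded s1_def]
  have f1: "fst s1 i = fst s i" if "i \<notin> {15, 17, 19, 21, 22, 23, 37, 38}" for i
    unfolding s1_def by (rule den_frame) (use that in \<open>simp add: asg_LOAD\<close>)
  have v1: "fst s1 15 0 0 = x" "fst s1 17 0 0 = e" "fst s1 19 0 0 = f" "fst s1 21 0 0 = g" "fst s1 22 0 0 = h" "fst s1 23 0 0 = r"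
    "fst s1 37 0 0 = fc" "fst s1 38 0 0 = oc"
    unfolding s1 x_def e_def f_def g_def h_def r_def fc_def oc_def q_def by (simp_all add: upd_apply)
  define al where "al i = (of_bool (q i \<noteq> oc \<and> i \<noteq> g) :: nat)" for i
  define s2 where "s2 = den n m ALI s1"
  have q1: "fst s1 31 0 = q" using f1[of 31] by (simp add: q_def)
  have a34: "fst s2 34 rr c = (if rr = 0 \<and> c < m then al c else fst s1 34 rr c)" for rr c
    unfolding s2_def ALI_def by (rule fill[where F = al and R = 0]) (use v1 q1 in \<open>auto simp: upd_def al_def\<close>)
  have a35: "fst s2 35 rr c = (if rr = 0 \<and> c < m then al c else fst s1 35 rr c)" for rr c
    unfolding s2_def ALI_def by (rule fill[where F = al and R = 0]) (use v1 q1 in \<open>auto simp: upd_def al_def\<close>)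
  have f2: "fst s2 i = fst s1 i" if "i \<notin> {34, 35, 40}" for i
    unfolding s2_def by (rule den_frame) (use that in \<open>simp add: ALI_def\<close>)
  define s3 where "s3 = den n m LABI s2"
  have f3: "fst s3 i = fst s2 i" if "i \<notin> {42, 32}" for i
    unfolding s3_def by (rule den_frame) (use that in \<open>simp add: asg_progs\<close>)
  have l3: "fst s3 32 0 = (\<lambda>_. 0)"
    unfolding s3_def using LABI_correct[of n m s2 0] f1[of 32] f2[of 32] lz by (auto simp: lab_zero_def fun_eq_iff not_less)
  define s4 where "s4 = den n m (Set1 32 (ga (V 15)) (C 1)) s3"
  have lv: "level_A s4 = level_A s" "level_B s4 = level_B s"
    using f1 f2 f3 by (simp_all add: level_A_def level_B_def s4_def upd_def)
  have p0: "p0 < 2 * n" using ids[OF x] k by (simp add: p0_def level_A_def)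
  have "ev n (ga (V 15)) (fst s3) = p0" using f1 f2 f3 v1 k by (simp add: p0_def)
  then have s4: "fst s4 = upd 32 0 p0 1 (fst s3)" unfolding s4_def by simp
  have f4: "fst s4 i = fst s3 i" if "i \<noteq> 32" for i using that unfolding s4 by (simp add: upd_def)
  have l4: "fst s4 32 0 = (\<lambda>v. of_bool (v = p0))" unfolding s4 using l3 by (auto simp: upd_def)
  define s5 where "s5 = den n m REACH s4"
  have f5: "fst s5 i = fst s4 i" if "i \<notin> {41, 40, 33, 32, 79}" for i
    unfolding s5_def by (rule den_frame) (use that in \<open>simp add: asg_progs\<close>)
  have "labcard n (fst s4 32 0) = 1"
  proof -
    have "{v. v < 2 * n \<and> fst s4 32 0 v \<noteq> 0} = {p0}" unfolding l4 using p0 by auto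
    then show ?thesis by (simp add: labcard_def)
  qed
  then have lc: "fst s4 32 0 v \<le> labcard n (fst s4 32 0)" for v by (simp add: l4)
  note re = REACH_correct[where s = s4 and n = n and m = m, OF _ lc, unfolded lv, OF ids, folded s5_def]
  define L where "L = fst s5 32 0"
  define P where "P = fst s5 33 0"
  define bl where "bl = (\<lambda>i. of_bool (i < m \<and> q i \<noteq> oc \<and> i \<noteq> g) :: nat)"
  have al4: "fst s4 34 0 i = bl i" "fst s4 35 0 i = bl i" if "i < m" for i
    using a34[of 0 i] a35[of 0 i] f3 f4 that by (simp_all add: al_def bl_def)
  have pk: "pred_ok m (level_A s) (level_B s) bl bl (\<lambda>v. of_bool (v = p0)) L P"
    using re(1) al4 unfolding pred_ok_def L_def P_def l4 by metis
  have cl: "closed_lab m (level_A s) (level_B s) bl bl L"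
    using re(2) al4 unfolding closed_lab_def L_def by auto
  have s': "s' = den n m FIN s5"
    unfolding s'_def INS_def s5_def s4_def s3_def s2_def s1_def by (simp only: den.simps(5))
  have v5: "fst s5 17 0 0 = e" "fst s5 19 0 0 = f" "fst s5 21 0 0 = g" "fst s5 22 0 0 = h" "fst s5 23 0 0 = r" "fst s5 31 0 = q"
    "fst s5 37 0 0 = fc" "fst s5 38 0 0 = oc" "fst s5 11 0 0 = Suc j" "fst s5 12 0 0 = fst s 12 0 0"
    using f1 f2 f3 f4 f5 v1 k by (simp_all add: q_def)
  note fi = FIN_effect[where s = s5 and n = n and m = m, unfolded v5, folded s', OF d, folded L_def]
  have lz': "lab_zero n s'"
  proof -
    have "fst s' 32 = fst s5 32" unfolding s' by (rule den_frame) (simp add: FIN_def)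
    moreover have "L v = 0" if "2 * n \<le> v" for v
      by (rule pred_ok_zero[OF pk ids _ that]) (use p0 in auto)
    ultimately show ?thesis by (simp add: lab_zero_def L_def)
  qed
  show "\<exists>L P. pred_ok m (level_A s) (level_B s) (\<lambda>i. of_bool (i < m \<and> q i \<noteq> oc \<and> i \<noteq> g)) (\<lambda>i. of_bool (i < m \<and> q i \<noteq> oc \<and> i \<noteq> g))
       (\<lambda>v. of_bool (v = p0)) L P \<and>
     closed_lab m (level_A s) (level_B s) (\<lambda>i. of_bool (i < m \<and> q i \<noteq> oc \<and> i \<noteq> g)) (\<lambda>i. of_bool (i < m \<and> q i \<noteq> oc \<and> i \<noteq> g)) L \<and>
     lab_zero n s' \<and>
     fst s' 31 0 = (if L r \<noteq> 0
      then q(e := if q g = 0 then 1 else 0, f := fc, h := q g, g := oc)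
      else q(e := if q g = 0 then 1 else 0, f := fc, h := oc))"
    unfolding bl_def[symmetric] using pk cl lz' fi(1) by blast
  show "fst s' 11 0 0 = j" "fst s' 12 0 0 = fst s 12 0 0 - 1" using fi(2,3) by simp_all
qed

text \<open>The labelled set plays the part of \<open>D\<close> in \<open>valid_insertion\<close>:
  \<open>reach_separation\<close> shows that it hangs together without class \<open>oc\<close> and
  without \<open>g\<close>, and closedness of the labels shows that \<open>g\<close> is the only
  edge outside class \<open>oc\<close> that can leave it. Either end of \<open>x\<close> may serve
  as the source.\<close>

lemma INS_correct:
  fixes s and n m j :: nat defines "s' \<equiv> den n m INS s"
  assumes I: "inv n m A0 B0 s Vs" and mo: "fst s 13 0 0 = 1" and dn: "fst s 14 0 0 = 0"
    and k: "fst s 11 0 0 = Suc j" and ot: "fst s 4 0 j = 1"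
  shows "inv n m A0 B0 s' Vs" "mu n s' < mu n s"
proof -
  define x where "x = fst s 5 0 j"
  define e where "e = fst s 6 0 j"
  define f where "f = fst s 7 0 j"
  define g where "g = fst s 8 0 j"
  define h where "h = fst s 9 0 j"
  define r where "r = fst s 10 0 j"
  define q where "q = fst s 31 0"
  define A where "A = fst s 0 j"
  define B where "B = fst s 1 j"
  define A' where "A' = fst s 0 (Suc j)"
  define B' where "B' = fst s 1 (Suc j)"
  note nms = x_def[symmetric] e_def[symmetric] f_def[symmetric] g_def[symmetric] h_def[symmetric] r_def[symmetric] q_def[symmetric]
    A_def[symmetric] B_def[symmetric] A'_def[symmetric] B'_def[symmetric]
  have lv: "level_A s = A'" "level_B s = B'" by (simp_all add: level_A_def level_B_def k A'_def B'_def)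
  have "fst s 4 0 j = 1 \<and> del_op m s Vs j \<or> fst s 4 0 j = 2 \<and> con_op n m s Vs j" using I k by (simp add: inv_def)
  then have "del_op m s Vs j" using ot by simp
  then obtain S a b0 y p z where D: "deletion m A B A' B' S x a b0 e y f p g r h z"
    and ay: "a \<in> Vs j" "y \<in> Vs j" "Vs (Suc j) = Vs j - {a, y}" and qx: "q x \<in> {2, 3}"
    unfolding del_op_def nms by (elim exE conjE) (rule that)
  interpret D: deletion m A B A' B' S x a b0 e y f p g r h z by (rule D)
  have d: "distinct [e, f, g, h]" "x \<notin> {e, f, g, h}" using D.distinct_edges(1) by auto
  note b = inv_bound[OF I, unfolded lv]
  have lz: "lab_zero n s" using I by (simp add: inv_def)
  have ids: "\<forall>i<m. A' i < 2 * n \<and> B' i < 2 * n" using b(2) by blast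
  define oc :: nat where "oc = (if q x = 2 then 3 else 2)"
  define p0 where "p0 = A' x"
  define bl where "bl = (\<lambda>i. of_bool (i < m \<and> q i \<noteq> oc \<and> i \<noteq> g) :: nat)"
  note ef = INS_effect[where s = s and n = n and m = m and j = j, unfolded nms lv, OF k d(1) lz ids D.x(1), folded s'_def oc_def p0_def, folded bl_def]
  from ef(1) obtain L P where pk: "pred_ok m A' B' bl bl (\<lambda>v. of_bool (v = p0)) L P" and cl: "closed_lab m A' B' bl bl L"
    and lz': "lab_zero n s'" and q': "fst s' 31 0 = (if L r \<noteq> 0
      then q(e := if q g = 0 then 1 else 0, f := q x, h := q g, g := oc)
      else q(e := if q g = 0 then 1 else 0, f := q x, h := oc))" (is "_ = ?q'") by blast
  have lj: "lev_ok n m s Vs j" "lev_ok n m s Vs (Suc j)" using I k by (simp_all add: inv_def)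
  have E: "ends_in m A B (Vs j)" and E': "ends_in m A' B' (Vs (Suc j))" using lj unfolding lev_ok_def nms by blast+
  note ea = D.ends_after_deletion[OF E]
  have inV: "b0 \<in> Vs (Suc j)" "p \<in> Vs (Suc j)" "r \<in> Vs (Suc j)" "z \<in> Vs (Suc j)" "a \<notin> Vs (Suc j)" "y \<notin> Vs (Suc j)"
    using ea D.distinct_vertices ay(3) by auto
  have p0: "p0 \<in> {b0, p}" using D.x' by (auto simp: joins_def p0_def)
  define Dd where "Dd = {v. L v \<noteq> 0}"
  have DV: "Dd \<subseteq> Vs (Suc j)"
  proof
    fix v assume "v \<in> Dd"
    then have Lv: "L v \<noteq> 0" by (simp add: Dd_def)
    show "v \<in> Vs (Suc j)"
    proof (cases "v = p0")
      case True
      then show ?thesis using p0 inV by auto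
    next
      case False
      then have P: "P v < m" "(B' (P v) = v \<and> L v = Suc (L (A' (P v)))) \<or> (A' (P v) = v \<and> L v = Suc (L (B' (P v))))"
        using pk Lv unfolding pred_ok_def by auto
      have "A' (P v) \<noteq> B' (P v)"
      proof
        assume eq: "A' (P v) = B' (P v)"
        have "L v = Suc (L v)" using P(2) eq by (elim disjE conjE) metis+
        then show False by simp
      qed
      then have "A' (P v) \<in> Vs (Suc j) \<and> B' (P v) \<in> Vs (Suc j)" using E' P(1) unfolding ends_in_def by blast
      then show ?thesis using P(2) by (elim disjE conjE) metis+
    qed
  qed
  obtain t where t: "t \<in> Vs (Suc j)" "valid m A' B' q (Vs (Suc j)) {t}"
    using I mo k unfolding inv_def cur_ok_def Let_def lv q_def by auto
  have blD: "bl i = 1 \<longleftrightarrow> i < m \<and> q i \<noteq> oc \<and> i \<noteq> g" for i by (simp add: bl_def)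
  have "valid m A B ?q' (insert a (insert y (Vs (Suc j)))) {t}"
  proof (rule D.valid_insertion[OF t(2,1) inV, where fc = "q x" and oc = oc and D = Dd and ?p0.0 = p0])
    show "oc = 5 - q x" using qx by (auto simp: oc_def)
    show "?q' x = q x" "?q' f = q x" "?q' e = (if q g = 0 then 1 else 0)" using d by auto
    show "?q' i = q i" if "i < m" "i \<notin> {x, e, f, g, h}" for i using that by auto
    show "if r \<in> Dd then ?q' g = oc \<and> ?q' h = q g else ?q' g = q g \<and> ?q' h = oc" using d by (auto simp: Dd_def)
    show "p0 \<in> Dd" using pk unfolding pred_ok_def Dd_def by auto
    show "\<exists>i\<in>cut m A' B' U. q i \<noteq> oc \<and> i \<noteq> g" if "v \<in> Dd" "(p0 \<in> U) \<noteq> (v \<in> U)" for v U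
    proof -
      have "\<exists>i\<in>cut m A' B' U. bl i = 1 \<or> bl i = 1"
        by (rule reach_separation[OF pk, of p0 v U]) (use that in \<open>auto simp: Dd_def\<close>)
      then show ?thesis unfolding blD by blast
    qed
    show "i = g" if "i \<in> cut m A' B' Dd" "q i \<noteq> oc" for i
      using that cl blD[of i] unfolding closed_lab_def Dd_def in_cut cr_def by blast
  qed (use DV p0 E' qx in auto)
  moreover have "insert a (insert y (Vs (Suc j))) = Vs j" using ay by auto
  ultimately have val: "valid m A B (fst s' 31 0) (Vs j) {t}" unfolding q' by simp
  have k': "fst s' 11 0 0 = j" by (rule ef(2))
  have fr: "fst s' i = fst s i" if "i \<in> {0, 1, 2, 3, 4, 5, 6, 7, 8, 9, 10, 13, 14}" for i
    unfolding s'_def by (rule den_frame) (use that in \<open>auto simp: asg_INS\<close>)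
  have lv': "level_A s' = A" "level_B s' = B" using fr by (simp_all add: level_A_def level_B_def k' A_def B_def)
  have pr: "prot n s" using I by (simp add: inv_def)
  \<comment> \<open>\<open>protD\<close> rules out \<open>e\<close>, \<open>f\<close> and
    \<open>h\<close>. If the pending protected edge is \<open>g\<close>, its class becomes
    \<open>oc\<close> or stays; in all other cases it is untouched.\<close>
  have xq: "fst s' 31 0 (fst s 5 0 i) \<in> {2, 3}" if "i < j" "fst s 4 0 i = 1" "fst s 31 0 (fst s 5 0 i) \<in> {2, 3}" for i
  proof -
    have "fst s 5 0 i \<notin> {e, f, h}" using protD(1)[OF pr that(1) _ that(2)] k ot unfolding nms by simp
    moreover have "q (fst s 5 0 i) \<in> {2, 3}" using that(3) by (simp add: q_def)
    moreover have "oc \<in> {2, 3}" by (simp add: oc_def)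
    ultimately show ?thesis unfolding q' by simp
  qed
  show "inv n m A0 B0 s' Vs" unfolding inv_def k'
  proof (intro conjI)
    show "\<forall>i<m. fst s' 0 0 i = A0 i \<and> fst s' 1 0 i = B0 i" using I fr by (simp add: inv_def)
    show "fst s' 12 0 0 = n + j" using I k ef(3) by (simp add: inv_def)
    have q3: "q i \<le> 3" if "i < m" for i using I that by (simp add: inv_def q_def)
    have o3: "oc \<le> 3" by (simp add: oc_def)
    show "\<forall>i<m. fst s' 31 0 i \<le> 3" unfolding q' using q3 o3 D.g(1) D.x(1) by auto
    show "Vs 0 = {..<n}" "1 \<le> n" using I by (auto simp: inv_def)
    show "\<forall>i\<le>j. lev_ok n m s' Vs i"
    proof (intro allI impI)
      fix i assume "i \<le> j"
      then have "lev_ok n m s Vs i" using I k by (simp add: inv_def)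
      then show "lev_ok n m s' Vs i" using fr by (intro lev_ok_cong[of s' i s Vs Vs]) auto
    qed
    show "\<forall>i<j. fst s' 4 0 i = 1 \<and> del_op m s' Vs i \<or> fst s' 4 0 i = 2 \<and> con_op n m s' Vs i"
    proof (intro allI impI)
      fix i assume i: "i < j"
      have e: "fst s' 4 0 i = fst s 4 0 i" "fst s' 0 i = fst s 0 i" "fst s' 1 i = fst s 1 i" "fst s' 0 (Suc i) = fst s 0 (Suc i)"
        "fst s' 1 (Suc i) = fst s 1 (Suc i)" "fst s' 5 0 i = fst s 5 0 i" "fst s' 6 0 i = fst s 6 0 i" "fst s' 7 0 i = fst s 7 0 i"
        "fst s' 8 0 i = fst s 8 0 i" "fst s' 9 0 i = fst s 9 0 i" "fst s' 10 0 i = fst s 10 0 i" "fst s' 3 i = fst s 3 i"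
        using fr by auto
      have "fst s 4 0 i = 1 \<and> del_op m s Vs i \<or> fst s 4 0 i = 2 \<and> con_op n m s Vs i" using I i k by (simp add: inv_def)
      moreover have "del_op m s' Vs i" if "del_op m s Vs i" "fst s 4 0 i = 1"
        by (rule del_op_cong[OF e(2-11), where Vs = Vs and Vs' = Vs]) (use xq[OF i that(2)] that in auto)
      moreover have "con_op n m s' Vs i" if "con_op n m s Vs i"
        by (rule con_op_cong[OF e(2-5,12), where Vs = Vs and Vs' = Vs]) (use that in auto)
      ultimately show "fst s' 4 0 i = 1 \<and> del_op m s' Vs i \<or> fst s' 4 0 i = 2 \<and> con_op n m s' Vs i" unfolding e(1) by blast
    qed
    show "cur_ok n m s' Vs" unfolding cur_ok_def Let_def k' lv' using fr[of 13] mo val t(1) ay(3) by auto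
    show "prot n s'" unfolding prot_def k'
    proof (intro allI impI conjI)
      fix i assume i: "i < j" "fst s' 4 0 i = 1"
      show "\<not> (level_A s' (fst s' 5 0 i) \<in> reg n s' \<and> level_B s' (fst s' 5 0 i) \<in> reg n s')" if "fst s' 13 0 0 = 0"
        using that fr[of 13] mo by simp
      fix j' assume j': "j' < j" "i < j'"
      have i': "i < Suc j" "fst s 4 0 i = 1" "j' < Suc j" "i < j'" using i j' fr[of 4] by auto
      have w: "wset n s' j' = wset n s j'" using fr[of 3] by (simp add: wset_def)
      show "fst s' 5 0 i \<notin> {fst s' 6 0 j', fst s' 7 0 j', fst s' 9 0 j'}" if "fst s' 4 0 j' = 1"
        using protD(1)[OF pr i'(4) _ i'(2)] k i'(3) that fr by simp
      show "\<not> (fst s' 0 j' (fst s' 5 0 i) \<in> wset n s' j' \<and> fst s' 1 j' (fst s' 5 0 i) \<in> wset n s' j')" if "fst s' 4 0 j' = 2"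
        using protD(2)[OF pr i'(4) _ i'(2)] k i'(3) that fr unfolding w by simp
    qed
  qed (use lz' dn fr in auto)
  have "(\<Sum>i<j. if fst s' 4 0 i = 1 then 1 else 2 * card (wset n s' i) - 4 + 1) =
    (\<Sum>i<j. if fst s 4 0 i = 1 then 1 else 2 * card (wset n s i) - 4 + 1)"
    by (rule sum.cong) (use fr in \<open>auto simp: wset_def\<close>)
  then show "mu n s' < mu n s" using fr[of 13] mo ot unfolding mu_def k k' by simp
qed

section \<open>Reopening a contracted set\<close>

definition UNCON :: hp where
  "UNCON = Sq (SetV 11 (Dec (V 11))) (Sq (SetV 12 (Dec (V 12))) (Sq (SetV 13 (C 0))
     (Sq (For 42 (LN 2) (Set 2 (V 11) vv (Arr 3 (V 11) vv)))
     (SCAN (And (Xor (Eq (rs (ga iv)) (C 1)) (Eq (rs (gb iv)) (C 1))) (Lt (C 1) (A1 31 iv))) 15 45))))"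

lemma asg_UNCON: "asg UNCON = {11, 12, 13, 42, 2, 45, 40, 15, 79}"
  by (auto simp: UNCON_def asg_SCAN)

text \<open>The exempt role is first moved to the contracted vertex \<open>n + j\<close>. Reopening
  that vertex makes \<open>W\<close> the exempt set, which is exactly the situation in which the
  reduction of \<open>W\<close> can start.\<close>

lemma UNCON_correct:
  fixes s and n m j :: nat defines "s' \<equiv> den n m UNCON s"
  assumes I: "inv n m A0 B0 s Vs" and mo: "fst s 13 0 0 = 1" and dn: "fst s 14 0 0 = 0"
    and k: "fst s 11 0 0 = Suc j" and ot: "fst s 4 0 j = 2"
  shows "inv n m A0 B0 s' Vs" "mu n s' < mu n s"
proof -
  define A where "A = fst s 0 j"
  define B where "B = fst s 1 j"
  define A' where "A' = fst s 0 (Suc j)"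
  define B' where "B' = fst s 1 (Suc j)"
  define q where "q = fst s 31 0"
  define W where "W = wset n s j"
  note nms = q_def[symmetric] A_def[symmetric] B_def[symmetric] A'_def[symmetric] B'_def[symmetric] W_def[symmetric]
  have lv: "level_A s = A'" "level_B s = B'" by (simp_all add: level_A_def level_B_def k A'_def B'_def)
  have "fst s 4 0 j = 1 \<and> del_op m s Vs j \<or> fst s 4 0 j = 2 \<and> con_op n m s Vs j" using I k by (simp add: inv_def)
  then have "con_op n m s Vs j" using ot by simp
  then have R: "region m A B W" and WV: "W \<subset> Vs j" and W2: "2 \<le> card W"
    and AB: "\<And>i. i < m \<Longrightarrow> A' i = (if A i \<in> W then n + j else A i) \<and> B' i = (if B i \<in> W then n + j else B i)"
    and V': "Vs (Suc j) = insert (n + j) (Vs j - W)"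
    unfolding con_op_def nms by blast+
  have lj: "lev_ok n m s Vs j" "lev_ok n m s Vs (Suc j)" using I k by (simp_all add: inv_def)
  have E: "ends_in m A B (Vs j)" and E': "ends_in m A' B' (Vs (Suc j))" using lj unfolding lev_ok_def nms by blast+
  have lt: "A i < n + j \<and> B i < n + j" if "i < m" for i using lj(1) that unfolding lev_ok_def nms by blast
  have jn: "Suc j < n" using inv_bound(1)[OF I] k by simp
  have wV: "n + j \<notin> Vs j" using lj(1) by (auto simp: lev_ok_def)
  have ltn: "A i \<noteq> n + j \<and> B i \<noteq> n + j" if "i < m" for i using lt[OF that] by auto
  obtain t where t: "t \<in> Vs (Suc j)" "valid m A' B' q (Vs (Suc j)) {t}"
    using I mo k unfolding inv_def cur_ok_def Let_def lv q_def by auto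
  have "n + j \<in> Vs (Suc j)" using V' by simp
  note v1 = valid_singleton_change[OF t(2) E' t(1) this]
  let ?A = "\<lambda>i. if A i \<in> W then n + j else A i" and ?B = "\<lambda>i. if B i \<in> W then n + j else B i"
  have "valid m ?A ?B q (Vs (Suc j)) {n + j} = valid m A' B' q (Vs (Suc j)) {n + j}"
    by (rule valid_congr) (use AB in auto)
  then have "valid m ?A ?B q (insert (n + j) (Vs j - W)) {n + j}" using v1 V' by simp
  then have val: "valid m A B q (Vs j) W"
    by (rule valid_before_contraction[OF _ ltn wV])
  define s1 where "s1 = den n m (Sq (SetV 11 (Dec (V 11))) (Sq (SetV 12 (Dec (V 12))) (SetV 13 (C 0)))) s"
  have s1: "fst s1 = upd 13 0 0 0 (upd 12 0 0 (fst s 12 0 0 - 1) (upd 11 0 0 j (fst s)))"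
    unfolding s1_def by (simp add: upd_apply k)
  define s2 where "s2 = den n m (For 42 (LN 2) (Set 2 (V 11) vv (Arr 3 (V 11) vv))) s1"
  have n1: "fst s1 11 0 0 = j" "fst s1 3 = fst s 3" unfolding s1 by (simp_all add: upd_def)
  have r2: "fst s2 2 rr c = (if rr = j \<and> c < 2 * n then fst s 3 j c else fst s1 2 rr c)" for rr c
    unfolding s2_def by (rule fill[where F = "fst s 3 j" and R = j]) (use n1 in \<open>auto simp: upd_def\<close>)
  have f2: "fst s2 i = fst s1 i" if "i \<notin> {2, 42}" for i
    unfolding s2_def by (rule den_frame) (use that in auto)
  let ?b = "And (Xor (Eq (rs (ga iv)) (C 1)) (Eq (rs (gb iv)) (C 1))) (Lt (C 1) (A1 31 iv))"
  have s': "s' = den n m (SCAN ?b 15 45) s2"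
    unfolding s'_def UNCON_def s2_def s1_def by (simp only: den.simps(5))
  have f3: "fst s' i = fst s2 i" if "i \<notin> {45, 40, 15, 79}" for i
    unfolding s' by (rule den_frame) (use that in \<open>simp add: asg_SCAN\<close>)
  have fr: "fst s' i = fst s i" if "i \<in> {0, 1, 3, 4, 5, 6, 7, 8, 9, 10, 14, 31, 32}" for i
    unfolding s'_def by (rule den_frame) (use that in \<open>auto simp: asg_UNCON\<close>)
  have k': "fst s' 11 0 0 = j" and k12: "fst s' 12 0 0 = fst s 12 0 0 - 1" and k13: "fst s' 13 0 0 = 0"
    using f3 f2 unfolding s1 by (simp_all add: upd_apply)
  have lv': "level_A s' = A" "level_B s' = B" using fr by (simp_all add: level_A_def level_B_def k' A_def B_def)
  have reg': "reg n s' = W" unfolding reg_def k' W_def wset_def using f3[of 2] r2 by auto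
  let ?Pr = "\<lambda>i. (fst s2 2 j (A i) = 1) \<noteq> (fst s2 2 j (B i) = 1) \<and> 1 < q i"
  have sc: "(fst s' 45 0 0 = 0 \<and> (\<forall>i<m. \<not> ?Pr i)) \<or> (fst s' 45 0 0 = 1 \<and> fst s' 15 0 0 < m \<and> ?Pr (fst s' 15 0 0))"
    unfolding s'
  proof (rule SCAN_correct)
    fix t :: store assume t: "\<And>j. j \<notin> {45, 40, 15, 79} \<Longrightarrow> fst t j = fst s2 j"
    have s2v: "fst s2 0 j = A" "fst s2 1 j = B" "fst s2 31 0 = q" "fst s2 11 0 0 = j"
      using f2 unfolding s1 by (simp_all add: upd_def A_def B_def q_def)
    show "bv n m ?b t = ?Pr (fst t 40 0 0)"
      using t s2v by simp
  qed auto
  have P: "?Pr i \<longleftrightarrow> i \<in> cut m A B W \<and> 1 < q i" if "i < m" for i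
  proof -
    have "fst s2 2 j v = 1 \<longleftrightarrow> v \<in> W" if "v < n + j" for v
      using r2[of j v] that jn by (simp add: W_def wset_def)
    then show ?thesis using lt[OF that] that by (simp add: in_cut cr_def)
  qed
  \<comment> \<open>If all boundary edges had class 0 or 1, those outside class 0 and those outside
    class 1 would be disjoint sets of at least two edges each, but there are only three edges.
    Validity is applied to the complement of \<open>W\<close>, which is nonempty and has the same
    cut.\<close>
  have ex: "\<exists>i\<in>cut m A B W. 1 < q i"
  proof (rule ccontr)
    assume n: "\<not> ?thesis"
    have "cut m A B (Vs j - W) = cut m A B W" by (rule cut_complement[OF E]) (use WV in auto)
    moreover have "Vs j - W \<noteq> {}" using WV by auto
    ultimately have c: "2 \<le> card {i \<in> cut m A B W. q i \<noteq> 0}" "2 \<le> card {i \<in> cut m A B W. q i \<noteq> 1}"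
      using val[unfolded valid_def, rule_format, of "Vs j - W"] by auto
    have "card {i \<in> cut m A B W. q i \<noteq> 0} + card {i \<in> cut m A B W. q i \<noteq> 1} =
      card ({i \<in> cut m A B W. q i \<noteq> 0} \<union> {i \<in> cut m A B W. q i \<noteq> 1})"
      by (rule card_Un_disjoint[symmetric]) (use n in auto)
    also have "\<dots> \<le> card (cut m A B W)" by (rule card_mono) auto
    also have "\<dots> = 3" using R by (simp add: region_def)
    finally show False using c by simp
  qed
  then have "\<not> (\<forall>i<m. \<not> ?Pr i)" using P by (meson in_cut)
  then have "fst s' 15 0 0 < m" "?Pr (fst s' 15 0 0)" using sc by blast+
  then have x: "fst s' 15 0 0 \<in> cut m A B W" "1 < q (fst s' 15 0 0)" using P by blast+
  have pr: "prot n s" using I by (simp add: inv_def)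
  have ws: "wset n s' i = wset n s i" for i using fr[of 3] by (simp add: wset_def)
  show "inv n m A0 B0 s' Vs" unfolding inv_def k'
  proof (intro conjI)
    show "\<forall>i<m. fst s' 0 0 i = A0 i \<and> fst s' 1 0 i = B0 i" using I fr by (simp add: inv_def)
    show "fst s' 12 0 0 = n + j" using I k k12 by (simp add: inv_def)
    show q3: "\<forall>i<m. fst s' 31 0 i \<le> 3" using I fr by (simp add: inv_def)
    show "Vs 0 = {..<n}" "1 \<le> n" using I by (auto simp: inv_def)
    show "\<forall>i\<le>j. lev_ok n m s' Vs i"
    proof (intro allI impI)
      fix i assume "i \<le> j"
      then have "lev_ok n m s Vs i" using I k by (simp add: inv_def)
      then show "lev_ok n m s' Vs i" using fr by (intro lev_ok_cong[of s' i s Vs Vs]) auto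
    qed
    show "\<forall>i<j. fst s' 4 0 i = 1 \<and> del_op m s' Vs i \<or> fst s' 4 0 i = 2 \<and> con_op n m s' Vs i"
    proof (intro allI impI)
      fix i assume i: "i < j"
      have e: "fst s' 4 0 i = fst s 4 0 i" "fst s' 0 i = fst s 0 i" "fst s' 1 i = fst s 1 i" "fst s' 0 (Suc i) = fst s 0 (Suc i)"
        "fst s' 1 (Suc i) = fst s 1 (Suc i)" "fst s' 5 0 i = fst s 5 0 i" "fst s' 6 0 i = fst s 6 0 i" "fst s' 7 0 i = fst s 7 0 i"
        "fst s' 8 0 i = fst s 8 0 i" "fst s' 9 0 i = fst s 9 0 i" "fst s' 10 0 i = fst s 10 0 i" "fst s' 3 i = fst s 3 i"
        "fst s' 31 = fst s 31"
        using fr by auto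
      have "fst s 4 0 i = 1 \<and> del_op m s Vs i \<or> fst s 4 0 i = 2 \<and> con_op n m s Vs i" using I i k by (simp add: inv_def)
      moreover have "del_op m s' Vs i" if "del_op m s Vs i" "fst s 4 0 i = 1"
        by (rule del_op_cong[OF e(2-11), where Vs = Vs and Vs' = Vs]) (use that e(13) in auto)
      moreover have "con_op n m s' Vs i" if "con_op n m s Vs i"
        by (rule con_op_cong[OF e(2-5,12), where Vs = Vs and Vs' = Vs]) (use that in auto)
      ultimately show "fst s' 4 0 i = 1 \<and> del_op m s' Vs i \<or> fst s' 4 0 i = 2 \<and> con_op n m s' Vs i" unfolding e(1) by blast
    qed
    have "q (fst s' 15 0 0) \<le> 3" using q3 x(1) fr[of 31] by (simp add: in_cut q_def)
    then have "q (fst s' 15 0 0) \<in> {2, 3}" using x(2) by auto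
    then show "cur_ok n m s' Vs" unfolding cur_ok_def Let_def k' lv' reg' using k13 R WV x(1) val fr[of 31] by (auto simp: q_def)
    show "prot n s'" unfolding prot_def k' lv' reg'
    proof (intro allI impI conjI)
      fix i assume i: "i < j" "fst s' 4 0 i = 1"
      have i': "i < Suc j" "fst s 4 0 i = 1" using i fr[of 4] by auto
      have "\<not> (fst s 0 j (fst s 5 0 i) \<in> wset n s j \<and> fst s 1 j (fst s 5 0 i) \<in> wset n s j)"
        using protD(2)[OF pr i(1) _ i'(2)] k ot by simp
      then show "\<not> (A (fst s' 5 0 i) \<in> W \<and> B (fst s' 5 0 i) \<in> W)" using fr[of 5] unfolding nms by simp
      fix j' assume j': "j' < j" "i < j'"
      show "fst s' 5 0 i \<notin> {fst s' 6 0 j', fst s' 7 0 j', fst s' 9 0 j'}" if "fst s' 4 0 j' = 1"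
        using protD(1)[OF pr j'(2) _ i'(2)] k j'(1) that fr by simp
      show "\<not> (fst s' 0 j' (fst s' 5 0 i) \<in> wset n s' j' \<and> fst s' 1 j' (fst s' 5 0 i) \<in> wset n s' j')" if "fst s' 4 0 j' = 2"
        using protD(2)[OF pr j'(2) _ i'(2)] k j'(1) that fr unfolding ws by simp
    qed
    show "lab_zero n s'" using I fr[of 32] by (simp add: inv_def lab_zero_def)
    show "fst s' 14 0 0 = 0 \<or> fst s' 14 0 0 = 1 \<and> j = 0 \<and> fst s' 13 0 0 = 1" using fr[of 14] dn by simp
  qed
  have "(\<Sum>i<j. if fst s' 4 0 i = 1 then 1 else 2 * card (wset n s' i) - 4 + 1) =
    (\<Sum>i<j. if fst s 4 0 i = 1 then 1 else 2 * card (wset n s i) - 4 + 1)"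
    by (rule sum.cong) (use fr ws in auto)
  then show "mu n s' < mu n s" using k13 mo ot unfolding mu_def k k' reg' W_def by simp
qed

text \<open>Being at level 0 in backward mode means that the classes are valid for the input graph.
  Flag 14 then makes all later steps idle, as the surrounding loop has a fixed length.\<close>

definition POP :: hp where
  "POP = Sq (SetV 13 (C 1)) (If (Eq (V 11) (C 0)) (SetV 14 (C 1)) (If (Eq (A1 4 (Dec (V 11))) (C 1)) INS UNCON))"

lemma inv_mode1:
  fixes s and n m :: nat defines "s' \<equiv> den n m (SetV 13 (C 1)) s"
  assumes I: "inv n m A0 B0 s Vs" and dn: "fst s 14 0 0 = 0"
    and c: "\<exists>t\<in>Vs (fst s 11 0 0). valid m (level_A s) (level_B s) (fst s 31 0) (Vs (fst s 11 0 0)) {t}"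
  shows "inv n m A0 B0 s' Vs" "mu n s' \<le> mu n s" "fst s' 13 0 0 = 1" "fst s' 14 0 0 = 0" "fst s' 11 0 0 = fst s 11 0 0"
proof -
  have e: "fst s' j = fst s j" if "j \<noteq> 13" for j unfolding s'_def by (rule den_frame) (use that in auto)
  have e': "fst s' 0 = fst s 0" "fst s' 1 = fst s 1" "fst s' 2 = fst s 2" "fst s' 3 = fst s 3" "fst s' 4 = fst s 4" "fst s' 5 = fst s 5"
    "fst s' 6 = fst s 6" "fst s' 7 = fst s 7" "fst s' 8 = fst s 8" "fst s' 9 = fst s 9" "fst s' 10 = fst s 10" "fst s' 11 = fst s 11"
    "fst s' 12 = fst s 12" "fst s' 14 = fst s 14" "fst s' 15 = fst s 15" "fst s' 31 = fst s 31" "fst s' 32 = fst s 32"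
    by (rule e; simp)+
  show m13: "fst s' 13 0 0 = 1" by (simp add: s'_def upd_def)
  show "inv n m A0 B0 s' Vs" using I c dn
    unfolding inv_def lev_ok_def del_op_def con_op_def cur_ok_def prot_def wset_def level_A_def level_B_def reg_def e' m13 lab_zero_def
    by simp
  show "mu n s' \<le> mu n s" unfolding mu_def reg_def wset_def e' m13 by simp
  show "fst s' 14 0 0 = 0" "fst s' 11 0 0 = fst s 11 0 0" using e' dn by simp_all
qed

lemma POP_correct:
  fixes s and n m :: nat defines "s' \<equiv> den n m POP s"
  assumes I: "inv n m A0 B0 s Vs" and dn: "fst s 14 0 0 = 0"
    and c: "\<exists>t\<in>Vs (fst s 11 0 0). valid m (level_A s) (level_B s) (fst s 31 0) (Vs (fst s 11 0 0)) {t}"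
  shows "inv n m A0 B0 s' Vs" "fst s' 14 0 0 = 0 \<Longrightarrow> mu n s' < mu n s"
proof -
  define s1 where "s1 = den n m (SetV 13 (C 1)) s"
  note 1 = inv_mode1[OF I dn c, folded s1_def]
  define p where "p = If (Eq (A1 4 (Dec (V 11))) (C 1)) INS UNCON"
  have s': "s' = den n m (If (Eq (V 11) (C 0)) (SetV 14 (C 1)) p) s1"
    unfolding s'_def POP_def s1_def p_def by (simp only: den.simps(5))
  have "inv n m A0 B0 s' Vs \<and> (fst s' 14 0 0 = 0 \<longrightarrow> mu n s' < mu n s)"
  proof (cases "fst s1 11 0 0")
    case 0
    have s2: "s' = den n m (SetV 14 (C 1)) s1" unfolding s' by (rule den_If_True) (use 0 in simp)
    have e: "fst s' j = fst s1 j" if "j \<noteq> 14" for j unfolding s2 by (rule den_frame) (use that in auto)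
    have e': "fst s' 0 = fst s1 0" "fst s' 1 = fst s1 1" "fst s' 2 = fst s1 2" "fst s' 3 = fst s1 3" "fst s' 4 = fst s1 4" "fst s' 5 = fst s1 5"
      "fst s' 6 = fst s1 6" "fst s' 7 = fst s1 7" "fst s' 8 = fst s1 8" "fst s' 9 = fst s1 9" "fst s' 10 = fst s1 10" "fst s' 11 = fst s1 11"
      "fst s' 12 = fst s1 12" "fst s' 13 = fst s1 13" "fst s' 15 = fst s1 15" "fst s' 31 = fst s1 31" "fst s' 32 = fst s1 32"
      by (rule e; simp)+
    have m14: "fst s' 14 0 0 = 1" by (simp add: s2 upd_def)
    have eqs: "lev_ok n m s' Vs = lev_ok n m s1 Vs" "cur_ok n m s' Vs = cur_ok n m s1 Vs" "prot n s' = prot n s1" "lab_zero n s' = lab_zero n s1"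
      unfolding lev_ok_def cur_ok_def prot_def wset_def level_A_def level_B_def reg_def e' lab_zero_def by (rule refl)+
    have "inv n m A0 B0 s' Vs" using 1(1,3) 0 unfolding inv_def eqs e' m14 by simp
    then show ?thesis using m14 by simp
  next
    case (Suc j)
    have s2: "s' = den n m p s1" unfolding s' by (rule den_If_False) (use Suc in simp)
    show ?thesis
    proof (cases "fst s1 4 0 j = 1")
      case True
      have "s' = den n m INS s1" unfolding s2 p_def by (rule den_If_True) (use True Suc in simp)
      then show ?thesis using INS_correct[OF 1(1,3,4) Suc True] 1(2) by simp
    next
      case False
      have "s' = den n m UNCON s1" unfolding s2 p_def by (rule den_If_False) (use False Suc in simp)
      moreover have "fst s1 4 0 j = 2" using 1(1) Suc False by (auto simp: inv_def)
      ultimately show ?thesis using UNCON_correct[OF 1(1,3,4) Suc] 1(2) by simp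
    qed
  qed
  then show "inv n m A0 B0 s' Vs" "fst s' 14 0 0 = 0 \<Longrightarrow> mu n s' < mu n s" by auto
qed

section \<open>The reduction loop\<close>

definition STEP :: hp where
  "STEP = If1 (Eq (V 14) (C 0)) (Sq (If (Eq (V 13) (C 0)) PREP1 (SetV 18 (C 0)))
     (If (Eq (V 18) (C 1)) (Sq PREP2 (Sq SEARCH (If (Eq (V 27) (C 1)) CONT DEL))) POP))"

lemma STEP_reduce:
  fixes s and n m :: nat
  assumes I: "inv n m A0 B0 s Vs" and mo: "fst s 13 0 0 = 0" and dn: "fst s 14 0 0 = 0"
    and fd: "fst (den n m PREP1 s) 18 0 0 = 1"
  defines "s' \<equiv> den n m (Sq PREP2 (Sq SEARCH (If (Eq (V 27) (C 1)) CONT DEL))) (den n m PREP1 s)"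
  shows "(\<exists>Vs. inv n m A0 B0 s' Vs) \<and> mu n s' < mu n s"
proof -
  define s1 where "s1 = den n m PREP1 s"
  define s2 where "s2 = den n m PREP2 s1"
  define s3 where "s3 = den n m SEARCH s2"
  have s': "s' = den n m (If (Eq (V 27) (C 1)) CONT DEL) s3" unfolding s'_def s3_def s2_def s1_def by (simp only: den.simps(5))
  have f1: "fst s1 i = fst s i" if "i \<notin> {16, 18, 40, 17, 79}" for i
    unfolding s1_def by (rule den_frame) (use that in \<open>simp add: asg_PREP1\<close>)
  have f2: "fst s2 i = fst s1 i" if "i \<notin> {45, 40, 19, 79, 25, 20, 21, 22, 23, 24, 46}" for i
    unfolding s2_def by (rule den_frame) (use that in \<open>simp add: asg_PREP2\<close>)
  have f3: "fst s3 i = fst s2 i" if "i \<notin> {26, 40, 34, 35, 42, 32, 41, 33, 79, 47, 29, 27, 28, 30, 46, 36}" for i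
    unfolding s3_def by (rule den_frame) (use that in \<open>simp add: asg_SEARCH\<close>)
  define A where "A = level_A s"
  define B where "B = level_B s"
  define S where "S = reg n s"
  define x where "x = fst s 15 0 0"
  have lv: "level_A s1 = A" "level_B s1 = B" "reg n s1 = S" "level_A s2 = A" "level_B s2 = B" "reg n s2 = S"
    "level_A s3 = A" "level_B s3 = B" "reg n s3 = S"
    using f1 f2 f3 by (simp_all add: level_A_def level_B_def reg_def A_def B_def S_def)
  note ids = inv_bound(2)[OF I]
  have R: "region m A B S" and xc: "x \<in> cut m A B S"
    using I mo unfolding inv_def cur_ok_def Let_def A_def B_def S_def x_def by auto
  note p1 = PREP1_correct[OF ids, OF _ xc[unfolded A_def B_def S_def x_def], folded s1_def A_def B_def S_def x_def]
  let ?a = "fst s1 16 0 0" and ?e = "fst s1 17 0 0"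
  define b0 where "b0 = oth A B ?a x"
  have a: "?a \<in> S" "b0 \<notin> S" "joins A B x b0 ?a" using p1(1-3) unfolding b0_def by blast+
  have fd1: "fst s1 18 0 0 = 1" using fd by (simp add: s1_def)
  have e: "?e < m \<and> ?e \<noteq> x \<and> cr A B {?a} ?e \<and> oth A B ?a ?e \<in> S" using p1(4) fd1 by auto
  have xa: "x \<in> cut m A B {?a}" using xc a cr_joins[OF a(3), of "{?a}"] by (auto simp: in_cut)
  have x1: "fst s1 15 0 0 = x" using f1[of 15] by (simp add: x_def)
  have prep: "prep_ok m A B S x ?a ?e (fst s2 20 0 0) (fst s2 19 0 0) (fst s2 25 0 0) (fst s2 21 0 0) (fst s2 23 0 0) (fst s2 22 0 0) (fst s2 24 0 0)"
    unfolding s2_def using PREP2_correct[of m s1 n, unfolded lv x1] ids[folded A_def B_def] R xc xa a(1) e by blast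
  have a2: "fst s2 16 0 0 = ?a" "fst s2 17 0 0 = ?e" "fst s2 15 0 0 = x" using f2 x1 by simp_all
  have lz2: "lab_zero n s2" using I f1[of 32] f2[of 32] by (simp add: inv_def lab_zero_def)
  note sr = SEARCH_correct[of m s2 n, unfolded lv a2, folded s3_def, OF ids[folded A_def B_def] lz2 R prep a(1)]
  have f13: "fst s3 q = fst s q" if "q \<in> {0..15} \<union> {31}" for q
    using that f1[of q] f2[of q] f3[of q] by auto
  have lz3: "lab_zero n s3" using sr(1) by blast
  have I3: "inv n m A0 B0 s3 Vs" "mu n s3 = mu n s" using inv_cong[OF I f13 lz3] by blast+
  have mo3: "fst s3 13 0 0 = 0" "fst s3 14 0 0 = 0" using f1 f2 f3 mo dn by simp_all
  from sr(2) have "(fst s3 27 0 0 = 1 \<and> labset n s3 \<subseteq> S - {?a} \<and> 2 \<le> card (labset n s3) \<and>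
        card (cut m A B (labset n s3)) = 3) \<or>
      (fst s3 27 0 0 = 0 \<and> (\<forall>W\<subseteq>S - {?a}. fst s2 20 0 0 \<in> W \<longrightarrow> 2 \<le> card W \<longrightarrow> card (cut m A B W) \<noteq> 3))" by blast
  then show ?thesis
  proof (elim disjE conjE)
    assume h: "fst s3 27 0 0 = 1" "labset n s3 \<subseteq> S - {?a}" "2 \<le> card (labset n s3)" "card (cut m A B (labset n s3)) = 3"
    have "s' = den n m CONT s3" unfolding s' by (rule den_If_True) (use h in simp)
    moreover have "labset n s3 \<subset> reg n s3" using h(2) a(1) lv by auto
    ultimately show ?thesis using CONT_correct[OF I3(1) mo3, unfolded lv] h I3(2) lv by auto
  next
    assume h: "fst s3 27 0 0 = 0" "\<forall>W\<subseteq>S - {?a}. fst s2 20 0 0 \<in> W \<longrightarrow> 2 \<le> card W \<longrightarrow> card (cut m A B W) \<noteq> 3"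
    have "s' = den n m DEL s3" unfolding s' by (rule den_If_False) (use h in simp)
    moreover have v3: "fst s3 15 0 0 = x" "fst s3 16 0 0 = ?a" "fst s3 17 0 0 = ?e" "fst s3 19 0 0 = fst s2 19 0 0" "fst s3 20 0 0 = fst s2 20 0 0"
      "fst s3 21 0 0 = fst s2 21 0 0" "fst s3 22 0 0 = fst s2 22 0 0" "fst s3 23 0 0 = fst s2 23 0 0" "fst s3 24 0 0 = fst s2 24 0 0"
      "fst s3 25 0 0 = fst s2 25 0 0" using f3 a2 by simp_all
    ultimately show ?thesis using DEL_correct[OF I3(1) mo3, where ?b0.0 = b0, unfolded lv v3, OF a(1,3,2) prep h(2)] I3(2) by auto
  qed
qed

lemma STEP_correct:
  fixes s and n m :: nat defines "s' \<equiv> den n m STEP s"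
  assumes I: "inv n m A0 B0 s Vs"
  shows "(\<exists>Vs. inv n m A0 B0 s' Vs) \<and> (fst s' 14 0 0 = 0 \<longrightarrow> mu n s' < mu n s)"
proof (cases "fst s 14 0 0 = 0")
  case False
  have s': "s' = den n m Sk s" unfolding s'_def STEP_def by (rule den_If_False) (use False in simp)
  have e: "fst s' j = fst s j" if "j \<noteq> 79" for j unfolding s' by (rule den_frame) (use that in auto)
  have "inv n m A0 B0 s' Vs" by (rule inv_cong(1)[OF I]) (use e I in \<open>auto simp: inv_def lab_zero_def\<close>)
  then show ?thesis using e[of 14] False by auto
next
  case dn: True
  define s1 where "s1 = den n m (If (Eq (V 13) (C 0)) PREP1 (SetV 18 (C 0))) s"
  let ?p = "Sq PREP2 (Sq SEARCH (If (Eq (V 27) (C 1)) CONT DEL))"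
  have s': "s' = den n m (If (Eq (V 18) (C 1)) ?p POP) s1"
  proof -
    have "s' = den n m (Sq (If (Eq (V 13) (C 0)) PREP1 (SetV 18 (C 0))) (If (Eq (V 18) (C 1)) ?p POP)) s"
      unfolding s'_def STEP_def by (rule den_If_True) (use dn in simp)
    then show ?thesis unfolding s1_def by (simp only: den.simps(5))
  qed
  have f1: "fst s1 i = fst s i" if "i \<notin> {16, 18, 40, 17, 79}" for i
    unfolding s1_def by (rule den_frame) (use that in \<open>simp add: asg_PREP1\<close>)
  have I1: "inv n m A0 B0 s1 Vs" "mu n s1 = mu n s"
    by (rule inv_cong[OF I]; use f1 I in \<open>auto simp: inv_def lab_zero_def\<close>)+
  have lv: "level_A s1 = level_A s" "level_B s1 = level_B s" "reg n s1 = reg n s"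
    using f1 by (simp_all add: level_A_def level_B_def reg_def)
  show ?thesis
  proof (cases "fst s 13 0 0 = 0")
    case mo: True
    have s1: "s1 = den n m PREP1 s" unfolding s1_def by (rule den_If_True) (use mo in simp)
    show ?thesis
    proof (cases "fst s1 18 0 0 = 1")
      case True
      have "s' = den n m ?p s1" unfolding s' by (rule den_If_True) (use True in simp)
      then show ?thesis using STEP_reduce[OF I mo dn] True unfolding s1 by blast
    next
      case False
      have s'': "s' = den n m POP s1" unfolding s' by (rule den_If_False) (use False in simp)
      define A where "A = level_A s"
      define B where "B = level_B s"
      define S where "S = reg n s"
      define x where "x = fst s 15 0 0"
      have R: "region m A B S" and xc: "x \<in> cut m A B S" and SV: "S \<subseteq> Vs (fst s 11 0 0)"
        and val: "valid m A B (fst s 31 0) (Vs (fst s 11 0 0)) S"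
        using I mo unfolding inv_def cur_ok_def Let_def A_def B_def S_def x_def by auto
      note p1 = PREP1_correct[OF inv_bound(2)[OF I], OF _ xc[unfolded A_def B_def S_def x_def], folded s1 A_def B_def S_def x_def]
      let ?a = "fst s1 16 0 0"
      define b0 where "b0 = oth A B ?a x"
      have a: "?a \<in> S" "b0 \<notin> S" "joins A B x b0 ?a" using p1(1-3) unfolding b0_def by blast+
      have no: "\<forall>i<m. i \<noteq> x \<longrightarrow> cr A B {?a} i \<longrightarrow> cr A B S i" using p1(4) False by auto
      have xa: "x \<in> cut m A B {?a}" using xc a cr_joins[OF a(3), of "{?a}"] by (auto simp: in_cut)
      \<comment> \<open>Every edge at \<open>a\<close> other than \<open>x\<close> leaves
        \<open>S\<close> too, but a region with more vertices has only one boundary edge at each of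
        them.\<close>
      have S1: "S = {?a}"
      proof (rule ccontr)
        assume S: "S \<noteq> {?a}"
        have "card (cut m A B {?a}) = 3" using R a(1) by (simp add: region_def)
        then have "cut m A B {?a} \<noteq> {x}" by auto
        then obtain i where i: "i \<in> cut m A B {?a}" "i \<noteq> x" using xa by auto
        then have "i \<in> cut m A B S" using no by (auto simp: in_cut)
        then show False using region_local[OF R xc xa a(1) i S] by simp
      qed
      have "\<exists>t\<in>Vs (fst s1 11 0 0). valid m (level_A s1) (level_B s1) (fst s1 31 0) (Vs (fst s1 11 0 0)) {t}"
        using val SV a(1) f1[of 11] f1[of 31] unfolding S1 lv A_def B_def by auto
      from POP_correct[OF I1(1) _ this] show ?thesis using f1[of 14] dn I1(2) unfolding s'' by auto
    qed
  next
    case mo: False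
    have s1: "s1 = den n m (SetV 18 (C 0)) s" unfolding s1_def by (rule den_If_False) (use mo in simp)
    have "fst s1 18 0 0 = 0" unfolding s1 by (simp add: upd_apply)
    then have s'': "s' = den n m POP s1" unfolding s' by (intro den_If_False) simp
    have "\<exists>t\<in>Vs (fst s1 11 0 0). valid m (level_A s1) (level_B s1) (fst s1 31 0) (Vs (fst s1 11 0 0)) {t}"
      using I1(1) mo f1[of 13] unfolding inv_def cur_ok_def Let_def by auto
    from POP_correct[OF I1(1) _ this] show ?thesis using f1[of 14] dn I1(2) unfolding s'' by auto
  qed
qed

definition REDUCE :: hp where
  "REDUCE = For 44 (LN 2) STEP"

text \<open>\<open>mu\<close> starts below \<open>2 * n\<close> and falls in every step that does
  not finish, so the \<open>2 * n\<close> rounds of the loop cannot all be unfinished.\<close>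

lemma REDUCE_correct:
  fixes s and n m :: nat defines "s' \<equiv> den n m REDUCE s"
  assumes I: "inv n m A0 B0 s Vs" and m: "mu n s < 2 * n"
  shows "\<exists>t<n. valid m A0 B0 (fst s' 31 0) {..<n} {t}" "\<forall>i<m. fst s' 31 0 i \<le> 3" "lab_zero n s'"
    "\<forall>i<m. fst s' 0 0 i = A0 i \<and> fst s' 1 0 i = B0 i" "fst s' 11 0 0 = 0"
proof -
  define J where "J j t \<longleftrightarrow> (\<exists>Vs. inv n m A0 B0 t Vs) \<and> (fst t 14 0 0 = 0 \<longrightarrow> mu n t + j < 2 * n)"
    for j and t :: store
  have sv: "J j (setv 44 x t)" if "J j t" for j x t
  proof -
    obtain Vs where Vs: "inv n m A0 B0 t Vs" using \<open>J j t\<close> by (auto simp: J_def)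
    have z: "lab_zero n (setv 44 x t)" using Vs by (simp add: inv_def lab_zero_def)
    have "fst (setv 44 x t) q = fst t q" if "q \<in> {0..15} \<union> {31}" for q using that by auto
    note c = inv_cong[OF Vs this z]
    show ?thesis using \<open>J j t\<close> c unfolding J_def by auto
  qed
  have "J (lv n m (LN 2)) s'" unfolding s'_def REDUCE_def
  proof (rule for_rule)
    show "J 0 (setv 44 0 s)" by (rule sv) (use I m in \<open>auto simp: J_def\<close>)
    fix j and t :: store assume "J j t"
    then obtain Vs where Vs: "inv n m A0 B0 t Vs" and mt: "fst t 14 0 0 = 0 \<Longrightarrow> mu n t + j < 2 * n" by (auto simp: J_def)
    have st: "fst t 14 0 0 = 0" if "fst (den n m STEP t) 14 0 0 = 0"
    proof (rule ccontr)
      assume n: "fst t 14 0 0 \<noteq> 0"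
      have s': "den n m STEP t = den n m Sk t" unfolding STEP_def by (rule den_If_False) (use n in simp)
      have "fst (den n m STEP t) 14 = fst t 14" unfolding s' by (rule den_frame) auto
      then show False using that n by simp
    qed
    show "J (Suc j) (setv 44 (Suc j) (den n m STEP t))"
      by (rule sv) (use STEP_correct[OF Vs] mt st in \<open>fastforce simp: J_def\<close>)
  qed
  then have "J (2 * n) s'" by simp
  then obtain Vs where Vs: "inv n m A0 B0 s' Vs" and d: "fst s' 14 0 0 \<noteq> 0" by (auto simp: J_def)
  then have k: "fst s' 11 0 0 = 0" "fst s' 13 0 0 = 1" and V0: "Vs 0 = {..<n}" by (auto simp: inv_def)
  then obtain t where t: "t < n" "valid m (fst s' 0 0) (fst s' 1 0) (fst s' 31 0) {..<n} {t}"
    using Vs unfolding inv_def cur_ok_def Let_def level_A_def level_B_def by auto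
  have "valid m (fst s' 0 0) (fst s' 1 0) (fst s' 31 0) {..<n} {t} = valid m A0 B0 (fst s' 31 0) {..<n} {t}"
    by (rule valid_congr) (use Vs in \<open>auto simp: inv_def\<close>)
  then show "\<exists>t<n. valid m A0 B0 (fst s' 31 0) {..<n} {t}" using t by auto
  show "\<forall>i<m. fst s' 31 0 i \<le> 3" "lab_zero n s'" "\<forall>i<m. fst s' 0 0 i = A0 i \<and> fst s' 1 0 i = B0 i" "fst s' 11 0 0 = 0"
    using Vs k by (auto simp: inv_def)
qed

section \<open>Colouring links over a rooted tree\<close>

text \<open>\<open>anc v\<close> consists of \<open>v\<close> and its ancestors. The tree edge above
  \<open>y\<close> lies on the tree path between two vertices exactly if \<open>y\<close> is an
  ancestor of one of them only.\<close>

definition covers :: "(nat \<Rightarrow> nat set) \<Rightarrow> (nat \<Rightarrow> nat) \<Rightarrow> (nat \<Rightarrow> nat) \<Rightarrow> nat \<Rightarrow> nat \<Rightarrow> bool" where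
  "covers anc A B i y \<longleftrightarrow> (y \<in> anc (A i)) \<noteq> (y \<in> anc (B i))"

text \<open>The common ancestors form the path from the root to the meet, so that their number
  measures its depth.\<close>

definition depth_meet :: "(nat \<Rightarrow> nat set) \<Rightarrow> (nat \<Rightarrow> nat) \<Rightarrow> (nat \<Rightarrow> nat) \<Rightarrow> nat \<Rightarrow> nat" where
  "depth_meet anc A B i = card (anc (A i) \<inter> anc (B i))"

text \<open>State \<open>st y\<close> of the tree edge above \<open>y\<close>: 0 uncovered, \<open>c \<le> 3\<close> covered by a single link, of colour \<open>c\<close>, 4 covered in two colours.\<close>

definition colour_ok :: "nat \<Rightarrow> (nat \<Rightarrow> nat set) \<Rightarrow> (nat \<Rightarrow> nat) \<Rightarrow> (nat \<Rightarrow> nat) \<Rightarrow> nat set \<Rightarrow> (nat \<Rightarrow> nat) \<Rightarrow> (nat \<Rightarrow> nat) \<Rightarrow> bool" where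
  "colour_ok n anc A B P st col \<longleftrightarrow> (\<forall>i\<in>P. col i \<in> {1, 2, 3}) \<and> (\<forall>y<n.
     (st y = 0 \<longrightarrow> (\<forall>i\<in>P. \<not> covers anc A B i y)) \<and>
     (st y \<in> {1, 2, 3} \<longrightarrow> (\<exists>i\<in>P. covers anc A B i y \<and> col i = st y \<and> (\<forall>j\<in>P. covers anc A B j y \<longrightarrow> j = i))) \<and>
     (3 < st y \<longrightarrow> (\<exists>i\<in>P. \<exists>j\<in>P. covers anc A B i y \<and> covers anc A B j y \<and> col i \<noteq> col j)))"

text \<open>All that the colouring argument needs of a tree: ancestor sets are nested, and each of
  them is a chain. This separates it from the way the tree is stored.\<close>

locale ancestors =
  fixes n :: nat and anc :: "nat \<Rightarrow> nat set"
  assumes self: "v < n \<Longrightarrow> v \<in> anc v" and sub: "v < n \<Longrightarrow> anc v \<subseteq> {..<n}"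
    and trans: "u < n \<Longrightarrow> z \<in> anc u \<Longrightarrow> anc z \<subseteq> anc u"
    and chain: "u < n \<Longrightarrow> y \<in> anc u \<Longrightarrow> z \<in> anc u \<Longrightarrow> y \<in> anc z \<or> z \<in> anc y"
begin

lemma finite_anc: "v < n \<Longrightarrow> finite (anc v)"
  using sub finite_subset by blast

text \<open>The meet of \<open>p\<close>, \<open>q\<close> is not deeper than that of \<open>u\<close>, \<open>v\<close>, so a link \<open>pq\<close> covering a tree edge on the \<open>u\<close>-side covers everything above it on that side.\<close>

lemma cover_up:
  assumes lt: "u < n" "v < n" "p < n" "q < n" and y: "y1 \<in> anc u" "y2 \<in> anc u" "y2 \<notin> anc v" "y2 \<in> anc y1"
    and le: "card (anc p \<inter> anc q) \<le> card (anc u \<inter> anc v)" and p: "y1 \<in> anc p"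
  shows "y2 \<in> anc p \<and> y2 \<notin> anc q"
proof -
  have y2: "y2 < n" using sub[OF lt(1)] y by auto
  have yp: "y2 \<in> anc p" using trans[OF lt(3) p] y(4) by auto
  have "y2 \<notin> anc q"
  proof
    assume yq: "y2 \<in> anc q"
    have "anc y2 \<subseteq> anc p \<inter> anc q" using trans[OF lt(3) yp] trans[OF lt(4) yq] by auto
    then have 1: "card (anc y2) \<le> card (anc p \<inter> anc q)" using finite_anc[OF lt(3)] by (intro card_mono) auto
    have "anc u \<inter> anc v \<subset> anc y2"
    proof
      show "anc u \<inter> anc v \<subseteq> anc y2"
      proof
        fix z assume z: "z \<in> anc u \<inter> anc v"
        then have "y2 \<in> anc z \<or> z \<in> anc y2" using chain[OF lt(1) y(2)] by auto
        moreover have "y2 \<notin> anc z" using z trans[OF lt(2), of z] y(3) by auto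
        ultimately show "z \<in> anc y2" by simp
      qed
      show "anc u \<inter> anc v \<noteq> anc y2" using self[OF y2] y(3) by auto
    qed
    then have "card (anc u \<inter> anc v) < card (anc y2)" using finite_anc[OF y2] by (rule psubset_card_mono[rotated])
    then show False using 1 le by simp
  qed
  then show ?thesis using yp by simp
qed

text \<open>Let \<open>y2\<close> lie above \<open>y1\<close>. By \<open>cover_up\<close> the only
  link covering \<open>y1\<close> also covers \<open>y2\<close>, so it is the only one there and the
  colours agree. Either end of that link may be the one below \<open>y1\<close>, hence the use of
  \<open>cover_up\<close> in both orders.\<close>

lemma mono_agree:
  assumes ok: "colour_ok n anc A B P st col" and lt: "u < n" "v < n" "\<And>i. i \<in> P \<Longrightarrow> A i < n \<and> B i < n"
    and le: "\<And>i. i \<in> P \<Longrightarrow> depth_meet anc A B i \<le> card (anc u \<inter> anc v)"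
    and y: "y1 \<in> anc u - anc v" "y2 \<in> anc u - anc v" "st y1 \<in> {1, 2, 3}" "st y2 \<in> {1, 2, 3}"
  shows "st y1 = st y2"
proof -
  have up: "st y1 = st y2" if y: "y1 \<in> anc u - anc v" "y2 \<in> anc u - anc v" "st y1 \<in> {1, 2, 3}" "st y2 \<in> {1, 2, 3}" and a: "y2 \<in> anc y1" for y1 y2
  proof -
    have yn: "y1 < n" "y2 < n" using y sub[OF lt(1)] by auto
    obtain i where i: "i \<in> P" "covers anc A B i y1" "col i = st y1" using ok yn(1) y(3) unfolding colour_ok_def by meson
    obtain j where j: "col j = st y2" "\<And>k. k \<in> P \<Longrightarrow> covers anc A B k y2 \<Longrightarrow> k = j" using ok yn(2) y(4) unfolding colour_ok_def by meson
    have ln: "A i < n" "B i < n" using lt(3)[OF i(1)] by auto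
    have le1: "card (anc (A i) \<inter> anc (B i)) \<le> card (anc u \<inter> anc v)" using le[OF i(1)] by (simp add: depth_meet_def)
    then have le2: "card (anc (B i) \<inter> anc (A i)) \<le> card (anc u \<inter> anc v)" by (simp add: Int_commute)
    have yy: "y1 \<in> anc u" "y2 \<in> anc u" "y2 \<notin> anc v" using y by auto
    have "covers anc A B i y2"
      using i(2) cover_up[OF lt(1,2) ln yy a le1] cover_up[OF lt(1,2) ln(2,1) yy a le2] unfolding covers_def by blast
    then have "i = j" using j(2)[OF i(1)] by simp
    then show ?thesis using i(3) j(1) by simp
  qed
  have "y1 \<in> anc y2 \<or> y2 \<in> anc y1" using chain[OF lt(1), of y1 y2] y by auto
  then show ?thesis using up[OF y] up[OF y(2,1,4,3)] by auto
qed

text \<open>A singly covered tree edge that the new link covers becomes two-coloured, because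
  \<open>c\<close> differs from the colour common to its side. By \<open>mono_agree\<close> it is
  enough that the hypotheses exhibit one representative per side.\<close>

lemma colour_step:
  assumes ok: "colour_ok n anc A B P st col" and b: "b \<notin> P" "A b < n" "B b < n" and lt: "\<And>i. i \<in> P \<Longrightarrow> A i < n \<and> B i < n"
    and le: "\<And>i. i \<in> P \<Longrightarrow> depth_meet anc A B i \<le> depth_meet anc A B b" and c: "c \<in> {1, 2, 3}"
    and u: "\<And>y. y \<in> anc (A b) - anc (B b) \<Longrightarrow> st y \<in> {1, 2, 3} \<Longrightarrow> \<exists>y'\<in>anc (A b) - anc (B b). st y' \<in> {1, 2, 3} \<and> c \<noteq> st y'"
    and v: "\<And>y. y \<in> anc (B b) - anc (A b) \<Longrightarrow> st y \<in> {1, 2, 3} \<Longrightarrow> \<exists>y'\<in>anc (B b) - anc (A b). st y' \<in> {1, 2, 3} \<and> c \<noteq> st y'"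
    and col': "col' = col(b := c)"
    and st': "\<And>y. y < n \<Longrightarrow> st' y = (if covers anc A B b y then (if st y = 0 then c else if st y \<noteq> c then 4 else st y) else st y)"
  shows "colour_ok n anc A B (insert b P) st' col'"
  unfolding colour_ok_def
proof (intro conjI allI impI)
  show "\<forall>i\<in>insert b P. col' i \<in> {1, 2, 3}" using ok c col' by (auto simp: colour_ok_def)
  fix y assume y: "y < n"
  have ok1: "st y = 0 \<Longrightarrow> i \<in> P \<Longrightarrow> \<not> covers anc A B i y" for i using ok y unfolding colour_ok_def by meson
  have ok2: "\<exists>i\<in>P. covers anc A B i y \<and> col i = st y \<and> (\<forall>j\<in>P. covers anc A B j y \<longrightarrow> j = i)" if "st y \<in> {1, 2, 3}"
    using ok y that unfolding colour_ok_def by meson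
  have ok3: "\<exists>i\<in>P. \<exists>j\<in>P. covers anc A B i y \<and> covers anc A B j y \<and> col i \<noteq> col j" if "3 < st y"
    using ok y that unfolding colour_ok_def by meson
  have colP: "col' i = col i" if "i \<in> P" for i using that b col' by auto
  have le1: "depth_meet anc A B i \<le> card (anc (A b) \<inter> anc (B b))" if "i \<in> P" for i using le[OF that] by (simp add: depth_meet_def)
  have le2: "depth_meet anc A B i \<le> card (anc (B b) \<inter> anc (A b))" if "i \<in> P" for i using le1[OF that] by (simp add: Int_commute)
  have ne: "st y \<noteq> c" if cv: "covers anc A B b y" and s: "st y \<in> {1, 2, 3}"
  proof (cases "y \<in> anc (A b)")
    case True
    then have y1: "y \<in> anc (A b) - anc (B b)" using cv by (auto simp: covers_def)
    from u[OF this s] obtain y' where y': "y' \<in> anc (A b) - anc (B b)" "st y' \<in> {1, 2, 3}" "c \<noteq> st y'" by blast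
    show ?thesis using mono_agree[OF ok b(2,3) lt le1 y1 y'(1) s y'(2)] y'(3) by simp
  next
    case False
    then have y1: "y \<in> anc (B b) - anc (A b)" using cv by (auto simp: covers_def)
    from v[OF this s] obtain y' where y': "y' \<in> anc (B b) - anc (A b)" "st y' \<in> {1, 2, 3}" "c \<noteq> st y'" by blast
    show ?thesis using mono_agree[OF ok b(3,2) lt le2 y1 y'(1) s y'(2)] y'(3) by simp
  qed
  show "\<forall>i\<in>insert b P. \<not> covers anc A B i y" if "st' y = 0"
    using that st'[OF y] c ok1 by (auto split: if_splits)
  show "\<exists>i\<in>insert b P. covers anc A B i y \<and> col' i = st' y \<and> (\<forall>j\<in>insert b P. covers anc A B j y \<longrightarrow> j = i)" if s: "st' y \<in> {1, 2, 3}"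
  proof (cases "covers anc A B b y")
    case True
    then have "st y = 0 \<or> st y = c" using st'[OF y] s by (auto split: if_splits)
    then have "st y = 0" using ne[OF True] c by auto
    then show ?thesis using True st'[OF y] ok1 col' by auto
  next
    case False
    then have "st' y = st y" using st'[OF y] by simp
    then obtain i where i: "i \<in> P" "covers anc A B i y" "col i = st' y" "\<forall>j\<in>P. covers anc A B j y \<longrightarrow> j = i"
      using ok2 s by metis
    have "\<forall>j\<in>insert b P. covers anc A B j y \<longrightarrow> j = i" using i(4) False by blast
    moreover have "col' i = st' y" using colP[OF i(1)] i(3) by simp
    ultimately show ?thesis using i(1,2) by blast
  qed
  show "\<exists>i\<in>insert b P. \<exists>j\<in>insert b P. covers anc A B i y \<and> covers anc A B j y \<and> col' i \<noteq> col' j" if s: "3 < st' y"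
  proof (cases "3 < st y")
    case True
    then obtain i j where "i \<in> P" "j \<in> P" "covers anc A B i y" "covers anc A B j y" "col i \<noteq> col j" using ok3 by blast
    moreover from this have "col' i \<noteq> col' j" using colP by simp
    ultimately show ?thesis by blast
  next
    case False
    then have cv: "covers anc A B b y" and n: "st y \<noteq> 0" "st y \<noteq> c" using st'[OF y] s c by (auto split: if_splits)
    then have "st y \<in> {1, 2, 3}" using False by auto
    then obtain i where i: "i \<in> P" "covers anc A B i y" "col i = st y" using ok2 by blast
    then have "col' i \<noteq> col' b" using colP n col' by auto
    then show ?thesis using i(1,2) cv by blast
  qed
qed

end

section \<open>The tree formed by the predecessors of a search from vertex 0\<close>

locale rooted_tree =
  fixes n m :: nat and A B L P al :: "nat \<Rightarrow> nat"
  assumes n: "0 < n" and ends: "i < m \<Longrightarrow> A i < n \<and> B i < n"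
    and pk: "pred_ok m A B al al (\<lambda>v. of_bool (v = 0)) L P" and lab: "v < n \<Longrightarrow> L v \<noteq> 0"
begin

definition par :: "nat \<Rightarrow> nat" where "par v = oth A B v (P v)"
text \<open>\<open>L v\<close> is the number of vertices on the path from \<open>v\<close> to the
  root. Iterates from \<open>L v\<close> on are excluded, because \<open>par\<close> has no meaning
  at the root.\<close>

definition anc :: "nat \<Rightarrow> nat set" where "anc v = {(par ^^ i) v | i. i < L v}"

lemma L_root: "L 0 = 1"
  using pk unfolding pred_ok_def by auto

lemma par:
  assumes "v < n" "v \<noteq> 0"
  shows "P v < m" "joins A B (P v) (par v) v" "par v < n" "L v = Suc (L (par v))" "al (P v) = 1"
proof -
  have p: "P v < m" "(B (P v) = v \<and> al (P v) = 1 \<and> L (A (P v)) \<noteq> 0 \<and> L v = Suc (L (A (P v)))) \<or>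
        (A (P v) = v \<and> al (P v) = 1 \<and> L (B (P v)) \<noteq> 0 \<and> L v = Suc (L (B (P v))))"
    using pk lab[OF assms(1)] assms(2) unfolding pred_ok_def by auto
  define i where "i = P v"
  have "joins A B i (par v) v \<and> L v = Suc (L (par v)) \<and> al i = 1"
    using p(2) unfolding i_def[symmetric] par_def oth_def joins_def by (cases "A i = v") auto
  then show r: "joins A B (P v) (par v) v" "L v = Suc (L (par v))" "al (P v) = 1" by (auto simp: i_def)
  show "P v < m" by (rule p(1))
  then show "par v < n" using ends[of "P v"] r(1) unfolding joins_def by auto
qed

lemma iter:
  assumes "v < n" "i < L v"
  shows "(par ^^ i) v < n \<and> L ((par ^^ i) v) = L v - i"
  using assms(2)
proof (induction i)
  case 0
  then show ?case using assms by simp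
next
  case (Suc i)
  let ?x = "(par ^^ i) v"
  have x: "?x < n" "L ?x = L v - i" using Suc by auto
  have "?x \<noteq> 0"
  proof
    assume "?x = 0"
    then have "L v - i = 1" using x(2) L_root by simp
    then show False using Suc.prems by simp
  qed
  then show ?case using par[OF x(1)] x(2) Suc.prems by simp
qed

lemma anc_root: "anc 0 = {0}"
  by (auto simp: anc_def L_root)

lemma anc_par: "v < n \<Longrightarrow> v \<noteq> 0 \<Longrightarrow> anc v = insert v (anc (par v))"
proof -
  assume v: "v < n" "v \<noteq> 0"
  have "anc v = (\<lambda>i. (par ^^ i) v) ` {..<Suc (L (par v))}" unfolding anc_def par(4)[OF v] by auto
  also have "{..<Suc (L (par v))} = insert 0 (Suc ` {..<L (par v)})" by (rule lessThan_Suc_eq_insert_0)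
  also have "(\<lambda>i. (par ^^ i) v) ` insert 0 (Suc ` {..<L (par v)}) = insert v ((\<lambda>i. (par ^^ i) (par v)) ` {..<L (par v)})"
    by (simp add: image_image funpow_swap1)
  also have "(\<lambda>i. (par ^^ i) (par v)) ` {..<L (par v)} = anc (par v)" by (auto simp: anc_def)
  finally show ?thesis .
qed

lemma anc_iter:
  assumes "u < n" "i < L u" "i \<le> j" "j < L u"
  shows "(par ^^ j) u \<in> anc ((par ^^ i) u)"
proof -
  have "(par ^^ j) u = (par ^^ (j - i)) ((par ^^ i) u)" using assms(3) by (metis add.commute funpow_add le_add_diff_inverse o_apply)
  moreover have "j - i < L ((par ^^ i) u)" using iter[OF assms(1,2)] assms by simp
  ultimately show ?thesis unfolding anc_def by blast
qed

sublocale ancestors n anc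
proof
  show "v \<in> anc v" if "v < n" for v using lab[OF that] unfolding anc_def by (auto intro!: exI[of _ 0])
  show "anc v \<subseteq> {..<n}" if "v < n" for v using iter[OF that] unfolding anc_def by auto
  show "anc z \<subseteq> anc u" if u: "u < n" "z \<in> anc u" for u z
  proof
    obtain i where i: "z = (par ^^ i) u" "i < L u" using u by (auto simp: anc_def)
    fix y assume "y \<in> anc z"
    then obtain j where j: "y = (par ^^ j) z" "j < L z" by (auto simp: anc_def)
    have "y = (par ^^ (j + i)) u" using i j by (simp add: funpow_add)
    moreover have "j + i < L u" using iter[OF u(1) i(2)] i j by simp
    ultimately show "y \<in> anc u" by (auto simp: anc_def)
  qed
  show "y \<in> anc z \<or> z \<in> anc y" if u: "u < n" "y \<in> anc u" "z \<in> anc u" for u y z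
  proof -
    obtain i j where i: "y = (par ^^ i) u" "i < L u" and j: "z = (par ^^ j) u" "j < L u" using u by (auto simp: anc_def)
    then show ?thesis using anc_iter[OF u(1), of i j] anc_iter[OF u(1), of j i] by (cases "i \<le> j") auto
  qed
qed

lemma anc_less: "v < n \<Longrightarrow> y \<in> anc v \<Longrightarrow> L y \<le> L v"
  using iter[of v] by (auto simp: anc_def)

text \<open>Two different vertices sharing a parent edge would be parents of each other, which the
  labels forbid.\<close>

lemma parent_edge_inj:
  assumes "u < n" "u \<noteq> 0" "v < n" "v \<noteq> 0" "P u = P v"
  shows "u = v"
proof -
  have "joins A B (P u) (par u) u" "joins A B (P u) (par v) v" "L u = Suc (L (par u))" "L v = Suc (L (par v))"
    using par[of u] par[of v] assms by auto
  then show ?thesis unfolding joins_def by auto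
qed

text \<open>On the way down from the root, which is outside \<open>U\<close>, membership in
  \<open>U\<close> can change only at the tree edge above \<open>y\<close>; so \<open>U\<close> is
  the subtree below \<open>y\<close>.\<close>

lemma subtree_cut:
  assumes U: "0 \<notin> U" and y: "y < n" "y \<noteq> 0" and one: "\<And>v. v < n \<Longrightarrow> v \<noteq> 0 \<Longrightarrow> P v \<in> cut m A B U \<longleftrightarrow> v = y" and v: "v < n"
  shows "v \<in> U \<longleftrightarrow> y \<in> anc v"
  using v
proof (induction "L v" arbitrary: v rule: less_induct)
  case less
  show ?case
  proof (cases "v = 0")
    case True
    then show ?thesis using U y anc_root by auto
  next
    case False
    note p = par[OF less.prems False]
    have "P v \<in> cut m A B U \<longleftrightarrow> (par v \<in> U) \<noteq> (v \<in> U)" using p(1) by (simp add: in_cut cr_joins[OF p(2)])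
    then have c: "(par v \<in> U) \<noteq> (v \<in> U) \<longleftrightarrow> v = y" using one[OF less.prems False] by simp
    have ih: "par v \<in> U \<longleftrightarrow> y \<in> anc (par v)" using less.hyps[of "par v"] p by simp
    have "y \<notin> anc (par v)" if "v = y" using anc_less[OF p(3), of y] p(4) that by auto
    then show ?thesis using c ih anc_par[OF less.prems False] by auto
  qed
qed

text \<open>Suppose at most one edge of the cut is kept. The tree is kept and crosses the cut, so
  the kept edge is a tree edge and the cut is its fundamental cut. All other edges of the cut, at
  least two, are then links of colour \<open>c\<close> covering that tree edge, which is neither
  uncovered nor covered by a single link nor covered in two colours.\<close>

lemma two_crossing_colour:
  assumes ok: "colour_ok n anc A B {i. i < m \<and> al i \<noteq> 1} st col"
    and U: "U \<subseteq> {..<n}" "U \<noteq> {}" "U \<noteq> {..<n}" and c3: "3 \<le> card (cut m A B U)"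
  shows "2 \<le> card {i \<in> cut m A B U. \<not> (al i \<noteq> 1 \<and> col i = c)}"
proof (rule ccontr)
  define U' where "U' = (if 0 \<in> U then {..<n} - U else U)"
  have "ends_in m A B {..<n}" using ends by (auto simp: ends_in_def)
  then have cU: "cut m A B U' = cut m A B U" using cut_complement[of m A B "{..<n}" U] U by (simp add: U'_def)
  have U': "0 \<notin> U'" "U' \<subseteq> {..<n}" "U' \<noteq> {}" using U by (auto simp: U'_def)
  define X where "X = {i \<in> cut m A B U'. \<not> (al i \<noteq> 1 \<and> col i = c)}"
  assume "\<not> ?thesis"
  then have X1: "card X \<le> 1" by (simp add: X_def cU)
  have finX: "finite X" by (simp add: X_def)
  \<comment> \<open>The parent of a vertex of least label lies outside, so the tree edge above it
    crosses the cut.\<close>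
  obtain y where y: "y \<in> U'" "\<And>v. v \<in> U' \<Longrightarrow> L y \<le> L v" 
  proof -
    obtain v where "v \<in> U'" using U'(3) by blast
    then show ?thesis using ex_has_least_nat[of "\<lambda>v. v \<in> U'" v L] that by blast
  qed
  have yn: "y < n" "y \<noteq> 0" using y U' by auto
  note py = par[OF yn]
  have "par y \<notin> U'" using y(2)[of "par y"] py(4) by auto
  then have Py: "P y \<in> cut m A B U'" using y(1) py(1) by (simp add: in_cut cr_joins[OF py(2)])
  then have "P y \<in> X" using py(5) by (simp add: X_def)
  then have X: "X = {P y}" using X1 card_le_Suc0_iff_eq[OF finX] by auto
  have one: "P v \<in> cut m A B U' \<longleftrightarrow> v = y" if "v < n" "v \<noteq> 0" for v
  proof
    assume "P v \<in> cut m A B U'"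
    then have "P v \<in> X" using par(5)[OF that] by (simp add: X_def)
    then show "v = y" using X parent_edge_inj[OF that yn] by simp
  qed (use Py in simp)
  note sub = subtree_cut[OF U'(1) yn one]
  have cov: "covers anc A B i y \<longleftrightarrow> i \<in> cut m A B U'" if "i < m" for i
    using sub[of "A i"] sub[of "B i"] ends[OF that] that by (simp add: covers_def in_cut cr_def)
  have lk: "al i \<noteq> 1 \<and> col i = c \<and> i < m" if "i \<in> cut m A B U'" "i \<noteq> P y" for i
    using that X by (auto simp: X_def in_cut)
  have "2 \<le> card (cut m A B U' - {P y})" using c3 Py cU by simp
  then obtain i j where ij: "i \<in> cut m A B U' - {P y}" "j \<in> cut m A B U' - {P y}" "i \<noteq> j" by (rule two_le_cardE)
  have i: "i \<in> {i. i < m \<and> al i \<noteq> 1}" "covers anc A B i y" and j: "j \<in> {i. i < m \<and> al i \<noteq> 1}" "covers anc A B j y"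
    using lk[of i] lk[of j] cov[of i] cov[of j] ij by auto
  consider "st y = 0" | "st y \<in> {1, 2, 3}" | "3 < st y" by fastforce
  then show False
  proof cases
    case 1
    then show ?thesis using ok yn(1) i unfolding colour_ok_def by blast
  next
    case 2
    then obtain k where "\<forall>j\<in>{i. i < m \<and> al i \<noteq> 1}. covers anc A B j y \<longrightarrow> j = k" using ok yn(1) unfolding colour_ok_def by meson
    then show ?thesis using i j ij(3) by blast
  next
    case 3
    then obtain i j where k: "i \<in> {i. i < m \<and> al i \<noteq> 1}" "j \<in> {i. i < m \<and> al i \<noteq> 1}" "covers anc A B i y" "covers anc A B j y" "col i \<noteq> col j"
      using ok yn(1) unfolding colour_ok_def by meson
    have "i \<noteq> P y" "j \<noteq> P y" using k(1,2) py(5) by auto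
    then show ?thesis using k lk[of i] lk[of j] cov[of i] cov[of j] by auto
  qed
qed

end

section \<open>Computing the colouring\<close>

text \<open>Row \<open>v\<close> of array 49 becomes the indicator of the ancestors of
  \<open>v\<close>. The walk has a fixed number of rounds and waits at the root, marking it
  again.\<close>

definition ANCW :: hp where
  "ANCW = Sq (SetV 30 vv) (For 41 (LN 2) (Sq (Set 49 vv (V 30) (C 1))
     (If1 (Lt (C 1) (lab (V 30))) (OTH 30 (V 30) (A1 33 (V 30))))))"

definition ANCALL :: hp where
  "ANCALL = For 42 (LN 1) ANCW"

lemma asg_ANCW: "asg ANCW = {30, 41, 49, 79}"
  by (auto simp: ANCW_def asg_OTH)

lemma asg_ANCALL: "asg ANCALL = {42, 30, 41, 49, 79}"
  by (auto simp: ANCALL_def asg_ANCW)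

lemma ANCW_correct:
  fixes s and n m :: nat and al defines "s' \<equiv> den n m ANCW s" and "u \<equiv> fst s 42 0 0"
  assumes T: "rooted_tree n m (level_A s) (level_B s) (fst s 32 0) (fst s 33 0) al"
    and u: "u < n" and L: "fst s 32 0 u \<le> 2 * n" and z: "\<And>y. fst s 49 u y = 0"
  shows "fst s' 49 r y = (if r = u then of_bool (y \<in> rooted_tree.anc (level_A s) (level_B s) (fst s 32 0) (fst s 33 0) u) else fst s 49 r y)"
proof -
  let ?L = "fst s 32 0"
  interpret T: rooted_tree n m "level_A s" "level_B s" ?L "fst s 33 0" al by (rule T)
  let ?it = "\<lambda>j. (T.par ^^ j) u"
  define b where "b = Sq (Set 49 vv (V 30) (C 1)) (If1 (Lt (C 1) (lab (V 30))) (OTH 30 (V 30) (A1 33 (V 30))))"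
  define s1 where "s1 = den n m (SetV 30 vv) s"
  have s1: "fst s1 = upd 30 0 0 u (fst s)" by (simp add: s1_def u_def)
  have L0: "?L u \<noteq> 0" using T.lab[OF u] .
  define J where "J j t \<longleftrightarrow> (\<forall>r y. fst t 49 r y = (if r = u \<and> (\<exists>i. i < j \<and> i < ?L u \<and> y = ?it i) then 1 else fst s 49 r y)) \<and>
    fst t 30 0 0 = ?it (min j (?L u - 1))" for j and t :: store
  have s': "s' = den n m (For 41 (LN 2) b) s1" unfolding s'_def ANCW_def s1_def b_def by (simp only: den.simps(5))
  have "J (lv n m (LN 2)) s'" unfolding s'
  proof (rule for_rule)
    show "J 0 (setv 41 0 s1)" by (auto simp: J_def s1 upd_def setv_def)
    fix j and t :: store
    assume Jt: "J j t" and fr: "\<And>q. q \<noteq> 41 \<Longrightarrow> q \<notin> asg b \<Longrightarrow> fst t q = fst s1 q"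
    have fr': "fst t q = fst s q" if "q \<notin> {41, 49, 79, 30}" for q
      using fr[of q] that by (simp add: b_def asg_OTH s1 upd_def)
    let ?k = "min j (?L u - 1)"
    have k: "?k < ?L u" using L0 by simp
    have x: "fst t 30 0 0 = ?it ?k" using Jt by (simp add: J_def)
    have itk: "?it ?k < n" "?L (?it ?k) = ?L u - ?k" using T.iter[OF u k] by auto
    define t1 where "t1 = den n m (Set 49 vv (V 30) (C 1)) t"
    have t1: "fst t1 = upd 49 u (?it ?k) 1 (fst t)" unfolding t1_def using fr'[of 42] x by (simp add: u_def)
    define t2 where "t2 = den n m b t"
    have t2: "t2 = den n m (If1 (Lt (C 1) (lab (V 30))) (OTH 30 (V 30) (A1 33 (V 30)))) t1"
      unfolding t2_def b_def t1_def by (simp only: den.simps(5))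
    have l1: "level_A t1 = level_A s" "level_B t1 = level_B s" "fst t1 32 = fst s 32" "fst t1 33 = fst s 33" "fst t1 30 0 0 = ?it ?k"
      using fr' x by (simp_all add: t1 upd_def level_A_def level_B_def)
    have "fst t2 30 0 0 = ?it (min (Suc j) (?L u - 1))"
    proof (cases "1 < ?L (?it ?k)")
      case True
      have "t2 = den n m (OTH 30 (V 30) (A1 33 (V 30))) t1" unfolding t2 by (rule den_If_True) (use True l1 in simp)
      then have "fst t2 30 0 0 = T.par (?it ?k)" by (simp add: OTH_correct l1 T.par_def)
      moreover have "?k = j" "min (Suc j) (?L u - 1) = Suc j" using True itk(2) by auto
      ultimately show ?thesis by simp
    next
      case False
      have "t2 = den n m Sk t1" unfolding t2 by (rule den_If_False) (use False l1 in simp)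
      then have "fst t2 30 0 0 = ?it ?k" using l1 by (simp add: upd_def)
      moreover have "min (Suc j) (?L u - 1) = ?k" using False itk(2) by auto
      ultimately show ?thesis by simp
    qed
    moreover have "fst t2 49 = fst t1 49" unfolding t2 by (rule den_frame) (simp add: asg_OTH)
    moreover have "fst t1 49 r y = (if r = u \<and> (\<exists>i. i < Suc j \<and> i < ?L u \<and> y = ?it i) then 1 else fst s 49 r y)" for r y
    proof -
      have "(\<exists>i. i < Suc j \<and> i < ?L u \<and> y = ?it i) \<longleftrightarrow> y = ?it ?k \<or> (\<exists>i. i < j \<and> i < ?L u \<and> y = ?it i)"
      proof (cases "j < ?L u")
        case True
        then have "?k = j" by simp
        then show ?thesis using True less_Suc_eq by auto
      next
        case False
        then have kj: "?k < j" using L0 by auto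
        have "i < Suc j \<and> i < ?L u \<longleftrightarrow> i < j \<and> i < ?L u" for i using False by auto
        then show ?thesis using k kj by blast
      qed
      then show ?thesis using Jt by (auto simp: t1 upd_def J_def)
    qed
    ultimately have "J (Suc j) t2" unfolding J_def by simp
    then show "J (Suc j) (setv 41 (Suc j) (den n m b t))" unfolding J_def t2_def[symmetric] by simp
  qed
  then have "J (2 * n) s'" by simp
  moreover have "(\<exists>i. i < 2 * n \<and> i < ?L u \<and> y = ?it i) \<longleftrightarrow> y \<in> T.anc u" for y
  proof -
    have "i < 2 * n" if "i < ?L u" for i using L that by simp
    then show ?thesis unfolding T.anc_def by blast
  qed
  ultimately show ?thesis using z by (auto simp: J_def)
qed

lemma ANCALL_correct:
  fixes s and n m :: nat and al defines "s' \<equiv> den n m ANCALL s"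
  assumes T: "rooted_tree n m (level_A s) (level_B s) (fst s 32 0) (fst s 33 0) al"
    and L: "\<And>u. u < n \<Longrightarrow> fst s 32 0 u \<le> 2 * n" and z: "\<And>r y. fst s 49 r y = 0" and u: "u < n"
  shows "fst s' 49 u y = of_bool (y \<in> rooted_tree.anc (level_A s) (level_B s) (fst s 32 0) (fst s 33 0) u)"
proof -
  let ?anc = "rooted_tree.anc (level_A s) (level_B s) (fst s 32 0) (fst s 33 0)"
  define J where "J j t \<longleftrightarrow> (\<forall>r y. fst t 49 r y = of_bool (r < j \<and> y \<in> ?anc r))" for j and t :: store
  have "J (lv n m (LN 1)) s'" unfolding s'_def ANCALL_def
  proof (rule for_rule)
    show "J 0 (setv 42 0 s)" using z by (simp add: J_def)
    fix j and t :: store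
    assume j: "j < lv n m (LN 1)" and Jt: "J j t" and tj: "fst t 42 0 0 = j"
      and fr: "\<And>q. q \<noteq> 42 \<Longrightarrow> q \<notin> asg ANCW \<Longrightarrow> fst t q = fst s q"
    have jn: "j < n" using j by simp
    have e: "level_A t = level_A s" "level_B t = level_B s" "fst t 32 = fst s 32" "fst t 33 = fst s 33"
      using fr by (simp_all add: asg_ANCW level_A_def level_B_def)
    have "fst (den n m ANCW t) 49 r y = (if r = j then of_bool (y \<in> ?anc j) else fst t 49 r y)" for r y
      using ANCW_correct[of n m t al r y, unfolded e tj, OF T jn L[OF jn]] Jt by (simp add: J_def)
    then show "J (Suc j) (setv 42 (Suc j) (den n m ANCW t))" using Jt by (auto simp: J_def less_Suc_eq)
  qed
  then show ?thesis using u by (simp add: J_def)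
qed

section \<open>Depths of the meets and choice of the colours\<close>

definition MEET :: hp where
  "MEET = For 40 LM (Sq (Set1 50 iv (C 0)) (For 42 (LN 1)
     (If1 (And (Eq (Arr 49 (ga iv) vv) (C 1)) (Eq (Arr 49 (gb iv) vv) (C 1))) (Set1 50 iv (Inc (A1 50 iv))))))"

lemma asg_MEET: "asg MEET = {40, 42, 50, 79}"
  by (auto simp: MEET_def)

lemma MEET_correct:
  fixes s and n m :: nat defines "s' \<equiv> den n m MEET s"
  assumes i: "i < m"
  shows "fst s' 50 0 i = card {v. v < n \<and> fst s 49 (level_A s i) v = 1 \<and> fst s 49 (level_B s i) v = 1}"
proof -
  let ?F = "\<lambda>i. card {v. v < n \<and> fst s 49 (level_A s i) v = 1 \<and> fst s 49 (level_B s i) v = 1}"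
  let ?b = "If1 (And (Eq (Arr 49 (ga iv) vv) (C 1)) (Eq (Arr 49 (gb iv) vv) (C 1))) (Set1 50 iv (Inc (A1 50 iv)))"
  have "fst s' 50 r c = (if r = 0 \<and> c < m then ?F c else fst s 50 r c)" for r c
    unfolding s'_def MEET_def
  proof (rule fill)
    fix t :: store and i
    assume ti: "fst t 40 0 0 = i" and fr: "\<And>q. q \<noteq> 40 \<Longrightarrow> q \<notin> asg (Sq (Set1 50 iv (C 0)) (For 42 (LN 1) ?b)) \<Longrightarrow> fst t q = fst s q"
    define t1 where "t1 = den n m (Set1 50 iv (C 0)) t"
    have t1: "fst t1 = upd 50 0 i 0 (fst t)" by (simp add: t1_def ti)
    define G where "G j = card {v. v < j \<and> fst s 49 (level_A s i) v = 1 \<and> fst s 49 (level_B s i) v = 1}" for j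
    define J where "J j t' \<longleftrightarrow> fst t' 50 = (fst t 50)(0 := (fst t 50 0)(i := G j))" for j and t' :: store
    have "J (lv n m (LN 1)) (den n m (For 42 (LN 1) ?b) t1)"
    proof (rule for_rule)
      show "J 0 (setv 42 0 t1)" by (simp add: J_def t1 upd_def G_def)
      fix j and u :: store
      assume Ju: "J j u" and uj: "fst u 42 0 0 = j" and fru: "\<And>q. q \<noteq> 42 \<Longrightarrow> q \<notin> asg ?b \<Longrightarrow> fst u q = fst t1 q"
      have e: "fst u 40 0 0 = i" "fst u 0 (fst u 11 0 0) i = level_A s i" "fst u 1 (fst u 11 0 0) i = level_B s i" "fst u 49 = fst s 49"
        using fru fr ti by (simp_all add: t1 upd_def level_A_def level_B_def)
      have "G (Suc j) = (if fst s 49 (level_A s i) j = 1 \<and> fst s 49 (level_B s i) j = 1 then Suc (G j) else G j)"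
      proof -
        have "{v. v < Suc j \<and> fst s 49 (level_A s i) v = 1 \<and> fst s 49 (level_B s i) v = 1} =
          (if fst s 49 (level_A s i) j = 1 \<and> fst s 49 (level_B s i) j = 1 then insert j else (\<lambda>x. x))
            {v. v < j \<and> fst s 49 (level_A s i) v = 1 \<and> fst s 49 (level_B s i) v = 1}" by (auto simp: less_Suc_eq)
        then show ?thesis by (simp add: G_def)
      qed
      then show "J (Suc j) (setv 42 (Suc j) (den n m ?b u))" using Ju e uj by (auto simp: J_def upd_def)
    qed
    then show "fst (den n m (Sq (Set1 50 iv (C 0)) (For 42 (LN 1) ?b)) t) 50 = (fst t 50)(0 := (fst t 50 0)(i := ?F i))"
      by (simp only: den.simps(5) t1_def[symmetric] J_def G_def lv.simps mult_1)
  qed simp_all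
  then show ?thesis using i by simp
qed

text \<open>Any singly covered tree edge may represent its side, since by \<open>mono_agree\<close>
  all of them have the same colour. The default 0 is no colour and forbids nothing.\<close>

definition CHI :: "nat \<Rightarrow> he \<Rightarrow> he \<Rightarrow> hp" where
  "CHI q u v = Sq (SetV q (C 0)) (For 42 (LN 1) (If1 (And (Eq (Arr 49 u vv) (C 1)) (And (Ne (Arr 49 v vv) (C 1))
     (And (Lt (C 0) (A1 55 vv)) (Lt (A1 55 vv) (C 4))))) (SetV q (A1 55 vv))))"

lemma asg_CHI: "asg (CHI q u v) = {q, 42, 79}"
  by (auto simp: CHI_def)

lemma CHI_correct:
  fixes s and n m q :: nat and x y :: nat and u v defines "s' \<equiv> den n m (CHI q u v) s"
    and "Q \<equiv> \<lambda>w. fst s 49 x w = 1 \<and> fst s 49 y w \<noteq> 1 \<and> fst s 55 0 w \<in> {1, 2, 3}"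
  assumes uv: "\<And>t :: store. (\<And>j. j \<notin> {q, 42, 79} \<Longrightarrow> fst t j = fst s j) \<Longrightarrow> ev n u (fst t) = x \<and> ev n v (fst t) = y"
    and q: "q \<notin> {42, 49, 55, 79}"
  shows "(fst s' q 0 0 = 0 \<and> (\<forall>w<n. \<not> Q w)) \<or> (\<exists>w<n. Q w \<and> fst s' q 0 0 = fst s 55 0 w)"
proof -
  let ?b = "If1 (And (Eq (Arr 49 u vv) (C 1)) (And (Ne (Arr 49 v vv) (C 1))
     (And (Lt (C 0) (A1 55 vv)) (Lt (A1 55 vv) (C 4))))) (SetV q (A1 55 vv))"
  define s1 where "s1 = den n m (SetV q (C 0)) s"
  have s1: "fst s1 = upd q 0 0 0 (fst s)" by (simp add: s1_def)
  define J where "J j t \<longleftrightarrow> (fst t q 0 0 = 0 \<and> (\<forall>w<j. \<not> Q w)) \<or> (\<exists>w<j. Q w \<and> fst t q 0 0 = fst s 55 0 w)"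
    for j and t :: store
  have s': "s' = den n m (For 42 (LN 1) ?b) s1" unfolding s'_def CHI_def s1_def by (simp only: den.simps(5))
  have "J (lv n m (LN 1)) s'" unfolding s'
  proof (rule for_rule)
    show "J 0 (setv 42 0 s1)" using q by (simp add: J_def s1 upd_def)
    fix j and t :: store
    assume Jt: "J j t" and tj: "fst t 42 0 0 = j" and fr: "\<And>p. p \<noteq> 42 \<Longrightarrow> p \<notin> asg ?b \<Longrightarrow> fst t p = fst s1 p"
    have fr': "fst t p = fst s p" if "p \<notin> {q, 42, 79}" for p using fr[of p] that by (simp add: s1 upd_def)
    have e: "ev n u (fst t) = x" "ev n v (fst t) = y" "fst t 49 = fst s 49" "fst t 55 = fst s 55"
      using uv[of t] fr' q by auto
    have b: "bv n m (And (Eq (Arr 49 u vv) (C 1)) (And (Ne (Arr 49 v vv) (C 1))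
     (And (Lt (C 0) (A1 55 vv)) (Lt (A1 55 vv) (C 4))))) t \<longleftrightarrow> Q j" using e tj by (auto simp: Q_def)
    show "J (Suc j) (setv 42 (Suc j) (den n m ?b t))"
    proof (cases "Q j")
      case True
      have "den n m ?b t = den n m (SetV q (A1 55 vv)) t" by (rule den_If_True) (use b True in blast)
      then have "fst (den n m ?b t) q 0 0 = fst s 55 0 j" using e tj by (simp add: upd_def)
      then show ?thesis using True q by (auto simp: J_def)
    next
      case False
      have "den n m ?b t = den n m Sk t" by (rule den_If_False) (use b False in blast)
      then have "fst (den n m ?b t) q 0 0 = fst t q 0 0" using q by (simp add: upd_def)
      then show ?thesis using Jt False q by (auto simp: J_def less_Suc_eq)
    qed
  qed
  then show ?thesis by (simp add: J_def)
qed

definition PROC :: hp where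
  "PROC = Sq (CHI 45 (ga iv) (gb iv)) (Sq (CHI 46 (gb iv) (ga iv)) (Sq
     (If (And (Ne (V 45) (C 1)) (Ne (V 46) (C 1))) (SetV 47 (C 1))
       (If (And (Ne (V 45) (C 2)) (Ne (V 46) (C 2))) (SetV 47 (C 2)) (SetV 47 (C 3))))
     (Sq (Set1 51 iv (V 47)) (For 42 (LN 1) (If1 (Xor (Eq (Arr 49 (ga iv) vv) (C 1)) (Eq (Arr 49 (gb iv) vv) (C 1)))
       (If (Eq (A1 55 vv) (C 0)) (Set1 55 vv (V 47)) (If1 (Ne (A1 55 vv) (V 47)) (Set1 55 vv (C 4)))))))))"

lemma asg_PROC: "asg PROC = {45, 42, 79, 46, 47, 51, 55}"
  by (auto simp: PROC_def asg_CHI)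

lemma PROC_correct:
  fixes s and n m :: nat defines "s' \<equiv> den n m PROC s" and "i \<equiv> fst s 40 0 0"
  defines "u \<equiv> level_A s i" and "v \<equiv> level_B s i" and "st \<equiv> fst s 55 0"
  defines "Qu \<equiv> \<lambda>w. fst s 49 u w = 1 \<and> fst s 49 v w \<noteq> 1 \<and> st w \<in> {1, 2, 3}"
    and "Qv \<equiv> \<lambda>w. fst s 49 v w = 1 \<and> fst s 49 u w \<noteq> 1 \<and> st w \<in> {1, 2, 3}"
  shows "\<exists>c\<in>{1, 2, 3}. fst s' 51 0 = (fst s 51 0)(i := c) \<and>
    (\<forall>y<n. fst s' 55 0 y = (if (fst s 49 u y = 1) \<noteq> (fst s 49 v y = 1) then (if st y = 0 then c else if st y \<noteq> c then 4 else st y) else st y)) \<and>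
    ((\<forall>w<n. \<not> Qu w) \<or> (\<exists>w<n. Qu w \<and> c \<noteq> st w)) \<and> ((\<forall>w<n. \<not> Qv w) \<or> (\<exists>w<n. Qv w \<and> c \<noteq> st w))"
proof -
  define s1 where "s1 = den n m (CHI 45 (ga iv) (gb iv)) s"
  define s2 where "s2 = den n m (CHI 46 (gb iv) (ga iv)) s1"
  define pk where "pk = If (And (Ne (V 45) (C 1)) (Ne (V 46) (C 1))) (SetV 47 (C 1))
       (If (And (Ne (V 45) (C 2)) (Ne (V 46) (C 2))) (SetV 47 (C 2)) (SetV 47 (C 3)))"
  define s3 where "s3 = den n m pk s2"
  define s4 where "s4 = den n m (Set1 51 iv (V 47)) s3"
  let ?b = "If1 (Xor (Eq (Arr 49 (ga iv) vv) (C 1)) (Eq (Arr 49 (gb iv) vv) (C 1)))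
       (If (Eq (A1 55 vv) (C 0)) (Set1 55 vv (V 47)) (If1 (Ne (A1 55 vv) (V 47)) (Set1 55 vv (C 4))))"
  have s': "s' = den n m (For 42 (LN 1) ?b) s4"
    unfolding s'_def PROC_def s4_def s3_def s2_def s1_def pk_def by (simp only: den.simps(5))
  have f1: "fst s1 q = fst s q" if "q \<notin> {45, 42, 79}" for q unfolding s1_def by (rule den_frame) (use that in \<open>simp add: asg_CHI\<close>)
  have f2: "fst s2 q = fst s1 q" if "q \<notin> {46, 42, 79}" for q unfolding s2_def by (rule den_frame) (use that in \<open>simp add: asg_CHI\<close>)
  have f3: "fst s3 q = fst s2 q" if "q \<noteq> 47" for q unfolding s3_def pk_def by (rule den_frame) (use that in simp)
  have f4: "fst s4 q = fst s3 q" if "q \<noteq> 51" for q unfolding s4_def by (rule den_frame) (use that in simp)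
  have 1: "(fst s1 45 0 0 = 0 \<and> (\<forall>w<n. \<not> Qu w)) \<or> (\<exists>w<n. Qu w \<and> fst s1 45 0 0 = st w)"
    unfolding s1_def Qu_def st_def by (rule CHI_correct) (auto simp: u_def v_def i_def level_A_def level_B_def)
  have e1: "fst s1 49 = fst s 49" "fst s1 55 = fst s 55" using f1 by auto
  have "(fst s2 46 0 0 = 0 \<and> (\<forall>w<n. \<not> (fst s1 49 v w = 1 \<and> fst s1 49 u w \<noteq> 1 \<and> fst s1 55 0 w \<in> {1, 2, 3}))) \<or>
    (\<exists>w<n. (fst s1 49 v w = 1 \<and> fst s1 49 u w \<noteq> 1 \<and> fst s1 55 0 w \<in> {1, 2, 3}) \<and> fst s2 46 0 0 = fst s1 55 0 w)"
    unfolding s2_def by (rule CHI_correct) (use f1 in \<open>auto simp: u_def v_def i_def level_A_def level_B_def\<close>)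
  then have 2: "(fst s2 46 0 0 = 0 \<and> (\<forall>w<n. \<not> Qv w)) \<or> (\<exists>w<n. Qv w \<and> fst s2 46 0 0 = st w)"
    unfolding e1 Qv_def st_def .
  define c where "c = fst s3 47 0 0"
  have c: "c \<in> {1, 2, 3}" "c \<noteq> fst s1 45 0 0" "c \<noteq> fst s2 46 0 0"
    using f2[of 45] by (auto simp: c_def s3_def pk_def upd_def)
  have e3: "fst s3 40 0 0 = i" "fst s3 51 = fst s 51" using f1 f2 f3 by (simp_all add: i_def)
  have e4: "fst s4 40 0 0 = i" "fst s4 49 = fst s 49" "fst s4 47 0 0 = c" "level_A s4 = level_A s" "level_B s4 = level_B s" "fst s4 55 = fst s 55"
    "fst s4 51 0 = (fst s 51 0)(i := c)"
    using f1 f2 f3 f4 e3 by (simp_all add: c_def level_A_def level_B_def i_def s4_def upd_def)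
  let ?F = "\<lambda>y. if (fst s 49 u y = 1) \<noteq> (fst s 49 v y = 1) then (if st y = 0 then c else if st y \<noteq> c then 4 else st y) else st y"
  have "fst s' 55 r y = (if r = 0 \<and> y < n then ?F y else fst s4 55 r y)" for r y
    unfolding s'
  proof (rule fill)
    fix t :: store and j
    assume tj: "fst t 42 0 0 = j" and fr: "\<And>q. q \<noteq> 42 \<Longrightarrow> q \<notin> asg ?b \<Longrightarrow> fst t q = fst s4 q"
      and old: "\<And>r c. fst t 55 r c = (if r = 0 \<and> c < j then ?F c else fst s4 55 r c)"
    have e: "fst t 40 0 0 = i" "fst t 49 = fst s 49" "fst t 47 0 0 = c" "fst t 0 (fst t 11 0 0) i = u" "fst t 1 (fst t 11 0 0) i = v"
      using fr e4 by (simp_all add: level_A_def level_B_def u_def v_def)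
    have tj55: "fst t 55 0 j = st j" using old[of 0 j] e4 by (simp add: st_def)
    have triv: "(fst t 55)(0 := (fst t 55 0)(j := st j)) = fst t 55" using tj55 by (metis fun_upd_triv)
    show "fst (den n m ?b t) 55 = (fst t 55)(0 := (fst t 55 0)(j := ?F j))"
      using e tj tj55 triv by (auto simp: upd_def)
  qed simp_all
  moreover have "fst s' 51 = fst s4 51" unfolding s' by (rule den_frame) auto
  ultimately have "fst s' 51 0 = (fst s 51 0)(i := c) \<and> (\<forall>y<n. fst s' 55 0 y = ?F y)" using e4 by auto
  moreover have "((\<forall>w<n. \<not> Qu w) \<or> (\<exists>w<n. Qu w \<and> c \<noteq> st w))" using 1 c(2) by auto
  moreover have "((\<forall>w<n. \<not> Qv w) \<or> (\<exists>w<n. Qv w \<and> c \<noteq> st w))" using 2 c(3) by auto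
  ultimately show ?thesis using c(1) by blast
qed

text \<open>Instead of sorting the links, the outer loop runs through all possible depths of a meet
  and the inner one picks the links of that depth. With the linear work per link this stays
  cubic.\<close>

definition COLS :: hp where
  "COLS = For 41 (LN 2) (For 40 LM (If1 (And (Eq (A1 31 iv) (V 48)) (Eq (A1 50 iv) (V 41))) PROC))"

lemma asg_COLS: "asg COLS = {41, 40, 45, 42, 79, 46, 47, 51, 55}"
  by (auto simp: COLS_def asg_PROC)

lemma COLS_correct:
  fixes s and n m :: nat and anc defines "s' \<equiv> den n m COLS s" and "A \<equiv> level_A s" and "B \<equiv> level_B s"
  assumes an: "ancestors n anc" and AB: "\<And>i. i < m \<Longrightarrow> A i < n \<and> B i < n"
    and M: "\<And>u y. u < n \<Longrightarrow> fst s 49 u y = of_bool (y \<in> anc u)"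
    and D: "\<And>i. i < m \<Longrightarrow> fst s 50 0 i = depth_meet anc A B i" and z: "\<And>y. fst s 55 0 y = 0" and n: "0 < n"
  shows "colour_ok n anc A B {i. i < m \<and> fst s 31 0 i = fst s 48 0 0} (fst s' 55 0) (fst s' 51 0)"
proof -
  interpret ancestors n anc by (rule an)
  let ?lk = "\<lambda>i. fst s 31 0 i = fst s 48 0 0"
  let ?b = "If1 (And (Eq (A1 31 iv) (V 48)) (Eq (A1 50 iv) (V 41))) PROC"
  \<comment> \<open>The links processed so far when the loops stand at depth \<open>d\<close> and
    edge \<open>j\<close>: those that precede lexicographically by depth and name.\<close>
  define P where "P d j = {i. i < m \<and> ?lk i \<and> (depth_meet anc A B i < d \<or> depth_meet anc A B i = d \<and> i < j)}" for d j
  define J where "J d t \<longleftrightarrow> colour_ok n anc A B (P d 0) (fst t 55 0) (fst t 51 0)" for d and t :: store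
  have "J (lv n m (LN 2)) s'" unfolding s'_def COLS_def
  proof (rule for_rule)
    show "J 0 (setv 41 0 s)" using z by (simp add: J_def P_def colour_ok_def)
    fix d and t :: store
    assume Jt: "J d t" and td: "fst t 41 0 0 = d" and frt: "\<And>q. q \<noteq> 41 \<Longrightarrow> q \<notin> asg (For 40 LM ?b) \<Longrightarrow> fst t q = fst s q"
    define I where "I j u \<longleftrightarrow> colour_ok n anc A B (P d j) (fst u 55 0) (fst u 51 0)" for j and u :: store
    have "I (lv n m LM) (den n m (For 40 LM ?b) t)"
    proof (rule for_rule)
      show "I 0 (setv 40 0 t)" using Jt by (simp add: I_def J_def)
      fix i and u :: store
      assume i: "i < lv n m LM" and Iu: "I i u" and ui: "fst u 40 0 0 = i" and fru: "\<And>q. q \<noteq> 40 \<Longrightarrow> q \<notin> asg ?b \<Longrightarrow> fst u q = fst t q"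
      have im: "i < m" using i by simp
      have fr: "fst u q = fst s q" if "q \<notin> {41, 40, 45, 42, 79, 46, 47, 51, 55}" for q
        using that frt[of q] fru[of q] by (simp add: asg_PROC)
      have u41: "fst u 41 0 0 = d" using fru[of 41] td by (simp add: asg_PROC)
      have lv: "level_A u = A" "level_B u = B" using fr by (simp_all add: level_A_def level_B_def A_def B_def)
      have c: "bv n m (And (Eq (A1 31 iv) (V 48)) (Eq (A1 50 iv) (V 41))) u \<longleftrightarrow> ?lk i \<and> depth_meet anc A B i = d"
        using fr ui u41 D[OF im] by simp
      show "I (Suc i) (setv 40 (Suc i) (den n m ?b u))"
      proof (cases "?lk i \<and> depth_meet anc A B i = d")
        case False
        have "den n m ?b u = den n m Sk u" by (rule den_If_False) (use c False in blast)
        then have "fst (den n m ?b u) 55 = fst u 55" "fst (den n m ?b u) 51 = fst u 51" by (simp_all add: upd_def)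
        moreover have "P d (Suc i) = P d i" using False by (auto simp: P_def less_Suc_eq)
        ultimately show ?thesis using Iu by (simp add: I_def)
      next
        case True
        have b: "den n m ?b u = den n m PROC u" by (rule den_If_True) (use c True in blast)
        have Pi: "P d (Suc i) = insert i (P d i)" "i \<notin> P d i" using True im by (auto simp: P_def less_Suc_eq)
        have ABi: "A i < n" "B i < n" using AB[OF im] by auto
        have fs49: "fst u 49 = fst s 49" using fr by simp
        have M1: "fst u 49 (A i) w = 1 \<longleftrightarrow> w \<in> anc (A i)" "fst u 49 (B i) w = 1 \<longleftrightarrow> w \<in> anc (B i)" for w
          using M ABi fs49 by simp_all
        from PROC_correct[of n m u, unfolded ui lv M1] obtain c where c: "c \<in> {1, 2, 3}" and
          col: "fst (den n m PROC u) 51 0 = (fst u 51 0)(i := c)" and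
          st: "\<forall>y<n. fst (den n m PROC u) 55 0 y = (if (y \<in> anc (A i)) \<noteq> (y \<in> anc (B i)) then (if fst u 55 0 y = 0 then c else if fst u 55 0 y \<noteq> c then 4 else fst u 55 0 y) else fst u 55 0 y)" and
          qu: "(\<forall>w<n. \<not> (w \<in> anc (A i) \<and> w \<notin> anc (B i) \<and> fst u 55 0 w \<in> {1, 2, 3})) \<or>
            (\<exists>w<n. (w \<in> anc (A i) \<and> w \<notin> anc (B i) \<and> fst u 55 0 w \<in> {1, 2, 3}) \<and> c \<noteq> fst u 55 0 w)" and
          qv: "(\<forall>w<n. \<not> (w \<in> anc (B i) \<and> w \<notin> anc (A i) \<and> fst u 55 0 w \<in> {1, 2, 3})) \<or>
            (\<exists>w<n. (w \<in> anc (B i) \<and> w \<notin> anc (A i) \<and> fst u 55 0 w \<in> {1, 2, 3}) \<and> c \<noteq> fst u 55 0 w)" by blast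
        have "colour_ok n anc A B (insert i (P d i)) (fst (den n m PROC u) 55 0) (fst (den n m PROC u) 51 0)"
        proof (rule colour_step[where A = A and B = B and b = i, OF _ Pi(2) ABi _ _ c])
          show "colour_ok n anc A B (P d i) (fst u 55 0) (fst u 51 0)" using Iu by (simp add: I_def)
          show "A j < n \<and> B j < n" if "j \<in> P d i" for j using AB that by (simp add: P_def)
          show "depth_meet anc A B j \<le> depth_meet anc A B i" if "j \<in> P d i" for j using that True by (auto simp: P_def)
          show "\<exists>y'\<in>anc (A i) - anc (B i). fst u 55 0 y' \<in> {1, 2, 3} \<and> c \<noteq> fst u 55 0 y'" if "y \<in> anc (A i) - anc (B i)" "fst u 55 0 y \<in> {1, 2, 3}" for y
          proof -
            have "y < n" using that(1) sub[OF ABi(1)] by blast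
            then show ?thesis using qu that by blast
          qed
          show "\<exists>y'\<in>anc (B i) - anc (A i). fst u 55 0 y' \<in> {1, 2, 3} \<and> c \<noteq> fst u 55 0 y'" if "y \<in> anc (B i) - anc (A i)" "fst u 55 0 y \<in> {1, 2, 3}" for y
          proof -
            have "y < n" using that(1) sub[OF ABi(2)] by blast
            then show ?thesis using qv that by blast
          qed
          show "fst (den n m PROC u) 51 0 = (fst u 51 0)(i := c)" by (rule col)
          show "fst (den n m PROC u) 55 0 y = (if covers anc A B i y then (if fst u 55 0 y = 0 then c else if fst u 55 0 y \<noteq> c then 4 else fst u 55 0 y) else fst u 55 0 y)"
            if "y < n" for y using st that unfolding covers_def by blast
        qed
        then show ?thesis unfolding I_def Pi b by simp
      qed
    qed
    moreover have "P d m = P (Suc d) 0" by (auto simp: P_def)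
    ultimately show "J (Suc d) (setv 41 (Suc d) (den n m (For 40 LM ?b) t))" by (simp add: I_def J_def)
  qed
  moreover have "P (2 * n) 0 = {i. i < m \<and> ?lk i}"
  proof -
    have "depth_meet anc A B i < 2 * n" if "i < m" for i
    proof -
      have "card (anc (A i) \<inter> anc (B i)) \<le> card {..<n}" using sub AB[OF that] by (intro card_mono) auto
      then show ?thesis using n by (simp add: depth_meet_def)
    qed
    then show ?thesis by (auto simp: P_def)
  qed
  ultimately show ?thesis by (simp add: J_def)
qed

definition cubic :: "nat \<Rightarrow> nat \<Rightarrow> (nat \<Rightarrow> nat) \<Rightarrow> (nat \<Rightarrow> nat) \<Rightarrow> bool" where
  "cubic n m A B \<longleftrightarrow> 2 \<le> n \<and> (\<forall>i<m. A i < n \<and> B i < n \<and> A i \<noteq> B i) \<and> (\<forall>v<n. card (cut m A B {v}) = 3) \<and>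
     (\<forall>U. U \<subseteq> {..<n} \<longrightarrow> U \<noteq> {} \<longrightarrow> U \<noteq> {..<n} \<longrightarrow> 3 \<le> card (cut m A B U))"

section \<open>Initialisation\<close>

text \<open>The region consists of all vertices but 0, so at the start validity concerns only the
  three edges at 0: one of them in class 3, two in class 2, none in class 0 or 1.\<close>

definition INIT :: hp where
  "INIT = Sq (SetV 12 Nn) (Sq (For 40 LM (Set1 31 iv (C 2)))
     (Sq (For 42 (LN 2) (If (And (Lt (C 0) vv) (Lt vv Nn)) (Set 2 (C 0) vv (C 1)) (Set 2 (C 0) vv (C 0))))
     (Sq (SCAN (At (C 0) iv) 15 45) (Set1 31 (V 15) (C 3)))))"

lemma asg_INIT: "asg INIT = {12, 40, 31, 42, 2, 45, 15, 79}"
  by (auto simp: INIT_def asg_SCAN)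

lemma cubic_region:
  assumes "cubic n m A B"
  shows "region m A B {0<..<n}" "cut m A B {0<..<n} = cut m A B {0}" "ends_in m A B {..<n}"
proof -
  show e: "ends_in m A B {..<n}" using assms by (auto simp: cubic_def ends_in_def)
  have "{0<..<n} = {..<n} - {0}" by auto
  then show c: "cut m A B {0<..<n} = cut m A B {0}" using cut_complement[OF e, of "{0}"] assms by (auto simp: cubic_def)
  have "3 \<le> card (cut m A B U)" if "U \<subseteq> {0<..<n}" "U \<noteq> {}" for U
  proof -
    have "0 \<notin> U" "U \<subseteq> {..<n}" using that by auto
    then have "U \<noteq> {..<n}" using assms by (auto simp: cubic_def)
    then show ?thesis using assms \<open>U \<subseteq> {..<n}\<close> that(2) unfolding cubic_def by blast
  qed
  moreover have "(1::nat) \<in> {0<..<n}" using assms by (auto simp: cubic_def)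
  then have "{0<..<n} \<noteq> {}" by blast
  ultimately show "region m A B {0<..<n}" using c assms unfolding region_def cubic_def by auto
qed

lemma INIT_correct:
  fixes s and n m :: nat defines "s' \<equiv> den n m INIT s"
  assumes G: "cubic n m A B" and AB: "\<And>i. i < m \<Longrightarrow> fst s 0 0 i = A i \<and> fst s 1 0 i = B i"
    and z: "\<And>j r c. 2 \<le> j \<Longrightarrow> fst s j r c = 0"
  shows "\<exists>Vs. inv n m A B s' Vs" "mu n s' < 2 * n"
proof -
  define s1 where "s1 = den n m (SetV 12 Nn) s"
  define s2 where "s2 = den n m (For 40 LM (Set1 31 iv (C 2))) s1"
  define s3 where "s3 = den n m (For 42 (LN 2) (If (And (Lt (C 0) vv) (Lt vv Nn)) (Set 2 (C 0) vv (C 1)) (Set 2 (C 0) vv (C 0)))) s2"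
  define s4 where "s4 = den n m (SCAN (At (C 0) iv) 15 45) s3"
  have s': "s' = den n m (Set1 31 (V 15) (C 3)) s4" unfolding s'_def INIT_def s4_def s3_def s2_def s1_def by (simp only: den.simps(5))
  have f1: "fst s1 q = fst s q" if "q \<noteq> 12" for q unfolding s1_def by (rule den_frame) (use that in auto)
  have f2: "fst s2 q = fst s1 q" if "q \<notin> {40, 31}" for q unfolding s2_def by (rule den_frame) (use that in auto)
  have f3: "fst s3 q = fst s2 q" if "q \<notin> {42, 2}" for q unfolding s3_def by (rule den_frame) (use that in auto)
  have f4: "fst s4 q = fst s3 q" if "q \<notin> {15, 45, 40, 79}" for q unfolding s4_def by (rule den_frame) (use that in \<open>auto simp: asg_SCAN\<close>)
  have f5: "fst s' q = fst s4 q" if "q \<noteq> 31" for q unfolding s' by (rule den_frame) (use that in auto)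
  have c2: "fst s2 31 r c = (if r = 0 \<and> c < m then 2 else fst s1 31 r c)" for r c
    unfolding s2_def by (rule fill[where F = "\<lambda>_. 2" and R = 0]) (auto simp: upd_def)
  have r3: "fst s3 2 r c = (if r = 0 \<and> c < 2 * n then of_bool (0 < c \<and> c < n) else fst s2 2 r c)" for r c
    unfolding s3_def by (rule fill[where F = "\<lambda>c. of_bool (0 < c \<and> c < n)" and R = 0]) (auto simp: upd_def)
  have k: "fst s3 11 0 0 = 0" "fst s3 0 0 = fst s 0 0" "fst s3 1 0 = fst s 1 0" using f1 f2 f3 z by simp_all
  let ?Pr = "\<lambda>i. (fst s 0 0 i = 0) \<noteq> (fst s 1 0 i = 0)"
  have sc: "(fst s4 45 0 0 = 0 \<and> (\<forall>i<m. \<not> ?Pr i)) \<or> (fst s4 45 0 0 = 1 \<and> fst s4 15 0 0 < m \<and> ?Pr (fst s4 15 0 0))"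
    unfolding s4_def
  proof (rule SCAN_correct)
    fix t :: store assume t: "\<And>j. j \<notin> {45, 40, 15, 79} \<Longrightarrow> fst t j = fst s3 j"
    show "bv n m (At (C 0) iv) t = ?Pr (fst t 40 0 0)" using t k by (simp add: At_def)
  qed auto
  define x where "x = fst s4 15 0 0"
  have P: "?Pr i \<longleftrightarrow> i \<in> cut m A B {0}" if "i < m" for i using AB[OF that] that by (auto simp: in_cut cr_def)
  have c0: "card (cut m A B {0}) = 3" using G by (simp add: cubic_def)
  then have "cut m A B {0} \<noteq> {}" by auto
  then obtain i0 where "i0 \<in> cut m A B {0}" by blast
  then have "\<not> (\<forall>i<m. \<not> ?Pr i)" using P by (meson in_cut)
  then have "x < m" "?Pr x" using sc by (auto simp: x_def)
  then have x: "x \<in> cut m A B {0}" "x < m" using P by blast+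
  define q where "q = (\<lambda>i. if i = x then 3 else if i < m then 2 else 0 :: nat)"
  have q: "fst s' 31 0 = q"
    unfolding s' using c2 f1 f3 f4 z by (auto simp: q_def x_def upd_def fun_eq_iff)
  have lz: "lab_zero n s'" using f1 f2 f3 f4 f5 z by (simp add: lab_zero_def)
  have k': "fst s' 11 0 0 = 0" "fst s' 12 0 0 = n" "fst s' 13 0 0 = 0" "fst s' 14 0 0 = 0" "fst s' 15 0 0 = x"
    "fst s' 0 0 = fst s 0 0" "fst s' 1 0 = fst s 1 0"
    using f1 f2 f3 f4 f5 z by (simp_all add: x_def s1_def upd_def)
  have reg: "reg n s' = {0<..<n}" unfolding reg_def k' using f4 f5 r3 by (auto simp: of_bool_def split: if_splits)
  have lv: "level_A s' = fst s 0 0" "level_B s' = fst s 1 0" using k' by (simp_all add: level_A_def level_B_def)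
  have cg: "region m (fst s 0 0) (fst s 1 0) X = region m A B X" "valid m (fst s 0 0) (fst s 1 0) q X Y = valid m A B q X Y"
    "cut m (fst s 0 0) (fst s 1 0) X = cut m A B X" for X Y
    by (rule region_congr valid_congr cut_congr; rule AB; assumption)+
  note cr = cubic_region[OF G]
  have val: "valid m A B q {..<n} {0<..<n}" unfolding valid_def
  proof (intro allI impI)
    fix U assume U: "U \<subseteq> {..<n} - {0<..<n}" "U \<noteq> {}"
    then have U0: "U = {0}" by auto
    have "2 \<le> card (cut m A B {0} - {x})" using c0 x by simp
    then obtain i j where ij: "i \<in> cut m A B {0} - {x}" "j \<in> cut m A B {0} - {x}" "i \<noteq> j" by (rule two_le_cardE)
    then have qi: "q i = 2" "q j = 2" by (auto simp: q_def in_cut)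
    have cc: "2 \<le> card {k \<in> cut m A B {0}. q k \<noteq> c}" if "c \<in> {0, 1}" for c
      by (rule two_le_card[of _ i j]) (use ij qi that in auto)
    have "q x = 3" by (simp add: q_def)
    then have "\<exists>i\<in>cut m A B {0}. q i \<noteq> 2" using x(1) by (intro bexI[of _ x]) auto
    moreover have "\<exists>i\<in>cut m A B {0}. q i \<noteq> 3" using ij(1) qi(1) by (intro bexI[of _ i]) auto
    ultimately show "(\<exists>i\<in>cut m A B U. q i \<noteq> 2) \<and> (\<exists>i\<in>cut m A B U. q i \<noteq> 3) \<and>
     2 \<le> card {i \<in> cut m A B U. q i \<noteq> 0} \<and> 2 \<le> card {i \<in> cut m A B U. q i \<noteq> 1}" unfolding U0 using cc[of 0] cc[of 1] by blast
  qed
  define Vs :: "nat \<Rightarrow> nat set" where "Vs = (\<lambda>_. {..<n})"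
  have "inv n m A B s' Vs" unfolding inv_def k' q
  proof (intro conjI)
    show "\<forall>i<m. fst s 0 0 i = A i \<and> fst s 1 0 i = B i" using AB by blast
    show "\<forall>i<m. q i \<le> 3" by (simp add: q_def)
    show "1 \<le> n" using G by (simp add: cubic_def)
    have "ends_in m (fst s 0 0) (fst s 1 0) {..<n}" using cr(3) AB unfolding ends_in_def by metis
    moreover have "\<forall>i<m. fst s 0 0 i < n \<and> fst s 1 0 i < n" using G AB unfolding cubic_def by metis
    ultimately have "lev_ok n m s' Vs 0" unfolding lev_ok_def k' Vs_def by simp
    then show "\<forall>j\<le>0. lev_ok n m s' Vs j" by simp
    show "cur_ok n m s' Vs" unfolding cur_ok_def Let_def k' reg lv q cg Vs_def using cr val x by (auto simp: q_def)
    show "prot n s'" by (simp add: prot_def k')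
  qed (use lz in \<open>auto simp: Vs_def\<close>)
  then show "\<exists>Vs. inv n m A B s' Vs" by blast
  have "2 \<le> n" using G by (simp add: cubic_def)
  then show "mu n s' < 2 * n" unfolding mu_def k' reg by simp
qed

section \<open>Sums of costs\<close>

definition RSUM :: "nat \<Rightarrow> hb \<Rightarrow> hp" where
  "RSUM c b = Sq (RZ c) (For 40 LM (If1 b (RA c iv)))"

lemma asg_RSUM: "asg (RSUM c b) = {40, 79}"
  by (auto simp: RSUM_def)

lemma RSUM_correct:
  fixes s and n m c :: nat and b defines "s' \<equiv> den n m (RSUM c b) s"
  assumes b: "\<And>t. (\<And>j. j \<notin> {40, 79} \<Longrightarrow> fst t j = fst s j) \<Longrightarrow> bv n m b t = Pr (fst t 40 0 0)"
  shows "snd s' = (snd s)(m + c := \<Sum>i | i < m \<and> Pr i. snd s i)"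
proof -
  define s1 where "s1 = den n m (RZ c) s"
  have s1: "fst s1 = fst s" "snd s1 = (snd s)(m + c := 0)" by (simp_all add: s1_def)
  define J where "J j t \<longleftrightarrow> snd t = (snd s)(m + c := \<Sum>i | i < j \<and> Pr i. snd s i)" for j and t :: store
  have s': "s' = den n m (For 40 LM (If1 b (RA c iv))) s1" unfolding s'_def RSUM_def s1_def by (simp only: den.simps(5))
  have "J (lv n m LM) s'" unfolding s'
  proof (rule for_rule)
    show "J 0 (setv 40 0 s1)" by (simp add: J_def s1)
    fix j and t :: store
    assume j: "j < lv n m LM" and Jt: "J j t" and tj: "fst t 40 0 0 = j"
      and fr: "\<And>q. q \<noteq> 40 \<Longrightarrow> q \<notin> asg (If1 b (RA c iv)) \<Longrightarrow> fst t q = fst s1 q"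
    have bt: "bv n m b t = Pr j" using b[of t] fr tj s1 by simp
    have Sj: "{i. i < Suc j \<and> Pr i} = (if Pr j then insert j else (\<lambda>x. x)) {i. i < j \<and> Pr i}" by (auto simp: less_Suc_eq)
    show "J (Suc j) (setv 40 (Suc j) (den n m (If1 b (RA c iv)) t))"
    proof (cases "Pr j")
      case True
      have "den n m (If1 b (RA c iv)) t = den n m (RA c iv) t" by (rule den_If_True) (use bt True in blast)
      then show ?thesis using Jt True j tj by (simp add: J_def Sj add.commute)
    next
      case False
      have "den n m (If1 b (RA c iv)) t = den n m Sk t" by (rule den_If_False) (use bt False in blast)
      then show ?thesis using Jt False by (simp add: J_def Sj)
    qed
  qed
  then show ?thesis by (simp add: J_def)
qed

definition SELC :: hp where
  "SELC = Sq (RSUM 2 (Eq (A1 31 iv) (C 2))) (Sq (RSUM 3 (Eq (A1 31 iv) (C 3))) (If (RLt 2 3) (SetV 48 (C 3)) (SetV 48 (C 2))))"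

lemma asg_SELC: "asg SELC = {40, 79, 48}"
  by (auto simp: SELC_def asg_RSUM)

lemma SELC_correct:
  fixes s and n m :: nat defines "s' \<equiv> den n m SELC s"
  defines "S \<equiv> \<lambda>k. \<Sum>i | i < m \<and> fst s 31 0 i = k. snd s i"
  shows "fst s' 48 0 0 \<in> {2, 3} \<and> S 2 \<le> S (fst s' 48 0 0) \<and> S 3 \<le> S (fst s' 48 0 0)" "\<And>i. i < m \<Longrightarrow> snd s' i = snd s i"
proof -
  define s1 where "s1 = den n m (RSUM 2 (Eq (A1 31 iv) (C 2))) s"
  define s2 where "s2 = den n m (RSUM 3 (Eq (A1 31 iv) (C 3))) s1"
  have s': "s' = den n m (If (RLt 2 3) (SetV 48 (C 3)) (SetV 48 (C 2))) s2" unfolding s'_def SELC_def s2_def s1_def by (simp only: den.simps(5))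
  have f1: "fst s1 q = fst s q" if "q \<notin> {40, 79}" for q unfolding s1_def by (rule den_frame) (use that in \<open>auto simp: asg_RSUM\<close>)
  have 1: "snd s1 = (snd s)(m + 2 := S 2)" unfolding s1_def S_def by (rule RSUM_correct) simp
  have 2: "snd s2 = (snd s1)(m + 3 := \<Sum>i | i < m \<and> fst s 31 0 i = 3. snd s1 i)" unfolding s2_def
    by (rule RSUM_correct) (use f1 in simp)
  have "(\<Sum>i | i < m \<and> fst s 31 0 i = 3. snd s1 i) = S 3" unfolding S_def by (rule sum.cong) (auto simp: 1)
  then have 3: "snd s2 = (snd s)(m + 2 := S 2, m + 3 := S 3)" using 1 2 by simp
  then show "fst s' 48 0 0 \<in> {2, 3} \<and> S 2 \<le> S (fst s' 48 0 0) \<and> S 3 \<le> S (fst s' 48 0 0)" unfolding s' by (auto simp: upd_def)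
  show "snd s' i = snd s i" if "i < m" for i using that 3 unfolding s' by auto
qed

definition BESTSTEP :: "nat \<Rightarrow> hp" where
  "BESTSTEP j = If1 (RLt 5 j) (Sq (RC 5 j) (SetV 53 (C j)))"

definition BEST :: hp where
  "BEST = Sq (Sq (RSUM 0 (Eq (A1 52 iv) (C 0))) (Sq (RSUM 1 (Eq (A1 52 iv) (C 1))) (Sq (RSUM 2 (Eq (A1 52 iv) (C 2)))
     (Sq (RSUM 3 (Eq (A1 52 iv) (C 3))) (RSUM 4 (Eq (A1 52 iv) (C 4)))))))
     (Sq (Sq (RC 5 0) (SetV 53 (C 0))) (Sq (BESTSTEP 1) (Sq (BESTSTEP 2) (Sq (BESTSTEP 3) (BESTSTEP 4)))))"

lemma asg_BEST: "asg BEST = {40, 79, 53}"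
  by (auto simp: BEST_def BESTSTEP_def asg_RSUM)

lemma BEST_correct:
  fixes s and n m :: nat defines "s' \<equiv> den n m BEST s"
  defines "S \<equiv> \<lambda>k. \<Sum>i | i < m \<and> fst s 52 0 i = k. snd s i"
  shows "fst s' 53 0 0 \<le> 4 \<and> (\<forall>j\<le>4. S j \<le> S (fst s' 53 0 0))"
proof -
  have sm: "(\<forall>i<m. snd (den n m (RSUM c (Eq (A1 52 iv) (C c))) t) i = snd s i) \<and> fst (den n m (RSUM c (Eq (A1 52 iv) (C c))) t) 52 = fst s 52 \<and>
     (\<forall>j\<le>c. snd (den n m (RSUM c (Eq (A1 52 iv) (C c))) t) (m + j) = S j)"
    if "\<forall>i<m. snd t i = snd s i" "fst t 52 = fst s 52" "\<forall>j<c. snd t (m + j) = S j" for t c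
  proof -
    define t' where "t' = den n m (RSUM c (Eq (A1 52 iv) (C c))) t"
    have "snd t' = (snd t)(m + c := \<Sum>i | i < m \<and> fst t 52 0 i = c. snd t i)" unfolding t'_def by (rule RSUM_correct) simp
    moreover have "(\<Sum>i | i < m \<and> fst t 52 0 i = c. snd t i) = S c" unfolding S_def by (rule sum.cong) (use that in auto)
    ultimately have 1: "snd t' = (snd t)(m + c := S c)" by simp
    have "fst t' 52 = fst t 52" unfolding t'_def by (rule den_frame) (simp add: asg_RSUM)
    then show ?thesis using 1 that unfolding t'_def[symmetric] by (auto simp: le_less)
  qed
  define t0 where "t0 = den n m (RSUM 0 (Eq (A1 52 iv) (C 0))) s"
  define t1 where "t1 = den n m (RSUM 1 (Eq (A1 52 iv) (C 1))) t0"
  define t2 where "t2 = den n m (RSUM 2 (Eq (A1 52 iv) (C 2))) t1"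
  define t3 where "t3 = den n m (RSUM 3 (Eq (A1 52 iv) (C 3))) t2"
  define t4 where "t4 = den n m (RSUM 4 (Eq (A1 52 iv) (C 4))) t3"
  have h0: "(\<forall>i<m. snd t0 i = snd s i) \<and> fst t0 52 = fst s 52 \<and> (\<forall>j\<le>0. snd t0 (m + j) = S j)" unfolding t0_def by (rule sm) auto
  have h1: "(\<forall>i<m. snd t1 i = snd s i) \<and> fst t1 52 = fst s 52 \<and> (\<forall>j\<le>1. snd t1 (m + j) = S j)" unfolding t1_def by (rule sm) (use h0 in auto)
  have h2: "(\<forall>i<m. snd t2 i = snd s i) \<and> fst t2 52 = fst s 52 \<and> (\<forall>j\<le>2. snd t2 (m + j) = S j)" unfolding t2_def by (rule sm) (use h1 in auto)
  have h3: "(\<forall>i<m. snd t3 i = snd s i) \<and> fst t3 52 = fst s 52 \<and> (\<forall>j\<le>3. snd t3 (m + j) = S j)" unfolding t3_def by (rule sm) (use h2 in auto)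
  have h4: "(\<forall>i<m. snd t4 i = snd s i) \<and> fst t4 52 = fst s 52 \<and> (\<forall>j\<le>4. snd t4 (m + j) = S j)" unfolding t4_def by (rule sm) (use h3 in auto)
  define M where "M j t \<longleftrightarrow> (\<forall>i\<le>4. snd t (m + i) = S i) \<and> fst t 53 0 0 \<le> j \<and> snd t (m + 5) = S (fst t 53 0 0) \<and> (\<forall>i\<le>j. S i \<le> S (fst t 53 0 0))"
    for j and t :: store
  have st: "M (Suc j) (den n m (BESTSTEP (Suc j)) t)" if Mt: "M j t" and j: "Suc j \<le> 4" for j t
  proof -
  have Sj: "snd t (m + Suc j) = S (Suc j)" using Mt j unfolding M_def by blast
  show ?thesis
  proof (cases "S (fst t 53 0 0) < S (Suc j)")
    case True
    have b: "bv n m (RLt 5 (Suc j)) t" using True Mt Sj by (simp add: M_def)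
    have d: "den n m (BESTSTEP (Suc j)) t = den n m (Sq (RC 5 (Suc j)) (SetV 53 (C (Suc j)))) t"
      unfolding BESTSTEP_def by (rule den_If_True[OF b])
    have "snd (den n m (BESTSTEP (Suc j)) t) = (snd t)(m + 5 := S (Suc j))" "fst (den n m (BESTSTEP (Suc j)) t) 53 0 0 = Suc j"
      using Sj unfolding d by (simp_all add: upd_def)
    moreover have "S i \<le> S (Suc j)" if "i \<le> Suc j" for i
    proof (cases "i = Suc j")
      case False
      then have "S i \<le> S (fst t 53 0 0)" using Mt that by (simp add: M_def)
      then show ?thesis using True by simp
    qed simp
    ultimately show ?thesis using Mt j by (auto simp: M_def)
  next
    case False
    have b: "\<not> bv n m (RLt 5 (Suc j)) t" using False Mt Sj by (simp add: M_def)
    have d: "den n m (BESTSTEP (Suc j)) t = den n m Sk t" unfolding BESTSTEP_def by (rule den_If_False[OF b])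
    have "snd (den n m (BESTSTEP (Suc j)) t) = snd t" "fst (den n m (BESTSTEP (Suc j)) t) 53 0 0 = fst t 53 0 0"
      unfolding d by (simp_all add: upd_def)
    then show ?thesis using Mt False by (auto simp: M_def le_Suc_eq)
  qed
  qed
  define u0 where "u0 = den n m (Sq (RC 5 0) (SetV 53 (C 0))) t4"
  have "snd t4 (m + 0) = S 0" using h4 by blast
  then have "M 0 u0" using h4 by (simp add: M_def u0_def upd_def)
  then have "M (Suc (Suc (Suc (Suc 0)))) (den n m (BESTSTEP (Suc (Suc (Suc (Suc 0))))) (den n m (BESTSTEP (Suc (Suc (Suc 0)))) (den n m (BESTSTEP (Suc (Suc 0)))
    (den n m (BESTSTEP (Suc 0)) u0))))" by (intro st) auto
  moreover have "s' = den n m (BESTSTEP 4) (den n m (BESTSTEP 3) (den n m (BESTSTEP 2) (den n m (BESTSTEP 1) u0)))"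
    unfolding s'_def BEST_def u0_def t4_def t3_def t2_def t1_def t0_def by (simp only: den.simps(5))
  ultimately have "M 4 s'" by (simp add: numeral_eq_Suc)
  then show ?thesis by (simp add: M_def)
qed

section \<open>The complete program\<close>

definition TREE :: hp where
  "TREE = Sq (For 40 LM (If (Eq (A1 31 iv) (V 48)) (Sq (Set1 34 iv (C 0)) (Set1 35 iv (C 0))) (Sq (Set1 34 iv (C 1)) (Set1 35 iv (C 1)))))
     (Sq LABI (Sq (Set1 32 (C 0) (C 1)) REACH))"

lemma asg_TREE: "asg TREE = {40, 34, 35, 42, 32, 41, 33, 79}"
  by (auto simp: TREE_def asg_progs)

text \<open>If a vertex stayed unlabelled, the labelled vertices would have a proper cut, which some
  edge outside the chosen class crosses; this contradicts closedness of the labels.\<close>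

lemma TREE_correct:
  fixes s and n m :: nat defines "s' \<equiv> den n m TREE s" and "A \<equiv> level_A s" and "B \<equiv> level_B s"
  assumes AB: "\<And>i. i < m \<Longrightarrow> A i < n \<and> B i < n" and lz: "lab_zero n s" and n: "0 < n"
    and con: "\<And>U. U \<subseteq> {..<n} \<Longrightarrow> U \<noteq> {} \<Longrightarrow> U \<noteq> {..<n} \<Longrightarrow> \<exists>i\<in>cut m A B U. fst s 31 0 i \<noteq> fst s 48 0 0"
  shows "rooted_tree n m A B (fst s' 32 0) (fst s' 33 0) (\<lambda>i. of_bool (i < m \<and> fst s 31 0 i \<noteq> fst s 48 0 0))"
    "\<And>v. v < n \<Longrightarrow> fst s' 32 0 v \<le> 2 * n"
proof -
  let ?p = "For 40 LM (If (Eq (A1 31 iv) (V 48)) (Sq (Set1 34 iv (C 0)) (Set1 35 iv (C 0))) (Sq (Set1 34 iv (C 1)) (Set1 35 iv (C 1))))"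
  define al where "al = (\<lambda>i. of_bool (i < m \<and> fst s 31 0 i \<noteq> fst s 48 0 0) :: nat)"
  define s1 where "s1 = den n m ?p s"
  define s2 where "s2 = den n m LABI s1"
  define s3 where "s3 = den n m (Set1 32 (C 0) (C 1)) s2"
  have s': "s' = den n m REACH s3" unfolding s'_def TREE_def s3_def s2_def s1_def by (simp only: den.simps(5))
  have f1: "fst s1 q = fst s q" if "q \<notin> {40, 34, 35}" for q unfolding s1_def by (rule den_frame) (use that in auto)
  have f2: "fst s2 q = fst s1 q" if "q \<notin> {42, 32}" for q unfolding s2_def by (rule den_frame) (use that in \<open>auto simp: asg_progs\<close>)
  have a34: "fst s1 34 r c = (if r = 0 \<and> c < m then of_bool (fst s 31 0 c \<noteq> fst s 48 0 0) else fst s 34 r c)" for r c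
    unfolding s1_def by (rule fill[where F = "\<lambda>c. of_bool (fst s 31 0 c \<noteq> fst s 48 0 0)" and R = 0]) (auto simp: upd_def)
  have a35: "fst s1 35 r c = (if r = 0 \<and> c < m then of_bool (fst s 31 0 c \<noteq> fst s 48 0 0) else fst s 35 r c)" for r c
    unfolding s1_def by (rule fill[where F = "\<lambda>c. of_bool (fst s 31 0 c \<noteq> fst s 48 0 0)" and R = 0]) (auto simp: upd_def)
  have l2: "fst s2 32 0 = (\<lambda>_. 0)"
    unfolding s2_def using LABI_correct[of n m s1 0] f1[of 32] lz by (auto simp: lab_zero_def fun_eq_iff not_less)
  have s3: "fst s3 = upd 32 0 0 1 (fst s2)" by (simp add: s3_def)
  have l3: "fst s3 32 0 = (\<lambda>v. of_bool (v = 0))" unfolding s3 using l2 by (auto simp: upd_def)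
  have lv: "level_A s3 = A" "level_B s3 = B" using f1 f2 by (simp_all add: s3 upd_def level_A_def level_B_def A_def B_def)
  have al3: "fst s3 34 0 i = al i" "fst s3 35 0 i = al i" if "i < m" for i
    using a34[of 0 i] a35[of 0 i] f2 that by (simp_all add: s3 upd_def al_def)
  have "labcard n (fst s3 32 0) = 1"
  proof -
    have "{v. v < 2 * n \<and> fst s3 32 0 v \<noteq> 0} = {0}" unfolding l3 using n by auto
    then show ?thesis by (simp add: labcard_def)
  qed
  then have lc: "fst s3 32 0 v \<le> labcard n (fst s3 32 0)" for v by (simp add: l3)
  have ids: "A i < 2 * n \<and> B i < 2 * n" if "i < m" for i using AB[OF that] by auto
  note re = REACH_correct[where s = s3 and n = n and m = m, OF _ lc, unfolded lv, OF ids, folded s']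
  let ?L = "fst s' 32 0" and ?P = "fst s' 33 0"
  have pk: "pred_ok m A B al al (\<lambda>v. of_bool (v = 0)) ?L ?P"
    using re(1) al3 unfolding pred_ok_def l3 by metis
  have cl: "closed_lab m A B al al ?L" using re(2) al3 unfolding closed_lab_def by auto
  have lab: "?L v \<noteq> 0" if "v < n" for v
  proof (rule ccontr)
    assume v: "\<not> ?thesis"
    define U where "U = {v. v < n \<and> ?L v \<noteq> 0}"
    have "?L 0 \<noteq> 0" using pk unfolding pred_ok_def by auto
    then have "U \<subseteq> {..<n}" "U \<noteq> {}" "U \<noteq> {..<n}" using n v that unfolding U_def by blast+
    then obtain i where i: "i \<in> cut m A B U" "fst s 31 0 i \<noteq> fst s 48 0 0" using con by blast
    then have im: "i < m" "al i = 1" by (auto simp: in_cut al_def)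
    then show False using cl i(1) AB[OF im(1)] unfolding closed_lab_def U_def in_cut cr_def by blast
  qed
  show "rooted_tree n m A B ?L ?P (\<lambda>i. of_bool (i < m \<and> fst s 31 0 i \<noteq> fst s 48 0 0))"
    unfolding al_def[symmetric] by unfold_locales (use n AB pk lab in auto)
  show "?L v \<le> 2 * n" if "v < n" for v using re(3)[of v] that by simp
qed

text \<open>Candidates 0 and 1 are the classes of that number, 2 to 4 the colours of the chosen
  class, shifted by one. The value 5 marks the edges of the other one of the classes 2 and 3, which
  are kept in any case.\<close>

definition FCLASS :: hp where
  "FCLASS = For 40 LM (If (Lt (A1 31 iv) (C 2)) (Set1 52 iv (A1 31 iv))
     (If (Eq (A1 31 iv) (V 48)) (Set1 52 iv (Inc (A1 51 iv))) (Set1 52 iv (C 5))))"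

definition OUTP :: hp where
  "OUTP = For 40 LM (If (Eq (A1 52 iv) (V 53)) (Set1 54 iv (C 0)) (Set1 54 iv (C 1)))"

definition COLOUR :: hp where
  "COLOUR = Sq SELC (Sq TREE (Sq ANCALL (Sq MEET COLS)))"

definition SELECT :: hp where
  "SELECT = Sq FCLASS (Sq BEST OUTP)"

lemma valid_proper:
  assumes v: "valid m A B q {..<n} {t}" "t < n" and e: "ends_in m A B {..<n}" and U: "U \<subseteq> {..<n}" "U \<noteq> {}" "U \<noteq> {..<n}"
  shows "\<exists>i\<in>cut m A B U. q i \<noteq> 2" "\<exists>i\<in>cut m A B U. q i \<noteq> 3"
    "2 \<le> card {i \<in> cut m A B U. q i \<noteq> 0}" "2 \<le> card {i \<in> cut m A B U. q i \<noteq> 1}"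
proof -
  define U' where "U' = (if t \<in> U then {..<n} - U else U)"
  have "U' \<subseteq> {..<n} - {t}" "U' \<noteq> {}" using U by (auto simp: U'_def)
  note c = v(1)[unfolded valid_def, rule_format, OF this]
  have "cut m A B U' = cut m A B U" using cut_complement[OF e U(1)] by (simp add: U'_def)
  then show "\<exists>i\<in>cut m A B U. q i \<noteq> 2" "\<exists>i\<in>cut m A B U. q i \<noteq> 3"
    "2 \<le> card {i \<in> cut m A B U. q i \<noteq> 0}" "2 \<le> card {i \<in> cut m A B U. q i \<noteq> 1}" using c by auto
qed

lemma COLOUR_correct:
  fixes s and n m :: nat defines "s' \<equiv> den n m COLOUR s" and "A \<equiv> level_A s" and "B \<equiv> level_B s" and "q \<equiv> fst s 31 0"
  assumes G: "cubic n m A B" and v: "valid m A B q {..<n} {t}" "t < n" and lz: "lab_zero n s"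
    and z: "\<And>r c. fst s 49 r c = 0" "\<And>c. fst s 55 0 c = 0"
  defines "S \<equiv> \<lambda>k. \<Sum>i | i < m \<and> q i = k. snd s i" and "cs \<equiv> fst s' 48 0 0" and "col \<equiv> fst s' 51 0"
  shows "cs \<in> {2, 3}" "S 2 \<le> S cs" "S 3 \<le> S cs" "\<And>i. i < m \<Longrightarrow> snd s' i = snd s i"
    "\<And>i. i < m \<Longrightarrow> q i = cs \<Longrightarrow> col i \<in> {1, 2, 3}"
    "\<And>U c. U \<subseteq> {..<n} \<Longrightarrow> U \<noteq> {} \<Longrightarrow> U \<noteq> {..<n} \<Longrightarrow> 2 \<le> card {i \<in> cut m A B U. \<not> (q i = cs \<and> col i = c)}"
proof -
  define s1 where "s1 = den n m SELC s"
  define s2 where "s2 = den n m TREE s1"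
  define s3 where "s3 = den n m ANCALL s2"
  define s4 where "s4 = den n m MEET s3"
  have s': "s' = den n m COLS s4" unfolding s'_def COLOUR_def s4_def s3_def s2_def s1_def by (simp only: den.simps(5))
  have f1: "fst s1 j = fst s j" if "j \<notin> {40, 79, 48}" for j unfolding s1_def by (rule den_frame) (use that in \<open>auto simp: asg_SELC\<close>)
  have f2: "fst s2 j = fst s1 j" if "j \<notin> {40, 34, 35, 42, 32, 41, 33, 79}" for j unfolding s2_def by (rule den_frame) (use that in \<open>auto simp: asg_TREE\<close>)
  have f3: "fst s3 j = fst s2 j" if "j \<notin> {42, 30, 41, 49, 79}" for j unfolding s3_def by (rule den_frame) (use that in \<open>auto simp: asg_ANCALL\<close>)
  have f4: "fst s4 j = fst s3 j" if "j \<notin> {40, 42, 50, 79}" for j unfolding s4_def by (rule den_frame) (use that in \<open>auto simp: asg_MEET\<close>)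
  have f5: "fst s' j = fst s4 j" if "j \<notin> {41, 40, 45, 42, 79, 46, 47, 51, 55}" for j unfolding s' by (rule den_frame) (use that in \<open>auto simp: asg_COLS\<close>)
  have g: "snd s2 = snd s1" "snd s3 = snd s2" "snd s4 = snd s3" "snd s' = snd s4"
    unfolding s' s4_def s3_def s2_def
    by (rule den_snd; simp add: TREE_def LABI_def REACH_def reach_body_def ANCALL_def ANCW_def OTH_def MEET_def COLS_def PROC_def CHI_def)+
  have cs1: "fst s1 48 0 0 = cs" using f2 f3 f4 f5 by (simp add: cs_def)
  note se = SELC_correct[where s = s and n = n and m = m, folded s1_def q_def S_def, unfolded cs1]
  show cs: "cs \<in> {2, 3}" and "S 2 \<le> S cs" "S 3 \<le> S cs" using se(1) unfolding S_def by auto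
  show "snd s' i = snd s i" if "i < m" for i using se(2)[OF that] g by simp
  note e = cubic_region(3)[OF G]
  have n: "0 < n" using G by (simp add: cubic_def)
  have AB: "A i < n \<and> B i < n" if "i < m" for i using G that by (simp add: cubic_def)
  have l1: "level_A s1 = A" "level_B s1 = B" "fst s1 31 0 = q" using f1 by (simp_all add: level_A_def level_B_def A_def B_def q_def)
  define al where "al = (\<lambda>i. of_bool (i < m \<and> q i \<noteq> cs) :: nat)"
  have tr: "rooted_tree n m A B (fst s2 32 0) (fst s2 33 0) al" and tl: "\<And>v. v < n \<Longrightarrow> fst s2 32 0 v \<le> 2 * n"
  proof -
    have "lab_zero n s1" using lz f1[of 32] by (simp add: lab_zero_def)
    moreover have "\<exists>i\<in>cut m A B U. q i \<noteq> cs" if "U \<subseteq> {..<n}" "U \<noteq> {}" "U \<noteq> {..<n}" for U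
      using valid_proper(1,2)[OF v e that] cs by auto
    ultimately show "rooted_tree n m A B (fst s2 32 0) (fst s2 33 0) al" "\<And>v. v < n \<Longrightarrow> fst s2 32 0 v \<le> 2 * n"
      using TREE_correct[of m s1 n, unfolded l1 cs1, folded s2_def al_def] AB n by blast+
  qed
  interpret T: rooted_tree n m A B "fst s2 32 0" "fst s2 33 0" al by (rule tr)
  have l2: "level_A s2 = A" "level_B s2 = B" using f2 l1 by (simp_all add: level_A_def level_B_def)
  have M: "fst s3 49 u y = of_bool (y \<in> T.anc u)" if "u < n" for u y
    unfolding s3_def using ANCALL_correct[of n m s2 al u y, unfolded l2, OF tr tl _ that] z(1) f1 f2 by simp
  have l3: "level_A s3 = A" "level_B s3 = B" using f3 l2 by (simp_all add: level_A_def level_B_def)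
  have D: "fst s4 50 0 i = depth_meet T.anc A B i" if "i < m" for i
  proof -
    have "{v. v < n \<and> fst s3 49 (A i) v = 1 \<and> fst s3 49 (B i) v = 1} = T.anc (A i) \<inter> T.anc (B i)"
      using M AB[OF that] T.sub[of "A i"] by auto
    then show ?thesis unfolding s4_def using MEET_correct[OF that, of n s3, unfolded l3] by (simp add: depth_meet_def)
  qed
  have l4: "level_A s4 = A" "level_B s4 = B" "fst s4 31 0 = q" "fst s4 48 0 0 = cs" "fst s4 49 = fst s3 49"
    using f2 f3 f4 l1 l3 cs1 by (simp_all add: level_A_def level_B_def)
  have z4: "fst s4 55 0 y = 0" for y using z(2) f1 f2 f3 f4 by simp
  have "colour_ok n T.anc A B {i. i < m \<and> q i = cs} (fst s' 55 0) col"
    unfolding col_def s' using COLS_correct[of n T.anc m s4, unfolded l4] T.ancestors_axioms AB M D z4 n by blast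
  moreover have "{i. i < m \<and> q i = cs} = {i. i < m \<and> al i \<noteq> 1}" by (auto simp: al_def)
  ultimately have ok: "colour_ok n T.anc A B {i. i < m \<and> al i \<noteq> 1} (fst s' 55 0) col" by simp
  show "col i \<in> {1, 2, 3}" if "i < m" "q i = cs" for i
    using ok that by (simp add: colour_ok_def al_def)
  show "2 \<le> card {i \<in> cut m A B U. \<not> (q i = cs \<and> col i = c)}" if U: "U \<subseteq> {..<n}" "U \<noteq> {}" "U \<noteq> {..<n}" for U c
  proof -
    have "3 \<le> card (cut m A B U)" using G U unfolding cubic_def by blast
    moreover have "{i \<in> cut m A B U. \<not> (al i \<noteq> 1 \<and> col i = c)} = {i \<in> cut m A B U. \<not> (q i = cs \<and> col i = c)}"
      by (auto simp: al_def in_cut)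
    ultimately show ?thesis using T.two_crossing_colour[OF ok U, of c] by simp
  qed
qed

lemma SELECT_correct:
  fixes s and n m :: nat and A B :: "nat \<Rightarrow> nat" defines "s' \<equiv> den n m SELECT s" and "q \<equiv> fst s 31 0" and "cs \<equiv> fst s 48 0 0" and "col \<equiv> fst s 51 0"
  defines "S \<equiv> \<lambda>k. \<Sum>i | i < m \<and> q i = k. snd s i" and "out \<equiv> fst s' 54 0"
  assumes cs: "cs \<in> {2, 3}" and S: "S 2 \<le> S cs" "S 3 \<le> S cs" and q3: "\<And>i. i < m \<Longrightarrow> q i \<le> 3"
    and col: "\<And>i. i < m \<Longrightarrow> q i = cs \<Longrightarrow> col i \<in> {1, 2, 3}"
    and U: "2 \<le> card {i \<in> cut m A B U. q i \<noteq> 0}" "2 \<le> card {i \<in> cut m A B U. q i \<noteq> 1}"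
      "\<And>c. 2 \<le> card {i \<in> cut m A B U. \<not> (q i = cs \<and> col i = c)}"
  shows "i < m \<Longrightarrow> out i \<le> 1" "2 \<le> card {i \<in> cut m A B U. out i = 1}"
    "(\<Sum>i<m. snd s i) \<le> 8 * (\<Sum>i | i < m \<and> out i = 0. snd s i)"
proof -
  define F where "F i = (if q i < 2 then q i else if q i = cs then Suc (col i) else 5)" for i
  define s1 where "s1 = den n m FCLASS s"
  define s2 where "s2 = den n m BEST s1"
  have s': "s' = den n m OUTP s2" unfolding s'_def SELECT_def s2_def s1_def by (simp only: den.simps(5))
  have 1: "fst s1 52 0 i = F i" if "i < m" for i
  proof -
    have "fst s1 52 r c = (if r = 0 \<and> c < m then F c else fst s 52 r c)" for r c
      unfolding s1_def FCLASS_def by (rule fill[where F = F and R = 0]) (auto simp: upd_def F_def q_def cs_def col_def)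
    then show ?thesis using that by simp
  qed
  have g1: "snd s1 = snd s" unfolding s1_def by (rule den_snd) (simp add: FCLASS_def)
  have f2: "fst s2 52 = fst s1 52" unfolding s2_def by (rule den_frame) (simp add: asg_BEST)
  define b where "b = fst s2 53 0 0"
  define R where "R k = (\<Sum>i | i < m \<and> F i = k. snd s i)" for k
  have R: "(\<Sum>i | i < m \<and> fst s1 52 0 i = k. snd s1 i) = R k" for k
    unfolding R_def g1 by (rule sum.cong) (use 1 in auto)
  have "b \<le> 4 \<and> (\<forall>j\<le>4. R j \<le> R b)"
    using BEST_correct[of n m s1] unfolding s2_def[symmetric] b_def[symmetric] R .
  then have b: "b \<le> 4" "\<And>j. j \<le> 4 \<Longrightarrow> R j \<le> R b" by simp_all
  have o: "out i = (if F i = b then 0 else 1)" if "i < m" for i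
  proof -
    have "fst s' 54 r c = (if r = 0 \<and> c < m then (if F c = b then 0 else 1) else fst s2 54 r c)" for r c
      unfolding s' OUTP_def by (rule fill[where R = 0]) (use 1 f2 in \<open>auto simp: upd_def b_def\<close>)
    then show ?thesis using that by (simp add: out_def)
  qed
  show "out i \<le> 1" if "i < m" for i using o[OF that] by simp
  have F: "F i = k \<longleftrightarrow> (if k < 2 then q i = k else q i = cs \<and> col i = k - 1)" if "i < m" "k \<le> 4" for i k
    using col[OF that(1)] cs that(2) by (auto simp: F_def)
  have oc: "{i \<in> cut m A B U. out i = 1} = {i \<in> cut m A B U. F i \<noteq> b}" using o by (auto simp: in_cut)
  consider "b = 0" | "b = 1" | "2 \<le> b" by linarith
  then show "2 \<le> card {i \<in> cut m A B U. out i = 1}"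
  proof cases
    case 1
    have "F i \<noteq> b \<longleftrightarrow> q i \<noteq> 0" if "i < m" for i using F[OF that, of 0] 1 by simp
    then have "{i \<in> cut m A B U. F i \<noteq> b} = {i \<in> cut m A B U. q i \<noteq> 0}" unfolding cut_def by blast
    then show ?thesis using U(1) oc by simp
  next
    case 2
    have "F i \<noteq> b \<longleftrightarrow> q i \<noteq> 1" if "i < m" for i using F[OF that, of 1] 2 by simp
    then have "{i \<in> cut m A B U. F i \<noteq> b} = {i \<in> cut m A B U. q i \<noteq> 1}" unfolding cut_def by blast
    then show ?thesis using U(2) oc by simp
  next
    case 3
    have "F i \<noteq> b \<longleftrightarrow> \<not> (q i = cs \<and> col i = b - 1)" if "i < m" for i using F[OF that b(1)] 3 by simp
    then have "{i \<in> cut m A B U. F i \<noteq> b} = {i \<in> cut m A B U. \<not> (q i = cs \<and> col i = b - 1)}" unfolding cut_def by blast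
    then show ?thesis using U(3)[of "b - 1"] oc by simp
  qed
  have ob: "(\<Sum>i | i < m \<and> out i = 0. snd s i) = R b" unfolding R_def by (rule sum.cong) (use o in \<open>auto split: if_splits\<close>)
  have part: "(\<Sum>i<m. snd s i) = S 0 + S 1 + S 2 + S 3"
  proof -
    have "(\<Sum>i<m. snd s i) = (\<Sum>k\<in>{0, 1, 2, 3}. \<Sum>i\<in>{i\<in>{..<m}. q i = k}. snd s i)"
      by (rule sum.group[symmetric]) (use q3 in \<open>fastforce+\<close>)
    then show ?thesis by (simp add: S_def)
  qed
  have "{i. i < m \<and> F i = 0} = {i. i < m \<and> q i = 0}" "{i. i < m \<and> F i = 1} = {i. i < m \<and> q i = 1}"
    using F[of _ 0] F[of _ 1] by fastforce+
  then have R01: "R 0 = S 0" "R 1 = S 1" unfolding R_def S_def by simp_all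
  have Scs: "S cs = R 2 + R 3 + R 4"
  proof -
    have "S cs = (\<Sum>i\<in>{i. i < m \<and> q i = cs}. snd s i)" by (simp add: S_def)
    also have "\<dots> = (\<Sum>k\<in>{2, 3, 4}. \<Sum>i\<in>{i\<in>{i. i < m \<and> q i = cs}. F i = k}. snd s i)"
    proof (rule sum.group[symmetric])
      show "F ` {i. i < m \<and> q i = cs} \<subseteq> {2, 3, 4}"
      proof (rule image_subsetI)
        fix i assume i: "i \<in> {i. i < m \<and> q i = cs}"
        then have "col i \<in> {1, 2, 3}" using col by simp
        then show "F i \<in> {2, 3, 4}" using i cs by (auto simp: F_def)
      qed
    qed simp_all
    also have "\<dots> = (\<Sum>k\<in>{2, 3, 4}. R k)" unfolding R_def
      by (intro sum.cong refl Collect_cong) (use F[of _ 2] F[of _ 3] F[of _ 4] in auto)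
    finally show ?thesis by simp
  qed
  show "(\<Sum>i<m. snd s i) \<le> 8 * (\<Sum>i | i < m \<and> out i = 0. snd s i)"
    unfolding part ob using S R01 Scs b(2)[of 0] b(2)[of 1] b(2)[of 2] b(2)[of 3] b(2)[of 4] by simp
qed

definition MAIN :: hp where
  "MAIN = Sq INIT (Sq REDUCE (Sq COLOUR SELECT))"

lemmas programs = MAIN_def INIT_def REDUCE_def STEP_def PREP1_def PREP2_def SEARCH_def FLOWZ_def FITER_def ALF1_def ALF2_def LABI_def
  REACH_def reach_body_def FINDT_def AUG_def aug_body_def SCAN_def At_def Xor_def OTH_def inner_def CONT_def DEL_def COPY_def KILL_def
  MOVE_def POP_def INS_def LOAD_def ALI_def FIN_def UNCON_def COLOUR_def SELC_def RSUM_def TREE_def ANCALL_def ANCW_def MEET_def COLS_def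
  PROC_def CHI_def SELECT_def FCLASS_def BEST_def BESTSTEP_def OUTP_def

text \<open>What matters is that the reduction leaves arrays 49 and 55 at zero, from which the
  ancestor table and the colouring start.\<close>

lemma asg_REDUCE: "asg REDUCE \<subseteq> {0..47} \<union> {79}"
  by (simp add: programs)

lemma wfp_MAIN: "wfp MAIN"
  by (simp add: programs)

text \<open>Depth 3 is attained twice: by the linear loop of the reduction around searches made of
  two nested loops, and by depths, links and tree vertices in the colouring. This is the origin of
  the cubic time bound.\<close>

lemma dg_MAIN: "dg MAIN \<le> 3"
  by (simp add: programs)

lemma MAIN_correct:
  fixes s and n m :: nat defines "s' \<equiv> den n m MAIN s" and "out \<equiv> fst (den n m MAIN s) 54 0"
  assumes G: "cubic n m A B" and AB: "\<And>i. i < m \<Longrightarrow> fst s 0 0 i = A i \<and> fst s 1 0 i = B i"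
    and z: "\<And>j r c. 2 \<le> j \<Longrightarrow> fst s j r c = 0"
  shows "\<And>i. i < m \<Longrightarrow> out i \<le> 1"
    "\<And>U. U \<subseteq> {..<n} \<Longrightarrow> U \<noteq> {} \<Longrightarrow> U \<noteq> {..<n} \<Longrightarrow> 2 \<le> card {i \<in> cut m A B U. out i = 1}"
    "(\<Sum>i<m. snd s i) \<le> 8 * (\<Sum>i | i < m \<and> out i = 0. snd s i)"
proof -
  define s1 where "s1 = den n m INIT s"
  define s2 where "s2 = den n m REDUCE s1"
  define s3 where "s3 = den n m COLOUR s2"
  have o: "out = fst (den n m SELECT s3) 54 0" unfolding out_def MAIN_def s3_def s2_def s1_def by (simp only: den.simps(5))
  obtain Vs where I: "inv n m A B s1 Vs" and mu: "mu n s1 < 2 * n" using INIT_correct[OF G AB z] unfolding s1_def by blast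
  note red = REDUCE_correct[OF I mu, folded s2_def]
  have f1: "fst s1 j = fst s j" if "j \<in> {49, 55}" for j unfolding s1_def by (rule den_frame) (use that in \<open>auto simp: asg_INIT\<close>)
  have f2: "fst s2 j = fst s1 j" if "j \<in> {49, 55}" for j unfolding s2_def by (rule den_frame) (use that asg_REDUCE in auto)
  have g: "snd s1 = snd s" "snd s2 = snd s1" unfolding s2_def s1_def by (rule den_snd; simp add: programs)+
  define q where "q = fst s2 31 0"
  have lv: "level_A s2 = fst s2 0 0" "level_B s2 = fst s2 1 0" using red(5) by (simp_all add: level_A_def level_B_def)
  have AB2: "fst s2 0 0 i = A i \<and> fst s2 1 0 i = B i" if "i < m" for i using red(4) that by blast
  have cg: "cut m (fst s2 0 0) (fst s2 1 0) X = cut m A B X" for X by (rule cut_congr) (rule AB2)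
  have cgv: "valid m (fst s2 0 0) (fst s2 1 0) q X Y = valid m A B q X Y" for X Y by (rule valid_congr) (rule AB2)
  have G2: "cubic n m (fst s2 0 0) (fst s2 1 0)" using G AB2 unfolding cubic_def cg by simp
  obtain t where t: "valid m A B q {..<n} {t}" "t < n" using red(1) unfolding q_def by blast
  have z2: "fst s2 49 r c = 0" "fst s2 55 0 c = 0" for r c using f1 f2 z by auto
  note co = COLOUR_correct[of n m s2 t, unfolded lv cg, folded s3_def q_def, unfolded cgv, OF G2 t red(3) z2]
  have f3: "fst s3 31 = fst s2 31" unfolding s3_def
    by (rule den_frame) (simp add: COLOUR_def asg_SELC asg_TREE asg_ANCALL asg_MEET asg_COLS)
  have q3: "fst s3 31 0 = q" using f3 by (simp add: q_def)
  have Sm: "(\<Sum>i | i < m \<and> q i = k. snd s2 i) = (\<Sum>i | i < m \<and> q i = k. snd s3 i)" for k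
    by (rule sum.cong) (use co(4) in auto)
  have qle: "q i \<le> 3" if "i < m" for i using red(2) that by (simp add: q_def)
  note e = cubic_region(3)[OF G]
  note sel = SELECT_correct[where s = s3 and n = n and m = m and A = A and B = B, unfolded q3, folded o, OF co(1) co(2)[unfolded Sm] co(3)[unfolded Sm] qle co(5)]
  show U: "2 \<le> card {i \<in> cut m A B U. out i = 1}" if U: "U \<subseteq> {..<n}" "U \<noteq> {}" "U \<noteq> {..<n}" for U
    by (rule sel(2)) (use valid_proper(3,4)[OF t e U] co(6)[OF U] in auto)
  have U0: "{0} \<subseteq> {..<n}" "{0} \<noteq> ({} :: nat set)" "{0} \<noteq> {..<n}"
  proof -
    have "0 < n" "1 < n" using G by (auto simp: cubic_def)
    then show "{0} \<subseteq> {..<n}" "{0} \<noteq> ({} :: nat set)" "{0} \<noteq> {..<n}" by auto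
  qed
  note vp = valid_proper(3,4)[OF t e U0] and c6 = co(6)[OF U0]
  show "out i \<le> 1" if "i < m" for i using sel(1)[OF _ _ _ vp c6 that] by blast
  have s3s: "snd s3 i = snd s i" if "i < m" for i using co(4)[OF that] g by simp
  have "(\<Sum>i<m. snd s3 i) \<le> 8 * (\<Sum>i | i < m \<and> out i = 0. snd s3 i)" using sel(3)[OF _ _ _ vp c6] by blast
  moreover have "(\<Sum>i<m. snd s3 i) = (\<Sum>i<m. snd s i)" by (rule sum.cong) (use s3s in auto)
  moreover have "(\<Sum>i | i < m \<and> out i = 0. snd s3 i) = (\<Sum>i | i < m \<and> out i = 0. snd s i)" by (rule sum.cong) (use s3s in auto)
  ultimately show "(\<Sum>i<m. snd s i) \<le> 8 * (\<Sum>i | i < m \<and> out i = 0. snd s i)" by simp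
qed

section \<open>Input and output\<close>

lemma exec_counting_loop:
  assumes step: "\<And>j s. j < N \<Longrightarrow> I j s \<Longrightarrow> bval g s \<and> (\<exists>t s'. exec w c s t s' \<and> t \<le> T \<and> I (Suc j) s')"
    and stop: "\<And>s. I N s \<Longrightarrow> \<not> bval g s" and I0: "I 0 s"
  shows "\<exists>t s'. exec w (While g c) s t s' \<and> t \<le> N * (T + 1) + 1 \<and> I N s'"
proof -
  have "j \<le> N \<Longrightarrow> I j s \<Longrightarrow> \<exists>t s'. exec w (While g c) s t s' \<and> t \<le> (N - j) * (T + 1) + 1 \<and> I N s'" for j s
  proof (induction "N - j" arbitrary: j s)
    case 0
    then have "j = N" by simp
    then show ?case using exec.WhileFalse[OF stop] 0 by fastforce
  next
    case (Suc d)
    then have j: "j < N" by simp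
    obtain t1 s1 where 1: "bval g s" "exec w c s t1 s1" "t1 \<le> T" "I (Suc j) s1" using step[OF j Suc.prems(2)] by blast
    obtain t2 s2 where 2: "exec w (While g c) s1 t2 s2" "t2 \<le> (N - Suc j) * (T + 1) + 1" "I N s2"
      using Suc.hyps(1)[OF _ Suc_leI[OF j] 1(4)] Suc.hyps(2) by (metis Suc_diff_Suc j nat.inject)
    have "exec w (While g c) s (1 + t1 + t2) s2" by (rule exec.WhileTrue[OF 1(1,2) 2(1)])
    moreover have "N - j = Suc (N - Suc j)" using j by simp
    then have "1 + t1 + t2 \<le> (N - j) * (T + 1) + 1" using 1(3) 2(2) by simp
    ultimately show ?case using 2(3) by blast
  qed
  from this[of 0 s] I0 show ?thesis by simp
qed

lemma exec_NStore:
  assumes "nval a s = x" "nval b s = y" "x \<le> w" "y \<le> w"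
  shows "exec w (NStore a b) s 1 ((fst s)(x := y), snd s)"
  using exec.NStore[of a s w b] assms by simp

abbreviation counter :: nexp where "counter \<equiv> NLoad (va 40)"
abbreviation advance :: com where "advance \<equiv> NStore (va 40) (NAdd counter (NConst 1))"

text \<open>Written in the machine language itself, as array programs cannot address the input cells
  below their arrays. The last store resets the counter, restoring the zero contents that the main
  program expects in all arrays from 2 on.\<close>

definition PROLOGUE :: com where
  "PROLOGUE = Seq (While (NLess counter (NLoad (NConst 1)))
     (Seq (NStore (cadr 0 (NConst 0) counter) (NLoad (NAdd (NConst 2) (NMul (NConst 2) counter))))
     (Seq (NStore (cadr 1 (NConst 0) counter) (NLoad (NAdd (NConst 3) (NMul (NConst 2) counter)))) advance)))
     (NStore (va 40) (NConst 0))"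

text \<open>Cells 0 and 1 hold \<open>n\<close> and \<open>m\<close>, which are needed to address the arrays; hence they are overwritten last.\<close>

definition EPILOGUE :: com where
  "EPILOGUE = Seq (NStore (va 40) (NConst 2)) (Seq (While (NLess counter (NLoad (NConst 1)))
     (Seq (NStore counter (NLoad (cadr 54 (NConst 0) counter))) advance))
     (Seq (NStore (NConst 0) (NLoad (cadr 54 (NConst 0) (NConst 0)))) (NStore (NConst 1) (NLoad (cadr 54 (NConst 0) (NConst 1))))))"

lemma nval_counter: "rep n m s st \<Longrightarrow> nval counter s = fst st 40 0 0"
  using nval_ce[of n m s st "V 40"] by simp

lemma addr_ge: "2 + 2 * m \<le> addr m j r c"
  by (simp add: addr_def)

lemma rep_input_cell: "rep n m s st \<Longrightarrow> 2 \<le> i \<Longrightarrow> i < 2 + 2 * m \<Longrightarrow> rep n m ((fst s)(i := x), snd s) st"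
proof -
  assume a: "rep n m s st" "2 \<le> i" "i < 2 + 2 * m"
  have "addr m j r c \<noteq> i" for j r c using addr_ge[of m j r c] a(3) by linarith
  then show ?thesis using a by (simp add: rep_def)
qed

definition loaded :: "(nat \<Rightarrow> nat) \<Rightarrow> (nat \<Rightarrow> nat) \<Rightarrow> nat \<Rightarrow> nat \<Rightarrow> mem" where
  "loaded a b j k = (\<lambda>q r c. if q = 0 \<and> r = 0 \<and> c < j then a c else if q = 1 \<and> r = 0 \<and> c < j then b c
     else if q = 40 \<and> r = 0 \<and> c = 0 then k else 0)"

lemma exec_PROLOGUE:
  assumes ab: "\<And>i. i < m \<Longrightarrow> a i < n \<and> b i < n" and w: "abound (n + m) \<le> w"
  shows "\<exists>t s. exec w PROLOGUE (input_state n m a b c) t s \<and> t \<le> 4 * m + 2 \<and>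
    rep n m s (loaded a b m 0, \<lambda>j. if j < m then c j else 0) \<and> (\<forall>x. fst s x \<le> n + m)"
proof -
  let ?in = "input_state n m a b c" and ?c = "\<lambda>j. if j < m then c j else 0"
  define I where "I j s \<longleftrightarrow> rep n m s (loaded a b j j, ?c) \<and> (\<forall>x<2 + 2 * m. fst s x = fst ?in x) \<and> (\<forall>x. fst s x \<le> n + m)"
    for j and s :: state
  have inb: "fst ?in x \<le> n + m" for x
  proof -
    have "(x - 2) div 2 < m" if "x < 2 + 2 * m" "2 \<le> x" using that by auto
    then have "a ((x - 2) div 2) \<le> n" "b ((x - 2) div 2) \<le> n" if "x < 2 + 2 * m" "2 \<le> x" using that ab less_imp_le by blast+
    then show ?thesis unfolding input_state_def by (auto intro: trans_le_add1)
  qed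
  have wb: "n + m \<le> w" using w by (simp add: abound_def)
  have ad: "addr m q 0 k \<le> w" if "q < 80" "k \<le> m" for q k
    by (rule order_trans[OF addr_le w]) (use that in auto)
  have st: "rep n m ((fst s)(addr m q 0 k := x), snd s) (upd q 0 k x M, ?c) \<and> (\<forall>y<2 + 2 * m. ((fst s)(addr m q 0 k := x)) y = fst ?in y) \<and>
     (\<forall>y. ((fst s)(addr m q 0 k := x)) y \<le> n + m)"
    if "rep n m s (M, ?c)" "\<forall>y<2 + 2 * m. fst s y = fst ?in y" "\<forall>y. fst s y \<le> n + m" "q < 80" "x \<le> n + m" for s q k x M
    using rep_store[OF that(1,4), of 0 k x] that addr_ge[of m q 0 k] by auto
  have loop: "\<exists>t s'. exec w (While (NLess counter (NLoad (NConst 1)))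
     (Seq (NStore (cadr 0 (NConst 0) counter) (NLoad (NAdd (NConst 2) (NMul (NConst 2) counter))))
     (Seq (NStore (cadr 1 (NConst 0) counter) (NLoad (NAdd (NConst 3) (NMul (NConst 2) counter)))) advance))) ?in t s' \<and>
     t \<le> m * (3 + 1) + 1 \<and> I m s'"
  proof (rule exec_counting_loop[where I = I])
    have "rep n m ?in (loaded a b 0 0, ?c)"
    proof -
      have "fst ?in (addr m j r k) = 0" for j r k using addr_ge[of m j r k] by (simp add: input_state_def)
      moreover have "fst ?in 0 = n" "fst ?in 1 = m" "snd ?in = ?c" by (simp_all add: input_state_def)
      ultimately show ?thesis by (simp add: rep_def loaded_def)
    qed
    then show "I 0 ?in" using inb by (simp add: I_def)
    show "\<not> bval (NLess counter (NLoad (NConst 1))) s" if "I m s" for s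
    proof -
      have r: "rep n m s (loaded a b m m, ?c)" using that by (simp add: I_def)
      have "nval counter s = m" using nval_counter[OF r] by (simp add: loaded_def)
      then show ?thesis using r by (simp add: rep_def)
    qed
    fix j s assume j: "j < m" and "I j s"
    then have r0: "rep n m s (loaded a b j j, ?c)" and i0: "\<forall>y<2 + 2 * m. fst s y = fst ?in y" and b0: "\<forall>y. fst s y \<le> n + m" by (auto simp: I_def)
    have cn: "nval counter s = j" using nval_counter[OF r0] by (simp add: loaded_def)
    have g: "bval (NLess counter (NLoad (NConst 1))) s" using r0 cn j by (simp add: rep_def)
    define s1 where "s1 = ((fst s)(addr m 0 0 j := a j), snd s)"
    have aj: "a j \<le> n + m" "b j \<le> n + m" using ab[OF j] by auto
    have "fst ?in (2 + 2 * j) = a j" "fst ?in (3 + 2 * j) = b j" using j by (auto simp: input_state_def)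
    then have in_j: "fst ?in (Suc (Suc (2 * j))) = a j" "fst ?in (Suc (Suc (Suc (2 * j)))) = b j" by (simp_all add: numeral_eq_Suc)
    have e1: "exec w (NStore (cadr 0 (NConst 0) counter) (NLoad (NAdd (NConst 2) (NMul (NConst 2) counter)))) s 1 s1"
      unfolding s1_def
    proof (rule exec_NStore)
      show "nval (cadr 0 (NConst 0) counter) s = addr m 0 0 j" using nval_cadr[OF r0, of 0 "NConst 0" counter] cn by simp
      show "nval (NLoad (NAdd (NConst 2) (NMul (NConst 2) counter))) s = a j" using cn i0 j in_j by simp
    qed (use ad[of 0 j] j aj wb in auto)
    have 1: "rep n m s1 (upd 0 0 j (a j) (loaded a b j j), ?c)" "\<forall>y<2 + 2 * m. fst s1 y = fst ?in y" "\<forall>y. fst s1 y \<le> n + m"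
      unfolding s1_def using st[OF r0 i0 b0, of 0 "a j" j] aj by auto
    have cn1: "nval counter s1 = j" using nval_counter[OF 1(1)] by (simp add: loaded_def upd_def)
    define s2 where "s2 = ((fst s1)(addr m 1 0 j := b j), snd s1)"
    have e2: "exec w (NStore (cadr 1 (NConst 0) counter) (NLoad (NAdd (NConst 3) (NMul (NConst 2) counter)))) s1 1 s2"
      unfolding s2_def
    proof (rule exec_NStore)
      show "nval (cadr 1 (NConst 0) counter) s1 = addr m 1 0 j" using nval_cadr[OF 1(1), of 1 "NConst 0" counter] cn1 by simp
      show "nval (NLoad (NAdd (NConst 3) (NMul (NConst 2) counter))) s1 = b j" using cn1 1(2) j in_j by (simp add: numeral_eq_Suc)
    qed (use ad[of 1 j] j aj wb in auto)
    have 2: "rep n m s2 (upd 1 0 j (b j) (upd 0 0 j (a j) (loaded a b j j)), ?c)" "\<forall>y<2 + 2 * m. fst s2 y = fst ?in y" "\<forall>y. fst s2 y \<le> n + m"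
      unfolding s2_def using st[OF 1, of 1 "b j" j] aj by auto
    have cn2: "nval counter s2 = j" using nval_counter[OF 2(1)] by (simp add: loaded_def upd_def)
    define s3 where "s3 = ((fst s2)(addr m 40 0 0 := Suc j), snd s2)"
    have e3: "exec w advance s2 1 s3"
      unfolding s3_def
    proof (rule exec_NStore)
      show "nval (va 40) s2 = addr m 40 0 0" using nval_cadr[OF 2(1), of 40 "NConst 0" "NConst 0"] by simp
      show "nval (NAdd counter (NConst 1)) s2 = Suc j" using cn2 by simp
    qed (use ad[of 40 0] j wb in auto)
    have 3: "rep n m s3 (upd 40 0 0 (Suc j) (upd 1 0 j (b j) (upd 0 0 j (a j) (loaded a b j j))), ?c)" "\<forall>y<2 + 2 * m. fst s3 y = fst ?in y" "\<forall>y. fst s3 y \<le> n + m"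
      unfolding s3_def using st[OF 2, of 40 "Suc j" 0] j by auto
    have "upd 40 0 0 (Suc j) (upd 1 0 j (b j) (upd 0 0 j (a j) (loaded a b j j))) = loaded a b (Suc j) (Suc j)"
      by (intro ext) (auto simp: upd_apply loaded_def less_Suc_eq)
    then have "I (Suc j) s3" using 3 by (simp add: I_def)
    moreover have "exec w (Seq (NStore (cadr 0 (NConst 0) counter) (NLoad (NAdd (NConst 2) (NMul (NConst 2) counter))))
     (Seq (NStore (cadr 1 (NConst 0) counter) (NLoad (NAdd (NConst 3) (NMul (NConst 2) counter)))) advance)) s (1 + (1 + 1)) s3"
      by (intro exec.Seq) (rule e1 e2 e3)+
    ultimately show "bval (NLess counter (NLoad (NConst 1))) s \<and> (\<exists>t s'. exec w (Seq (NStore (cadr 0 (NConst 0) counter) (NLoad (NAdd (NConst 2) (NMul (NConst 2) counter))))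
     (Seq (NStore (cadr 1 (NConst 0) counter) (NLoad (NAdd (NConst 3) (NMul (NConst 2) counter)))) advance)) s t s' \<and> t \<le> 3 \<and> I (Suc j) s')"
      using g by (intro conjI exI[of _ "1 + (1 + 1)"] exI[of _ s3]) auto
  qed
  then obtain t s where 1: "exec w (While (NLess counter (NLoad (NConst 1)))
     (Seq (NStore (cadr 0 (NConst 0) counter) (NLoad (NAdd (NConst 2) (NMul (NConst 2) counter))))
     (Seq (NStore (cadr 1 (NConst 0) counter) (NLoad (NAdd (NConst 3) (NMul (NConst 2) counter)))) advance))) ?in t s" "t \<le> m * (3 + 1) + 1" "I m s"
    by blast
  define s' where "s' = ((fst s)(addr m 40 0 0 := 0), snd s)"
  have r: "rep n m s (loaded a b m m, ?c)" "\<forall>y<2 + 2 * m. fst s y = fst ?in y" "\<forall>y. fst s y \<le> n + m" using 1(3) by (auto simp: I_def)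
  have e: "exec w (NStore (va 40) (NConst 0)) s 1 s'"
    unfolding s'_def
  proof (rule exec_NStore)
    show "nval (va 40) s = addr m 40 0 0" using nval_cadr[OF r(1), of 40 "NConst 0" "NConst 0"] by simp
  qed (use ad[of 40 0] in auto)
  have "rep n m s' (upd 40 0 0 0 (loaded a b m m), ?c)" "\<forall>y. fst s' y \<le> n + m" unfolding s'_def using st[OF r, of 40 0 0] by auto
  moreover have "upd 40 0 0 0 (loaded a b m m) = loaded a b m 0" by (intro ext) (auto simp: upd_apply loaded_def)
  moreover have "exec w PROLOGUE ?in (t + 1) s'" unfolding PROLOGUE_def by (rule exec.Seq[OF 1(1) e])
  ultimately show ?thesis using 1(2) by (intro exI[of _ "t + 1"] exI[of _ s']) auto
qed

lemma exec_EPILOGUE: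
  assumes r: "rep n m s st" and out: "\<And>i. i < m \<Longrightarrow> fst st 54 0 i \<le> 1" and m: "2 \<le> m" and w: "abound m \<le> w"
  shows "\<exists>t s'. exec w EPILOGUE s t s' \<and> t \<le> 3 * m + 4 \<and> (\<forall>i<m. fst s' i = fst st 54 0 i)"
proof -
  let ?o = "fst st 54 0"
  define I where "I j u \<longleftrightarrow> (\<exists>st'. rep n m u st' \<and> fst st' 54 0 = ?o \<and> fst st' 40 0 0 = 2 + j) \<and> (\<forall>i. 2 \<le> i \<longrightarrow> i < 2 + j \<longrightarrow> fst u i = ?o i)"
    for j and u :: state
  have wb: "82 + m \<le> w" using w by (simp add: abound_def)
  have ad: "addr m q 0 k \<le> w" if "q < 80" "k \<le> m" for q k
    by (rule order_trans[OF addr_le w]) (use that in auto)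
  have va: "nval (va 40) u = addr m 40 0 0" if "rep n m u st'" for u st'
    using nval_cadr[OF that, of 40 "NConst 0" "NConst 0"] by simp
  have rd: "nval (NLoad (cadr 54 (NConst 0) e)) u = fst st' 54 0 (nval e u)" if "rep n m u st'" for u st' e
    using nval_cadr[OF that, of 54 "NConst 0" e] that by (simp add: rep_def)
  define s1 where "s1 = ((fst s)(addr m 40 0 0 := 2), snd s)"
  have e1: "exec w (NStore (va 40) (NConst 2)) s 1 s1" unfolding s1_def
    by (rule exec_NStore) (use va[OF r] ad[of 40 0] wb in auto)
  have "rep n m s1 (upd 40 0 0 2 (fst st), snd st)" unfolding s1_def by (rule rep_store[OF r]) simp
  then have I0: "I 0 s1" unfolding I_def by (intro conjI exI[of _ "(upd 40 0 0 2 (fst st), snd st)"]) (auto simp: upd_def)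
  have "\<exists>t s'. exec w (While (NLess counter (NLoad (NConst 1))) (Seq (NStore counter (NLoad (cadr 54 (NConst 0) counter))) advance)) s1 t s' \<and>
     t \<le> (m - 2) * (2 + 1) + 1 \<and> I (m - 2) s'"
  proof (rule exec_counting_loop[where I = I, OF _ _ I0])
    show "\<not> bval (NLess counter (NLoad (NConst 1))) u" if Iu: "I (m - 2) u" for u
    proof -
      obtain st' where r': "rep n m u st'" "fst st' 40 0 0 = 2 + (m - 2)" using Iu by (auto simp: I_def)
      show ?thesis using nval_counter[OF r'(1)] r' m by (simp add: rep_def)
    qed
    fix j u assume j: "j < m - 2" and Iu: "I j u"
    then obtain st' where r': "rep n m u st'" and o: "fst st' 54 0 = ?o" and c: "fst st' 40 0 0 = 2 + j" by (auto simp: I_def)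
    have old: "fst u i = ?o i" if "2 \<le> i" "i < 2 + j" for i using Iu that by (auto simp: I_def)
    have jm: "2 + j < m" using j by simp
    have cn: "nval counter u = 2 + j" using nval_counter[OF r'] c by simp
    have g: "bval (NLess counter (NLoad (NConst 1))) u" using r' cn jm by (simp add: rep_def)
    define u1 where "u1 = ((fst u)(2 + j := ?o (2 + j)), snd u)"
    have a1: "exec w (NStore counter (NLoad (cadr 54 (NConst 0) counter))) u 1 u1" unfolding u1_def
    proof (rule exec_NStore)
      show "nval (NLoad (cadr 54 (NConst 0) counter)) u = ?o (2 + j)" using rd[OF r', of counter] cn o by simp
      show "?o (2 + j) \<le> w" using out[OF jm] wb by simp
      show "2 + j \<le> w" using jm wb by simp
    qed (rule cn)
    have r1: "rep n m u1 st'" unfolding u1_def by (rule rep_input_cell[OF r']) (use jm in auto)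
    define u2 where "u2 = ((fst u1)(addr m 40 0 0 := 2 + Suc j), snd u1)"
    have a2: "exec w advance u1 1 u2" unfolding u2_def
    proof (rule exec_NStore)
      show "nval (NAdd counter (NConst 1)) u1 = 2 + Suc j" using nval_counter[OF r1] c by simp
      show "2 + Suc j \<le> w" using jm wb by simp
    qed (use va[OF r1] ad[of 40 0] in auto)
    have "rep n m u2 (upd 40 0 0 (2 + Suc j) (fst st'), snd st')" unfolding u2_def by (rule rep_store[OF r1]) simp
    moreover have "fst u2 i = ?o i" if "2 \<le> i" "i < 2 + Suc j" for i
    proof -
      have "i \<noteq> addr m 40 0 0" using addr_ge[of m 40 0 0] that jm by auto
      then show ?thesis using old[OF that(1)] that by (cases "i = 2 + j") (auto simp: u2_def u1_def)
    qed
    ultimately have "I (Suc j) u2" unfolding I_def using o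
      by (intro conjI exI[of _ "(upd 40 0 0 (2 + Suc j) (fst st'), snd st')"]) (auto simp: upd_def)
    moreover have "exec w (Seq (NStore counter (NLoad (cadr 54 (NConst 0) counter))) advance) u (1 + 1) u2" by (rule exec.Seq[OF a1 a2])
    ultimately show "bval (NLess counter (NLoad (NConst 1))) u \<and> (\<exists>t s'. exec w (Seq (NStore counter (NLoad (cadr 54 (NConst 0) counter))) advance) u t s' \<and> t \<le> 2 \<and> I (Suc j) s')"
      using g by (intro conjI exI[of _ "1 + 1"] exI[of _ u2]) auto
  qed
  then obtain t2 s2 where 2: "exec w (While (NLess counter (NLoad (NConst 1))) (Seq (NStore counter (NLoad (cadr 54 (NConst 0) counter))) advance)) s1 t2 s2"
     "t2 \<le> (m - 2) * (2 + 1) + 1" "I (m - 2) s2" by blast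
  then obtain st' where r': "rep n m s2 st'" and o: "fst st' 54 0 = ?o" by (auto simp: I_def)
  have old: "fst s2 i = ?o i" if "2 \<le> i" "i < m" for i using 2(3) that by (auto simp: I_def)
  define s3 where "s3 = ((fst s2)(0 := ?o 0), snd s2)"
  have o01: "?o 0 \<le> 1" "?o 1 \<le> 1" using out[of 0] out[of 1] m by auto
  have e3: "exec w (NStore (NConst 0) (NLoad (cadr 54 (NConst 0) (NConst 0)))) s2 1 s3" unfolding s3_def
    by (rule exec_NStore) (use rd[OF r', of "NConst 0"] o o01 wb in auto)
  define s4 where "s4 = ((fst s3)(1 := ?o 1), snd s3)"
  have "fst s3 1 = m" using r' by (simp add: s3_def rep_def)
  then have "nval (cadr 54 (NConst 0) (NConst 1)) s3 = addr m 54 0 1" by (simp add: cadr_def addr_def)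
  moreover have "fst s3 (addr m 54 0 1) = ?o 1" using addr_ge[of m 54 0 1] r' o by (simp add: s3_def rep_def)
  ultimately have v1: "nval (NLoad (cadr 54 (NConst 0) (NConst 1))) s3 = ?o 1" by simp
  have e4: "exec w (NStore (NConst 1) (NLoad (cadr 54 (NConst 0) (NConst 1)))) s3 1 s4" unfolding s4_def
    by (rule exec_NStore[OF _ v1]) (use o01 wb in auto)
  have "exec w EPILOGUE s (1 + (t2 + (1 + 1))) s4" unfolding EPILOGUE_def by (intro exec.Seq) (rule e1 2(1) e3 e4)+
  moreover have "1 + (t2 + (1 + 1)) \<le> 3 * m + 4" using 2(2) m by simp
  moreover have "fst s4 i = ?o i" if "i < m" for i
  proof -
    consider "i = 0" | "i = 1" | "2 \<le> i" by linarith
    then show ?thesis by cases (use old[OF _ that] in \<open>auto simp: s4_def s3_def\<close>)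
  qed
  ultimately show ?thesis by blast
qed

section \<open>Cuts and connectivity\<close>

text \<open>A cut of fewer than three edges could be removed as a whole; the rest would be
  connected, although no path could then leave \<open>U\<close>.\<close>

lemma cubic_of_regular:
  assumes mg: "multigraph {..<n} {..<m} (\<lambda>i. {a i, b i})" and rg: "regular_graph 3 {..<n} {..<m} (\<lambda>i. {a i, b i})"
    and ec: "edge_connected 3 {..<n} (\<lambda>i. {a i, b i}) (mset_set {..<m})"
  shows "cubic n m a b"
proof -
  have ab: "a i < n \<and> b i < n \<and> a i \<noteq> b i" if "i < m" for i
  proof -
    have "\<exists>u\<in>{..<n}. \<exists>v\<in>{..<n}. u \<noteq> v \<and> {a i, b i} = {u, v}"
      by (rule mg[unfolded multigraph_def, THEN conjunct2, THEN conjunct2, THEN conjunct2, rule_format]) (use that in simp)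
    then obtain u v where "u < n" "v < n" "u \<noteq> v" "{a i, b i} = {u, v}" by auto
    then show ?thesis by (auto simp: doubleton_eq_iff)
  qed
  have cv: "card (cut m a b {v}) = 3" if "v < n" for v
  proof -
    have "cr a b {v} e \<longleftrightarrow> v \<in> {a e, b e}" if "e < m" for e using ab[OF that] by (auto simp: cr_def)
    then have "cut m a b {v} = {e \<in> {..<m}. v \<in> {a e, b e}}" unfolding cut_def lessThan_iff by blast
    then show ?thesis using rg that by (simp add: regular_graph_def)
  qed
  have "0 < n" using mg by (auto simp: multigraph_def)
  have n: "2 \<le> n"
  proof -
    have "cut m a b {0} \<noteq> {}" using cv[OF \<open>0 < n\<close>] by auto
    then obtain i where "i < m" by (auto simp: cut_def)
    then show ?thesis using ab[of i] by linarith
  qed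
  have "3 \<le> card (cut m a b U)" if U: "U \<subseteq> {..<n}" "U \<noteq> {}" "U \<noteq> {..<n}" for U
  proof (rule ccontr)
    assume c: "\<not> ?thesis"
    let ?F = "mset_set (cut m a b U)"
    have sub: "cut m a b U \<subseteq> {..<m}" by (auto simp: cut_def)
    then have FM: "?F \<subseteq># mset_set {..<m}" by (simp add: subset_imp_msubset_mset_set)
    have D: "mset_set {..<m} - ?F = mset_set ({..<m} - cut m a b U)" using sub by (simp add: mset_set_Diff)
    have con: "connected_graph {..<n} (\<lambda>i. {a i, b i}) (mset_set ({..<m} - cut m a b U))"
    proof -
      have "size ?F < 3" using c by simp
      then show ?thesis using ec FM unfolding edge_connected_def D[symmetric] by simp
    qed
    obtain u v where uv: "u \<in> U" "v \<in> {..<n}" "v \<notin> U" using U by auto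
    then have "(\<lambda>x y. \<exists>e\<in>#mset_set ({..<m} - cut m a b U). {a e, b e} = {x, y})\<^sup>*\<^sup>* u v"
      using con U(1) unfolding connected_graph_def by blast
    then have "v \<in> U"
    proof (induction rule: rtranclp_induct)
      case base
      then show ?case using uv by simp
    next
      case (step y z)
      then obtain e where e: "e < m" "e \<notin> cut m a b U" "{a e, b e} = {y, z}" by auto
      then have "(a e \<in> U) = (b e \<in> U)" by (auto simp: in_cut cr_def)
      then show ?case using step.IH e(3) by (auto simp: doubleton_eq_iff)
    qed
    then show False using uv by simp
  qed
  then show ?thesis using n ab cv unfolding cubic_def by blast
qed

text \<open>The union bound over the vertex cuts counts each edge twice, but 3 edges per vertex are
  good enough for the time bound.\<close>

lemma cubic_edges:
  assumes "cubic n m a b"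
  shows "m \<le> 3 * n" "3 \<le> m"
proof -
  have "{..<m} \<subseteq> (\<Union>v<n. cut m a b {v})"
  proof
    fix i assume "i \<in> {..<m}"
    then have "i < m" "a i < n" "a i \<noteq> b i" using assms by (auto simp: cubic_def)
    then have "i \<in> cut m a b {a i}" by (simp add: in_cut cr_def)
    then show "i \<in> (\<Union>v<n. cut m a b {v})" using \<open>a i < n\<close> by blast
  qed
  then have "card {..<m} \<le> card (\<Union>v<n. cut m a b {v})" by (intro card_mono) auto
  also have "\<dots> \<le> (\<Sum>v<n. card (cut m a b {v}))" by (rule card_UN_le) simp
  also have "\<dots> = (\<Sum>v<n. 3)" by (rule sum.cong) (use assms in \<open>auto simp: cubic_def\<close>)
  finally show "m \<le> 3 * n" by simp
  have "card (cut m a b {0}) = 3" using assms by (simp add: cubic_def)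
  moreover have "card (cut m a b {0}) \<le> card {..<m}" by (intro card_mono) (auto simp: cut_def)
  ultimately show "3 \<le> m" by simp
qed

text \<open>The set of vertices reachable from \<open>u\<close> is closed under the edges of
  \<open>M\<close>; if it were a proper subset, an edge of \<open>M\<close> would cross it.\<close>

lemma connected_of_cuts:
  assumes ab: "\<And>i. i < m \<Longrightarrow> a i < n \<and> b i < n"
    and c: "\<And>U. U \<subseteq> {..<n} \<Longrightarrow> U \<noteq> {} \<Longrightarrow> U \<noteq> {..<n} \<Longrightarrow> \<exists>i\<in>cut m a b U. i \<in># M"
  shows "connected_graph {..<n} (\<lambda>i. {a i, b i}) M"
  unfolding connected_graph_def
proof (intro ballI)
  fix u v assume uv: "u \<in> {..<n}" "v \<in> {..<n}"
  let ?R = "\<lambda>x y. \<exists>e\<in>#M. {a e, b e} = {x, y}"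
  define U where "U = {x. x < n \<and> ?R\<^sup>*\<^sup>* u x}"
  show "?R\<^sup>*\<^sup>* u v"
  proof (rule ccontr)
    assume "\<not> ?thesis"
    then have "U \<noteq> {..<n}" "U \<subseteq> {..<n}" "U \<noteq> {}" using uv by (auto simp: U_def)
    then obtain i where i: "i \<in> cut m a b U" "i \<in># M" using c by blast
    then have im: "i < m" "(a i \<in> U) \<noteq> (b i \<in> U)" by (auto simp: in_cut cr_def)
    have "?R (a i) (b i)" "?R (b i) (a i)" using i(2) by blast+
    then have "?R\<^sup>*\<^sup>* u (a i) \<longleftrightarrow> ?R\<^sup>*\<^sup>* u (b i)" using rtranclp.rtrancl_into_rtrancl[of ?R u "a i" "b i"] rtranclp.rtrancl_into_rtrancl[of ?R u "b i" "a i"] by blast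
    then show False using im ab[OF im(1)] by (auto simp: U_def)
  qed
qed

section \<open>From multiplicities to the multisubgraph\<close>

lemma count_output: fixes m :: nat shows "count (\<Sum>i<m. replicate_mset (f i) i) j = (if j < m then f j else 0)"
  by (induction m) (auto simp: less_Suc_eq)

lemma cost_output: fixes m :: nat shows "cost c (\<Sum>i<m. replicate_mset (f i) i) = (\<Sum>i<m. real (f i) * c i)"
  by (induction m) (auto simp: cost_def)

lemma output_correct:
  assumes G: "cubic n m a b" and out: "\<And>i. i < m \<Longrightarrow> out i \<le> 1"
    and cuts: "\<And>U. U \<subseteq> {..<n} \<Longrightarrow> U \<noteq> {} \<Longrightarrow> U \<noteq> {..<n} \<Longrightarrow> 2 \<le> card {i \<in> cut m a b U. out i = 1}"
    and cst: "(\<Sum>i<m. c i) \<le> 8 * (\<Sum>i | i < m \<and> out i = 0. c i)"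
  defines "H \<equiv> \<Sum>i<m. replicate_mset (out i) i"
  shows "spanning_multisubgraph {..<m} H" "two_edge_connected {..<n} (\<lambda>i. {a i, b i}) H"
    "cost c H \<le> 7 / 8 * cost c (mset_set {..<m})"
proof -
  have cnt: "count H i = (if i < m then out i else 0)" for i unfolding H_def by (rule count_output)
  have mem: "i \<in># H \<longleftrightarrow> i < m \<and> out i = 1" for i
  proof -
    have "i \<in># H \<longleftrightarrow> i < m \<and> out i \<noteq> 0" using cnt[of i] by (simp add: count_greater_zero_iff[symmetric] del: count_greater_zero_iff)
    then show ?thesis using out[of i] by (cases "i < m") auto
  qed
  show "spanning_multisubgraph {..<m} H" using mem by (auto simp: spanning_multisubgraph_def)
  have ab: "a i < n \<and> b i < n" if "i < m" for i using G that by (simp add: cubic_def)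
  have two: "\<exists>i\<in>cut m a b U. i \<in># H \<and> i \<noteq> e" if U: "U \<subseteq> {..<n}" "U \<noteq> {}" "U \<noteq> {..<n}" for U e
  proof -
    obtain i j where "i \<in> {i \<in> cut m a b U. out i = 1}" "j \<in> {i \<in> cut m a b U. out i = 1}" "i \<noteq> j"
      using cuts[OF U] by (rule two_le_cardE)
    then show ?thesis using mem by (metis (mono_tags, lifting) in_cut mem_Collect_eq)
  qed
  have "connected_graph {..<n} (\<lambda>i. {a i, b i}) H" 
  proof (rule connected_of_cuts[OF ab])
    fix U assume "U \<subseteq> {..<n}" "U \<noteq> {}" "U \<noteq> {..<n}"
    \<comment> \<open>The excluded name \<open>m\<close> belongs to no edge, so nothing is excluded
      here.\<close>
    from two[OF this, of m] show "\<exists>i\<in>cut m a b U. i \<in># H" by blast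
  qed
  moreover have "connected_graph {..<n} (\<lambda>i. {a i, b i}) (H - {#e#})" for e
  proof (rule connected_of_cuts[OF ab])
    fix U assume "U \<subseteq> {..<n}" "U \<noteq> {}" "U \<noteq> {..<n}"
    then obtain i where "i \<in> cut m a b U" "i \<in># H" "i \<noteq> e" using two by blast
    then show "\<exists>i\<in>cut m a b U. i \<in># H - {#e#}" by (intro bexI[of _ i]) (auto simp: in_diff_count)
  qed
  ultimately show "two_edge_connected {..<n} (\<lambda>i. {a i, b i}) H" by (simp add: two_edge_connected_def)
  have "(\<Sum>i<m. c i) = (\<Sum>i<m. real (out i) * c i) + (\<Sum>i | i < m \<and> out i = 0. c i)"
  proof -
    have "(\<Sum>i | i < m \<and> out i = 0. c i) = (\<Sum>i<m. if out i = 0 then c i else 0)"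
      by (rule sum.mono_neutral_cong_left) auto
    moreover have "(\<Sum>i<m. real (out i) * c i) + (\<Sum>i<m. if out i = 0 then c i else 0) = (\<Sum>i<m. c i)"
      unfolding sum.distrib[symmetric]
    proof (rule sum.cong)
      fix i assume "i \<in> {..<m}"
      then have "out i = 0 \<or> out i = 1" using out[of i] by auto
      then show "real (out i) * c i + (if out i = 0 then c i else 0) = c i" by auto
    qed simp
    ultimately show ?thesis by simp
  qed
  moreover have "cost c (mset_set {..<m}) = (\<Sum>i<m. c i)" by (simp add: cost_def sum_unfold_sum_mset)
  ultimately show "cost c H \<le> 7 / 8 * cost c (mset_set {..<m})" using cst unfolding H_def cost_output by simp
qed

section \<open>The whole program and its polynomial bounds\<close>

definition ALG :: com where
  "ALG = Seq PROLOGUE (Seq (cp MAIN) EPILOGUE)"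

lemma exec_ALG:
  assumes G: "cubic n m a b" and w: "abound (n + m + szp MAIN * time n m MAIN) \<le> w"
  shows "\<exists>t s. exec w ALG (input_state n m a b c) t s \<and> t \<le> 7 * m + 6 + time n m MAIN \<and>
    (let H = output_multiset m s in spanning_multisubgraph {..<m} H \<and> two_edge_connected {..<n} (\<lambda>i. {a i, b i}) H \<and>
      cost c H \<le> 7 / 8 * cost c (mset_set {..<m}))"
proof -
  let ?c = "\<lambda>j. if j < m then c j else 0"
  define st where "st = (loaded a b m 0, ?c)"
  have ab: "a i < n \<and> b i < n" if "i < m" for i using G that by (simp add: cubic_def)
  have "abound (n + m) \<le> w" by (rule order_trans[OF abound_mono w]) simp
  then obtain t1 s1 where 1: "exec w PROLOGUE (input_state n m a b c) t1 s1" "t1 \<le> 4 * m + 2" "rep n m s1 st" "\<forall>x. fst s1 x \<le> n + m"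
    using exec_PROLOGUE[where n = n and m = m and a = a and b = b and w = w and c = c] ab unfolding st_def by blast
  obtain t2 s2 where 2: "runs w (cp MAIN) s1 t2 s2 (n + m) (szp MAIN) (time n m MAIN)" "rep n m s2 (den n m MAIN st)"
    using exec_cp[OF wfp_MAIN 1(3,4) order_refl w] by blast
  define out where "out = fst (den n m MAIN st) 54 0"
  have ld: "fst st 0 0 i = a i \<and> fst st 1 0 i = b i" if "i < m" for i using that by (simp add: st_def loaded_def)
  have z: "fst st j r k = 0" if "2 \<le> j" for j r k using that by (simp add: st_def loaded_def)
  note mc = MAIN_correct[where s = st and n = n and m = m, OF G ld z, folded out_def]
  have o1: "out i \<le> 1" if "i < m" for i using mc(1) that by blast
  have "2 \<le> m" using cubic_edges[OF G] by simp
  moreover have "abound m \<le> w" by (rule order_trans[OF abound_mono w]) simp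
  ultimately obtain t3 s3 where 3: "exec w EPILOGUE s2 t3 s3" "t3 \<le> 3 * m + 4" "\<forall>i<m. fst s3 i = out i"
    using exec_EPILOGUE[OF 2(2)] o1 unfolding out_def by blast
  have "exec w ALG (input_state n m a b c) (t1 + (t2 + t3)) s3"
    unfolding ALG_def by (intro exec.Seq) (use 1(1) 2(1) 3(1) in \<open>auto simp: runs_def\<close>)
  moreover have "t1 + (t2 + t3) \<le> 7 * m + 6 + time n m MAIN" using 1(2) 2(1) 3(2) by (simp add: runs_def)
  moreover have H: "output_multiset m s3 = (\<Sum>i<m. replicate_mset (out i) i)"
    unfolding output_multiset_def by (rule sum.cong) (use 3(3) in auto)
  have cst: "(\<Sum>i<m. c i) \<le> 8 * (\<Sum>i | i < m \<and> out i = 0. c i)"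
  proof -
    have "(\<Sum>i<m. snd st i) \<le> 8 * (\<Sum>i | i < m \<and> out i = 0. snd st i)" using mc(3) by blast
    moreover have "(\<Sum>i<m. snd st i) = (\<Sum>i<m. c i)" by (rule sum.cong) (auto simp: st_def)
    moreover have "(\<Sum>i | i < m \<and> out i = 0. snd st i) = (\<Sum>i | i < m \<and> out i = 0. c i)" by (rule sum.cong) (auto simp: st_def)
    ultimately show ?thesis by simp
  qed
  have cuts: "2 \<le> card {i \<in> cut m a b U. out i = 1}" if "U \<subseteq> {..<n}" "U \<noteq> {}" "U \<noteq> {..<n}" for U using mc(2)[OF _ _ that] by blast
  have "let H = output_multiset m s3 in spanning_multisubgraph {..<m} H \<and> two_edge_connected {..<n} (\<lambda>i. {a i, b i}) H \<and>
      cost c H \<le> 7 / 8 * cost c (mset_set {..<m})"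
    unfolding Let_def H by (intro conjI; rule output_correct[OF G _ _ cst]; (rule o1 | rule cuts); assumption)
  ultimately show ?thesis by blast
qed

lemma bigo_power:
  fixes f :: "nat \<Rightarrow> nat"
  assumes "\<And>n. 1 \<le> n \<Longrightarrow> f n \<le> K * n ^ k"
  shows "(\<lambda>n. real (f n)) \<in> O(\<lambda>n. real n ^ k)"
proof (rule bigoI[of _ "real K"])
  show "\<forall>\<^sub>F n in at_top. norm (real (f n)) \<le> real K * norm (real n ^ k)"
    using eventually_ge_at_top[of 1]
  proof eventually_elim
    case (elim n)
    then show ?case using assms[of n] by (simp flip: of_nat_power of_nat_mult)
  qed
qed

theorem theorem4:
  shows "\<exists>(p :: com) (T :: nat \<Rightarrow> nat) (w :: nat \<Rightarrow> nat) (k :: nat).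
    (\<lambda>n. real (T n)) \<in> O(\<lambda>n. real n ^ 3) \<and>
    (\<lambda>n. real (w n)) \<in> O(\<lambda>n. real n ^ k) \<and>
    (\<forall>(n :: nat) (m :: nat) (a :: nat \<Rightarrow> nat) (b :: nat \<Rightarrow> nat) (c :: nat \<Rightarrow> real).
      let V = {..<n}; E = {..<m}; ends = (\<lambda>i. {a i, b i}) in
      multigraph V E ends \<and> regular_graph 3 V E ends \<and>
      edge_connected 3 V ends (mset_set E) \<and> (\<forall>e\<in>E. 0 \<le> c e) \<longrightarrow>
      (\<exists>t s. exec (w n) p (input_state n m a b c) t s \<and> t \<le> T n \<and>
        (let H = output_multiset m s in
          spanning_multisubgraph E H \<and> two_edge_connected V ends H \<and>
          cost c H \<le> 7 / 8 * cost c (mset_set E))))"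
proof -
  obtain K where K: "\<And>n m. 1 \<le> n \<Longrightarrow> m \<le> 3 * n \<Longrightarrow> time n m MAIN \<le> K * n ^ dg MAIN" using time_poly[of MAIN] by blast
  have K3: "time n m MAIN \<le> K * n ^ 3" if "1 \<le> n" "m \<le> 3 * n" for n m
    by (rule order_trans[OF K[OF that]]) (use that dg_MAIN in \<open>intro mult_le_mono2 power_increasing, auto\<close>)
  \<comment> \<open>The 4 accounts for \<open>n + m \<le> 4 * n\<close>, the product for the growth
    of the memory contents during the main program.\<close>
  define Q where "Q = 4 + szp MAIN * K"
  \<comment> \<open>Input and output take \<open>7 * m + 6 \<le> 21 * n + 6\<close> steps, which is
    at most \<open>27 * n ^ 3\<close>.\<close>
  define T where "T n = (K + 27) * n ^ 3" for n :: nat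
  define w where "w n = abound (Q * n ^ 3)" for n :: nat
  have T: "(\<lambda>n. real (T n)) \<in> O(\<lambda>n. real n ^ 3)" by (rule bigo_power[of _ "K + 27"]) (simp add: T_def)
  \<comment> \<open>Contents are cubic in \<open>n\<close>, and addresses are quadratic in the
    contents.\<close>
  have w: "(\<lambda>n. real (w n)) \<in> O(\<lambda>n. real n ^ 6)"
  proof (rule bigo_power)
    fix n :: nat assume n: "1 \<le> n"
    have n6: "1 \<le> n ^ 6" "n ^ 3 \<le> n ^ 6" by (rule one_le_power[OF n], rule power_increasing[OF _ n], simp)
    have "n ^ 3 * n ^ 3 = n ^ 6" by (simp flip: power_add)
    then have sq: "(2 * (Q * n ^ 3)) * (2 * (Q * n ^ 3)) = 4 * Q * Q * n ^ 6" by (metis (no_types, lifting) mult.assoc mult.left_commute numeral_Bit0_eq_double)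
    have h: "Q * n ^ 3 \<le> Q * n ^ 6" "82 \<le> 82 * n ^ 6" 
      using mult_le_mono2[OF n6(2), of Q] mult_le_mono2[OF n6(1), of 82] unfolding mult_1_right by this
    have "w n \<le> 82 * n ^ 6 + 3 * (Q * n ^ 6) + 80 * (4 * Q * Q * n ^ 6 + Q * n ^ 6)"
      unfolding w_def abound_def sq by (intro add_mono h mult_le_mono2 order_refl)
    then show "w n \<le> (82 + 3 * Q + 80 * (4 * Q * Q + Q)) * n ^ 6" by (simp add: algebra_simps)
  qed
  have "\<exists>t s. exec (w n) ALG (input_state n m a b c) t s \<and> t \<le> T n \<and>
        (let H = output_multiset m s in spanning_multisubgraph {..<m} H \<and> two_edge_connected {..<n} (\<lambda>i. {a i, b i}) H \<and>
          cost c H \<le> 7 / 8 * cost c (mset_set {..<m}))"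
    if G: "cubic n m a b" for n m a b c
  proof -
    have n: "1 \<le> n" using G by (simp add: cubic_def)
    have m: "m \<le> 3 * n" by (rule cubic_edges(1)[OF G])
    have n3: "n \<le> n ^ 3" "1 \<le> n ^ 3" using n by (auto simp: self_le_power)
    have t: "time n m MAIN \<le> K * n ^ 3" by (rule K3[OF n m])
    then have "szp MAIN * time n m MAIN \<le> szp MAIN * K * n ^ 3" by (metis mult.assoc mult_le_mono2)
    then have "n + m + szp MAIN * time n m MAIN \<le> Q * n ^ 3" using m n3 unfolding Q_def distrib_right by linarith
    then have "abound (n + m + szp MAIN * time n m MAIN) \<le> w n" unfolding w_def by (rule abound_mono)
    from exec_ALG[OF G this, of c] obtain t s where ts: "exec (w n) ALG (input_state n m a b c) t s" "t \<le> 7 * m + 6 + time n m MAIN"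
      "let H = output_multiset m s in spanning_multisubgraph {..<m} H \<and> two_edge_connected {..<n} (\<lambda>i. {a i, b i}) H \<and>
          cost c H \<le> 7 / 8 * cost c (mset_set {..<m})" by blast
    have "t \<le> T n" using ts(2) t m n3 unfolding T_def distrib_right by linarith
    then show ?thesis using ts by blast
  qed
  note run = this
  show ?thesis
    by (rule exI[of _ ALG], rule exI[of _ T], rule exI[of _ w], rule exI[of _ 6], unfold Let_def)
      (use T w run[unfolded Let_def] cubic_of_regular in blast)
qed

end
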